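(* In the setting described in the context (nondegenerately intersecting manifolds, assumptions on $\rho^{(i)}$, $\eta$ and $(\varepsilon_n)$), almost surely the following holds: every sequence $(u_n)_{n\in\mathbb N}$ with $u_n\in L^2(\mu_n)$ and $$\sup_{n\in\mathbb N}E_{n,\varepsilon_n}(u_n)<\infty,\qquad \sup_{n\in\mathbb N}\|u_n\|_{L^2(\mu_n)}<\infty$$ possesses a subsequence which converges in the $TL^2(\mathcal M)$-sense (to some $u\in L^2(\mathcal M)$).
   Context: Geometry. $\mathcal M^{(1)},\mathcal M^{(2)}\subset\mathbb R^N$ are compact smooth Riemannian manifolds without boundary embedded in $\mathbb R^N$ (with induced metric), of dimensions $1\le d^{(1)}\le d^{(2)}$; $\mathcal M=\mathcal M^{(1)}\cup\mathcal M^{(2)}$ and $\mathcal M^{(12)}=\mathcal M^{(1)}\cap\mathcal M^{(2)}$. They intersect nondegenerately: $\mathcal M^{(12)}$ is a manifold of dimension $d^{(12)}<d^{(1)}$ embedded in $\mathbb R^N$, and for every $x\in\mathcal M^{(12)}$ the dimension of $\mathrm{span}(T_x\mathcal M^{(1)}\cup T_x\mathcal M^{(2)})$ is $d^{(1)}+d^{(2)}-d^{(12)}$. $\mathrm{Vol}^{(i)}$ is the volume measure of $\mathcal M^{(i)}$, and $\mathrm{Vol}(A)=\sum_{i}\mathrm{Vol}^{(i)}(A\cap\mathcal M^{(i)})$; $L^2(\mathcal M)=L^2(\mathcal M,\mathrm{Vol})$. Measures. For $i=1,2$, $\mu^{(i)}=\rho^{(i)}\mathrm{Vol}^{(i)}$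 is a probability measure on $\mathcal M^{(i)}$ with $\rho^{(i)}$ Lipschitz continuous and $1/C_\rho\le\rho^{(i)}\le C_\rho$ for some $C_\rho>0$. Numbers $\alpha^{(1)},\alpha^{(2)}>0$ with $\alpha^{(1)}+\alpha^{(2)}=1$ are fixed and $\mu(A)=\sum_{i}\alpha^{(i)}\mu^{(i)}(A\cap\mathcal M^{(i)})$. $V_n=\{x_1,\dots,x_n\}$ where $x_1,x_2,\dots$ are i.i.d. with law $\mu$, and $\mu_n=\frac1n\sum_{x\in V_n}\delta_x$. Kernel. $\eta:[0,\infty)\to[0,\infty)$ is non-increasing, $\eta(0)>0$, $\eta$ is continuous at $0$, and $\operatorname{supp}\eta=[0,1]$. $\eta_\varepsilon(t)=\eta(t/\varepsilon)$, $|\cdot|$ is the Euclidean norm of $\mathbb R^N$. Bandwidth. $\varepsilon_n>0$ satisfies $\ell_n\ll\varepsilon_n\ll1$ (where $a_n\ll b_n$ means $a_n/b_n\to0$), with $d=\max\{d^{(1)},d^{(2)}\}$, $\ell_n=\sqrt{\log\log n/n}$ if $d=1$ and $\ell_n=(\log n/n)^{1/d}$ if $d\ge2$. Energy. $\deg_{n,\varepsilon}(x)=\frac1n\sum_{y\in V_n}\eta_\varepsilon(|x-y|)$ and $$E_{n,\varepsilon}(u)=\frac1{n^2\varepsilon^2}\sum_{x,y\in V_n}\eta_\varepsilon(|x-y|)\left|\frac{u(x)}{\sqrt{\deg_{n,\varepsilon}(x)}}-\frac{u(y)}{\sqrt{\deg_{n,\varepsilon}(y)}}\right|^2 .$$ $TL^2$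 convergence. $u_n\in L^2(\mu_n)$ converges to $u\in L^2(\mathcal M)$ in the $TL^2(\mathcal M)$-sense if there are couplings $\pi_n$ of $\mu$ and $\mu_n$ with $\iint|x-y|\,d\pi_n(x,y)\to0$ and $\iint|u(x)-u_n(y)|^2d\pi_n(x,y)\to0$. *)

theory Defs
  imports "HOL-Probability.Probability"
begin

text \<open>Intended for open sets \<open>S\<close>: \<open>f\<close> is \<open>C\<^sup>k\<close> on \<open>S\<close> if all iterated directional
  derivatives up to order \<open>k\<close> exist and are continuous.\<close>

primrec Ck_on :: "nat \<Rightarrow> 'a::euclidean_space set \<Rightarrow> ('a \<Rightarrow> 'b::euclidean_space) \<Rightarrow> bool" where
  "Ck_on 0 S f \<longleftrightarrow> continuous_on S f"
| "Ck_on (Suc k) S f \<longleftrightarrow>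
     (\<forall>x\<in>S. f differentiable (at x)) \<and> (\<forall>v. Ck_on k S (\<lambda>x. frechet_derivative f (at x) v))"

definition smooth_on :: "'a::euclidean_space set \<Rightarrow> ('a \<Rightarrow> 'b::euclidean_space) \<Rightarrow> bool" where
  "smooth_on S f \<longleftrightarrow> (\<forall>k. Ck_on k S f)"

text \<open>Smooth embedded \<open>k\<close>-dimensional submanifold without boundary, by slice charts: near each of
  its points \<open>M\<close> is straightened by an ambient diffeomorphism to a \<open>k\<close>-dimensional linear subspace.
  The empty set is a manifold of every dimension.\<close>

definition smooth_submanifold :: "nat \<Rightarrow> 'a::euclidean_space set \<Rightarrow> bool" where
  "smooth_submanifold k M \<longleftrightarrow>
     (\<forall>x\<in>M. \<exists>U V L (\<phi>::'a \<Rightarrow> 'a) (\<psi>::'a \<Rightarrow> 'a).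
        open U \<and> x \<in> U \<and> open V \<and> subspace L \<and> dim L = k \<and>
        homeomorphism U V \<phi> \<psi> \<and> smooth_on U \<phi> \<and> smooth_on V \<psi> \<and>
        \<phi> ` (M \<inter> U) = L \<inter> V)"

text \<open>Velocities at \<open>x\<close> of smooth curves in \<open>M\<close>.\<close>

definition tangent_space :: "'a::euclidean_space set \<Rightarrow> 'a \<Rightarrow> 'a set" where
  "tangent_space M x =
     {v. \<exists>(\<gamma>::real \<Rightarrow> 'a) \<delta>. \<delta> > 0 \<and> smooth_on {-\<delta><..<\<delta>} \<gamma> \<and> \<gamma> ` {-\<delta><..<\<delta>} \<subseteq> M \<and>
        \<gamma> 0 = x \<and> (\<gamma> has_vector_derivative v) (at 0)}"

definition nondegenerate_intersection ::
  "nat \<Rightarrow> nat \<Rightarrow> nat \<Rightarrow> 'a::euclidean_space set \<Rightarrow> 'a set \<Rightarrow> bool" where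
  "nondegenerate_intersection d1 d2 d12 M1 M2 \<longleftrightarrow>
     d12 < d1 \<and> smooth_submanifold d12 (M1 \<inter> M2) \<and>
     (\<forall>x \<in> M1 \<inter> M2. dim (span (tangent_space M1 x \<union> tangent_space M2 x)) = d1 + d2 - d12)"

definition local_parametrization ::
  "'a::euclidean_space set \<Rightarrow> (real^'m) set \<Rightarrow> (real^'m \<Rightarrow> 'a) \<Rightarrow> bool" where
  "local_parametrization M W \<psi> \<longleftrightarrow>
     open W \<and> smooth_on W \<psi> \<and> (\<forall>y\<in>W. inj (frechet_derivative \<psi> (at y))) \<and>
     openin (top_of_set M) (\<psi> ` W) \<and> (\<exists>\<theta>. homeomorphism W (\<psi> ` W) \<psi> \<theta>)"

text \<open>The metric tensor of the induced metric in the coordinates given by \<open>\<psi>\<close>.\<close>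

definition gram :: "(real^'m \<Rightarrow> 'a::euclidean_space) \<Rightarrow> real^'m \<Rightarrow> real^'m^'m" where
  "gram \<psi> y = (\<chi> i j. frechet_derivative \<psi> (at y) (axis i 1) \<bullet> frechet_derivative \<psi> (at y) (axis j 1))"

text \<open>\<open>\<nu>\<close> is the Riemannian volume measure of the \<open>CARD('m)\<close>-dimensional submanifold \<open>M\<close> with the
  induced metric, viewed as a Borel measure on the ambient space: it is carried by \<open>M\<close> and has
  density \<open>sqrt (det g)\<close> in every coordinate patch.\<close>

definition riemannian_volume ::
  "'m::finite itself \<Rightarrow> 'a::euclidean_space set \<Rightarrow> 'a measure \<Rightarrow> bool" where
  "riemannian_volume _ M \<nu> \<longleftrightarrow>
     sets \<nu> = sets borel \<and> emeasure \<nu> (- M) = 0 \<and>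
     (\<forall>W (\<psi>::real^'m \<Rightarrow> 'a). local_parametrization M W \<psi> \<longrightarrow>
        (\<forall>A\<in>sets borel. A \<subseteq> \<psi> ` W \<longrightarrow>
           emeasure \<nu> A = (\<integral>\<^sup>+y\<in>W \<inter> \<psi> -` A. ennreal (sqrt (det (gram \<psi> y))) \<partial>lborel)))"

definition union_measure ::
  "'a::euclidean_space set \<Rightarrow> 'a set \<Rightarrow> 'a measure \<Rightarrow> 'a measure \<Rightarrow> 'a measure" where
  "union_measure M1 M2 \<nu>1 \<nu>2 =
     measure_of UNIV (sets borel) (\<lambda>A. emeasure \<nu>1 (A \<inter> M1) + emeasure \<nu>2 (A \<inter> M2))"

lemma sets_measure_of_borel: "sets (measure_of UNIV (sets borel) f) = sets (borel :: 'a::euclidean_space measure)"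
  using sets.sets_measure_of_eq[of "borel :: 'a measure" f] by simp

lemma emeasure_union_measure:
  assumes "sets \<nu>1 = sets borel" "sets \<nu>2 = sets borel"
    and "M1 \<in> sets borel" "M2 \<in> sets borel" "A \<in> sets borel"
  shows "emeasure (union_measure M1 M2 \<nu>1 \<nu>2) A = emeasure \<nu>1 (A \<inter> M1) + emeasure \<nu>2 (A \<inter> M2)"
proof (rule emeasure_measure_of[OF union_measure_def])
  show "countably_additive (sets (union_measure M1 M2 \<nu>1 \<nu>2))
      (\<lambda>A. emeasure \<nu>1 (A \<inter> M1) + emeasure \<nu>2 (A \<inter> M2))"
  proof (rule countably_additiveI)
    fix B :: "nat \<Rightarrow> 'a set"
    assume "range B \<subseteq> sets (union_measure M1 M2 \<nu>1 \<nu>2)" and disj: "disjoint_family B"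
    then have B: "\<And>i. B i \<in> sets borel"
      by (auto simp: union_measure_def sets_measure_of_borel)
    have *: "(\<Sum>i. emeasure \<nu> (B i \<inter> M)) = emeasure \<nu> ((\<Union>i. B i) \<inter> M)"
      if "sets \<nu> = sets borel" "M \<in> sets borel" for \<nu> :: "'a measure" and M
    proof -
      have "(\<Sum>i. emeasure \<nu> (B i \<inter> M)) = emeasure \<nu> (\<Union>i. B i \<inter> M)"
        using that B disj by (intro suminf_emeasure) (auto, fastforce simp: disjoint_family_on_def)
      also have "(\<Union>i. B i \<inter> M) = (\<Union>i. B i) \<inter> M"
        by blast
      finally show ?thesis .
    qed
    show "(\<Sum>i. emeasure \<nu>1 (B i \<inter> M1) + emeasure \<nu>2 (B i \<inter> M2)) =
        emeasure \<nu>1 (\<Union> (range B) \<inter> M1) + emeasure \<nu>2 (\<Union> (range B) \<inter> M2)"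
      using assms by (subst suminf_add[symmetric]) (auto simp: *)
  qed
qed (use assms in \<open>auto simp: positive_def union_measure_def sets_measure_of_borel\<close>)

text \<open>The probability measure with density \<open>\<rho>\<close>, a function on \<open>M\<close>, with respect to \<open>\<nu>\<close>; the values
  of \<open>\<rho>\<close> off \<open>M\<close> are discarded.\<close>

definition density_on ::
  "'a::euclidean_space set \<Rightarrow> 'a measure \<Rightarrow> ('a \<Rightarrow> real) \<Rightarrow> 'a measure" where
  "density_on M \<nu> \<rho> = density \<nu> (\<lambda>x. ennreal (\<rho> x * indicator M x))"

definition admissible_density ::
  "'a::euclidean_space set \<Rightarrow> 'a measure \<Rightarrow> real \<Rightarrow> ('a \<Rightarrow> real) \<Rightarrow> bool" where
  "admissible_density M \<nu> C \<rho> \<longleftrightarrow>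
     (\<exists>L. L-lipschitz_on M \<rho>) \<and> (\<forall>x\<in>M. 1 / C \<le> \<rho> x \<and> \<rho> x \<le> C) \<and> prob_space (density_on M \<nu> \<rho>)"

definition admissible_kernel :: "(real \<Rightarrow> real) \<Rightarrow> bool" where
  "admissible_kernel \<eta> \<longleftrightarrow>
     (\<forall>t\<ge>0. \<eta> t \<ge> 0) \<and> antimono_on {0..} \<eta> \<and> \<eta> 0 > 0 \<and> continuous (at 0 within {0..}) \<eta> \<and>
     closure {t. t \<ge> 0 \<and> \<eta> t \<noteq> 0} = {0..1}"

definition connectivity_scale :: "nat \<Rightarrow> nat \<Rightarrow> real" where
  "connectivity_scale d n =
     (if d = 1 then sqrt (ln (ln (real n)) / real n) else (ln (real n) / real n) powr (1 / real d))"

text \<open>\<open>V\<close> is a set, so coinciding sample points are counted once.\<close>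

definition empirical_measure :: "nat \<Rightarrow> 'a::euclidean_space set \<Rightarrow> 'a measure" where
  "empirical_measure n V =
     scale_measure (ennreal (1 / real n))
       (measure_of UNIV (sets borel) (\<lambda>A. \<Sum>x\<in>V. emeasure (return borel x) A))"

lemma emeasure_empirical_measure:
  assumes "A \<in> sets borel"
  shows "emeasure (empirical_measure n V) A = ennreal (1 / real n) * (\<Sum>x\<in>V. indicator A x)"
proof -
  define N where
    "N = measure_of UNIV (sets borel) (\<lambda>A. \<Sum>x\<in>V. emeasure (return borel (x::'a)) A)"
  have "emeasure N A = (\<Sum>x\<in>V. emeasure (return borel x) A)"
  proof (rule emeasure_measure_of[OF N_def])
    show "countably_additive (sets N) (\<lambda>A. \<Sum>x\<in>V. emeasure (return borel x) A)"
    proof (rule countably_additiveI)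
      fix B :: "nat \<Rightarrow> 'a set"
      assume "range B \<subseteq> sets N" and disj: "disjoint_family B"
      then have B: "range B \<subseteq> sets borel"
        by (auto simp: N_def sets_measure_of_borel)
      show "(\<Sum>i. \<Sum>x\<in>V. emeasure (return borel x) (B i)) =
          (\<Sum>x\<in>V. emeasure (return borel x) (\<Union> (range B)))"
        using B disj by (subst suminf_sum) (auto intro!: sum.cong suminf_emeasure simp del: emeasure_return)
    qed
  qed (use assms in \<open>auto simp: positive_def N_def sets_measure_of_borel\<close>)
  then show ?thesis
    using assms by (simp add: empirical_measure_def N_def)
qed

definition graph_degree ::
  "(real \<Rightarrow> real) \<Rightarrow> nat \<Rightarrow> real \<Rightarrow> 'a::euclidean_space set \<Rightarrow> 'a \<Rightarrow> real" where
  "graph_degree \<eta> n \<epsilon> V x = 1 / real n * (\<Sum>y\<in>V. \<eta> (norm (x - y) / \<epsilon>))"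

definition graph_energy ::
  "(real \<Rightarrow> real) \<Rightarrow> nat \<Rightarrow> real \<Rightarrow> 'a::euclidean_space set \<Rightarrow> ('a \<Rightarrow> real) \<Rightarrow> real" where
  "graph_energy \<eta> n \<epsilon> V u =
     1 / ((real n)\<^sup>2 * \<epsilon>\<^sup>2) *
     (\<Sum>x\<in>V. \<Sum>y\<in>V. \<eta> (norm (x - y) / \<epsilon>) *
        \<bar>u x / sqrt (graph_degree \<eta> n \<epsilon> V x) - u y / sqrt (graph_degree \<eta> n \<epsilon> V y)\<bar>\<^sup>2)"

definition in_L2 :: "'a measure \<Rightarrow> ('a \<Rightarrow> real) \<Rightarrow> bool" where
  "in_L2 \<nu> u \<longleftrightarrow> u \<in> borel_measurable \<nu> \<and> integrable \<nu> (\<lambda>x. (u x)\<^sup>2)"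

definition L2_norm :: "'a measure \<Rightarrow> ('a \<Rightarrow> real) \<Rightarrow> real" where
  "L2_norm \<nu> u = sqrt (\<integral>x. (u x)\<^sup>2 \<partial>\<nu>)"

definition is_coupling ::
  "'a::euclidean_space measure \<Rightarrow> 'a measure \<Rightarrow> ('a \<times> 'a) measure \<Rightarrow> bool" where
  "is_coupling \<mu> \<nu> \<pi> \<longleftrightarrow>
     sets \<pi> = sets (borel \<Otimes>\<^sub>M borel) \<and> distr \<pi> borel fst = \<mu> \<and> distr \<pi> borel snd = \<nu>"

definition TL2_converges ::
  "'a::euclidean_space measure \<Rightarrow> (nat \<Rightarrow> 'a measure) \<Rightarrow> (nat \<Rightarrow> 'a \<Rightarrow> real) \<Rightarrow> ('a \<Rightarrow> real) \<Rightarrow> bool" where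
  "TL2_converges \<mu> \<nu> v u \<longleftrightarrow>
     (\<exists>\<pi>. (\<forall>k. is_coupling \<mu> (\<nu> k) (\<pi> k)) \<and>
        (\<lambda>k. \<integral>\<^sup>+(x, y). ennreal (norm (x - y)) \<partial>\<pi> k) \<longlonglongrightarrow> 0 \<and>
        (\<lambda>k. \<integral>\<^sup>+(x, y). ennreal (\<bar>u x - v k y\<bar>\<^sup>2) \<partial>\<pi> k) \<longlonglongrightarrow> 0)"

end

theory Submission
  imports Defs "HOL-Real_Asymp.Real_Asymp" "HOL-Library.Diagonal_Subsequence"
begin

text \<open>
  No transport maps are used. Chernoff bounds and Borel--Cantelli show that, almost surely, all balls of radius
  comparable to \<open>\<epsilon>\<^sub>n\<close> and all grid cells of that size in charts contain the expected number of sample points up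
  to constants. Along paths of adjacent cells a discrete Poincare inequality then bounds the variance of
  \<open>f = u / \<surd>deg\<close> on a fixed cell of size \<open>h\<close> by \<open>h\<^sup>2\<close> times the energy. As the degree within a piece, divided by
  \<open>\<epsilon>\<^sub>n\<^sup>d\<close>, is asymptotically locally constant, \<open>f\<close> times the root of the degree within the piece is close in
  \<open>L\<^sup>2(\<mu>\<^sub>n)\<close> to a function that is constant on the cells of a fixed partition.

  The two pieces interact only through points of \<open>M1\<close> at distance at most \<open>\<epsilon>\<^sub>n\<close> from \<open>M2\<close>. These have vanishing
  mass, because \<open>M1 \<inter> M2\<close> is a null set, and a function that is nearly piecewise constant cannot concentrate on
  them; so the degree from the other piece is negligible on \<open>M1\<close>, and the energy carries this over to \<open>M2\<close>. Hence
  \<open>u\<^sub>n\<close> itself is approximated, at each scale \<open>k\<close>, by functions constant on the cells of a fixed finite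
  partition. A diagonal argument makes the cell means converge, and couplings that match the masses of the
  cells turn this into \<open>TL\<^sup>2\<close> convergence.
\<close>

section \<open>Counting sample points\<close>

text \<open>The two pieces play different roles. Near the intersection a point of M2 can receive
  from M1 a degree of order \<epsilon>^d1, far above the order \<epsilon>^d2 of its degree within M2
  when d1 < d2; so bounding the foreign degree by the own one works on M1 only. On M2 the inequality
  f(x)^2 <= 2 (f(x) - f(y))^2 + 2 f(y)^2 along the edges to M1 replaces it, at the price of a term
  of order \<epsilon>^2 times the energy. Since f is typically of size \<epsilon>^(-d/2),
  approximations are made for f times the root of a degree, which has the size of u. The factor
  \<epsilon>^d of the degree then cancels the one in the Poincare inequality and leaves the energy.
  Small relative errors of all counts at once require expected counts far above ln n, so the
  bandwidth condition enters as n \<epsilon>^d / ln n -> infinity. Constants and partitions are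
  chosen before the sample. Countably many almost sure events therefore suffice; everything after
  them is deterministic and treats all sequences u at once.\<close>

lemma exp_le_quadratic:
  fixes x :: real
  assumes "\<bar>x\<bar> \<le> 1"
  shows "exp x \<le> 1 + x + x\<^sup>2"
proof (cases "0 \<le> x")
  case True
  then show ?thesis using exp_bound[of x] assms by simp
next
  case False
  define y where "y = - x"
  have y: "0 \<le> y" "y \<le> 1" using False assms by (auto simp: y_def)
  have "1 + y \<le> exp y" by (rule exp_ge_add_one_self)
  then have "exp x \<le> 1 / (1 + y)"
    using y by (simp add: y_def exp_minus field_simps)
  also have "\<dots> \<le> 1 - y + y\<^sup>2"
  proof -
    have "1 \<le> (1 - y + y\<^sup>2) * (1 + y)"
      using y by (simp add: algebra_simps power2_eq_square)
    then show ?thesis using y by (simp add: field_simps)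
  qed
  finally show ?thesis by (simp add: y_def)
qed

locale iid_sample = prob_space P for P :: "'w measure" +
  fixes X :: "nat \<Rightarrow> 'w \<Rightarrow> 'a::euclidean_space" and \<mu> :: "'a measure"
  assumes indep: "indep_vars (\<lambda>_. borel) X {1..}"
    and law: "\<And>i. i \<ge> 1 \<Longrightarrow> distr P borel (X i) = \<mu>"
begin

lemma X_measurable [measurable]: "i \<ge> 1 \<Longrightarrow> X i \<in> borel_measurable P"
  using indep unfolding indep_vars_def by auto

lemma sets_law [simp, measurable_cong]: "sets \<mu> = sets borel"
  using law[of 1] by (metis order_refl sets_distr)

lemma space_law [simp]: "space \<mu> = UNIV"
  using sets_eq_imp_space_eq[OF sets_law] by simp

lemma prob_space_law: "prob_space \<mu>"
  using prob_space_distr[OF X_measurable[of 1]] law[of 1] by simp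

lemma prob_X_in: "i \<ge> 1 \<Longrightarrow> B \<in> sets borel \<Longrightarrow> prob {w \<in> space P. X i w \<in> B} = measure \<mu> B"
proof -
  assume i: "i \<ge> 1" and B: "B \<in> sets borel"
  have "measure (distr P borel (X i)) B = prob (X i -` B \<inter> space P)"
    using i B by (intro measure_distr) auto
  then show ?thesis
    by (simp add: law[OF i] vimage_def Int_def conj_commute)
qed

text \<open>Counts indices, hence with multiplicity: this makes it a sum of independent indicators.
  It becomes the cardinality of \<open>V n w \<inter> B\<close> once the sample points are
  distinct.\<close>

definition hits :: "nat \<Rightarrow> 'a set \<Rightarrow> 'w \<Rightarrow> real" where
  "hits n B w = (\<Sum>i=1..n. indicator B (X i w))"

lemma hits_measurable [measurable]: "B \<in> sets borel \<Longrightarrow> hits n B \<in> borel_measurable P"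
  unfolding hits_def by measurable auto

lemma integrable_exp_indicator:
  assumes "i \<ge> 1" "B \<in> sets borel"
  shows "integrable P (\<lambda>w. exp (l * indicator B (X i w)) :: real)"
    and "expectation (\<lambda>w. exp (l * indicator B (X i w))) = 1 + measure \<mu> B * (exp l - 1)"
proof -
  have eq: "exp (l * indicator B (X i w)) = 1 + (exp l - 1) * indicator {w \<in> space P. X i w \<in> B} w"
    if "w \<in> space P" for w
    using that by (auto simp: indicator_def)
  have [measurable]: "{w \<in> space P. X i w \<in> B} \<in> events"
    using assms by measurable
  have int: "integrable P (\<lambda>w. 1 + (exp l - 1) * indicator {w \<in> space P. X i w \<in> B} w :: real)"
    by (rule Bochner_Integration.integrable_add) (auto simp: less_top[symmetric])
  show "integrable P (\<lambda>w. exp (l * indicator B (X i w)) :: real)"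
    by (subst Bochner_Integration.integrable_cong[OF refl eq]) (use int in auto)
  have "expectation (\<lambda>w. exp (l * indicator B (X i w)))
      = expectation (\<lambda>w. 1 + (exp l - 1) * indicator {w \<in> space P. X i w \<in> B} w)"
    by (rule Bochner_Integration.integral_cong) (auto simp: eq)
  also have "\<dots> = 1 + (exp l - 1) * prob {w \<in> space P. X i w \<in> B}"
    by (subst Bochner_Integration.integral_add) (auto simp: prob_space less_top[symmetric])
  finally show "expectation (\<lambda>w. exp (l * indicator B (X i w))) = 1 + measure \<mu> B * (exp l - 1)"
    using prob_X_in[OF assms] by (simp add: mult.commute)
qed

text \<open>Independence turns the moment generating function into a power, and 1 + x <= exp x
  replaces the binomial one by the larger Poisson one.\<close>

lemma exp_hits:
  assumes B: "B \<in> sets borel"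
  shows "integrable P (\<lambda>w. exp (l * hits n B w))"
    and "expectation (\<lambda>w. exp (l * hits n B w)) \<le> exp (real n * measure \<mu> B * (exp l - 1))"
proof -
  have eq: "exp (l * hits n B w) = (\<Prod>i=1..n. exp (l * indicator B (X i w)))" for w
    unfolding hits_def sum_distrib_left by (rule exp_sum) simp
  have ind: "indep_vars (\<lambda>_. borel) (\<lambda>i w. exp (l * indicator B (X i w)) :: real) {1..n}"
    using indep_vars_compose2[OF indep_vars_subset[OF indep], of "{1..n}" "\<lambda>_ x. exp (l * indicator B x)" "\<lambda>_. borel"] B
    by auto
  show "integrable P (\<lambda>w. exp (l * hits n B w))"
    unfolding eq by (rule indep_vars_integrable[OF _ ind]) (auto intro!: integrable_exp_indicator B)
  have "expectation (\<lambda>w. exp (l * hits n B w)) = (\<Prod>i=1..n. expectation (\<lambda>w. exp (l * indicator B (X i w))))"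
    unfolding eq by (rule indep_vars_lebesgue_integral[OF _ ind]) (auto intro!: integrable_exp_indicator B)
  also have "\<dots> = (1 + measure \<mu> B * (exp l - 1)) ^ n"
    by (simp add: integrable_exp_indicator(2) B)
  also have "\<dots> \<le> exp (measure \<mu> B * (exp l - 1)) ^ n"
  proof (rule power_mono)
    \<comment> \<open>Monotonicity of the power needs a nonnegative base; for l < 0 this is where
      mass at most 1 enters.\<close>
    have "measure \<mu> B \<le> 1"
      using prob_space.prob_le_1[OF prob_space_law] .
    then have "measure \<mu> B * (1 - exp l) \<le> 1"
      using mult_mono[of "measure \<mu> B" 1 "1 - exp l" 1] mult_nonneg_nonpos[of "measure \<mu> B" "1 - exp l"]
      by (cases "exp l \<le> 1") (auto intro: order_trans)
    then show "0 \<le> 1 + measure \<mu> B * (exp l - 1)"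
      by (simp add: algebra_simps)
  qed (auto intro: exp_ge_add_one_self)
  also have "\<dots> = exp (real n * measure \<mu> B * (exp l - 1))"
    by (simp add: exp_of_nat_mult[symmetric] mult.assoc)
  finally show "expectation (\<lambda>w. exp (l * hits n B w)) \<le> exp (real n * measure \<mu> B * (exp l - 1))" .
qed

text \<open>The event is written with exponentials so that one statement serves both tails: the sign
  of \<open>l\<close> decides whether it speaks of too many or of too few hits.\<close>

lemma hits_tail:
  assumes B: "B \<in> sets borel" and l: "\<bar>l\<bar> \<le> 1"
  shows "prob {w \<in> space P. exp (l * c) \<le> exp (l * hits n B w)} \<le> exp (real n * measure \<mu> B * (l + l\<^sup>2) - l * c)"
proof -
  have "prob {w \<in> space P. exp (l * c) \<le> exp (l * hits n B w)} \<le> expectation (\<lambda>w. exp (l * hits n B w)) / exp (l * c)"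
    by (rule integral_Markov_inequality_measure[OF exp_hits(1)[OF B], where A="{}"]) auto
  also have "\<dots> \<le> exp (real n * measure \<mu> B * (exp l - 1)) / exp (l * c)"
    by (intro divide_right_mono exp_hits B) auto
  also have "\<dots> = exp (real n * measure \<mu> B * (exp l - 1) - l * c)"
    by (simp add: exp_diff)
  also have "\<dots> \<le> exp (real n * measure \<mu> B * (l + l\<^sup>2) - l * c)"
    using exp_le_quadratic[OF l] by (auto intro!: mult_left_mono)
  finally show ?thesis .
qed

text \<open>With p the expected count, the exponent p (l + l^2) - l (1 + t) p equals p (l^2 - t l),
  which is smallest at l = t / 2 with value - t^2 p / 4. The lower tail uses l = - t / 2.\<close>

lemma hits_chernoff:
  assumes B: "B \<in> sets borel" and t: "0 < t" "t \<le> 1"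
  shows "prob {w \<in> space P. t * (real n * measure \<mu> B) < \<bar>hits n B w - real n * measure \<mu> B\<bar>}
      \<le> 2 * exp (- (t\<^sup>2 * (real n * measure \<mu> B) / 4))"
proof -
  define p where "p = real n * measure \<mu> B"
  let ?U = "{w \<in> space P. exp (t/2 * ((1 + t) * p)) \<le> exp (t/2 * hits n B w)}"
  let ?L = "{w \<in> space P. exp (- (t/2) * ((1 - t) * p)) \<le> exp (- (t/2) * hits n B w)}"
  have [measurable]: "?U \<in> events" "?L \<in> events"
    using B by measurable
  have "{w \<in> space P. t * p < \<bar>hits n B w - p\<bar>} \<subseteq> ?U \<union> ?L"
  proof
    fix w assume w: "w \<in> {w \<in> space P. t * p < \<bar>hits n B w - p\<bar>}"
    then have "(1 + t) * p \<le> hits n B w \<or> hits n B w \<le> (1 - t) * p"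
      by (auto simp: algebra_simps abs_if split: if_splits)
    then show "w \<in> ?U \<union> ?L"
      using w t by (auto intro!: mult_left_mono)
  qed
  then have "prob {w \<in> space P. t * p < \<bar>hits n B w - p\<bar>} \<le> prob (?U \<union> ?L)"
    by (rule finite_measure_mono) (rule sets.Un; fact)
  also have "\<dots> \<le> prob ?U + prob ?L"
    by (rule measure_Un_le) fact+
  also have "prob ?U \<le> exp (p * (t/2 + (t/2)\<^sup>2) - t/2 * ((1 + t) * p))"
    using hits_tail[OF B, of "t/2" "(1 + t) * p" n] t by (simp add: p_def)
  also have "p * (t/2 + (t/2)\<^sup>2) - t/2 * ((1 + t) * p) = - (t\<^sup>2 * p / 4)"
    by (simp add: power2_eq_square field_simps)
  also have "prob ?L \<le> exp (p * (- (t/2) + (- (t/2))\<^sup>2) - (- (t/2)) * ((1 - t) * p))"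
    using hits_tail[OF B, of "- (t/2)" "(1 - t) * p" n] t by (simp add: p_def)
  also have "p * (- (t/2) + (- (t/2))\<^sup>2) - (- (t/2)) * ((1 - t) * p) = - (t\<^sup>2 * p / 4)"
    by (simp add: power2_eq_square field_simps)
  finally show ?thesis by (simp add: p_def)
qed

text \<open>The sets may change with \<open>n\<close>. Their expected counts eventually exceed 12 ln
  n / t^2, so each fails with probability at most 2 / n^3; a union over at most \<open>n\<close>
  sets leaves 2 / n^2, which is summable.\<close>

lemma AE_hits_uniform:
  fixes \<B> :: "nat \<Rightarrow> 'a set set" and b :: "nat \<Rightarrow> real"
  assumes fin: "\<And>n. finite (\<B> n)" and borel: "\<And>n B. B \<in> \<B> n \<Longrightarrow> B \<in> sets borel"
    and card: "eventually (\<lambda>n. card (\<B> n) \<le> n) sequentially"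
    and low: "eventually (\<lambda>n. \<forall>B\<in>\<B> n. b n \<le> measure \<mu> B) sequentially"
    and b: "filterlim (\<lambda>n. real n * b n / ln (real n)) at_top sequentially"
    and t: "0 < t" "t \<le> 1"
  shows "AE w in P. eventually (\<lambda>n. \<forall>B\<in>\<B> n.
    \<bar>hits n B w - real n * measure \<mu> B\<bar> \<le> t * (real n * measure \<mu> B)) sequentially"
proof -
  define E where "E n B = {w \<in> space P. t * (real n * measure \<mu> B) < \<bar>hits n B w - real n * measure \<mu> B\<bar>}" for n B
  define A where "A n = (\<Union>B\<in>\<B> n. E n B)" for n
  have E: "E n B \<in> events" if "B \<in> \<B> n" for n B
    using borel[OF that] unfolding E_def by measurable
  have A: "A n \<in> events" for n
    unfolding A_def using fin E by (intro sets.finite_UN) auto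
  have "eventually (\<lambda>n. real n * b n / ln (real n) \<ge> 12 / t\<^sup>2) sequentially"
    using b by (auto simp: filterlim_at_top)
  then have "eventually (\<lambda>n. prob (A n) \<le> 2 * inverse ((real n)\<^sup>2)) sequentially"
    using card low eventually_gt_at_top[of 1]
  proof eventually_elim
    case (elim n)
    have ln: "0 < ln (real n)" using elim by simp
    have "prob (A n) \<le> (\<Sum>B\<in>\<B> n. prob (E n B))"
      unfolding A_def using E by (intro finite_measure_subadditive_finite fin) auto
    also have "\<dots> \<le> (\<Sum>B\<in>\<B> n. 2 * inverse (real n ^ 3))"
    proof (rule sum_mono)
      fix B assume B: "B \<in> \<B> n"
      have "12 / t\<^sup>2 * ln (real n) \<le> real n * b n"
        using elim ln by (simp add: pos_le_divide_eq)
      also have "\<dots> \<le> real n * measure \<mu> B"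
        using elim B by (intro mult_left_mono) auto
      finally have "3 * ln (real n) \<le> t\<^sup>2 * (real n * measure \<mu> B) / 4"
        using t by (simp add: field_simps)
      then have "exp (- (t\<^sup>2 * (real n * measure \<mu> B) / 4)) \<le> exp (- (3 * ln (real n)))"
        by simp
      also have "\<dots> = inverse (real n ^ 3)"
        using elim exp_of_nat_mult[of 3 "ln (real n)"] by (simp add: exp_minus)
      finally show "prob (E n B) \<le> 2 * inverse (real n ^ 3)"
        using hits_chernoff[OF borel[OF B] t, of n] unfolding E_def by linarith
    qed
    also have "\<dots> = real (card (\<B> n)) * (2 * inverse (real n ^ 3))"
      by simp
    also have "\<dots> \<le> real n * (2 * inverse (real n ^ 3))"
      using elim by (intro mult_right_mono) auto
    also have "\<dots> = 2 * inverse ((real n)\<^sup>2)"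
      using elim by (simp add: field_simps power3_eq_cube power2_eq_square)
    finally show ?case .
  qed
  then have "summable (\<lambda>n. prob (A n))"
    by (intro summable_comparison_test_ev[OF _ summable_mult[OF inverse_power_summable[of 2]]]) auto
  then have "AE w in P. eventually (\<lambda>n. w \<in> space P - A n) sequentially"
    using A by (intro borel_cantelli_AE1) (auto simp: less_top[symmetric])
  then show ?thesis
    by eventually_elim (auto elim!: eventually_mono simp: A_def E_def not_less)
qed

lemma AE_not_hit:
  assumes "B \<in> sets borel" "measure \<mu> B = 0"
  shows "AE w in P. \<forall>i\<ge>1. X i w \<notin> B"
proof -
  have "AE w in P. i \<ge> 1 \<longrightarrow> X i w \<notin> B" for i
  proof (cases "i \<ge> 1")
    case True
    have "{w \<in> space P. X i w \<in> B} \<in> null_sets P"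
      using prob_X_in[OF True assms(1)] assms True by (auto simp: null_sets_def emeasure_eq_measure)
    then show ?thesis by (rule AE_I') auto
  qed simp
  then show ?thesis by (simp add: AE_all_countable)
qed

text \<open>The Chernoff bound with relative error 1 / (k + 1), applied to one set and intersected
  over all \<open>k\<close>. A null set, for which relative errors say nothing, is almost surely
  never hit.\<close>

lemma AE_lln:
  assumes "B \<in> sets borel"
  shows "AE w in P. (\<lambda>n. hits n B w / real n) \<longlonglongrightarrow> measure \<mu> B"
proof (cases "measure \<mu> B = 0")
  case True
  from AE_not_hit[OF assms this] show ?thesis
    by eventually_elim (auto simp: hits_def True)
next
  case False
  have 1: "0 < measure \<mu> B" using False by (simp add: zero_less_measure_iff)
  have "AE w in P. \<forall>k. eventually (\<lambda>n. \<forall>B\<in>{B}.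
    \<bar>hits n B w - real n * measure \<mu> B\<bar> \<le> (1 / real (Suc k)) * (real n * measure \<mu> B)) sequentially"
    unfolding AE_all_countable
  proof
    fix k
    show "AE w in P. eventually (\<lambda>n. \<forall>B\<in>{B}.
      \<bar>hits n B w - real n * measure \<mu> B\<bar> \<le> (1 / real (Suc k)) * (real n * measure \<mu> B)) sequentially"
    proof (rule AE_hits_uniform[where \<B>="\<lambda>_. {B}" and b="\<lambda>_. measure \<mu> B"])
      show "filterlim (\<lambda>n. real n * measure \<mu> B / ln (real n)) at_top sequentially"
        using 1 by real_asymp
    qed (use assms in \<open>auto simp: eventually_at_top_linorder intro: exI[of _ 1]\<close>)
  qed
  then show ?thesis
  proof eventually_elim
    case (elim w)
    show ?case
    proof (rule LIMSEQ_I)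
      fix r :: real assume r: "0 < r"
      obtain k where k: "1 / real (Suc k) < r"
        using r by (metis nat_approx_posE)
      have le1: "measure \<mu> B \<le> 1" by (rule prob_space.prob_le_1[OF prob_space_law])
      have "eventually (\<lambda>n. \<bar>hits n B w - real n * measure \<mu> B\<bar> \<le> (1 / real (Suc k)) * (real n * measure \<mu> B)) sequentially"
        using elim by simp
      then have "eventually (\<lambda>n. norm (hits n B w / real n - measure \<mu> B) < r) sequentially"
        using eventually_gt_at_top[of 0]
      proof eventually_elim
        case (elim n)
        have "\<bar>hits n B w / real n - measure \<mu> B\<bar> = \<bar>hits n B w - real n * measure \<mu> B\<bar> / real n"
          using elim by (simp add: field_simps abs_if)
        also have "\<dots> \<le> (1 / real (Suc k)) * (real n * measure \<mu> B) / real n"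
          using elim by (intro divide_right_mono) auto
        also have "\<dots> = (1 / real (Suc k)) * measure \<mu> B" using elim by simp
        also have "\<dots> \<le> (1 / real (Suc k)) * 1" by (intro mult_left_mono le1) auto
        finally show ?case using k by simp
      qed
      then show "\<exists>no. \<forall>n\<ge>no. norm (hits n B w / real n - measure \<mu> B) < r"
        by (simp add: eventually_sequentially)
    qed
  qed
qed

text \<open>By independence a pair of sample points has the product law, and by Fubini the diagonal
  is a null set for the product of an atomless measure with itself.\<close>

lemma AE_distinct:
  assumes atomless: "\<And>x. measure \<mu> {x} = 0"
  shows "AE w in P. inj_on (\<lambda>i. X i w) {1..}"
proof -
  interpret \<mu>: prob_space \<mu> by (rule prob_space_law)
  have "AE w in P. i \<ge> 1 \<and> j \<ge> 1 \<and> i \<noteq> j \<longrightarrow> X i w \<noteq> X j w" for i j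
  proof (cases "i \<ge> 1 \<and> j \<ge> 1 \<and> i \<noteq> j")
    case True
    have "indep_var borel ((\<lambda>f. f i) \<circ> (\<lambda>w. restrict (\<lambda>i. X i w) {i})) borel ((\<lambda>f. f j) \<circ> (\<lambda>w. restrict (\<lambda>i. X i w) {j}))"
      using True by (intro indep_var_compose[OF indep_var_restrict[OF indep, of "{i}" "{j}"]]) auto
    then have "indep_var borel (X i) borel (X j)"
      by (simp add: comp_def)
    then have eq: "\<mu> \<Otimes>\<^sub>M \<mu> = distr P (borel \<Otimes>\<^sub>M borel) (\<lambda>x. (X i x, X j x))"
      using True by (auto simp: indep_var_distribution_eq law)
    have D: "{x. fst x = snd x} \<in> sets (borel \<Otimes>\<^sub>M borel :: ('a \<times> 'a) measure)"
    proof -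
      have "{x. fst x = snd x} = {x \<in> space (borel \<Otimes>\<^sub>M borel :: ('a \<times> 'a) measure). fst x = snd x}"
        by (simp add: space_pair_measure)
      also have "\<dots> \<in> sets (borel \<Otimes>\<^sub>M borel)" by measurable
      finally show ?thesis .
    qed
    have "emeasure P {w \<in> space P. X i w = X j w} = emeasure (\<mu> \<Otimes>\<^sub>M \<mu>) {x. fst x = snd x}"
      unfolding eq using True D by (subst emeasure_distr) (auto intro!: arg_cong[where f="emeasure P"])
    also have "\<dots> = (\<integral>\<^sup>+x. emeasure \<mu> (Pair x -` {x. fst x = snd x}) \<partial>\<mu>)"
      using D by (intro \<mu>.emeasure_pair_measure_alt) (simp cong: sets_pair_measure_cong)
    also have "\<dots> = (\<integral>\<^sup>+x. 0 \<partial>\<mu>)"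
    proof (rule nn_integral_cong)
      fix x :: 'a
      have "Pair x -` {x. fst x = snd x} = {x}" by auto
      then show "emeasure \<mu> (Pair x -` {x. fst x = snd x}) = 0"
        using atomless by (simp add: \<mu>.emeasure_eq_measure)
    qed
    finally have "emeasure P {w \<in> space P. X i w = X j w} = 0" by simp
    moreover have "{w \<in> space P. X i w = X j w} \<in> events"
    proof -
      have [measurable]: "X i \<in> borel_measurable P" "X j \<in> borel_measurable P" using True by auto
      show ?thesis by measurable
    qed
    ultimately show ?thesis
      by (intro AE_I[where N="{w \<in> space P. X i w = X j w}"]) auto
  qed auto
  then have "AE w in P. \<forall>i j. i \<ge> 1 \<and> j \<ge> 1 \<and> i \<noteq> j \<longrightarrow> X i w \<noteq> X j w"
    by (simp add: AE_all_countable)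
  then show ?thesis
    by eventually_elim (auto simp: inj_on_def)
qed

end

section \<open>A discrete Poincare inequality on grids\<close>

definition grid :: "nat \<Rightarrow> ('m::finite \<Rightarrow> nat) set" where
  "grid q = {i. \<forall>k. i k < q}"

definition mix :: "'m set \<Rightarrow> ('m \<Rightarrow> nat) \<Rightarrow> ('m \<Rightarrow> nat) \<Rightarrow> 'm \<Rightarrow> nat" where
  "mix S i j = (\<lambda>k. if k \<in> S then j k else i k)"

lemma grid_eq_PiE: "grid q = PiE UNIV (\<lambda>_. {..<q})"
  by (auto simp: grid_def PiE_def)

lemma finite_grid [simp]: "finite (grid q :: ('m::finite \<Rightarrow> nat) set)"
  unfolding grid_eq_PiE by (rule finite_PiE) auto

lemma card_grid: "card (grid q :: ('m::finite \<Rightarrow> nat) set) = q ^ CARD('m)"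
  unfolding grid_eq_PiE by (subst card_PiE) auto

text \<open>Exchanging the coordinates in \<open>S\<close> between \<open>i\<close> and
  \<open>j\<close> is an involution of the set of pairs.\<close>

lemma sum_mix:
  fixes F :: "('m::finite \<Rightarrow> nat) \<Rightarrow> ('m \<Rightarrow> nat) \<Rightarrow> real"
  shows "(\<Sum>(i, j)\<in>grid q \<times> grid q. F (mix S i j) (mix S j i)) = (\<Sum>(i, j)\<in>grid q \<times> grid q. F i j)"
  by (rule sum.reindex_bij_witness[where i="\<lambda>(i, j). (mix S i j, mix S j i)" and j="\<lambda>(i, j). (mix S i j, mix S j i)"])
     (auto simp: mix_def grid_def fun_eq_iff)

text \<open>Exchanging the coordinate \<open>i k\<close> with the free position \<open>l\<close> is
  an involution of the pairs (i, l).\<close>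

lemma sum_grid_line:
  fixes F :: "('m::finite \<Rightarrow> nat) \<Rightarrow> real"
  shows "(\<Sum>i\<in>grid q. \<Sum>l<q. F (i(k := l))) = real q * (\<Sum>i\<in>grid q. F i)"
proof -
  have "(\<Sum>i\<in>grid q. \<Sum>l<q. F (i(k := l))) = (\<Sum>(i, l)\<in>grid q \<times> {..<q}. F (i(k := l)))"
    by (simp add: sum.cartesian_product)
  also have "\<dots> = (\<Sum>(i, l)\<in>grid q \<times> {..<q}. F i)"
    by (rule sum.reindex_bij_witness[where i="\<lambda>(i, l). (i(k := l), i k)" and j="\<lambda>(i, l). (i(k := l), i k)"])
       (auto simp: grid_def fun_eq_iff)
  also have "\<dots> = real q * (\<Sum>i\<in>grid q. F i)"
    by (simp add: sum.cartesian_product[symmetric] sum_distrib_left)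
  finally show ?thesis .
qed

lemma sum_sq_le_card_mult:
  fixes g :: "'b \<Rightarrow> real"
  assumes "finite A"
  shows "(\<Sum>x\<in>A. g x)\<^sup>2 \<le> real (card A) * (\<Sum>x\<in>A. (g x)\<^sup>2)"
  using Cauchy_Schwarz_ineq_sum[of "\<lambda>_. 1" g A] by simp

text \<open>Telescoping and Cauchy-Schwarz. The sum runs over the whole line, independently of
  \<open>a\<close> and \<open>b\<close>, the last position giving 0 because it has no successor; in
  this form it can be summed over the grid by \<open>sum_grid_line\<close>.\<close>

lemma sq_diff_le_line:
  fixes g :: "nat \<Rightarrow> real"
  assumes "a < q" "b < q"
  shows "(g a - g b)\<^sup>2 \<le> real q * (\<Sum>l<q. if Suc l < q then (g (Suc l) - g l)\<^sup>2 else 0)"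
proof -
  have *: "(g a - g b)\<^sup>2 \<le> real q * (\<Sum>l<q. if Suc l < q then (g (Suc l) - g l)\<^sup>2 else 0)"
    if "a \<le> b" "b < q" for a b
  proof -
    have "g b - g a = (\<Sum>l=a..<b. g (Suc l) - g l)"
      using that by (simp add: sum_Suc_diff')
    then have "(g a - g b)\<^sup>2 = (\<Sum>l=a..<b. g (Suc l) - g l)\<^sup>2"
      by (metis power2_commute)
    also have "\<dots> \<le> real (card {a..<b}) * (\<Sum>l=a..<b. (g (Suc l) - g l)\<^sup>2)"
      by (rule sum_sq_le_card_mult) simp
    also have "\<dots> \<le> real q * (\<Sum>l<q. if Suc l < q then (g (Suc l) - g l)\<^sup>2 else 0)"
    proof (rule mult_mono)
      have "(\<Sum>l=a..<b. (g (Suc l) - g l)\<^sup>2) = (\<Sum>l=a..<b. if Suc l < q then (g (Suc l) - g l)\<^sup>2 else 0)"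
        using that by (intro sum.cong) auto
      also have "\<dots> \<le> (\<Sum>l<q. if Suc l < q then (g (Suc l) - g l)\<^sup>2 else 0)"
        using that by (intro sum_mono2) auto
      finally show "(\<Sum>l=a..<b. (g (Suc l) - g l)\<^sup>2) \<le> (\<Sum>l<q. if Suc l < q then (g (Suc l) - g l)\<^sup>2 else 0)" .
    qed (use that in \<open>auto intro!: sum_nonneg\<close>)
    finally show ?thesis .
  qed
  show ?thesis
    using *[of a b] *[of b a] assms by (cases "a \<le> b") (auto simp: power2_commute)
qed

lemma sq_add_le: "(a + b)\<^sup>2 \<le> 2 * a\<^sup>2 + 2 * (b::real)\<^sup>2"
  using zero_le_power2[of "a - b"] by (simp add: power2_eq_square algebra_simps)

text \<open>Changing the coordinates one at a time, the intermediate multi-indices are themselves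
  uniformly distributed on the grid, by the involution \<open>sum_mix\<close>.\<close>

lemma sum_sq_mix_le:
  fixes f :: "('m::finite \<Rightarrow> nat) \<Rightarrow> real"
  assumes "finite S"
  shows "(\<Sum>(i, j)\<in>grid q \<times> grid q. (f i - f (mix S i j))\<^sup>2)
    \<le> 2 ^ card S * (\<Sum>k\<in>S. \<Sum>(i, j)\<in>grid q \<times> grid q. (f i - f (i(k := j k)))\<^sup>2)"
  using assms
proof (induction S)
  case empty
  then show ?case by (simp add: mix_def)
next
  case (insert k S)
  let ?T = "\<lambda>k. \<Sum>(i, j)\<in>grid q \<times> grid q. (f i - f (i(k := j k)))\<^sup>2"
  \<comment> \<open>Since \<open>k\<close> is not in \<open>S\<close>, \<open>mix S j i\<close>
    still carries the value \<open>j k\<close>. Written this way, the last change of a coordinate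
    has the form to which \<open>sum_mix\<close> applies.\<close>
  have mix: "mix (insert k S) i j = (mix S i j)(k := mix S j i k)" for i j
    using insert by (auto simp: mix_def fun_eq_iff)
  have nn: "0 \<le> ?T k" for k
    by (auto intro!: sum_nonneg)
  have "(\<Sum>(i, j)\<in>grid q \<times> grid q. (f i - f (mix (insert k S) i j))\<^sup>2)
    \<le> (\<Sum>(i, j)\<in>grid q \<times> grid q. 2 * (f i - f (mix S i j))\<^sup>2 + 2 * (f (mix S i j) - f ((mix S i j)(k := mix S j i k)))\<^sup>2)"
  proof (intro sum_mono, clarify)
    fix i j
    show "(f i - f (mix (insert k S) i j))\<^sup>2 \<le> 2 * (f i - f (mix S i j))\<^sup>2 + 2 * (f (mix S i j) - f ((mix S i j)(k := mix S j i k)))\<^sup>2"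
      using sq_add_le[of "f i - f (mix S i j)" "f (mix S i j) - f ((mix S i j)(k := mix S j i k))"]
      by (simp add: mix)
  qed
  also have "\<dots> = 2 * (\<Sum>(i, j)\<in>grid q \<times> grid q. (f i - f (mix S i j))\<^sup>2)
      + 2 * (\<Sum>(i, j)\<in>grid q \<times> grid q. (f (mix S i j) - f ((mix S i j)(k := mix S j i k)))\<^sup>2)"
    by (simp add: split_def sum.distrib sum_distrib_left)
  also have "(\<Sum>(i, j)\<in>grid q \<times> grid q. (f (mix S i j) - f ((mix S i j)(k := mix S j i k)))\<^sup>2) = ?T k"
    by (rule sum_mix)
  also have "2 * (\<Sum>(i, j)\<in>grid q \<times> grid q. (f i - f (mix S i j))\<^sup>2) + 2 * ?T k
      \<le> 2 * (2 ^ card S * (\<Sum>k\<in>S. ?T k)) + 2 * 2 ^ card S * ?T k"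
    using insert.IH mult_right_mono[OF one_le_power[of "2::real" "card S"] nn[of k]] by linarith
  also have "\<dots> = 2 ^ card (insert k S) * (\<Sum>k\<in>insert k S. ?T k)"
    using insert by (simp add: algebra_simps)
  finally show ?case .
qed

text \<open>Of the factor q^(m + 2), one q comes from Cauchy-Schwarz along a line, q^m from the
  index \<open>j\<close> on which the line sum does not depend, and one q from the free position on
  the line. The factor 2^m is the doubling at each change of a coordinate.\<close>

lemma grid_poincare:
  fixes f :: "('m::finite \<Rightarrow> nat) \<Rightarrow> real"
  shows "(\<Sum>i\<in>grid q. \<Sum>j\<in>grid q. (f i - f j)\<^sup>2) \<le> 2 ^ CARD('m) * real q ^ (CARD('m) + 2) *
    (\<Sum>k\<in>UNIV. \<Sum>i\<in>grid q. if Suc (i k) < q then (f (i(k := Suc (i k))) - f i)\<^sup>2 else 0)"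
proof -
  let ?D = "\<lambda>k i. if Suc (i k) < q then (f (i(k := Suc (i k))) - f i)\<^sup>2 else 0"
  have mix: "mix UNIV i j = j" for i j :: "'m \<Rightarrow> nat"
    by (simp add: mix_def)
  have T: "(\<Sum>(i, j)\<in>grid q \<times> grid q. (f i - f (i(k := j k)))\<^sup>2)
      \<le> real q ^ (CARD('m) + 2) * (\<Sum>i\<in>grid q. ?D k i)" for k
  proof -
    have "(\<Sum>(i, j)\<in>grid q \<times> grid q. (f i - f (i(k := j k)))\<^sup>2)
        \<le> (\<Sum>(i, j)\<in>grid q \<times> (grid q :: ('m \<Rightarrow> nat) set). real q * (\<Sum>l<q. ?D k (i(k := l))))"
    proof (intro sum_mono, clarify)
      fix i j :: "'m \<Rightarrow> nat" assume "i \<in> grid q" "j \<in> grid q"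
      then have "i k < q" "j k < q" by (auto simp: grid_def)
      from sq_diff_le_line[OF this, of "\<lambda>l. f (i(k := l))"]
      show "(f i - f (i(k := j k)))\<^sup>2 \<le> real q * (\<Sum>l<q. ?D k (i(k := l)))"
        by (simp cong: if_cong)
    qed
    also have "\<dots> = real q * (real q ^ CARD('m) * (\<Sum>i\<in>grid q. \<Sum>l<q. ?D k (i(k := l))))"
      by (simp add: sum.cartesian_product[symmetric] card_grid sum_distrib_left algebra_simps cong: if_cong)
    also have "\<dots> = real q ^ (CARD('m) + 2) * (\<Sum>i\<in>grid q. ?D k i)"
      by (subst sum_grid_line) (simp add: power2_eq_square power_add cong: if_cong)
    finally show ?thesis .
  qed
  have "(\<Sum>i\<in>grid q. \<Sum>j\<in>grid q. (f i - f j)\<^sup>2)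
      \<le> 2 ^ CARD('m) * (\<Sum>k\<in>UNIV. \<Sum>(i, j)\<in>grid q \<times> grid q. (f i - f (i(k := j k)))\<^sup>2)"
    using sum_sq_mix_le[where S="UNIV :: 'm set" and q=q and f=f] by (simp add: mix sum.cartesian_product)
  also have "\<dots> \<le> 2 ^ CARD('m) * (\<Sum>k\<in>UNIV. real q ^ (CARD('m) + 2) * (\<Sum>i\<in>grid q. ?D k i))"
    by (intro mult_left_mono sum_mono T) auto
  finally show ?thesis
    by (simp add: sum_distrib_left mult.assoc cong: if_cong)
qed

text \<open>The empty set gets mean 0, by division by 0; this is the value on cells without sample
  points.\<close>

definition mean :: "('b \<Rightarrow> real) \<Rightarrow> 'b set \<Rightarrow> real" where
  "mean f A = (\<Sum>x\<in>A. f x) / real (card A)"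

lemma mean_sq_le:
  assumes "finite A"
  shows "(mean f A)\<^sup>2 \<le> mean (\<lambda>x. (f x)\<^sup>2) A"
proof (cases "A = {}")
  case False
  then have "0 < real (card A)" using assms by (simp add: card_gt_0_iff)
  then show ?thesis
    using sum_sq_le_card_mult[OF assms, of f]
    by (simp add: mean_def power_divide power2_eq_square divide_simps mult_ac)
qed (simp add: mean_def)

lemma mean_diff: 
  assumes "finite A" "A \<noteq> {}"
  shows "mean (\<lambda>y. c - f y) A = c - mean f A"
  using assms by (simp add: mean_def sum_subtractf divide_simps)

lemma sum_sq_mean_le:
  assumes "finite A"
  shows "(\<Sum>x\<in>A. (f x - mean f A)\<^sup>2) \<le> (\<Sum>x\<in>A. \<Sum>y\<in>A. (f x - f y)\<^sup>2) / card A"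
proof (cases "A = {}")
  case False
  have "(f x - mean f A)\<^sup>2 \<le> mean (\<lambda>y. (f x - f y)\<^sup>2) A" for x
    using mean_sq_le[OF assms, of "\<lambda>y. f x - f y"] mean_diff[OF assms False] by simp
  then have "(\<Sum>x\<in>A. (f x - mean f A)\<^sup>2) \<le> (\<Sum>x\<in>A. mean (\<lambda>y. (f x - f y)\<^sup>2) A)"
    by (intro sum_mono)
  then show ?thesis
    by (simp add: mean_def sum_divide_distrib)
qed simp

lemma sq_mean_diff_le:
  assumes "finite A" "finite B" "A \<noteq> {}" "B \<noteq> {}"
  shows "(mean f A - mean f B)\<^sup>2 \<le> (\<Sum>x\<in>A. \<Sum>y\<in>B. (f x - f y)\<^sup>2) / (card A * card B)"
proof -
  have eq: "mean f A - c = mean (\<lambda>x. f x - c) A" for c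
    using assms by (simp add: mean_def sum_subtractf divide_simps)
  have "(mean f A - mean f B)\<^sup>2 \<le> mean (\<lambda>x. (f x - mean f B)\<^sup>2) A"
    unfolding eq by (rule mean_sq_le) fact
  also have "\<dots> \<le> mean (\<lambda>x. mean (\<lambda>y. (f x - f y)\<^sup>2) B) A"
  proof -
    have "(f x - mean f B)\<^sup>2 \<le> mean (\<lambda>y. (f x - f y)\<^sup>2) B" for x
      using mean_sq_le[OF assms(2), of "\<lambda>y. f x - f y"] mean_diff[OF assms(2,4)] by simp
    then show ?thesis
      unfolding mean_def[of _ A] by (intro divide_right_mono sum_mono) auto
  qed
  also have "\<dots> = (\<Sum>x\<in>A. \<Sum>y\<in>B. (f x - f y)\<^sup>2) / (card A * card B)"
    by (simp add: mean_def sum_divide_distrib mult.commute)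
  finally show ?thesis .
qed

text \<open>\<open>f\<close> is compared with its mean over each cell. The deviation within a cell
  is paid by pairs inside the cell, the difference of two neighbouring means by pairs joining the
  two cells, and \<open>grid_poincare\<close> handles the means. Passing between sums over points
  and sums over cells costs only the bounds \<open>\<nu>\<^sub>0\<close> and
  \<open>\<nu>\<^sub>1\<close> on the cell counts.\<close>

lemma cell_poincare:
  fixes f :: "'a \<Rightarrow> real" and W :: "('m::finite \<Rightarrow> nat) \<Rightarrow> 'a set"
    and w :: "'a \<Rightarrow> 'a \<Rightarrow> real"
  assumes fin: "\<And>i. i \<in> grid q \<Longrightarrow> finite (W i)"
    and disj: "\<And>i j. i \<in> grid q \<Longrightarrow> j \<in> grid q \<Longrightarrow> i \<noteq> j \<Longrightarrow> W i \<inter> W j = {}"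
    and U: "U = (\<Union>i\<in>grid q. W i)"
    and lo: "\<And>i. i \<in> grid q \<Longrightarrow> \<nu>\<^sub>0 \<le> real (card (W i))"
    and hi: "\<And>i. i \<in> grid q \<Longrightarrow> real (card (W i)) \<le> \<nu>\<^sub>1"
    and pos: "0 < \<nu>\<^sub>0" "0 < q" "0 < \<eta>\<^sub>0"
    and w0: "\<And>x y. x \<in> U \<Longrightarrow> y \<in> U \<Longrightarrow> 0 \<le> w x y"
    and w_same: "\<And>i x y. i \<in> grid q \<Longrightarrow> x \<in> W i \<Longrightarrow> y \<in> W i \<Longrightarrow> \<eta>\<^sub>0 \<le> w x y"
    and w_next: "\<And>i k x y. i \<in> grid q \<Longrightarrow> Suc (i k) < q \<Longrightarrow> x \<in> W i \<Longrightarrow> y \<in> W (i(k := Suc (i k))) \<Longrightarrow> \<eta>\<^sub>0 \<le> w x y"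
  shows "\<exists>a. (\<Sum>x\<in>U. (f x - a)\<^sup>2) \<le>
    (2 / \<nu>\<^sub>0 + 2 * \<nu>\<^sub>1 / \<nu>\<^sub>0\<^sup>2 * 2 ^ CARD('m) * (real q)\<^sup>2 * CARD('m)) * ((\<Sum>x\<in>U. \<Sum>y\<in>U. w x y * (f x - f y)\<^sup>2) / \<eta>\<^sub>0)"
proof -
  let ?G = "grid q :: ('m \<Rightarrow> nat) set"
  define a where "a i = mean f (W i)" for i
  define a0 where "a0 = mean a ?G"
  define Dir where "Dir = (\<Sum>x\<in>U. \<Sum>y\<in>U. w x y * (f x - f y)\<^sup>2) / \<eta>\<^sub>0"
  have ne: "W i \<noteq> {}" if "i \<in> ?G" for i
    using lo[OF that] pos by auto
  have cpos: "0 < real (card (W i))" if "i \<in> ?G" for i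
    using lo[OF that] pos by linarith
  have G0: "(\<lambda>_. 0) \<in> ?G" using pos by (simp add: grid_def)
  have \<nu>1: "0 < \<nu>\<^sub>1" using lo[OF G0] hi[OF G0] pos by linarith
  have finU: "finite U" unfolding U using fin by auto
  have sumU: "(\<Sum>x\<in>U. F x) = (\<Sum>i\<in>?G. \<Sum>x\<in>W i. F x)" for F :: "'a \<Rightarrow> real"
    unfolding U using fin disj by (subst sum.UNION_disjoint) auto
  \<comment> \<open>Each cell is charged with its pairs to a single cell \<open>h i\<close>. Since
    \<open>x\<close> determines its cell, no pair of points is used twice. The choices are
    \<open>h i = i\<close> and the successor of \<open>i\<close> in one direction.\<close>
  have pairs: "(\<Sum>i\<in>?G. if P i then (\<Sum>x\<in>W i. \<Sum>y\<in>W (h i). (f x - f y)\<^sup>2) else 0) \<le> Dir"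
    if h: "\<And>i. i \<in> ?G \<Longrightarrow> P i \<Longrightarrow> h i \<in> ?G"
      and wh: "\<And>i x y. i \<in> ?G \<Longrightarrow> P i \<Longrightarrow> x \<in> W i \<Longrightarrow> y \<in> W (h i) \<Longrightarrow> \<eta>\<^sub>0 \<le> w x y" for P h
  proof -
    have "(if P i then (\<Sum>x\<in>W i. \<Sum>y\<in>W (h i). (f x - f y)\<^sup>2) else 0) \<le> (\<Sum>x\<in>W i. \<Sum>y\<in>U. w x y * (f x - f y)\<^sup>2 / \<eta>\<^sub>0)"
      if i: "i \<in> ?G" for i
    proof -
      have sub: "W i \<subseteq> U" using i U by auto
      have "(\<Sum>x\<in>W i. \<Sum>y\<in>W (h i). (f x - f y)\<^sup>2) \<le> (\<Sum>x\<in>W i. \<Sum>y\<in>U. w x y * (f x - f y)\<^sup>2 / \<eta>\<^sub>0)" if "P i"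
      proof (rule sum_mono)
        fix x assume x: "x \<in> W i"
        have sub': "W (h i) \<subseteq> U" using h[OF i that] U by auto
        have "(\<Sum>y\<in>W (h i). (f x - f y)\<^sup>2) \<le> (\<Sum>y\<in>W (h i). w x y * (f x - f y)\<^sup>2 / \<eta>\<^sub>0)"
        proof (rule sum_mono)
          fix y assume "y \<in> W (h i)"
          then have "\<eta>\<^sub>0 * (f x - f y)\<^sup>2 \<le> w x y * (f x - f y)\<^sup>2"
            using wh[OF i that x] by (intro mult_right_mono) auto
          then show "(f x - f y)\<^sup>2 \<le> w x y * (f x - f y)\<^sup>2 / \<eta>\<^sub>0"
            using pos by (simp add: field_simps)
        qed
        also have "\<dots> \<le> (\<Sum>y\<in>U. w x y * (f x - f y)\<^sup>2 / \<eta>\<^sub>0)"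
          using finU sub sub' x w0 pos by (intro sum_mono2) auto
        finally show "(\<Sum>y\<in>W (h i). (f x - f y)\<^sup>2) \<le> (\<Sum>y\<in>U. w x y * (f x - f y)\<^sup>2 / \<eta>\<^sub>0)" .
      qed
      moreover have "0 \<le> (\<Sum>x\<in>W i. \<Sum>y\<in>U. w x y * (f x - f y)\<^sup>2 / \<eta>\<^sub>0)"
        using sub w0 pos by (intro sum_nonneg) auto
      ultimately show ?thesis by simp
    qed
    then have "(\<Sum>i\<in>?G. if P i then (\<Sum>x\<in>W i. \<Sum>y\<in>W (h i). (f x - f y)\<^sup>2) else 0)
        \<le> (\<Sum>i\<in>?G. \<Sum>x\<in>W i. \<Sum>y\<in>U. w x y * (f x - f y)\<^sup>2 / \<eta>\<^sub>0)"
      by (rule sum_mono)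
    also have "\<dots> = Dir"
      by (simp add: sumU[symmetric] Dir_def sum_divide_distrib)
    finally show ?thesis .
  qed
  have same: "(\<Sum>i\<in>?G. \<Sum>x\<in>W i. \<Sum>y\<in>W i. (f x - f y)\<^sup>2) \<le> Dir"
    using pairs[of "\<lambda>_. True" "\<lambda>i. i"] w_same by simp
  have nxt: "(\<Sum>i\<in>?G. if Suc (i k) < q then (\<Sum>x\<in>W i. \<Sum>y\<in>W (i(k := Suc (i k))). (f x - f y)\<^sup>2) else 0) \<le> Dir" for k
    using pairs[of "\<lambda>i. Suc (i k) < q" "\<lambda>i. i(k := Suc (i k))"] w_next by (simp add: grid_def)
  have within: "(\<Sum>i\<in>?G. \<Sum>x\<in>W i. (f x - a i)\<^sup>2) \<le> Dir / \<nu>\<^sub>0"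
  proof -
    have "(\<Sum>i\<in>?G. \<Sum>x\<in>W i. (f x - a i)\<^sup>2) \<le> (\<Sum>i\<in>?G. (\<Sum>x\<in>W i. \<Sum>y\<in>W i. (f x - f y)\<^sup>2) / \<nu>\<^sub>0)"
    proof (rule sum_mono)
      fix i assume i: "i \<in> ?G"
      have "(\<Sum>x\<in>W i. (f x - a i)\<^sup>2) \<le> (\<Sum>x\<in>W i. \<Sum>y\<in>W i. (f x - f y)\<^sup>2) / card (W i)"
        unfolding a_def by (rule sum_sq_mean_le) (rule fin[OF i])
      also have "\<dots> \<le> (\<Sum>x\<in>W i. \<Sum>y\<in>W i. (f x - f y)\<^sup>2) / \<nu>\<^sub>0"
        using lo[OF i] pos by (intro divide_left_mono) (auto intro!: sum_nonneg mult_pos_pos cpos i)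
      finally show "(\<Sum>x\<in>W i. (f x - a i)\<^sup>2) \<le> (\<Sum>x\<in>W i. \<Sum>y\<in>W i. (f x - f y)\<^sup>2) / \<nu>\<^sub>0" .
    qed
    also have "\<dots> \<le> Dir / \<nu>\<^sub>0"
      unfolding sum_divide_distrib[symmetric] using same pos by (intro divide_right_mono) auto
    finally show ?thesis .
  qed
  have step: "(a (i(k := Suc (i k))) - a i)\<^sup>2 \<le> (\<Sum>x\<in>W i. \<Sum>y\<in>W (i(k := Suc (i k))). (f x - f y)\<^sup>2) / \<nu>\<^sub>0\<^sup>2"
    if i: "i \<in> ?G" "Suc (i k) < q" for i k
  proof -
    have i': "i(k := Suc (i k)) \<in> ?G" using i by (simp add: grid_def)
    have "(a i - a (i(k := Suc (i k))))\<^sup>2 \<le>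
       (\<Sum>x\<in>W i. \<Sum>y\<in>W (i(k := Suc (i k))). (f x - f y)\<^sup>2) / (card (W i) * card (W (i(k := Suc (i k)))))"
      unfolding a_def using sq_mean_diff_le[OF fin[OF i(1)] fin[OF i'] ne[OF i(1)] ne[OF i']] by simp
    also have "\<dots> \<le> (\<Sum>x\<in>W i. \<Sum>y\<in>W (i(k := Suc (i k))). (f x - f y)\<^sup>2) / \<nu>\<^sub>0\<^sup>2"
    proof (rule divide_left_mono)
      show "\<nu>\<^sub>0\<^sup>2 \<le> real (card (W i) * card (W (i(k := Suc (i k)))))"
        unfolding power2_eq_square of_nat_mult using lo[OF i(1)] lo[OF i'] pos by (intro mult_mono) auto
    qed (use pos cpos[OF i(1)] cpos[OF i'] in \<open>auto intro!: sum_nonneg mult_pos_pos\<close>)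
    finally show ?thesis by (simp add: power2_commute)
  qed
  have "(\<Sum>k\<in>UNIV. \<Sum>i\<in>?G. if Suc (i k) < q then (a (i(k := Suc (i k))) - a i)\<^sup>2 else 0)
      \<le> (\<Sum>k\<in>(UNIV :: 'm set). \<Sum>i\<in>?G. (if Suc (i k) < q then (\<Sum>x\<in>W i. \<Sum>y\<in>W (i(k := Suc (i k))). (f x - f y)\<^sup>2) else 0) / \<nu>\<^sub>0\<^sup>2)"
    by (intro sum_mono) (use step in auto)
  also have "\<dots> \<le> (\<Sum>k\<in>(UNIV :: 'm set). Dir / \<nu>\<^sub>0\<^sup>2)"
    unfolding sum_divide_distrib[symmetric]
    by (intro sum_mono divide_right_mono nxt) auto
  finally have edges: "(\<Sum>k\<in>UNIV. \<Sum>i\<in>?G. if Suc (i k) < q then (a (i(k := Suc (i k))) - a i)\<^sup>2 else 0)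
      \<le> CARD('m) * (Dir / \<nu>\<^sub>0\<^sup>2)" by simp
  have cG: "card ?G = q ^ CARD('m)" by (rule card_grid)
  have "(\<Sum>i\<in>?G. (a i - a0)\<^sup>2) \<le> (\<Sum>i\<in>?G. \<Sum>j\<in>?G. (a i - a j)\<^sup>2) / card ?G"
    unfolding a0_def by (rule sum_sq_mean_le) simp
  also have "\<dots> \<le> 2 ^ CARD('m) * real q ^ (CARD('m) + 2) * (CARD('m) * (Dir / \<nu>\<^sub>0\<^sup>2)) / card ?G"
    using grid_poincare[where f=a and q=q] mult_left_mono[OF edges, of "2 ^ CARD('m) * real q ^ (CARD('m) + 2)"]
    by (intro divide_right_mono) auto
  \<comment> \<open>Dividing by the q^m cells leaves q^2: with q of order h / \<epsilon> this is the
    squared side of the cube in units of \<epsilon>.\<close>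
  also have "\<dots> = 2 ^ CARD('m) * (real q)\<^sup>2 * CARD('m) * (Dir / \<nu>\<^sub>0\<^sup>2)"
    using pos by (simp add: cG power_add power2_eq_square field_simps)
  finally have between: "(\<Sum>i\<in>?G. (a i - a0)\<^sup>2) \<le> 2 ^ CARD('m) * (real q)\<^sup>2 * CARD('m) * (Dir / \<nu>\<^sub>0\<^sup>2)" .
  have "(\<Sum>x\<in>U. (f x - a0)\<^sup>2) = (\<Sum>i\<in>?G. \<Sum>x\<in>W i. (f x - a0)\<^sup>2)"
    by (rule sumU)
  also have "\<dots> \<le> (\<Sum>i\<in>?G. \<Sum>x\<in>W i. 2 * (f x - a i)\<^sup>2 + 2 * (a i - a0)\<^sup>2)"
  proof (intro sum_mono)
    fix i x
    show "(f x - a0)\<^sup>2 \<le> 2 * (f x - a i)\<^sup>2 + 2 * (a i - a0)\<^sup>2"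
      using sq_add_le[of "f x - a i" "a i - a0"] by simp
  qed
  also have "\<dots> = 2 * (\<Sum>i\<in>?G. \<Sum>x\<in>W i. (f x - a i)\<^sup>2) + 2 * (\<Sum>i\<in>?G. card (W i) * (a i - a0)\<^sup>2)"
    by (simp add: sum.distrib sum_distrib_left mult_ac)
  also have "\<dots> \<le> 2 * (\<Sum>i\<in>?G. \<Sum>x\<in>W i. (f x - a i)\<^sup>2) + 2 * (\<nu>\<^sub>1 * (\<Sum>i\<in>?G. (a i - a0)\<^sup>2))"
    using hi by (intro add_left_mono mult_left_mono) (auto simp: sum_distrib_left intro!: sum_mono mult_right_mono)
  also have "\<dots> \<le> 2 * (Dir / \<nu>\<^sub>0) + 2 * (\<nu>\<^sub>1 * (2 ^ CARD('m) * (real q)\<^sup>2 * CARD('m) * (Dir / \<nu>\<^sub>0\<^sup>2)))"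
    using within mult_left_mono[OF between, of \<nu>\<^sub>1] \<nu>1 by linarith
  also have "\<dots> = (2 / \<nu>\<^sub>0 + 2 * \<nu>\<^sub>1 / \<nu>\<^sub>0\<^sup>2 * 2 ^ CARD('m) * (real q)\<^sup>2 * CARD('m)) * Dir"
    by (simp add: algebra_simps)
  finally show ?thesis unfolding Dir_def by blast
qed

section \<open>Charts of submanifolds\<close>

text \<open>\<open>frechet_derivative\<close> is a choice among all derivatives, so equal sets of
  derivatives give equal values even where there is no derivative.\<close>

lemma frechet_derivative_cong_open:
  assumes "open S" "x \<in> S" "\<And>x. x \<in> S \<Longrightarrow> f x = g x"
  shows "f differentiable (at x) \<longleftrightarrow> g differentiable (at x)"
    and "frechet_derivative f (at x) = frechet_derivative g (at x)"
proof -
  have "(f has_derivative f') (at x) \<longleftrightarrow> (g has_derivative f') (at x)" for f'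
    using has_derivative_transform_within_open[OF _ assms(1,2)] assms(3) by metis
  then show "f differentiable (at x) \<longleftrightarrow> g differentiable (at x)"
    and "frechet_derivative f (at x) = frechet_derivative g (at x)"
    by (auto simp: differentiable_def frechet_derivative_def)
qed

lemma Ck_on_cong_open:
  assumes "open S" "\<And>x. x \<in> S \<Longrightarrow> f x = g x"
  shows "Ck_on k S f \<longleftrightarrow> Ck_on k S g"
  using assms(2)
proof (induction k arbitrary: f g)
  case 0
  then show ?case by (simp cong: continuous_on_cong)
next
  case (Suc k)
  have "frechet_derivative f (at x) = frechet_derivative g (at x)" if "x \<in> S" for x
    using frechet_derivative_cong_open(2)[OF assms(1) that] Suc.prems by blast
  then have "Ck_on k S (\<lambda>x. frechet_derivative f (at x) v) \<longleftrightarrow> Ck_on k S (\<lambda>x. frechet_derivative g (at x) v)" for v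
    by (intro Suc.IH) simp
  moreover have "f differentiable (at x) \<longleftrightarrow> g differentiable (at x)" if "x \<in> S" for x
    using frechet_derivative_cong_open(1)[OF assms(1) that] Suc.prems by blast
  ultimately show ?case by simp
qed

lemma frechet_derivative_comp_linear:
  fixes l :: "'b::euclidean_space \<Rightarrow> 'a::euclidean_space"
  assumes "linear l" "f differentiable (at (l x))"
  shows "((\<lambda>x. f (l x)) has_derivative (\<lambda>v. frechet_derivative f (at (l x)) (l v))) (at x)"
proof -
  have "(l has_derivative l) (at x)"
    using assms(1) by (simp add: linear_imp_has_derivative)
  from has_derivative_compose[OF this assms(2)[unfolded frechet_derivative_works]]
  show ?thesis .
qed

text \<open>For a linear inner map the derivative of the composition in direction v is the
  derivative of \<open>f\<close> in direction \<open>l v\<close>, again composed with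
  \<open>l\<close>. The induction therefore stays within functions of the same form and needs no
  product rule.\<close>

lemma Ck_on_comp_linear:
  fixes l :: "'b::euclidean_space \<Rightarrow> 'a::euclidean_space"
  assumes "linear l" "open V" "Ck_on k V f"
  shows "Ck_on k (l -` V) (\<lambda>x. f (l x))"
  using assms(3)
proof (induction k arbitrary: f)
  case 0
  then show ?case
    using linear_continuous_on[of l] assms(1)
    by (auto simp: linear_conv_bounded_linear intro!: continuous_on_compose2[of V f])
next
  case (Suc k)
  have op: "open (l -` V)"
    using assms by (intro open_vimage linear_continuous_on) (auto simp: linear_conv_bounded_linear)
  have d: "((\<lambda>x. f (l x)) has_derivative (\<lambda>v. frechet_derivative f (at (l x)) (l v))) (at x)" if "x \<in> l -` V" for x
    using Suc.prems that by (intro frechet_derivative_comp_linear assms) auto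
  have "Ck_on k (l -` V) (\<lambda>x. frechet_derivative f (at (l x)) (l v))" for v
    using Suc.prems by (intro Suc.IH) auto
  moreover have "frechet_derivative (\<lambda>x. f (l x)) (at x) v = frechet_derivative f (at (l x)) (l v)"
    if "x \<in> l -` V" for x v
    by (rule fun_cong[OF frechet_derivative_at[OF d[OF that], symmetric]])
  ultimately have "Ck_on k (l -` V) (\<lambda>x. frechet_derivative (\<lambda>x. f (l x)) (at x) v)" for v
    using Ck_on_cong_open[OF op, of "\<lambda>x. frechet_derivative (\<lambda>x. f (l x)) (at x) v" "\<lambda>x. frechet_derivative f (at (l x)) (l v)" k]
    by blast
  then show ?case
    using d by (auto simp: differentiable_def)
qed

lemma smooth_onD:
  assumes "smooth_on S f"
  shows "\<And>x. x \<in> S \<Longrightarrow> f differentiable (at x)"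
    and "continuous_on S (\<lambda>x. frechet_derivative f (at x) v)"
proof -
  have "Ck_on (Suc 0) S f" using assms by (simp add: smooth_on_def)
  then show "\<And>x. x \<in> S \<Longrightarrow> f differentiable (at x)"
    and "continuous_on S (\<lambda>x. frechet_derivative f (at x) v)" by auto
qed

text \<open>The inverse slice chart is restricted to the subspace \<open>L\<close>, which is
  identified with R^m by a linear isometry. The slice chart itself provides the continuous inverse
  and, by differentiating \<open>\<phi> (\<sigma> z) = z\<close>, the injectivity of the
  derivative.\<close>

lemma local_parametrization_exists:
  fixes M :: "'a::euclidean_space set"
  assumes M: "smooth_submanifold CARD('m::finite) M" and x0: "x0 \<in> M"
  obtains W :: "(real^'m) set" and \<psi> y0 where "local_parametrization M W \<psi>" "y0 \<in> W" "\<psi> y0 = x0"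
proof -
  obtain U V L and \<phi> \<sigma> :: "'a \<Rightarrow> 'a" where
    U: "open U" "x0 \<in> U" and V: "open V" and L: "subspace L" "dim L = CARD('m)"
    and hom: "homeomorphism U V \<phi> \<sigma>" and sm: "smooth_on U \<phi>" "smooth_on V \<sigma>"
    and sl: "\<phi> ` (M \<inter> U) = L \<inter> V"
    using bspec[OF M[unfolded smooth_submanifold_def] x0] by (elim exE conjE)
  obtain l :: "real^'m \<Rightarrow> 'a" and g where
    l: "linear l" "linear g" "l ` UNIV = L" "\<And>x. norm (l x) = norm x" "\<And>x. g (l x) = x" "\<And>x. x \<in> L \<Longrightarrow> l (g x) = x"
    using isometries_subspaces[of "UNIV :: (real^'m) set" L] L by (metis UNIV_I dim_UNIV DIM_cart DIM_real mult.right_neutral subspace_UNIV)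
  define W where "W = l -` V"
  define \<psi> where "\<psi> y = \<sigma> (l y)" for y
  have inv: "\<And>x. x \<in> U \<Longrightarrow> \<sigma> (\<phi> x) = x" "\<And>y. y \<in> V \<Longrightarrow> \<phi> (\<sigma> y) = y" "\<phi> ` U = V" "\<sigma> ` V = U"
    "continuous_on U \<phi>" "continuous_on V \<sigma>"
    using hom by (auto simp: homeomorphism_def)
  have cl: "continuous_on S l" "continuous_on S' g" for S S'
    using l by (auto intro!: linear_continuous_on simp: linear_conv_bounded_linear[symmetric])
  have opW: "open W"
    unfolding W_def using V cl by (intro open_vimage) auto
  have sub: "\<psi> ` W = M \<inter> U"
  proof -
    have "\<psi> ` W = \<sigma> ` (L \<inter> V)"
      using l(3) by (auto simp: W_def \<psi>_def image_iff)
    also have "\<dots> = \<sigma> ` \<phi> ` (M \<inter> U)" by (simp add: sl)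
    also have "\<dots> = M \<inter> U" using inv by (force simp: image_iff)
    finally show ?thesis .
  qed
  have phiL: "\<phi> x \<in> L" if "x \<in> M \<inter> U" for x
    using sl that by blast
  have smo: "smooth_on W \<psi>"
    using sm(2) Ck_on_comp_linear[OF l(1) V] unfolding smooth_on_def W_def \<psi>_def by blast
  have der: "inj (frechet_derivative \<psi> (at y))" if y: "y \<in> W" for y
  proof -
    have yV: "l y \<in> V" using y by (simp add: W_def)
    have ds: "\<sigma> differentiable (at (l y))" using smooth_onD(1)[OF sm(2) yV] .
    have dp: "\<phi> differentiable (at (\<sigma> (l y)))" using smooth_onD(1)[OF sm(1)] inv yV by blast
    have "frechet_derivative \<psi> (at y) = (\<lambda>v. frechet_derivative \<sigma> (at (l y)) (l v))"
      unfolding \<psi>_def using frechet_derivative_comp_linear[OF l(1) ds] by (rule frechet_derivative_at[symmetric])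
    moreover have "((\<lambda>z. \<phi> (\<sigma> z)) has_derivative (\<lambda>v. frechet_derivative \<phi> (at (\<sigma> (l y))) (frechet_derivative \<sigma> (at (l y)) v))) (at (l y))"
      using has_derivative_compose[OF ds[unfolded frechet_derivative_works] dp[unfolded frechet_derivative_works]] .
    then have "((\<lambda>z. z) has_derivative (\<lambda>v. frechet_derivative \<phi> (at (\<sigma> (l y))) (frechet_derivative \<sigma> (at (l y)) v))) (at (l y))"
      by (rule has_derivative_transform_within_open[OF _ V yV]) (use inv in auto)
    then have "(\<lambda>v. frechet_derivative \<phi> (at (\<sigma> (l y))) (frechet_derivative \<sigma> (at (l y)) v)) = (\<lambda>v. v)"
      using has_derivative_unique has_derivative_ident by blast
    then have "frechet_derivative \<phi> (at (\<sigma> (l y))) (frechet_derivative \<sigma> (at (l y)) v) = v" for v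
      by meson
    ultimately show ?thesis
      using l(5) by (metis injI)
  qed
  have "homeomorphism W (\<psi> ` W) \<psi> (\<lambda>x. g (\<phi> x))"
  proof (rule homeomorphismI)
    show "continuous_on W \<psi>"
      unfolding \<psi>_def by (rule continuous_on_compose2[OF inv(6) cl(1)]) (auto simp: W_def)
    show "continuous_on (\<psi> ` W) (\<lambda>x. g (\<phi> x))"
      unfolding sub by (rule continuous_on_compose2[OF cl(2) continuous_on_subset[OF inv(5)]]) auto
    show "(\<lambda>x. g (\<phi> x)) ` (\<psi> ` W) \<subseteq> W"
      using inv(2) l(5) by (auto simp: \<psi>_def W_def)
    show "g (\<phi> (\<psi> y)) = y" if "y \<in> W" for y
      using inv(2) l(5) that by (auto simp: \<psi>_def W_def)
    show "\<psi> (g (\<phi> x)) = x" if "x \<in> \<psi> ` W" for x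
      using that inv(1) l(6) phiL unfolding sub by (auto simp: \<psi>_def)
  qed simp_all
  then have "local_parametrization M W \<psi>"
    unfolding local_parametrization_def using opW smo der sub U(1) by (auto simp: openin_open)
  moreover obtain y0 where "y0 \<in> W" "\<psi> y0 = x0"
    using sub x0 U by (metis (no_types, lifting) IntI imageE)
  ultimately show ?thesis using that by blast
qed

text \<open>Strict differentiability. Continuity of the directional derivatives makes the derivative
  of \<open>f\<close> minus its linear part at \<open>y0\<close> small in operator norm near
  \<open>y0\<close>, and the mean value inequality on the convex ball does the rest.\<close>

lemma smooth_strict_derivative:
  fixes f :: "'b::euclidean_space \<Rightarrow> 'a::euclidean_space"
  assumes "open W" "smooth_on W f" "y0 \<in> W" "0 < \<tau>"
  obtains r where "0 < r" "ball y0 r \<subseteq> W"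
    "\<And>y z. y \<in> ball y0 r \<Longrightarrow> z \<in> ball y0 r \<Longrightarrow>
      norm (f y - f z - frechet_derivative f (at y0) (y - z)) \<le> \<tau> * norm (y - z)"
proof -
  define D where "D y = frechet_derivative f (at y)" for y
  have der: "(f has_derivative D y) (at y)" if "y \<in> W" for y
    using smooth_onD(1)[OF assms(2) that] by (simp add: D_def frechet_derivative_works)
  \<comment> \<open>The operator norm is bounded by a sum over the basis vectors, each contributing
    \<open>t\<close>.\<close>
  define t where "t = \<tau> / DIM('b)"
  have t: "0 < t" using assms by (simp add: t_def)
  have "eventually (\<lambda>y. dist (D y e) (D y0 e) < t) (at y0)" for e
  proof -
    have "isCont (\<lambda>y. D y e) y0"
      using smooth_onD(2)[OF assms(2), of e] assms(1,3) by (simp add: D_def continuous_on_eq_continuous_at)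
    then show ?thesis using t by (simp add: isCont_def tendsto_iff)
  qed
  then have "eventually (\<lambda>y. \<forall>e\<in>Basis. dist (D y e) (D y0 e) < t) (at y0)"
    by (intro eventually_ball_finite) auto
  then obtain d where d: "0 < d" "\<And>y. y \<noteq> y0 \<Longrightarrow> dist y y0 < d \<Longrightarrow> \<forall>e\<in>Basis. dist (D y e) (D y0 e) < t"
    by (auto simp: eventually_at)
  obtain d' where d': "0 < d'" "ball y0 d' \<subseteq> W"
    using assms open_contains_ball by blast
  define r where "r = min d d'"
  have r: "0 < r" "ball y0 r \<subseteq> W" "r \<le> d" using d d' by (auto simp: r_def)
  have on: "onorm (\<lambda>v. D y v - D y0 v) \<le> \<tau>" if y: "y \<in> ball y0 r" for y
  proof (rule onorm_le)
    fix v :: 'b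
    have lin: "linear (D y)" "linear (D y0)"
      using der y r assms(3) has_derivative_linear by blast+
    have eq: "D y' v = (\<Sum>e\<in>Basis. (v \<bullet> e) *\<^sub>R D y' e)" if "linear (D y')" for y'
      by (subst euclidean_representation[of v, symmetric]) (simp only: linear_sum[OF that] linear_cmul[OF that] o_def)
    have "norm (D y v - D y0 v) = norm (\<Sum>e\<in>Basis. (v \<bullet> e) *\<^sub>R (D y e - D y0 e))"
      by (simp add: eq[OF lin(1)] eq[OF lin(2)] sum_subtractf scaleR_diff_right)
    also have "\<dots> \<le> (\<Sum>e\<in>(Basis :: 'b set). norm v * t)"
    proof (rule sum_norm_le)
      fix e :: 'b assume e: "e \<in> Basis"
      have "norm (D y e - D y0 e) \<le> t"
        using d(2)[of y] y r e t by (cases "y = y0") (auto simp: dist_norm norm_minus_commute less_imp_le)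
      then show "norm ((v \<bullet> e) *\<^sub>R (D y e - D y0 e)) \<le> norm v * t"
        unfolding norm_scaleR using Basis_le_norm[OF e, of v] by (intro mult_mono) auto
    qed
    also have "\<dots> = \<tau> * norm v" by (simp add: t_def)
    finally show "norm (D y v - D y0 v) \<le> \<tau> * norm v" .
  qed
  have lin0: "bounded_linear (D y0)" using der assms(3) has_derivative_bounded_linear by blast
  have "norm (f y - f z - D y0 (y - z)) \<le> \<tau> * norm (y - z)" if "y \<in> ball y0 r" "z \<in> ball y0 r" for y z
  proof -
    have "norm ((f y - D y0 y) - (f z - D y0 z)) \<le> \<tau> * norm (y - z)"
    proof (rule differentiable_bound[where S="ball y0 r" and f="\<lambda>y. f y - D y0 y"])
      show "((\<lambda>y. f y - D y0 y) has_derivative (\<lambda>v. D x v - D y0 v)) (at x within ball y0 r)" if "x \<in> ball y0 r" for x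
        using that r lin0
        by (intro has_derivative_diff has_derivative_at_withinI[OF der] bounded_linear_imp_has_derivative) auto
    qed (use that on in auto)
    moreover have "D y0 (y - z) = D y0 y - D y0 z"
      using lin0 by (intro linear_diff bounded_linear.linear)
    then have "f y - f z - D y0 (y - z) = (f y - D y0 y) - (f z - D y0 z)"
      by (simp only:) simp
    ultimately show ?thesis by (simp only:)
  qed
  then show ?thesis using that r unfolding D_def by blast
qed

lemma continuous_on_det:
  fixes G :: "'b::topological_space \<Rightarrow> real^'m^'m"
  assumes "\<And>i j. continuous_on S (\<lambda>y. G y $ i $ j)"
  shows "continuous_on S (\<lambda>y. det (G y))"
  unfolding det_def by (intro continuous_on_sum continuous_on_mult continuous_on_prod continuous_on_const assms)

text \<open>Along the segment from the identity to \<open>G\<close> all matrices other than possibly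
  the endpoint are positive definite, as is \<open>G\<close> itself; none has a kernel, so the
  determinant never vanishes and keeps its sign by the intermediate value theorem.\<close>

lemma det_pos_definite:
  fixes G :: "real^'m^'m"
  assumes pd: "\<And>v. v \<noteq> 0 \<Longrightarrow> 0 < v \<bullet> (G *v v)"
  shows "0 < det G"
proof (rule ccontr)
  assume neg: "\<not> 0 < det G"
  define H where "H t = t *\<^sub>R G + (1 - t) *\<^sub>R mat 1" for t :: real
  have "continuous_on {0..1} (\<lambda>t. det (H t))"
    by (rule continuous_on_det) (auto simp: H_def intro!: continuous_intros)
  moreover have "det (H 1) \<le> 0" "0 \<le> det (H 0)"
    using neg by (auto simp: H_def det_I)
  ultimately obtain t where t: "0 \<le> t" "t \<le> 1" "det (H t) = 0"
    using IVT2'[of "\<lambda>t. det (H t)" 1 0 0] by auto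
  then have "\<not> invertible (H t)" by (simp add: invertible_det_nz)
  then obtain v where v: "v \<noteq> 0" "H t *v v = 0"
    using matrix_left_invertible_ker[of "H t"] invertible_left_inverse[of "H t"] by auto
  have "H t *v v = t *\<^sub>R (G *v v) + (1 - t) *\<^sub>R v"
    by (simp add: H_def matrix_vector_mult_add_rdistrib scaleR_matrix_vector_assoc[symmetric])
  then have "t * (v \<bullet> (G *v v)) + (1 - t) * (v \<bullet> v) = 0"
    using v(2) by (metis inner_add_right inner_scaleR_right inner_zero_right)
  moreover have "0 < v \<bullet> (G *v v)" "0 < v \<bullet> v" using pd v by auto
  then have "0 < t * (v \<bullet> (G *v v)) + (1 - t) * (v \<bullet> v)"
    using t by (cases "t = 0") (auto intro!: add_pos_nonneg simp: inner_commute)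
  ultimately show False by simp
qed

text \<open>The Gram matrix represents the quadratic form |A v|^2, where \<open>A\<close> is the
  injective derivative.\<close>

lemma gram_det_pos:
  fixes f :: "real^'m \<Rightarrow> 'a::euclidean_space"
  assumes "f differentiable (at y)" "inj (frechet_derivative f (at y))"
  shows "0 < det (gram f y)"
proof (rule det_pos_definite)
  fix v :: "real^'m" assume v: "v \<noteq> 0"
  define A where "A = frechet_derivative f (at y)"
  have lin: "linear A" unfolding A_def using assms(1) by (rule linear_frechet_derivative)
  have Av: "A v = (\<Sum>i\<in>UNIV. (v $ i) *\<^sub>R A (axis i 1))"
    by (subst basis_expansion[of v, symmetric])
       (simp only: linear_sum[OF lin] linear_cmul[OF lin] o_def scalar_mult_eq_scaleR)
  have "v \<bullet> (gram f y *v v) = (\<Sum>i\<in>UNIV. \<Sum>j\<in>UNIV. v $ i * (v $ j * (A (axis i 1) \<bullet> A (axis j 1))))"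
    by (simp add: inner_vec_def matrix_vector_mult_def gram_def A_def sum_distrib_left mult_ac)
  also have "\<dots> = A v \<bullet> A v"
    unfolding Av by (simp add: inner_sum_left inner_sum_right sum_distrib_left inner_commute mult_ac)
  also have "\<dots> > 0"
    using assms(2) v lin by (simp add: A_def[symmetric]) (metis injD linear_0)
  finally show "0 < v \<bullet> (gram f y *v v)" .
qed

section \<open>Measures with a density in charts\<close>

lemma sets_borel_continuous_vimage:
  assumes "continuous_on S f" "S \<in> sets borel" "Q \<in> sets borel"
  shows "S \<inter> f -` Q \<in> sets borel"
proof -
  have "f -` Q \<inter> space (restrict_space borel S) \<in> sets (restrict_space borel S)"
    by (rule measurable_sets[OF borel_measurable_continuous_on_restrict[OF assms(1)] assms(3)])
  then show ?thesis
    using assms(2) by (auto simp: sets_restrict_space space_restrict_space Int_commute)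
qed

text \<open>The interface between geometry and probability. Up to the tolerance \<tau> the chart is
  linear and the measure is \<open>g\<close> times Lebesgue measure. The last clause says that small
  parameter balls cover a neighbourhood of the centre in \<open>M\<close>; it excludes other sheets
  of \<open>M\<close> that come back close to the centre.\<close>

definition nice_ball :: "'a::euclidean_space set \<Rightarrow> 'a measure \<Rightarrow> (real^'m \<Rightarrow> 'a) \<Rightarrow> real^'m \<Rightarrow>
    (real^'m \<Rightarrow> 'a) \<Rightarrow> real \<Rightarrow> real \<Rightarrow> real \<Rightarrow> bool" where
  "nice_ball M m \<psi> y0 A g \<tau> r \<longleftrightarrow> 0 < r \<and>
     (\<forall>y\<in>ball y0 r. \<forall>z\<in>ball y0 r. norm (\<psi> y - \<psi> z - A (y - z)) \<le> \<tau> * norm (y - z)) \<and>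
     (\<forall>Q\<in>sets borel. Q \<subseteq> ball y0 r \<longrightarrow> \<psi> ` Q \<in> sets borel \<and> \<psi> ` Q \<subseteq> M \<and>
        \<bar>measure m (\<psi> ` Q) - g * measure lborel Q\<bar> \<le> \<tau> * measure lborel Q) \<and>
     (\<forall>r'. 0 < r' \<and> r' \<le> r \<longrightarrow> (\<exists>s>0. \<forall>x\<in>M. dist x (\<psi> y0) < s \<longrightarrow> x \<in> \<psi> ` ball y0 r'))"

lemma nice_ballD:
  assumes "nice_ball M m \<psi> y0 A g \<tau> r"
  shows "0 < r"
    and "\<And>y z. y \<in> ball y0 r \<Longrightarrow> z \<in> ball y0 r \<Longrightarrow> norm (\<psi> y - \<psi> z - A (y - z)) \<le> \<tau> * norm (y - z)"
    and "\<And>Q. Q \<in> sets borel \<Longrightarrow> Q \<subseteq> ball y0 r \<Longrightarrow> \<psi> ` Q \<in> sets borel"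
    and "\<And>Q. Q \<in> sets borel \<Longrightarrow> Q \<subseteq> ball y0 r \<Longrightarrow> \<psi> ` Q \<subseteq> M"
    and "\<And>Q. Q \<in> sets borel \<Longrightarrow> Q \<subseteq> ball y0 r \<Longrightarrow>
      \<bar>measure m (\<psi> ` Q) - g * measure lborel Q\<bar> \<le> \<tau> * measure lborel Q"
    and "\<And>r'. 0 < r' \<Longrightarrow> r' \<le> r \<Longrightarrow> \<exists>s>0. \<forall>x\<in>M. dist x (\<psi> y0) < s \<longrightarrow> x \<in> \<psi> ` ball y0 r'"
proof -
  note * = assms[unfolded nice_ball_def]
  note 1 = conjunct1[OF *] and 2 = conjunct1[OF conjunct2[OF *]]
    and 3 = conjunct1[OF conjunct2[OF conjunct2[OF *]]] and 4 = conjunct2[OF conjunct2[OF conjunct2[OF *]]]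
  show "0 < r" by (rule 1)
  show "norm (\<psi> y - \<psi> z - A (y - z)) \<le> \<tau> * norm (y - z)" if "y \<in> ball y0 r" "z \<in> ball y0 r" for y z
    by (rule bspec[OF bspec[OF 2 that(1)] that(2)])
  show "\<psi> ` Q \<in> sets borel" "\<psi> ` Q \<subseteq> M" "\<bar>measure m (\<psi> ` Q) - g * measure lborel Q\<bar> \<le> \<tau> * measure lborel Q"
    if "Q \<in> sets borel" "Q \<subseteq> ball y0 r" for Q
  proof -
    note Q = mp[OF bspec[OF 3 that(1)] that(2)]
    show "\<psi> ` Q \<in> sets borel" by (rule conjunct1[OF Q])
    show "\<psi> ` Q \<subseteq> M" by (rule conjunct1[OF conjunct2[OF Q]])
    show "\<bar>measure m (\<psi> ` Q) - g * measure lborel Q\<bar> \<le> \<tau> * measure lborel Q"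
      by (rule conjunct2[OF conjunct2[OF Q]])
  qed
  show "\<exists>s>0. \<forall>x\<in>M. dist x (\<psi> y0) < s \<longrightarrow> x \<in> \<psi> ` ball y0 r'" if "0 < r'" "r' \<le> r" for r'
    by (rule mp[OF spec[OF 4] conjI[OF that]])
qed

lemma nice_ballI:
  assumes "0 < r"
    and "\<And>y z. y \<in> ball y0 r \<Longrightarrow> z \<in> ball y0 r \<Longrightarrow> norm (\<psi> y - \<psi> z - A (y - z)) \<le> \<tau> * norm (y - z)"
    and "\<And>Q. Q \<in> sets borel \<Longrightarrow> Q \<subseteq> ball y0 r \<Longrightarrow> \<psi> ` Q \<in> sets borel"
    and "\<And>Q. Q \<in> sets borel \<Longrightarrow> Q \<subseteq> ball y0 r \<Longrightarrow> \<psi> ` Q \<subseteq> M"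
    and "\<And>Q. Q \<in> sets borel \<Longrightarrow> Q \<subseteq> ball y0 r \<Longrightarrow>
      \<bar>measure m (\<psi> ` Q) - g * measure lborel Q\<bar> \<le> \<tau> * measure lborel Q"
    and "\<And>r'. 0 < r' \<Longrightarrow> r' \<le> r \<Longrightarrow> \<exists>s>0. \<forall>x\<in>M. dist x (\<psi> y0) < s \<longrightarrow> x \<in> \<psi> ` ball y0 r'"
  shows "nice_ball M m \<psi> y0 A g \<tau> r"
  unfolding nice_ball_def
proof (intro conjI ballI allI impI)
  fix r' assume "0 < r' \<and> r' \<le> r"
  then show "\<exists>s>0. \<forall>x\<in>M. dist x (\<psi> y0) < s \<longrightarrow> x \<in> \<psi> ` ball y0 r'"
    by (intro assms(6)) simp_all
qed (rule assms; assumption)+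

text \<open>\<open>A\<close> and \<open>g\<close> are chosen before \<tau>: they are the derivative
  and the density in coordinates at the point, so exact first-order asymptotics follow and not only
  two-sided bounds. The notion survives multiplication of the measure by a constant, which is how it
  passes to the mixture of the two pieces.\<close>

definition regular_piece :: "'m::finite itself \<Rightarrow> 'a::euclidean_space set \<Rightarrow> 'a measure \<Rightarrow> bool" where
  "regular_piece _ M m \<longleftrightarrow> compact M \<and>
     (\<forall>x0\<in>M. \<exists>(\<psi> :: real^'m \<Rightarrow> 'a) y0 A g. linear A \<and> inj A \<and> \<psi> y0 = x0 \<and> 0 < g \<and>
        (\<forall>\<tau>>0. \<exists>r. nice_ball M m \<psi> y0 A g \<tau> r))"

lemma perturb_product:
  fixes a b \<tau> :: real
  assumes "0 < a" "0 < b" "0 < \<tau>"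
  obtains \<sigma> where "0 < \<sigma>" "\<sigma> \<le> a" "\<sigma> \<le> b" "(a + \<sigma>) * (b + \<sigma>) \<le> a * b + \<tau>" "a * b - \<tau> \<le> (a - \<sigma>) * (b - \<sigma>)"
proof -
  \<comment> \<open>The bound \<tau> / (a + b + 1) absorbs \<sigma> (a + b) and, thanks to \<sigma>
    <= 1, also \<sigma>^2; the bounds by \<open>a\<close> and \<open>b\<close> keep the lower
    factors nonnegative.\<close>
  define \<sigma> where "\<sigma> = min (min a b) (min 1 (\<tau> / (a + b + 1)))"
  have s: "0 < \<sigma>" "\<sigma> \<le> a" "\<sigma> \<le> b" "\<sigma> \<le> 1" "\<sigma> \<le> \<tau> / (a + b + 1)"
    using assms by (auto simp: \<sigma>_def)
  have 1: "\<sigma> * (a + b + 1) \<le> \<tau>"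
    using s(5) assms by (simp add: pos_le_divide_eq)
  have 2: "\<sigma> * \<sigma> \<le> \<sigma> * 1" using s by (intro mult_left_mono) auto
  have "(a + \<sigma>) * (b + \<sigma>) \<le> a * b + \<tau>" using 1 2 by (simp add: algebra_simps)
  moreover have "(a - \<sigma>) * (b - \<sigma>) = a * b - \<sigma> * (a + b + 1) + \<sigma> + \<sigma> * \<sigma>" by (simp add: algebra_simps)
  then have "a * b - \<tau> \<le> (a - \<sigma>) * (b - \<sigma>)" using 1 s(1) zero_le_square[of \<sigma>] by linarith
  ultimately show ?thesis using that s by blast
qed

text \<open>In a parametrization the measure has the continuous density
  \<open>\<rho> (\<psi> y) * sqrt (det (gram \<psi> y))\<close>; its positive value at
  \<open>y0\<close> serves as \<open>g\<close>.\<close>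

lemma regular_piece_density:
  fixes M :: "'a::euclidean_space set"
  assumes M: "compact M" "smooth_submanifold CARD('m::finite) M"
    and vol: "riemannian_volume TYPE('m) M \<nu>"
    and C: "0 < C" and \<rho>: "admissible_density M \<nu> C \<rho>"
  shows "regular_piece TYPE('m) M (density_on M \<nu> \<rho>)"
  unfolding regular_piece_def
proof (intro conjI ballI)
  fix x0 assume x0: "x0 \<in> M"
  obtain W :: "(real^'m) set" and \<psi> y0 where lp: "local_parametrization M W \<psi>" and y0: "y0 \<in> W" "\<psi> y0 = x0"
    using local_parametrization_exists[OF M(2) x0] .
  have W: "open W" "smooth_on W \<psi>" "\<And>y. y \<in> W \<Longrightarrow> inj (frechet_derivative \<psi> (at y))"
    "openin (top_of_set M) (\<psi> ` W)"
    using lp by (auto simp: local_parametrization_def)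
  obtain \<theta> where hom: "homeomorphism W (\<psi> ` W) \<psi> \<theta>"
    using lp by (auto simp: local_parametrization_def)
  have \<theta>: "continuous_on W \<psi>" "continuous_on (\<psi> ` W) \<theta>" "\<And>y. y \<in> W \<Longrightarrow> \<theta> (\<psi> y) = y"
    using hom by (auto simp: homeomorphism_def)
  have WM: "\<psi> ` W \<subseteq> M" using W(4) by (auto simp: openin_open)
  have borelM: "M \<in> sets borel" using M(1) by (intro borel_closed compact_imp_closed)
  have borelW: "\<psi> ` W \<in> sets borel"
  proof -
    obtain T where "open T" "\<psi> ` W = M \<inter> T"
      using W(4) by (auto simp: openin_open)
    then show ?thesis using borelM by auto
  qed
  have img_borel: "\<psi> ` Q \<in> sets borel" if Q: "Q \<in> sets borel" "Q \<subseteq> W" for Q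
  proof -
    have "\<psi> ` Q = \<psi> ` W \<inter> \<theta> -` Q"
      using Q(2) \<theta>(3) by (auto simp: subset_iff)
    then show ?thesis
      using sets_borel_continuous_vimage[OF \<theta>(2) borelW Q(1)] by simp
  qed
  define A where "A = frechet_derivative \<psi> (at y0)"
  have diff: "\<psi> differentiable (at y)" if "y \<in> W" for y
    using smooth_onD(1)[OF W(2) that] .
  have linA: "linear A" unfolding A_def using diff[OF y0(1)] by (rule linear_frechet_derivative)
  have injA: "inj A" unfolding A_def by (rule W(3)) fact
  define J where "J y = sqrt (det (gram \<psi> y))" for y
  have contJ: "continuous_on W J"
    unfolding J_def
    by (intro continuous_on_real_sqrt continuous_on_det)
       (auto simp: gram_def intro!: continuous_on_inner smooth_onD(2)[OF W(2)])
  have J0: "0 < J y0"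
    unfolding J_def using gram_det_pos[OF diff[OF y0(1)] W(3)[OF y0(1)]] by simp
  obtain L where L: "L-lipschitz_on M \<rho>" using \<rho> by (auto simp: admissible_density_def)
  have cont\<rho>M: "continuous_on M \<rho>" using L by (rule lipschitz_on_continuous_on)
  have cont\<rho>: "continuous_on W (\<lambda>y. \<rho> (\<psi> y))"
    using WM by (intro continuous_on_compose2[OF cont\<rho>M \<theta>(1)]) auto
  have \<rho>pos: "0 < \<rho> x" if "x \<in> M" for x
  proof -
    have "1 / C \<le> \<rho> x" using \<rho> that by (auto simp: admissible_density_def)
    moreover have "0 < 1 / C" using C by simp
    ultimately show ?thesis by linarith
  qed
  have sets\<nu>: "sets \<nu> = sets borel" using vol by (simp add: riemannian_volume_def)
  have meas\<rho>: "(\<lambda>x. ennreal (\<rho> x * indicator M x)) \<in> borel_measurable \<nu>"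
  proof -
    have "(\<lambda>x. indicator M x *\<^sub>R \<rho> x) \<in> borel_measurable borel"
      using borelM cont\<rho>M by (rule borel_measurable_continuous_on_indicator)
    then have "(\<lambda>x. \<rho> x * indicator M x) \<in> borel_measurable \<nu>"
      by (simp add: measurable_cong_sets[OF sets\<nu> refl] mult.commute)
    then show ?thesis by measurable
  qed
  have near: "\<exists>r>0. ball y0 r \<subseteq> W \<and> (\<forall>y\<in>ball y0 r. \<bar>f y - f y0\<bar> \<le> \<sigma>)"
    if f: "continuous_on W f" and "0 < \<sigma>" for f :: "real^'m \<Rightarrow> real" and \<sigma>
  proof -
    obtain d where d: "0 < d" "\<And>y. y \<in> W \<Longrightarrow> dist y y0 < d \<Longrightarrow> dist (f y) (f y0) < \<sigma>"
      using f y0(1) \<open>0 < \<sigma>\<close> unfolding continuous_on_iff by metis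
    obtain d' where d': "0 < d'" "ball y0 d' \<subseteq> W"
      using W(1) y0(1) open_contains_ball by blast
    show ?thesis
      using d d' by (intro exI[of _ "min d d'"]) (auto simp: dist_commute dist_real_def subset_iff less_imp_le)
  qed
  have "\<exists>r. nice_ball M (density_on M \<nu> \<rho>) \<psi> y0 A (\<rho> x0 * J y0) \<tau> r" if \<tau>: "0 < \<tau>" for \<tau>
  proof -
    obtain \<sigma> where \<sigma>: "0 < \<sigma>" "\<sigma> \<le> \<rho> x0" "\<sigma> \<le> J y0" "(\<rho> x0 + \<sigma>) * (J y0 + \<sigma>) \<le> \<rho> x0 * J y0 + \<tau>"
      "\<rho> x0 * J y0 - \<tau> \<le> (\<rho> x0 - \<sigma>) * (J y0 - \<sigma>)"
      using perturb_product[OF \<rho>pos[OF x0] J0 \<tau>] .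
    obtain r1 where r1: "0 < r1" "ball y0 r1 \<subseteq> W" "\<And>y z. y \<in> ball y0 r1 \<Longrightarrow> z \<in> ball y0 r1 \<Longrightarrow>
        norm (\<psi> y - \<psi> z - A (y - z)) \<le> \<tau> * norm (y - z)"
      using smooth_strict_derivative[OF W(1,2) y0(1) \<tau>] unfolding A_def by blast
    obtain r2 where r2: "0 < r2" "\<And>y. y \<in> ball y0 r2 \<Longrightarrow> \<bar>J y - J y0\<bar> \<le> \<sigma>"
      using near[OF contJ \<sigma>(1)] by blast
    obtain r3 where r3: "0 < r3" "\<And>y. y \<in> ball y0 r3 \<Longrightarrow> \<bar>\<rho> (\<psi> y) - \<rho> x0\<bar> \<le> \<sigma>"
      using near[OF cont\<rho> \<sigma>(1)] y0 by blast
    define r where "r = min r1 (min r2 r3)"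
    have r: "0 < r" "ball y0 r \<subseteq> ball y0 r1" "ball y0 r \<subseteq> ball y0 r2" "ball y0 r \<subseteq> ball y0 r3"
      using r1 r2 r3 by (auto simp: r_def)
    have rW: "ball y0 r \<subseteq> W" using r r1 by blast
    have meas: "\<bar>measure (density_on M \<nu> \<rho>) (\<psi> ` Q) - \<rho> x0 * J y0 * measure lborel Q\<bar> \<le> \<tau> * measure lborel Q"
      if Q: "Q \<in> sets borel" "Q \<subseteq> ball y0 r" for Q
    proof -
      define B where "B = \<psi> ` Q"
      have QW: "Q \<subseteq> W" using Q rW by blast
      have B: "B \<in> sets borel" "B \<subseteq> M" "B \<subseteq> \<psi> ` W"
        using img_borel[OF Q(1) QW] QW WM by (auto simp: B_def)
      \<comment> \<open>The volume formula integrates over the preimage within \<open>W\<close>,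
        which by injectivity is \<open>Q\<close> itself.\<close>
      have pre: "W \<inter> \<psi> -` B = Q"
        using QW \<theta>(3) by (auto simp: B_def subset_iff) (metis)
      have fin: "emeasure lborel Q = ennreal (measure lborel Q)"
        using Q(2) by (intro emeasure_eq_ennreal_measure) 
          (metis bounded_ball bounded_subset emeasure_bounded_finite less_irrefl infinity_ennreal_def)
      have \<nu>B: "emeasure \<nu> B = (\<integral>\<^sup>+y. ennreal (J y) * indicator Q y \<partial>lborel)"
        using vol lp B pre unfolding riemannian_volume_def J_def by auto
      have mB: "emeasure (density_on M \<nu> \<rho>) B = (\<integral>\<^sup>+x. ennreal (\<rho> x) * indicator B x \<partial>\<nu>)"
        unfolding density_on_def using B sets\<nu> meas\<rho>
        by (subst emeasure_density) (auto intro!: nn_integral_cong simp: indicator_def)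
      have \<rho>B: "\<bar>\<rho> x - \<rho> x0\<bar> \<le> \<sigma>" if "x \<in> B" for x
        using that Q r r3 by (auto simp: B_def)
      have JQ: "\<bar>J y - J y0\<bar> \<le> \<sigma>" if "y \<in> Q" for y
        using that Q r r2 by auto
      have "emeasure (density_on M \<nu> \<rho>) B \<le> (\<integral>\<^sup>+x. ennreal (\<rho> x0 + \<sigma>) * indicator B x \<partial>\<nu>)"
        unfolding mB using \<rho>B by (intro nn_integral_mono) (fastforce simp: indicator_def intro!: ennreal_leI)
      also have "\<dots> = ennreal (\<rho> x0 + \<sigma>) * emeasure \<nu> B"
        using B sets\<nu> by (intro nn_integral_cmult_indicator) auto
      also have "emeasure \<nu> B \<le> (\<integral>\<^sup>+y. ennreal (J y0 + \<sigma>) * indicator Q y \<partial>lborel)"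
        unfolding \<nu>B using JQ by (intro nn_integral_mono) (fastforce simp: indicator_def intro!: ennreal_leI)
      also have "\<dots> = ennreal (J y0 + \<sigma>) * emeasure lborel Q"
        using Q by (intro nn_integral_cmult_indicator) auto
      finally have "emeasure (density_on M \<nu> \<rho>) B \<le> ennreal (\<rho> x0 + \<sigma>) * (ennreal (J y0 + \<sigma>) * emeasure lborel Q)"
        by (simp add: mult_left_mono)
      also have "\<dots> = ennreal ((\<rho> x0 + \<sigma>) * (J y0 + \<sigma>) * measure lborel Q)"
        using \<sigma> J0 \<rho>pos[OF x0] by (simp add: fin ennreal_mult[symmetric] mult.assoc del: ennreal_plus)
      also have "\<dots> \<le> ennreal ((\<rho> x0 * J y0 + \<tau>) * measure lborel Q)"
        using \<sigma> by (intro ennreal_leI mult_right_mono) auto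
      finally have up: "emeasure (density_on M \<nu> \<rho>) B \<le> ennreal ((\<rho> x0 * J y0 + \<tau>) * measure lborel Q)" .
      have finB: "emeasure (density_on M \<nu> \<rho>) B = ennreal (measure (density_on M \<nu> \<rho>) B)"
        using up by (intro emeasure_eq_ennreal_measure) (auto simp: top_unique)
      have "ennreal ((\<rho> x0 * J y0 - \<tau>) * measure lborel Q) \<le> ennreal ((\<rho> x0 - \<sigma>) * ((J y0 - \<sigma>) * measure lborel Q))"
        unfolding mult.assoc[symmetric] using \<sigma> by (intro ennreal_leI mult_right_mono) auto
      also have "\<dots> = ennreal (\<rho> x0 - \<sigma>) * (ennreal (J y0 - \<sigma>) * emeasure lborel Q)"
        using \<sigma> by (simp add: fin ennreal_mult)
      also have "ennreal (J y0 - \<sigma>) * emeasure lborel Q = (\<integral>\<^sup>+y. ennreal (J y0 - \<sigma>) * indicator Q y \<partial>lborel)"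
        using Q by (intro nn_integral_cmult_indicator[symmetric]) auto
      also have "ennreal (\<rho> x0 - \<sigma>) * \<dots> \<le> ennreal (\<rho> x0 - \<sigma>) * emeasure \<nu> B"
        unfolding \<nu>B using JQ by (intro mult_left_mono nn_integral_mono) (fastforce simp: indicator_def intro!: ennreal_leI)+
      also have "\<dots> = (\<integral>\<^sup>+x. ennreal (\<rho> x0 - \<sigma>) * indicator B x \<partial>\<nu>)"
        using B sets\<nu> by (intro nn_integral_cmult_indicator[symmetric]) auto
      also have "\<dots> \<le> emeasure (density_on M \<nu> \<rho>) B"
        unfolding mB using \<rho>B by (intro nn_integral_mono) (fastforce simp: indicator_def intro!: ennreal_leI)
      finally have "(\<rho> x0 * J y0 - \<tau>) * measure lborel Q \<le> measure (density_on M \<nu> \<rho>) B"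
        unfolding finB by (simp add: ennreal_le_iff)
      moreover have "measure (density_on M \<nu> \<rho>) B \<le> (\<rho> x0 * J y0 + \<tau>) * measure lborel Q"
        using up \<tau> J0 \<rho>pos[OF x0] unfolding finB by (subst (asm) ennreal_le_iff) auto
      ultimately show ?thesis by (simp add: B_def abs_le_iff algebra_simps)
    qed
    have open_img: "\<exists>s>0. \<forall>x\<in>M. dist x (\<psi> y0) < s \<longrightarrow> x \<in> \<psi> ` ball y0 r'" if r': "0 < r'" "r' \<le> r" for r'
    proof -
      have "openin (top_of_set (\<psi> ` W)) (\<psi> ` ball y0 r')"
        using homeomorphism_imp_open_map[OF hom, of "ball y0 r'"] r' rW W(1)
        by (auto simp: openin_open_eq[OF W(1)] subset_iff)
      then have "openin (top_of_set M) (\<psi> ` ball y0 r')"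
        using W(4) openin_trans by blast
      then show ?thesis
        using r' unfolding openin_euclidean_subtopology_iff by auto
    qed
    have "nice_ball M (density_on M \<nu> \<rho>) \<psi> y0 A (\<rho> x0 * J y0) \<tau> r"
    proof (rule nice_ballI)
      fix Q assume Q: "Q \<in> sets borel" "Q \<subseteq> ball y0 r"
      show "\<psi> ` Q \<in> sets borel" using img_borel[OF Q(1)] Q(2) rW by (meson subset_trans)
      show "\<psi> ` Q \<subseteq> M" using Q(2) rW WM by (meson image_mono subset_trans)
      show "\<bar>measure (density_on M \<nu> \<rho>) (\<psi> ` Q) - \<rho> x0 * J y0 * measure lborel Q\<bar> \<le> \<tau> * measure lborel Q"
        by (rule meas[OF Q])
    next
      fix y z assume "y \<in> ball y0 r" "z \<in> ball y0 r"
      then show "norm (\<psi> y - \<psi> z - A (y - z)) \<le> \<tau> * norm (y - z)"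
        using r(2) by (intro r1(3)) (erule subsetD, assumption)+
    qed (rule r(1), rule open_img)
    then show ?thesis ..
  qed
  then show "\<exists>(\<psi> :: real^'m \<Rightarrow> 'a) y0 A g. linear A \<and> inj A \<and> \<psi> y0 = x0 \<and> 0 < g \<and>
        (\<forall>\<tau>>0. \<exists>r. nice_ball M (density_on M \<nu> \<rho>) \<psi> y0 A g \<tau> r)"
    using linA injA y0 J0 \<rho>pos[OF x0] by (intro exI[of _ \<psi>] exI[of _ y0] exI[of _ A] exI[of _ "\<rho> x0 * J y0"]) auto
qed fact

lemma regular_piece_scale:
  assumes "regular_piece TYPE('m::finite) M m" "0 < a"
    and eq: "\<And>B. B \<in> sets borel \<Longrightarrow> B \<subseteq> M \<Longrightarrow> measure \<mu> B = a * measure m B"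
  shows "regular_piece TYPE('m) M \<mu>"
  unfolding regular_piece_def
proof (intro conjI ballI)
  show "compact M" using assms(1) by (simp add: regular_piece_def)
  fix x0 assume "x0 \<in> M"
  then obtain \<psi> :: "real^'m \<Rightarrow> 'a" and y0 A g where *: "linear A" "inj A" "\<psi> y0 = x0" "0 < g"
    "\<And>\<tau>. 0 < \<tau> \<Longrightarrow> \<exists>r. nice_ball M m \<psi> y0 A g \<tau> r"
    using assms(1) unfolding regular_piece_def by blast
  have "\<exists>r. nice_ball M \<mu> \<psi> y0 A (a * g) \<tau> r" if \<tau>: "0 < \<tau>" for \<tau>
  proof -
    define t where "t = min \<tau> (\<tau> / a)"
    have t: "0 < t" "t \<le> \<tau>" "a * t \<le> \<tau>"
      using \<tau> assms(2) by (auto simp: t_def min_def field_simps)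
    obtain r where r: "nice_ball M m \<psi> y0 A g t r" using *(5)[OF t(1)] by blast
    have "\<bar>measure \<mu> (\<psi> ` Q) - a * g * measure lborel Q\<bar> \<le> \<tau> * measure lborel Q"
      if Q: "Q \<in> sets borel" "Q \<subseteq> ball y0 r" for Q
    proof -
      note q = nice_ballD(3)[OF r Q] nice_ballD(4)[OF r Q] nice_ballD(5)[OF r Q]
      have "\<bar>measure \<mu> (\<psi> ` Q) - a * g * measure lborel Q\<bar> = a * \<bar>measure m (\<psi> ` Q) - g * measure lborel Q\<bar>"
        using assms(2) eq[OF q(1,2)] by (simp add: abs_mult[of a, simplified abs_of_pos[OF assms(2)], symmetric] algebra_simps)
      also have "\<dots> \<le> a * (t * measure lborel Q)"
        using q(3) assms(2) by (intro mult_left_mono) auto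
      also have "\<dots> \<le> \<tau> * measure lborel Q"
        unfolding mult.assoc[symmetric] using t by (intro mult_right_mono) auto
      finally show ?thesis .
    qed
    moreover have "norm (\<psi> y - \<psi> z - A (y - z)) \<le> \<tau> * norm (y - z)" if "y \<in> ball y0 r" "z \<in> ball y0 r" for y z
    proof -
      have "norm (\<psi> y - \<psi> z - A (y - z)) \<le> t * norm (y - z)" by (rule nice_ballD(2)[OF r that])
      also have "\<dots> \<le> \<tau> * norm (y - z)" using t by (intro mult_right_mono) auto
      finally show ?thesis .
    qed
    ultimately have "nice_ball M \<mu> \<psi> y0 A (a * g) \<tau> r"
      by (intro nice_ballI nice_ballD[OF r])
    then show ?thesis ..
  qed
  then show "\<exists>(\<psi> :: real^'m \<Rightarrow> 'a) y0 A g. linear A \<and> inj A \<and> \<psi> y0 = x0 \<and> 0 < g \<and> (\<forall>\<tau>>0. \<exists>r. nice_ball M \<mu> \<psi> y0 A g \<tau> r)"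
    using *(1-4) assms(2) by (intro exI[of _ \<psi>] exI[of _ y0] exI[of _ A] exI[of _ "a * g"]) auto
qed

lemma nice_ball_bilipschitz:
  assumes r: "nice_ball M m \<psi> y0 A g \<tau> r" and A: "linear A" "\<And>v. c * norm v \<le> norm (A v)"
  shows "\<And>y z. y \<in> ball y0 r \<Longrightarrow> z \<in> ball y0 r \<Longrightarrow> (c - \<tau>) * norm (y - z) \<le> norm (\<psi> y - \<psi> z)"
    and "\<And>y z. y \<in> ball y0 r \<Longrightarrow> z \<in> ball y0 r \<Longrightarrow> norm (\<psi> y - \<psi> z) \<le> (onorm A + \<tau>) * norm (y - z)"
    and "\<tau> < c \<Longrightarrow> inj_on \<psi> (ball y0 r)"
    and "0 \<le> \<tau> \<Longrightarrow> continuous_on (ball y0 r) \<psi>"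
proof -
  have bl: "bounded_linear A" using A(1) by (simp add: linear_conv_bounded_linear)
  show lo: "(c - \<tau>) * norm (y - z) \<le> norm (\<psi> y - \<psi> z)" if "y \<in> ball y0 r" "z \<in> ball y0 r" for y z
    using nice_ballD(2)[OF r that] A(2)[of "y - z"] norm_triangle_sub[of "A (y - z)" "\<psi> y - \<psi> z"]
    by (simp add: norm_minus_commute algebra_simps)
  show hi: "norm (\<psi> y - \<psi> z) \<le> (onorm A + \<tau>) * norm (y - z)" if "y \<in> ball y0 r" "z \<in> ball y0 r" for y z
    using nice_ballD(2)[OF r that] onorm[OF bl, of "y - z"] norm_triangle_sub[of "\<psi> y - \<psi> z" "A (y - z)"]
    by (simp add: algebra_simps)
  show "inj_on \<psi> (ball y0 r)" if "\<tau> < c"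
  proof (rule inj_onI)
    fix y z assume "y \<in> ball y0 r" "z \<in> ball y0 r" "\<psi> y = \<psi> z"
    then show "y = z" using lo[of y z] that by (simp add: mult_le_0_iff)
  qed
  show "continuous_on (ball y0 r) \<psi>" if "0 \<le> \<tau>"
  proof (rule lipschitz_on_continuous_on)
    show "(onorm A + \<tau>)-lipschitz_on (ball y0 r) \<psi>"
      by (rule lipschitz_onI) (use hi that onorm_pos_le[OF bl] in \<open>auto simp: dist_norm\<close>)
  qed
qed

text \<open>In a chart of \<open>M\<close> the set \<open>N\<close> is the image of part of a
  k-dimensional subspace under the inverse slice chart followed by the inverse of \<psi>. That
  inverse is Lipschitz because \<psi> shrinks distances at most by the factor c / 2, so the image is
  Lebesgue null, and the comparison with Lebesgue measure carries this to \<open>m\<close>.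
  Compactness of \<open>N\<close> globalises.\<close>

lemma regular_piece_null:
  fixes M N :: "'a::euclidean_space set"
  assumes reg: "regular_piece TYPE('m::finite) M m" and m: "finite_measure m" "sets m = sets borel"
    and N: "compact N" "N \<subseteq> M" "smooth_submanifold k N" "k < CARD('m)"
  shows "measure m N = 0"
proof -
  interpret finite_measure m by fact
  have borelN: "N \<in> sets borel" using N(1) by (intro borel_closed compact_imp_closed)
  have "\<exists>T. open T \<and> x0 \<in> T \<and> measure m (N \<inter> T) = 0" if x0: "x0 \<in> N" for x0
  proof -
    obtain \<psi> :: "real^'m \<Rightarrow> 'a" and y0 A g where chart: "linear A" "inj A" "\<psi> y0 = x0" "0 < g"
      "\<And>\<tau>. 0 < \<tau> \<Longrightarrow> \<exists>r. nice_ball M m \<psi> y0 A g \<tau> r"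
      using reg x0 N(2) unfolding regular_piece_def by blast
    obtain c where c: "0 < c" "\<And>v. c * norm v \<le> norm (A v)"
      using linear_inj_bounded_below_pos[OF chart(1,2)] by blast
    obtain r where r: "nice_ball M m \<psi> y0 A g (c/2) r" using chart(5)[of "c/2"] c by auto
    have lo: "c/2 * norm (y - z) \<le> norm (\<psi> y - \<psi> z)" if "y \<in> ball y0 r" "z \<in> ball y0 r" for y z
      using nice_ball_bilipschitz(1)[OF r chart(1) c(2) that] by simp
    have inj: "inj_on \<psi> (ball y0 r)"
      using nice_ball_bilipschitz(3)[OF r chart(1) c(2)] c(1) by simp
    have cont: "continuous_on (ball y0 r) \<psi>"
      using nice_ball_bilipschitz(4)[OF r chart(1) c(2)] c(1) by simp
    obtain s where s: "0 < s" "\<And>x. x \<in> M \<Longrightarrow> dist x x0 < s \<Longrightarrow> x \<in> \<psi> ` ball y0 r"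
      using nice_ballD(6)[OF r nice_ballD(1)[OF r] order_refl] chart(3) by blast
    obtain U V L and \<phi> \<sigma> :: "'a \<Rightarrow> 'a" where
      U: "open U" "x0 \<in> U" and V: "open V" and L: "subspace L" "dim L = k"
      and hom: "homeomorphism U V \<phi> \<sigma>" and sm: "smooth_on U \<phi>" "smooth_on V \<sigma>"
      and sl: "\<phi> ` (N \<inter> U) = L \<inter> V"
      using bspec[OF N(3)[unfolded smooth_submanifold_def] x0] by (elim exE conjE)
    have inv: "\<And>x. x \<in> U \<Longrightarrow> \<sigma> (\<phi> x) = x" using hom by (simp add: homeomorphism_def)
    \<comment> \<open>A copy of \<open>L\<close> inside R^m itself: there it is null because k < m,
      and the map \<open>F\<close> below goes between spaces of equal dimension, so that the theorem
      on locally Lipschitz images of null sets applies.\<close>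
    obtain L' :: "(real^'m) set" where L': "subspace L'" "dim L' = k"
      using choose_subspace_of_subspace[of k "UNIV :: (real^'m) set"] N(4) by auto
    obtain j h where j: "linear j" "j ` L' = L" "\<And>x. x \<in> L' \<Longrightarrow> norm (j x) = norm x"
      using isometries_subspaces[OF L'(1) L(1)] L'(2) L(2) by metis
    define T where "T = {t \<in> L'. j t \<in> V \<and> \<sigma> (j t) \<in> \<psi> ` ball y0 r}"
    define F where "F t = inv_into (ball y0 r) \<psi> (\<sigma> (j t))" for t
    define Z where "Z = ball y0 r \<inter> \<psi> -` (N \<inter> U)"
    have F: "F t \<in> ball y0 r" "\<psi> (F t) = \<sigma> (j t)" if "t \<in> T" for t
      using that unfolding T_def F_def by (auto intro: inv_into_into f_inv_into_f simp del: mem_ball)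
    have Z_sub: "Z \<subseteq> F ` T"
    proof
      fix y assume y: "y \<in> Z"
      then have "\<phi> (\<psi> y) \<in> L \<inter> V" using sl by (auto simp: Z_def)
      then obtain t where t: "t \<in> L'" "j t = \<phi> (\<psi> y)" "j t \<in> V" using j(2) by (metis IntD1 IntD2 imageE)
      have "\<sigma> (j t) = \<psi> y" using t inv y by (simp add: Z_def)
      then have "t \<in> T" "F t = y"
        using t y inj unfolding T_def F_def Z_def by (auto simp del: mem_ball)
      then show "y \<in> F ` T" by blast
    qed
    have "negligible T"
      by (rule negligible_subset[OF negligible_lowdim[of L']]) (use L' N(4) in \<open>auto simp: T_def\<close>)
    then have "negligible (F ` T)"
    proof (rule negligible_locally_Lipschitz_image[rotated])
      fix t assume t: "t \<in> T"
      then have "j t \<in> V" by (simp add: T_def)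
      then obtain q where q: "0 < q" "ball (j t) q \<subseteq> V" "\<And>y z. y \<in> ball (j t) q \<Longrightarrow> z \<in> ball (j t) q \<Longrightarrow>
          norm (\<sigma> y - \<sigma> z - frechet_derivative \<sigma> (at (j t)) (y - z)) \<le> 1 * norm (y - z)"
        using smooth_strict_derivative[OF V sm(2), of "j t" 1] by (metis zero_less_one)
      define K where "K = onorm (frechet_derivative \<sigma> (at (j t))) + 1"
      have blD: "bounded_linear (frechet_derivative \<sigma> (at (j t)))"
        using smooth_onD(1)[OF sm(2) \<open>j t \<in> V\<close>] linear_frechet_derivative linear_conv_bounded_linear by blast
      have "norm (F y - F t) \<le> (2 / c * K) * norm (y - t)" if y: "y \<in> T \<inter> ball t q" for y
      proof -
        have yt: "norm (j y - j t) = norm (y - t)"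
          using j(3)[of "y - t"] y t L' by (simp add: linear_diff[OF j(1)] T_def subspace_diff)
        have jb: "j y \<in> ball (j t) q" using y yt by (simp add: dist_norm norm_minus_commute)
        have "c/2 * norm (F y - F t) \<le> norm (\<psi> (F y) - \<psi> (F t))"
          using lo F t y by blast
        also have "\<dots> = norm (\<sigma> (j y) - \<sigma> (j t))" using F t y by auto
        also have "\<dots> \<le> norm (\<sigma> (j y) - \<sigma> (j t) - frechet_derivative \<sigma> (at (j t)) (j y - j t))
            + norm (frechet_derivative \<sigma> (at (j t)) (j y - j t))"
          using norm_triangle_ineq[of "\<sigma> (j y) - \<sigma> (j t) - frechet_derivative \<sigma> (at (j t)) (j y - j t)"
              "frechet_derivative \<sigma> (at (j t)) (j y - j t)"] by simp
        also have "\<dots> \<le> 1 * norm (j y - j t) + onorm (frechet_derivative \<sigma> (at (j t))) * norm (j y - j t)"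
          using q jb by (intro add_mono onorm[OF blD]) auto
        finally have "c/2 * norm (F y - F t) \<le> K * norm (y - t)"
          by (simp add: yt K_def algebra_simps)
        then show ?thesis using c(1) by (simp add: field_simps)
      qed
      then show "\<exists>S B. open S \<and> t \<in> S \<and> (\<forall>y\<in>T \<inter> S. norm (F y - F t) \<le> B * norm (y - t))"
        using q(1) by (intro exI[of _ "ball t q"] exI[of _ "2 / c * K"]) auto
    qed (rule order_refl)
    then have "negligible Z" using Z_sub negligible_subset by blast
    moreover have Zb: "Z \<in> sets borel"
      unfolding Z_def using U borelN by (intro sets_borel_continuous_vimage[OF cont]) auto
    ultimately have "Z \<in> null_sets lborel"
      by (simp add: negligible_iff_null_sets null_sets_completion_iff)
    then have "measure lborel Z = 0"
      by (simp add: null_sets_def measure_def)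
    moreover have "Z \<subseteq> ball y0 r" by (auto simp: Z_def)
    ultimately have img: "\<psi> ` Z \<in> sets borel" "measure m (\<psi> ` Z) \<le> 0"
      using nice_ballD(3)[OF r Zb] nice_ballD(5)[OF r Zb] by auto
    have "N \<inter> (U \<inter> ball x0 s) \<subseteq> \<psi> ` Z"
    proof
      fix x assume x: "x \<in> N \<inter> (U \<inter> ball x0 s)"
      then have "x \<in> M" "dist x x0 < s" using N(2) by (auto simp: dist_commute)
      then have "x \<in> \<psi> ` ball y0 r" by (rule s(2))
      then obtain y where "x = \<psi> y" "y \<in> ball y0 r" by (rule imageE)
      then show "x \<in> \<psi> ` Z" using x unfolding Z_def by blast
    qed
    then have "measure m (N \<inter> (U \<inter> ball x0 s)) \<le> measure m (\<psi> ` Z)"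
      by (rule finite_measure_mono) (simp add: m(2) img(1))
    then have "measure m (N \<inter> (U \<inter> ball x0 s)) = 0"
      using img(2) measure_nonneg[of m "N \<inter> (U \<inter> ball x0 s)"] by linarith
    then show ?thesis
      using U s(1) by (intro exI[of _ "U \<inter> ball x0 s"]) auto
  qed
  then obtain T where T: "\<And>x. x \<in> N \<Longrightarrow> open (T x) \<and> x \<in> T x \<and> measure m (N \<inter> T x) = 0" by metis
  obtain D where D: "D \<subseteq> N" "finite D" "N \<subseteq> (\<Union>x\<in>D. T x)"
    using compactE_image[OF N(1), of N T] T by blast
  have "measure m N = measure m (\<Union>x\<in>D. N \<inter> T x)"
    using D by (intro arg_cong[where f="measure m"]) auto
  also have "\<dots> \<le> (\<Sum>x\<in>D. measure m (N \<inter> T x))"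
    using D T borelN m(2) by (intro measure_UNION_le) auto
  also have "\<dots> = 0" using D T by (intro sum.neutral) auto
  finally show ?thesis using measure_nonneg[of m N] by linarith
qed


section \<open>Cubes, ellipsoids and the mass of small balls\<close>

definition cube :: "real^'m \<Rightarrow> real \<Rightarrow> (real^'m) set" where
  "cube p s = {y. \<forall>k. p $ k \<le> y $ k \<and> y $ k < p $ k + s}"

lemma cube_borel [measurable]: "cube p s \<in> sets borel"
proof -
  have "cube p s = (\<Inter>k. {y. p $ k \<le> y $ k} \<inter> {y. y $ k < p $ k + s})"
    by (auto simp: cube_def)
  moreover have "{y. p $ k \<le> y $ k} \<in> sets borel" "{y. y $ k < p $ k + s} \<in> sets borel" for k
    by (auto intro!: borel_closed borel_open closed_Collect_le open_Collect_less continuous_intros)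
  ultimately show ?thesis by (auto intro!: sets.finite_INT)
qed

lemma measure_cube:
  fixes p :: "real^'m"
  assumes "0 < s"
  shows "measure lborel (cube p s) = s ^ CARD('m)"
proof -
  define b where "b = (\<chi> k. p $ k + s)"
  have sub: "box p b \<subseteq> cube p s" "cube p s \<subseteq> cbox p b"
    by (auto simp: cube_def b_def mem_box_cart less_imp_le)
  have le: "p \<bullet> i \<le> b \<bullet> i" if "i \<in> Basis" for i
    using that assms by (auto simp: Basis_vec_def b_def inner_axis)
  have "emeasure lborel (box p b) = emeasure lborel (cbox p b)"
    using le by (simp add: emeasure_lborel_cbox_eq emeasure_lborel_box_eq)
  then have "emeasure lborel (cube p s) = emeasure lborel (cbox p b)"
    using emeasure_mono[OF sub(1), of lborel] emeasure_mono[OF sub(2), of lborel] by simp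
  then have "measure lborel (cube p s) = measure lborel (cbox p b)"
    by (simp add: measure_def)
  also have "\<dots> = (\<Prod>k\<in>UNIV. b $ k - p $ k)"
    using assms by (intro content_cbox_cart) (auto simp: interval_eq_empty_cart b_def not_less)
  finally show ?thesis by (simp add: b_def)
qed

text \<open>To first order the preimage of a ball under a chart is such an ellipsoid. Scaling and
  translation reduce all of them to one, whose volume is \<open>v0\<close>.\<close>

lemma measure_ellipsoid:
  fixes A :: "real^'m \<Rightarrow> 'a::euclidean_space"
  assumes A: "linear A" "0 < c" "\<And>v. c * norm v \<le> norm (A v)"
  obtains v0 where "0 < v0"
    "\<And>y t. 0 < t \<Longrightarrow> measure lborel {z. norm (A (z - y)) < t} = v0 * t ^ CARD('m)"
    "\<And>y t. {z. norm (A (z - y)) < t} \<in> sets borel"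
    "\<And>y t. 0 < t \<Longrightarrow> {z. norm (A (z - y)) < t} \<subseteq> ball y (t / c)"
proof
  let ?E = "\<lambda>y t. {z. norm (A (z - y)) < t}"
  have bl: "bounded_linear A" using A(1) by (simp add: linear_conv_bounded_linear)
  have cont: "continuous_on UNIV A" using bl by (rule linear_continuous_on)
  have op: "open (?E y t)" for y t
    by (intro open_Collect_less continuous_intros continuous_on_compose2[OF cont]) auto
  show bE: "?E y t \<in> sets borel" for y t using op by (rule borel_open)
  show sub: "?E y t \<subseteq> ball y (t / c)" if "0 < t" for y t
  proof
    fix z assume "z \<in> ?E y t"
    then have "c * norm (z - y) < t" using A(3)[of "z - y"] by simp
    then show "z \<in> ball y (t / c)" using A(2) by (simp add: dist_norm norm_minus_commute field_simps)
  qed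
  define K where "K = onorm A + 1"
  have K: "0 < K" using onorm_pos_le[OF bl] by (simp add: K_def)
  have "ball 0 (1 / K) \<subseteq> ?E 0 1"
  proof
    fix z :: "real^'m" assume "z \<in> ball 0 (1 / K)"
    then have "K * norm z < 1" using K by (simp add: field_simps)
    moreover have "norm (A z) \<le> K * norm z"
      using onorm[OF bl, of z] norm_ge_zero[of z] unfolding K_def distrib_right by linarith
    ultimately show "z \<in> ?E 0 1" by simp
  qed
  moreover have "emeasure lborel (?E 0 1) < \<infinity>"
    using sub[of 1 0] bounded_subset[OF bounded_ball] by (intro emeasure_bounded_finite) auto
  ultimately have le: "measure lborel (ball 0 (1 / K) :: (real^'m) set) \<le> measure lborel (?E 0 1)"
    using bE[of 0 1] by (intro measure_mono_fmeasurable) (auto simp: fmeasurable_def)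
  have "0 < 1 / K" using K by simp
  from content_ball_pos[OF this] le show "0 < measure lborel (?E 0 1)"
    by (rule less_le_trans)
  show "measure lborel (?E y t) = measure lborel (?E 0 1) * t ^ CARD('m)" if t: "0 < t" for y t
  proof -
    have "?E y t = (\<lambda>v. t *\<^sub>R v + y) ` ?E 0 1"
    proof (intro set_eqI iffI)
      fix z assume "z \<in> ?E y t"
      then show "z \<in> (\<lambda>v. t *\<^sub>R v + y) ` ?E 0 1"
        using t by (intro image_eqI[of _ _ "(1 / t) *\<^sub>R (z - y)"]) (auto simp: linear_cmul[OF A(1)])
    next
      fix z assume "z \<in> (\<lambda>v. t *\<^sub>R v + y) ` ?E 0 1"
      then show "z \<in> ?E y t" using t by (auto simp: linear_cmul[OF A(1)])
    qed
    then have "emeasure lebesgue (?E y t) = ennreal (\<bar>t\<bar> ^ DIM(real^'m)) * emeasure lebesgue (?E 0 1)"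
      using emeasure_lebesgue_affine[of t y "?E 0 1"] by simp
    then have "emeasure lborel (?E y t) = ennreal (t ^ CARD('m)) * emeasure lborel (?E 0 1)"
      using t bE[of y t] bE[of 0 1] by simp
    then show ?thesis
      using t by (simp add: measure_def enn2real_mult)
  qed
qed

text \<open>\<open>\<theta>\<close> is, up to the volume of the unit ball, the density at \<open>x0\<close>.\<close>

lemma regular_piece_ball:
  fixes M :: "'a::euclidean_space set"
  assumes reg: "regular_piece TYPE('m::finite) M m" and x0: "x0 \<in> M"
  shows "\<exists>\<theta>>0. \<forall>\<tau>>0. \<exists>s>0. \<forall>x\<in>M. \<forall>t. dist x x0 < s \<longrightarrow> 0 < t \<longrightarrow> t < s \<longrightarrow>
    \<bar>measure m (M \<inter> ball x t) - \<theta> * t ^ CARD('m)\<bar> \<le> \<tau> * t ^ CARD('m)"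
proof -
  let ?d = "CARD('m)"
  obtain \<psi> :: "real^'m \<Rightarrow> 'a" and y0 A g where chart: "linear A" "inj A" "\<psi> y0 = x0" "0 < g"
    "\<And>\<tau>. 0 < \<tau> \<Longrightarrow> \<exists>r. nice_ball M m \<psi> y0 A g \<tau> r"
    using reg x0 unfolding regular_piece_def by blast
  obtain c where c: "0 < c" "\<And>v. c * norm v \<le> norm (A v)"
    using linear_inj_bounded_below_pos[OF chart(1,2)] by blast
  obtain v0 where v0: "0 < v0"
    "\<And>y t. 0 < t \<Longrightarrow> measure lborel {z. norm (A (z - y)) < t} = v0 * t ^ ?d"
    "\<And>y t. {z. norm (A (z - y)) < t} \<in> sets borel"
    "\<And>y t. 0 < t \<Longrightarrow> {z. norm (A (z - y)) < t} \<subseteq> ball y (t / c)"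
    using measure_ellipsoid[OF chart(1) c] by metis
  have main: "\<exists>s>0. \<forall>x\<in>M. \<forall>t. dist x x0 < s \<longrightarrow> 0 < t \<longrightarrow> t < s \<longrightarrow>
    \<bar>measure m (M \<inter> ball x t) - g * v0 * t ^ ?d\<bar> \<le> \<tau> * t ^ ?d" if \<tau>: "0 < \<tau>" for \<tau>
  proof -
    \<comment> \<open>\<kappa> is a relative distortion: preimages of balls of radius t will lie
      between ellipsoids of radii t / (1 + \<kappa>) and t / (1 - \<kappa>), and the density will
      differ from \<open>g\<close> by at most c \<kappa>. Both resulting bounds tend to g
      v0.\<close>
    have "((\<lambda>\<kappa>. (g + c * \<kappa>) * (v0 / (1 - \<kappa>) ^ ?d)) \<longlongrightarrow> (g + c * 0) * (v0 / (1 - 0) ^ ?d)) (at_right 0)"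
      by (intro tendsto_intros) auto
    then have 1: "eventually (\<lambda>\<kappa>. (g + c * \<kappa>) * (v0 / (1 - \<kappa>) ^ ?d) < g * v0 + \<tau>) (at_right 0)"
      using \<tau> by (intro order_tendstoD(2)) auto
    have "((\<lambda>\<kappa>. (g - c * \<kappa>) * (v0 / (1 + \<kappa>) ^ ?d)) \<longlongrightarrow> (g - c * 0) * (v0 / (1 + 0) ^ ?d)) (at_right 0)"
      by (intro tendsto_intros) auto
    then have 2: "eventually (\<lambda>\<kappa>. g * v0 - \<tau> < (g - c * \<kappa>) * (v0 / (1 + \<kappa>) ^ ?d)) (at_right 0)"
      using \<tau> by (intro order_tendstoD(1)) auto
    have 3: "eventually (\<lambda>\<kappa>. \<kappa> \<in> {0<..<min 1 (g / c)}) (at_right (0::real))"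
      using c(1) chart(4) by (intro eventually_at_right_real) simp
    obtain \<kappa> where \<kappa>: "(g + c * \<kappa>) * (v0 / (1 - \<kappa>) ^ ?d) < g * v0 + \<tau>"
      "g * v0 - \<tau> < (g - c * \<kappa>) * (v0 / (1 + \<kappa>) ^ ?d)" "0 < \<kappa>" "\<kappa> < 1" "\<kappa> < g / c"
      using eventually_happens'[OF _ eventually_conj[OF 1 eventually_conj[OF 2 3]]] by auto
    have ck: "c * \<kappa> < g" using \<kappa>(5) c(1) by (simp add: field_simps)
    \<comment> \<open>An error c \<kappa> per unit of length is a relative error of at most \<kappa>
      in |A (z - y)|, because c |z - y| <= |A (z - y)|.\<close>
    obtain r where r: "nice_ball M m \<psi> y0 A g (c * \<kappa>) r" using chart(5)[of "c * \<kappa>"] c(1) \<kappa>(3) by auto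
    note r0 = nice_ballD(1)[OF r]
    have cont: "continuous_on (ball y0 r) \<psi>"
      using nice_ball_bilipschitz(4)[OF r chart(1) c(2)] c(1) \<kappa>(3) by simp
    obtain s1 where s1: "0 < s1" "\<And>x. x \<in> M \<Longrightarrow> dist x x0 < s1 \<Longrightarrow> x \<in> \<psi> ` ball y0 (r / 2)"
      using nice_ballD(6)[OF r, of "r / 2"] r0 chart(3) by auto
    obtain s2 where s2: "0 < s2" "\<And>x. x \<in> M \<Longrightarrow> dist x x0 < s2 \<Longrightarrow> x \<in> \<psi> ` ball y0 r"
      using nice_ballD(6)[OF r r0 order_refl] chart(3) by auto
    \<comment> \<open>The first bound puts \<open>x\<close> into the chart, the second keeps the
      ball around \<open>x\<close> inside it, the third keeps the inner ellipsoid inside the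
      parameter ball.\<close>
    define s where "s = min s1 (min (s2 / 2) (c * r / 2))"
    have s: "0 < s" "s \<le> s1" "2 * s \<le> s2" "s \<le> c * r / 2" using s1(1) s2(1) c(1) r0 by (auto simp: s_def)
    have "\<bar>measure m (M \<inter> ball x t) - g * v0 * t ^ ?d\<bar> \<le> \<tau> * t ^ ?d"
      if x: "x \<in> M" "dist x x0 < s" and t: "0 < t" "t < s" for x t
    proof -
      obtain y where y: "x = \<psi> y" "y \<in> ball y0 (r / 2)" using s1(2)[OF x(1)] x(2) s(2) by auto
      have yr: "y \<in> ball y0 r" using y(2) r0 by auto
      define Q where "Q = ball y0 r \<inter> \<psi> -` ball x t"
      have Q: "Q \<in> sets borel" "Q \<subseteq> ball y0 r"
        unfolding Q_def by (auto intro!: sets_borel_continuous_vimage[OF cont])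
      have img: "M \<inter> ball x t = \<psi> ` Q"
      proof
        show "\<psi> ` Q \<subseteq> M \<inter> ball x t" using nice_ballD(4)[OF r Q] by (auto simp: Q_def)
        show "M \<inter> ball x t \<subseteq> \<psi> ` Q"
        proof
          fix w assume w: "w \<in> M \<inter> ball x t"
          then have "dist w x0 < s2"
            using x(2) t s(3) dist_triangle[of w x0 x] by (auto simp: dist_commute)
          then have "w \<in> \<psi> ` ball y0 r" using s2(2) w by blast
          then obtain z where "w = \<psi> z" "z \<in> ball y0 r" by (rule imageE)
          then show "w \<in> \<psi> ` Q" using w by (auto simp: Q_def)
        qed
      qed
      have nb: "norm (\<psi> z - \<psi> y - A (z - y)) \<le> \<kappa> * norm (A (z - y))" if "z \<in> ball y0 r" for z
      proof -
        have "c * \<kappa> * norm (z - y) \<le> \<kappa> * norm (A (z - y))"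
          using mult_left_mono[OF c(2)[of "z - y"], of \<kappa>] \<kappa>(3) by (simp add: mult_ac)
        with nice_ballD(2)[OF r that yr] show ?thesis by (rule order_trans)
      qed
      have sub1: "Q \<subseteq> {z. norm (A (z - y)) < t / (1 - \<kappa>)}"
      proof
        fix z assume z: "z \<in> Q"
        then have "norm (\<psi> z - \<psi> y) < t" by (simp add: Q_def y(1) dist_norm norm_minus_commute)
        moreover have "norm (A (z - y)) \<le> norm (\<psi> z - \<psi> y) + norm (\<psi> z - \<psi> y - A (z - y))"
          using norm_triangle_sub[of "A (z - y)" "\<psi> z - \<psi> y"] by (simp add: norm_minus_commute)
        ultimately have "norm (A (z - y)) * (1 - \<kappa>) < t" using nb[of z] z by (simp add: Q_def algebra_simps)
        then show "z \<in> {z. norm (A (z - y)) < t / (1 - \<kappa>)}" using \<kappa>(4) by (simp add: pos_less_divide_eq)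
      qed
      have sub2: "{z. norm (A (z - y)) < t / (1 + \<kappa>)} \<subseteq> Q"
      proof
        fix z assume z: "z \<in> {z. norm (A (z - y)) < t / (1 + \<kappa>)}"
        then have At: "norm (A (z - y)) * (1 + \<kappa>) < t" using \<kappa>(3) by (simp add: pos_less_divide_eq)
        moreover have "0 \<le> norm (A (z - y)) * \<kappa>" using \<kappa>(3) by simp
        ultimately have "norm (A (z - y)) < t" by (simp add: algebra_simps)
        then have "c * norm (z - y) < c * (r / 2)" using c(2)[of "z - y"] t s(4) by simp
        then have "norm (z - y) < r / 2" using c(1) by simp
        then have zr: "z \<in> ball y0 r"
          using y(2) dist_triangle[of y0 z y] by (simp add: dist_norm norm_minus_commute)
        have "norm (\<psi> z - \<psi> y) < t"
          using nb[OF zr] At norm_triangle_sub[of "\<psi> z - \<psi> y" "A (z - y)"] by (simp add: algebra_simps)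
        then show "z \<in> Q" using zr by (simp add: Q_def y(1) dist_norm norm_minus_commute)
      qed
      define V where "V = measure lborel Q"
      have fin: "S \<in> fmeasurable lborel" if "S \<subseteq> ball z q" "S \<in> sets borel" for S and z :: "real^'m" and q
        using that bounded_subset[OF bounded_ball] emeasure_bounded_finite[of S] by (auto simp: fmeasurable_def)
      have V1: "V \<le> v0 * (t / (1 - \<kappa>)) ^ ?d"
      proof -
        have t': "0 < t / (1 - \<kappa>)" using t(1) \<kappa>(4) by simp
        have "V \<le> measure lborel {z. norm (A (z - y)) < t / (1 - \<kappa>)}"
          unfolding V_def using sub1 Q(1) fin[OF v0(4)[OF t'] v0(3)] by (intro measure_mono_fmeasurable) simp_all
        then show ?thesis unfolding v0(2)[OF t'] .
      qed
      have V2: "v0 * (t / (1 + \<kappa>)) ^ ?d \<le> V"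
      proof -
        have t': "0 < t / (1 + \<kappa>)" using t(1) \<kappa>(3) by simp
        have "measure lborel {z. norm (A (z - y)) < t / (1 + \<kappa>)} \<le> V"
          unfolding V_def using sub2 v0(3)[where y=y] fin[OF Q(2,1)] by (intro measure_mono_fmeasurable) simp_all
        then show ?thesis unfolding v0(2)[OF t'] .
      qed
      have mQ: "\<bar>measure m (M \<inter> ball x t) - g * V\<bar> \<le> c * \<kappa> * V"
        unfolding img V_def using nice_ballD(5)[OF r Q] .
      have "measure m (M \<inter> ball x t) \<le> (g + c * \<kappa>) * V" using mQ by (simp add: algebra_simps)
      also have "\<dots> \<le> (g + c * \<kappa>) * (v0 * (t / (1 - \<kappa>)) ^ ?d)"
        using V1 chart(4) c(1) \<kappa>(3) by (intro mult_left_mono) auto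
      also have "\<dots> = ((g + c * \<kappa>) * (v0 / (1 - \<kappa>) ^ ?d)) * t ^ ?d" by (simp add: power_divide)
      also have "\<dots> \<le> (g * v0 + \<tau>) * t ^ ?d" using \<kappa>(1) t(1) by (intro mult_right_mono) auto
      finally have up: "measure m (M \<inter> ball x t) \<le> (g * v0 + \<tau>) * t ^ ?d" .
      have "(g * v0 - \<tau>) * t ^ ?d \<le> ((g - c * \<kappa>) * (v0 / (1 + \<kappa>) ^ ?d)) * t ^ ?d"
        using \<kappa>(2) t(1) by (intro mult_right_mono) auto
      also have "\<dots> = (g - c * \<kappa>) * (v0 * (t / (1 + \<kappa>)) ^ ?d)" by (simp add: power_divide)
      also have "\<dots> \<le> (g - c * \<kappa>) * V" using V2 ck by (intro mult_left_mono) auto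
      also have "\<dots> \<le> measure m (M \<inter> ball x t)" using mQ by (simp add: algebra_simps)
      finally show ?thesis using up by (simp add: abs_le_iff algebra_simps)
    qed
    then show ?thesis using s(1) by blast
  qed
  have "0 < g * v0" using chart(4) v0(1) by simp
  then show ?thesis using main by blast
qed

text \<open>Unlike \<open>nice_ball\<close> this asks only for two-sided bounds, but for all
  subcubes with the same constants; a cube can then be subdivided at any scale without loss.\<close>

definition good_cube :: "'a::euclidean_space set \<Rightarrow> 'a measure \<Rightarrow> (real^'m \<Rightarrow> 'a) \<Rightarrow> real \<Rightarrow> real \<Rightarrow> real \<Rightarrow>
    real^'m \<Rightarrow> real \<Rightarrow> bool" where
  "good_cube M m \<psi> \<Lambda> c C p h \<longleftrightarrow> 0 < h \<and> inj_on \<psi> (cube p h) \<and>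
    (\<forall>y\<in>cube p h. \<forall>z\<in>cube p h. dist (\<psi> y) (\<psi> z) \<le> \<Lambda> * dist y z) \<and>
    (\<forall>q s. 0 < s \<longrightarrow> cube q s \<subseteq> cube p h \<longrightarrow> \<psi> ` cube q s \<in> sets borel \<and> \<psi> ` cube q s \<subseteq> M \<and>
      c * s ^ CARD('m) \<le> measure m (\<psi> ` cube q s) \<and> measure m (\<psi> ` cube q s) \<le> C * s ^ CARD('m))"

lemma regular_piece_good_cube:
  fixes M :: "'a::euclidean_space set"
  assumes reg: "regular_piece TYPE('m::finite) M m" and x0: "x0 \<in> M"
  shows "\<exists>(\<psi> :: real^'m \<Rightarrow> 'a) \<Lambda> c C p h. 0 < \<Lambda> \<and> 0 < c \<and> 0 < C \<and> good_cube M m \<psi> \<Lambda> c C p h \<and>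
    (\<exists>s>0. \<forall>x\<in>M. dist x x0 < s \<longrightarrow> x \<in> \<psi> ` cube p h)"
proof -
  obtain \<psi> :: "real^'m \<Rightarrow> 'a" and y0 A g where chart: "linear A" "inj A" "\<psi> y0 = x0" "0 < g"
    "\<And>\<tau>. 0 < \<tau> \<Longrightarrow> \<exists>r. nice_ball M m \<psi> y0 A g \<tau> r"
    using reg x0 unfolding regular_piece_def by blast
  obtain c where c: "0 < c" "\<And>v. c * norm v \<le> norm (A v)"
    using linear_inj_bounded_below_pos[OF chart(1,2)] by blast
  define \<tau> where "\<tau> = min (c / 2) (g / 2)"
  have \<tau>: "0 < \<tau>" "\<tau> < c" "\<tau> \<le> g / 2" using c chart(4) by (auto simp: \<tau>_def)
  obtain r where r: "nice_ball M m \<psi> y0 A g \<tau> r" using chart(5)[OF \<tau>(1)] by blast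
  note r0 = nice_ballD(1)[OF r]
  note bil = nice_ball_bilipschitz[OF r chart(1) c(2)]
  \<comment> \<open>A cube of side r / m centred at \<open>y0\<close> has sup-norm radius r / (2 m),
    hence Euclidean radius at most r / 2.\<close>
  define h where "h = r / CARD('m)"
  define p where "p = (\<chi> k. y0 $ k - h / 2)"
  have h: "0 < h" using r0 by (simp add: h_def)
  have sub: "cube p h \<subseteq> ball y0 r"
  proof
    fix y assume y: "y \<in> cube p h"
    have "norm (y - y0) \<le> (\<Sum>k\<in>UNIV. \<bar>(y - y0) $ k\<bar>)" by (rule norm_le_l1_cart)
    also have "\<dots> \<le> (\<Sum>k\<in>(UNIV :: 'm set). h / 2)"
    proof (rule sum_mono)
      fix k
      have "y0 $ k - h / 2 \<le> y $ k" "y $ k < y0 $ k - h / 2 + h" using y by (auto simp: cube_def p_def)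
      then show "\<bar>(y - y0) $ k\<bar> \<le> h / 2" unfolding vector_minus_component abs_le_iff by linarith
    qed
    also have "\<dots> < r" using r0 by (simp add: h_def)
    finally show "y \<in> ball y0 r" by (simp add: dist_norm norm_minus_commute)
  qed
  have sub2: "ball y0 (h / 2) \<subseteq> cube p h"
  proof
    fix y assume y: "y \<in> ball y0 (h / 2)"
    have "y0 $ k - h / 2 \<le> y $ k \<and> y $ k < y0 $ k - h / 2 + h" for k
    proof -
      have "\<bar>(y - y0) $ k\<bar> < h / 2"
        using component_le_norm_cart[of "y - y0" k] y by (simp only: mem_ball dist_norm norm_minus_commute)
      then show ?thesis unfolding vector_minus_component abs_less_iff by (auto simp: field_simps)
    qed
    then show "y \<in> cube p h" by (simp add: cube_def p_def)
  qed
  define \<Lambda> where "\<Lambda> = onorm A + \<tau>"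
  have "0 \<le> onorm A" using chart(1) by (intro onorm_pos_le) (simp add: linear_conv_bounded_linear)
  then have \<Lambda>: "0 < \<Lambda>" using \<tau>(1) by (simp add: \<Lambda>_def)
  have "good_cube M m \<psi> \<Lambda> (g / 2) (2 * g) p h"
    unfolding good_cube_def
  proof (intro conjI ballI allI impI)
    show "inj_on \<psi> (cube p h)" using bil(3) \<tau>(2) sub inj_on_subset by blast
    show "dist (\<psi> y) (\<psi> z) \<le> \<Lambda> * dist y z" if "y \<in> cube p h" "z \<in> cube p h" for y z
      using bil(2)[of y z] that sub unfolding dist_norm \<Lambda>_def by blast
    fix q s assume s: "0 < (s::real)" "cube q s \<subseteq> cube p h"
    have qs: "cube q s \<in> sets borel" "cube q s \<subseteq> ball y0 r" using s(2) sub by auto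
    show "\<psi> ` cube q s \<in> sets borel" "\<psi> ` cube q s \<subseteq> M"
      using nice_ballD(3)[OF r qs] nice_ballD(4)[OF r qs] .
    have "\<bar>measure m (\<psi> ` cube q s) - g * s ^ CARD('m)\<bar> \<le> \<tau> * s ^ CARD('m)"
      using nice_ballD(5)[OF r qs] by (simp add: measure_cube[OF s(1)])
    moreover have "\<tau> * s ^ CARD('m) \<le> g / 2 * s ^ CARD('m)" using \<tau>(3) s(1) by (intro mult_right_mono) auto
    moreover have "0 \<le> g * s ^ CARD('m)" using chart(4) s(1) by simp
    ultimately show "g / 2 * s ^ CARD('m) \<le> measure m (\<psi> ` cube q s)"
      "measure m (\<psi> ` cube q s) \<le> 2 * g * s ^ CARD('m)"
      by (simp_all add: abs_le_iff field_simps)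
  qed (use h in simp)
  moreover have "\<exists>s>0. \<forall>x\<in>M. dist x x0 < s \<longrightarrow> x \<in> \<psi> ` cube p h"
  proof -
    have "h / 2 \<le> r" using sub2 sub r0 h unfolding h_def
      by (simp add: field_simps) (smt (verit) mult_less_cancel_left1 of_nat_0_less_iff zero_less_card_finite of_nat_1 One_nat_def Suc_leI of_nat_le_iff mult_le_cancel_left1)
    then obtain s where "0 < s" "\<And>x. x \<in> M \<Longrightarrow> dist x x0 < s \<Longrightarrow> x \<in> \<psi> ` ball y0 (h / 2)"
      using nice_ballD(6)[OF r, of "h / 2"] h chart(3) by auto
    then show ?thesis using sub2 by blast
  qed
  ultimately show ?thesis using \<Lambda> chart(4) by (intro exI[of _ \<psi>] exI[of _ \<Lambda>] exI[of _ "g / 2"] exI[of _ "2 * g"]) auto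
qed

section \<open>Degrees of the sample graph\<close>

lemma kernel_nonneg: "admissible_kernel \<eta> \<Longrightarrow> 0 \<le> t \<Longrightarrow> 0 \<le> \<eta> t"
  by (simp add: admissible_kernel_def)

lemma kernel_antimono: "admissible_kernel \<eta> \<Longrightarrow> 0 \<le> s \<Longrightarrow> s \<le> t \<Longrightarrow> \<eta> t \<le> \<eta> s"
  by (auto simp: admissible_kernel_def monotone_on_def)

lemma kernel_pos: "admissible_kernel \<eta> \<Longrightarrow> 0 < \<eta> 0"
  by (simp add: admissible_kernel_def)

lemma kernel_zero:
  assumes "admissible_kernel \<eta>" "1 < t"
  shows "\<eta> t = 0"
proof (rule ccontr)
  assume "\<eta> t \<noteq> 0"
  then have "t \<in> closure {t. t \<ge> 0 \<and> \<eta> t \<noteq> 0}"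
    using assms(2) by (intro subsetD[OF closure_subset]) auto
  then show False using assms by (simp add: admissible_kernel_def)
qed

lemma kernel_lower_near_0:
  assumes "admissible_kernel \<eta>"
  obtains r0 \<eta>1 where "0 < r0" "r0 \<le> 1" "0 < \<eta>1" "\<And>t. 0 \<le> t \<Longrightarrow> t \<le> r0 \<Longrightarrow> \<eta>1 \<le> \<eta> t"
proof -
  have "continuous (at 0 within {0..}) \<eta>" "0 < \<eta> 0" using assms by (auto simp: admissible_kernel_def)
  then obtain d where d: "0 < d" "\<And>t. t \<in> {0..} \<Longrightarrow> dist t 0 < d \<Longrightarrow> dist (\<eta> t) (\<eta> 0) < \<eta> 0 / 2"
    unfolding continuous_within_eps_delta by (metis half_gt_zero)
  have "\<eta> 0 / 2 \<le> \<eta> t" if "0 \<le> t" "t \<le> min 1 (d / 2)" for t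
  proof -
    have "dist (\<eta> t) (\<eta> 0) < \<eta> 0 / 2" using d that by (intro d(2)) (auto simp: dist_real_def)
    then show ?thesis unfolding dist_real_def by arith
  qed
  then show ?thesis using that[of "min 1 (d / 2)" "\<eta> 0 / 2"] d(1) \<open>0 < \<eta> 0\<close> by auto
qed

text \<open>A discrete layer-cake formula: the number of levels j h below v, times h, recovers v up
  to one step, as long as the levels reach v.\<close>

lemma staircase_bounds:
  fixes h v :: real
  assumes "0 < h" "0 \<le> v"
  shows "min v (real k * h) \<le> (\<Sum>j<k. if real j * h < v then h else 0)"
    and "(\<Sum>j<k. if real j * h < v then h else 0) \<le> v + h"
proof -
  show "min v (real k * h) \<le> (\<Sum>j<k. if real j * h < v then h else 0)"
    using assms by (induction k) (auto simp: algebra_simps min_def split: if_splits)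
  have "(\<Sum>j<k. if real j * h < v then h else 0) \<le> real k * h" for k
    using sum_bounded_above[of "{..<k}" "\<lambda>j. if real j * h < v then h else 0" h] assms by auto
  note le = this
  show "(\<Sum>j<k. if real j * h < v then h else 0) \<le> v + h"
  proof (induction k)
    case (Suc k)
    then show ?case using le[of k] by (cases "real k * h < v") auto
  qed (use assms in simp)
qed

text \<open>Approximates the kernel by a combination of indicators of balls, which reduces the asymptotics of
  the degrees to those of the measures of balls.\<close>

lemma kernel_staircase:
  assumes \<eta>: "admissible_kernel \<eta>" and k: "0 < k"
  obtains R where "\<And>j. j < k \<Longrightarrow> 0 < R j" "\<And>j. j < k \<Longrightarrow> R j \<le> 1"
    "\<And>t. 0 \<le> t \<Longrightarrow> \<eta> t \<le> (\<Sum>j<k. if t \<le> R j then \<eta> 0 / real k else 0)"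
    "\<And>t. 0 \<le> t \<Longrightarrow> (\<Sum>j<k. if t < R j then \<eta> 0 / real k else 0) \<le> \<eta> t + (if t \<le> 1 then \<eta> 0 / real k else 0)"
proof -
  define h where "h = \<eta> 0 / real k"
  have h: "0 < h" using kernel_pos[OF \<eta>] k by (simp add: h_def)
  have kh: "real k * h = \<eta> 0" using k by (simp add: h_def)
  define S where "S j = {t. 0 \<le> t \<and> real j * h < \<eta> t}" for j
  \<comment> \<open>By monotonicity the superlevel set \<open>S j\<close> is an interval starting at
    0. Whether its right end belongs to it is unknown, which is why the upper bound uses
    \<open>t \<le> R j\<close> and the lower one \<open>t < R j\<close>. Continuity at 0 makes the
    radius positive.\<close>
  define R where "R j = Sup (S j)" for j
  have S1: "t \<le> 1" if "t \<in> S j" for t j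
  proof (rule ccontr)
    assume "\<not> t \<le> 1"
    then have "\<eta> t = 0" using kernel_zero[OF \<eta>] by simp
    moreover have "0 \<le> real j * h" using h by simp
    ultimately show False using that by (simp add: S_def)
  qed
  have bdd: "bdd_above (S j)" for j using S1 by (meson bdd_aboveI)
  have zero: "0 \<in> S j" if "j < k" for j
    using that h kh unfolding S_def by (auto simp: mult_strict_right_mono simp flip: kh)
  have R1: "R j \<le> 1" if "j < k" for j
    unfolding R_def using zero[OF that] S1 by (intro cSup_least) auto
  have R0: "0 < R j" if j: "j < k" for j
  proof -
    have "continuous (at 0 within {0..}) \<eta>" using \<eta> by (simp add: admissible_kernel_def)
    moreover have "real j * h < \<eta> 0" using zero[OF j] by (simp add: S_def)
    ultimately obtain d where d: "0 < d" "\<And>t. t \<in> {0..} \<Longrightarrow> dist t 0 < d \<Longrightarrow> dist (\<eta> t) (\<eta> 0) < \<eta> 0 - real j * h"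
      unfolding continuous_within_eps_delta by (metis diff_gt_0_iff_gt)
    have "d / 2 \<in> S j" using d(2)[of "d / 2"] d(1) by (auto simp: S_def dist_real_def)
    then have "d / 2 \<le> R j" unfolding R_def using bdd by (rule cSup_upper)
    then show ?thesis using d(1) by simp
  qed
  have up: "t \<le> R j" if "0 \<le> t" "real j * h < \<eta> t" for t j
    unfolding R_def using that bdd by (intro cSup_upper) (auto simp: S_def)
  have lo: "real j * h < \<eta> t" if t: "0 \<le> t" "t < R j" and j: "j < k" for t j
  proof -
    have "\<exists>t'\<in>S j. t < t'"
      using t(2) zero[OF j] less_cSup_iff[OF _ bdd, of j t] unfolding R_def by auto
    then obtain t' where "t' \<in> S j" "t < t'" by blast
    then show ?thesis using kernel_antimono[OF \<eta> t(1), of t'] by (auto simp: S_def)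
  qed
  show ?thesis
  proof (rule that[of R])
    fix t :: real assume t: "0 \<le> t"
    have v: "0 \<le> \<eta> t" "\<eta> t \<le> \<eta> 0" using kernel_nonneg[OF \<eta> t] kernel_antimono[OF \<eta> order_refl t] .
    have "\<eta> t \<le> (\<Sum>j<k. if real j * h < \<eta> t then h else 0)"
      using staircase_bounds(1)[OF h v(1), of k] v kh by simp
    also have "\<dots> \<le> (\<Sum>j<k. if t \<le> R j then h else 0)"
      using up[OF t] h by (intro sum_mono) auto
    finally show "\<eta> t \<le> (\<Sum>j<k. if t \<le> R j then \<eta> 0 / real k else 0)" unfolding h_def .
    have *: "(\<Sum>j<k. if t < R j then h else 0) \<le> (\<Sum>j<k. if real j * h < \<eta> t then h else 0)"
      using lo[OF t] h by (intro sum_mono) auto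
    show "(\<Sum>j<k. if t < R j then \<eta> 0 / real k else 0) \<le> \<eta> t + (if t \<le> 1 then \<eta> 0 / real k else 0)"
    proof (cases "t \<le> 1")
      case True
      then show ?thesis using * staircase_bounds(2)[OF h v(1), of k] unfolding h_def[symmetric] by simp
    next
      case False
      then have "\<eta> t = 0" using kernel_zero[OF \<eta>] by simp
      moreover have "\<not> real j * h < 0" for j using h by (simp add: not_less)
      ultimately show ?thesis using * False unfolding h_def[symmetric] by simp
    qed
  qed (use R0 R1 in auto)
qed

text \<open>The dimension is a number here and the geometry enters through the mass of balls, so
  that both pieces, with charts over different types, are instances with the same sample.\<close>

locale sample_piece = iid_sample P X \<mu>
  for P :: "'w measure" and X :: "nat \<Rightarrow> 'w \<Rightarrow> 'a::euclidean_space" and \<mu> +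
  fixes M :: "'a set" and d :: nat and \<eta> :: "real \<Rightarrow> real" and \<epsilon> :: "nat \<Rightarrow> real"
  assumes compact_M: "compact M"
    and d_pos: "0 < d"
    and ball_density: "\<And>x0. x0 \<in> M \<Longrightarrow> \<exists>\<theta>>0. \<forall>\<tau>>0. \<exists>s>0. \<forall>x\<in>M. \<forall>t. dist x x0 < s \<longrightarrow> 0 < t \<longrightarrow> t < s \<longrightarrow>
        \<bar>measure \<mu> (M \<inter> ball x t) - \<theta> * t ^ d\<bar> \<le> \<tau> * t ^ d"
    and distinct: "AE w in P. inj_on (\<lambda>i. X i w) {1..}"
    and kernel: "admissible_kernel \<eta>"
    and eps_pos: "\<And>n. 1 \<le> n \<Longrightarrow> 0 < \<epsilon> n"
    and eps_lim: "\<epsilon> \<longlonglongrightarrow> 0"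
    and scale: "filterlim (\<lambda>n. real n * \<epsilon> n ^ d / ln (real n)) at_top sequentially"
begin

definition V :: "nat \<Rightarrow> 'w \<Rightarrow> 'a set" where "V n w = (\<lambda>i. X i w) ` {1..n}"

lemma finite_V [simp]: "finite (V n w)" by (simp add: V_def)

lemma hits_eq_card:
  assumes "inj_on (\<lambda>i. X i w) {1..}"
  shows "hits n B w = real (card (V n w \<inter> B))"
proof -
  have inj: "inj_on (\<lambda>i. X i w) {1..n}" using assms by (rule inj_on_subset) auto
  have "hits n B w = (\<Sum>x\<in>V n w. indicator B x)"
    unfolding hits_def V_def by (subst sum.reindex[OF inj]) simp
  then show ?thesis by (simp add: indicator_def sum.If_cases)
qed

lemma M_borel [measurable]: "M \<in> sets borel"
  using compact_M by (intro borel_closed compact_imp_closed)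

lemma ev_eps_small:
  assumes "0 < a"
  shows "eventually (\<lambda>n. 0 < \<epsilon> n \<and> \<epsilon> n < a) sequentially"
  using order_tendstoD(2)[OF eps_lim assms] eventually_ge_at_top[of 1]
  by eventually_elim (auto intro: eps_pos)

lemma ev_scale_large: "eventually (\<lambda>n. K \<le> real n * \<epsilon> n ^ d) sequentially"
proof -
  define L where "L = max K 0"
  have L: "0 \<le> L" "K \<le> L" by (auto simp: L_def)
  have "eventually (\<lambda>n. L \<le> real n * \<epsilon> n ^ d / ln (real n)) sequentially"
    using scale unfolding filterlim_at_top by blast
  moreover have "eventually (\<lambda>n. 1 \<le> ln (real n)) sequentially" by real_asymp
  ultimately show ?thesis
  proof eventually_elim
    case (elim n)
    then have "L * ln (real n) \<le> real n * \<epsilon> n ^ d" by (simp add: pos_le_divide_eq)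
    moreover have "L * 1 \<le> L * ln (real n)" using elim L(1) by (intro mult_left_mono) auto
    ultimately show ?case using L(2) by simp
  qed
qed

text \<open>Compactness makes the local asymptotics uniform for radii below some \<open>s0\<close>.
  Radii up to 1 follow by shrinking the ball by the factor s0 / 2 for the lower bound, and from
  total mass 1 for the upper bound.\<close>

lemma ahlfors:
  obtains c C where "0 < c" "0 < C"
    "\<And>x t. x \<in> M \<Longrightarrow> 0 < t \<Longrightarrow> t \<le> 1 \<Longrightarrow> c * t ^ d \<le> measure \<mu> (M \<inter> ball x t)"
    "\<And>x t. x \<in> M \<Longrightarrow> 0 < t \<Longrightarrow> t \<le> 1 \<Longrightarrow> measure \<mu> (M \<inter> ball x t) \<le> C * t ^ d"
proof -
  interpret \<mu>: prob_space \<mu> by (rule prob_space_law)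
  have "\<exists>\<theta> s. 0 < \<theta> \<and> 0 < s \<and> (\<forall>x\<in>M. \<forall>t. dist x x0 < s \<longrightarrow> 0 < t \<longrightarrow> t < s \<longrightarrow>
        \<bar>measure \<mu> (M \<inter> ball x t) - \<theta> * t ^ d\<bar> \<le> \<theta> / 2 * t ^ d)" if "x0 \<in> M" for x0
    using ball_density[OF that] by (metis half_gt_zero)
  then obtain \<theta> s where \<theta>: "\<And>x0. x0 \<in> M \<Longrightarrow> 0 < \<theta> x0 \<and> 0 < s x0 \<and> (\<forall>x\<in>M. \<forall>t. dist x x0 < s x0 \<longrightarrow> 0 < t \<longrightarrow> t < s x0 \<longrightarrow>
        \<bar>measure \<mu> (M \<inter> ball x t) - \<theta> x0 * t ^ d\<bar> \<le> \<theta> x0 / 2 * t ^ d)" by metis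
  obtain D where D: "D \<subseteq> M" "finite D" "M \<subseteq> (\<Union>x\<in>D. ball x (s x))"
    using compactE_image[OF compact_M, of M "\<lambda>x. ball x (s x)"] \<theta> by (metis (no_types, lifting) UN_I centre_in_ball open_ball subsetI)
  define s0 where "s0 = Min (insert 1 (s ` D))"
  define c where "c = Min (insert 1 ((\<lambda>x. \<theta> x / 2) ` D))"
  define C where "C = (\<Sum>x\<in>D. 2 * \<theta> x) + 1"
  have s0: "0 < s0" "s0 \<le> 1" "\<And>x. x \<in> D \<Longrightarrow> s0 \<le> s x"
    unfolding s0_def using D \<theta> by (auto simp: Min_gr_iff)
  have c: "0 < c" unfolding c_def using D \<theta> by (auto simp: Min_gr_iff)
  have c2: "c \<le> \<theta> x / 2" if "x \<in> D" for x
    unfolding c_def using D that by (intro Min_le) auto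
  have C: "0 < C" "1 \<le> C" "\<And>x. x \<in> D \<Longrightarrow> 2 * \<theta> x \<le> C"
  proof -
    have nn: "0 \<le> (\<Sum>x\<in>D. 2 * \<theta> x)" using D \<theta> by (intro sum_nonneg) (auto simp: less_imp_le subset_iff)
    show "0 < C" "1 \<le> C" using nn by (auto simp: C_def)
    show "2 * \<theta> x \<le> C" if "x \<in> D" for x
      using member_le_sum[of x D "\<lambda>x. 2 * \<theta> x"] that D \<theta> by (auto simp: C_def less_imp_le subset_iff)
  qed
  have loc: "c * t ^ d \<le> measure \<mu> (M \<inter> ball x t) \<and> measure \<mu> (M \<inter> ball x t) \<le> C * t ^ d"
    if x: "x \<in> M" and t: "0 < t" "t < s0" for x t
  proof -
    obtain x0 where x0: "x0 \<in> D" "dist x x0 < s x0" using D(3) x by (auto simp: dist_commute)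
    have "\<bar>measure \<mu> (M \<inter> ball x t) - \<theta> x0 * t ^ d\<bar> \<le> \<theta> x0 / 2 * t ^ d"
      using \<theta>[of x0] x0 x t s0(3)[of x0] D(1) by auto
    then have "\<theta> x0 / 2 * t ^ d \<le> measure \<mu> (M \<inter> ball x t)" "measure \<mu> (M \<inter> ball x t) \<le> 3 / 2 * \<theta> x0 * t ^ d"
      by arith+
    moreover have "c * t ^ d \<le> \<theta> x0 / 2 * t ^ d" using c2[OF x0(1)] t by (intro mult_right_mono) auto
    moreover have "3 / 2 * \<theta> x0 * t ^ d \<le> C * t ^ d" using C(3)[OF x0(1)] t \<theta>[of x0] x0(1) D(1) by (intro mult_right_mono) auto
    ultimately show ?thesis by linarith
  qed
  show ?thesis
  proof
    show "0 < c * (s0 / 2) ^ d" "0 < C / (s0 / 2) ^ d" using c C(1) s0(1) by auto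
    fix x t assume x: "x \<in> M" and t: "0 < t" "t \<le> (1::real)"
    have s2: "0 < s0 / 2" "s0 / 2 \<le> 1" "s0 / 2 < s0" using s0 by auto
    have ts: "0 < t * (s0 / 2)" "t * (s0 / 2) < s0" "t * (s0 / 2) \<le> t"
      using t s0 mult_right_mono[of t 1 "s0/2"] mult_left_mono[of "s0/2" 1 t] by auto
    have "c * (s0 / 2) ^ d * t ^ d = c * (t * (s0 / 2)) ^ d" by (simp add: power_mult_distrib field_simps)
    also have "\<dots> \<le> measure \<mu> (M \<inter> ball x (t * (s0 / 2)))" using loc[OF x ts(1,2)] by blast
    also have "\<dots> \<le> measure \<mu> (M \<inter> ball x t)" using ts(3) by (intro \<mu>.finite_measure_mono) auto
    finally show "c * (s0 / 2) ^ d * t ^ d \<le> measure \<mu> (M \<inter> ball x t)" .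
    show "measure \<mu> (M \<inter> ball x t) \<le> C / (s0 / 2) ^ d * t ^ d"
    proof (cases "t < s0 / 2")
      case True
      have "measure \<mu> (M \<inter> ball x t) \<le> C * t ^ d" using loc[OF x t(1)] True s2 by simp
      also have "\<dots> \<le> C / (s0 / 2) ^ d * t ^ d"
        using C(1) t(1) s2 by (intro mult_right_mono) (auto simp: pos_le_divide_eq power_le_one mult_left_le)
      finally show ?thesis .
    next
      case False
      have "measure \<mu> (M \<inter> ball x t) \<le> 1" by (rule \<mu>.prob_le_1)
      also have "1 * (s0 / 2) ^ d \<le> C * t ^ d" using False C(2) s2 by (intro mult_mono power_mono) auto
      then have "1 \<le> C / (s0 / 2) ^ d * t ^ d" using s2 by (simp add: field_simps)
      finally show ?thesis .
    qed
  qed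
qed

text \<open>A maximal e-separated subset. The balls of half the radius around its points are
  disjoint and have mass at least c (e / 2)^d, which bounds the cardinality and thereby gives the
  existence of a maximal one.\<close>

lemma finite_net:
  assumes low: "\<And>x t. x \<in> M \<Longrightarrow> 0 < t \<Longrightarrow> t \<le> 1 \<Longrightarrow> c * t ^ d \<le> measure \<mu> (M \<inter> ball x t)" "0 < c"
    and e: "0 < e" "e \<le> 1"
  obtains F where "finite F" "F \<subseteq> M" "M \<subseteq> (\<Union>p\<in>F. ball p e)" "real (card F) * (c * (e / 2) ^ d) \<le> 1"
proof -
  interpret \<mu>: prob_space \<mu> by (rule prob_space_law)
  define S where "S F \<longleftrightarrow> finite F \<and> F \<subseteq> M \<and> (\<forall>x\<in>F. \<forall>y\<in>F. x \<noteq> y \<longrightarrow> e \<le> dist x y)" for F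
  have card: "real (card F) * (c * (e / 2) ^ d) \<le> 1" if F: "S F" for F
  proof -
    have "real (card F) * (c * (e / 2) ^ d) = (\<Sum>p\<in>F. c * (e / 2) ^ d)" by simp
    also have "\<dots> \<le> (\<Sum>p\<in>F. measure \<mu> (M \<inter> ball p (e / 2)))"
      using F e low(1)[of _ "e / 2"] by (intro sum_mono) (auto simp: S_def)
    also have "\<dots> = measure \<mu> (\<Union>p\<in>F. M \<inter> ball p (e / 2))"
    proof (rule \<mu>.finite_measure_finite_Union[symmetric])
      show "disjoint_family_on (\<lambda>p. M \<inter> ball p (e / 2)) F"
        unfolding disjoint_family_on_def
      proof (intro ballI impI)
        fix x y assume xy: "x \<in> F" "y \<in> F" "x \<noteq> y"
        have "e \<le> dist x y" using F xy by (simp add: S_def)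
        then show "M \<inter> ball x (e / 2) \<inter> (M \<inter> ball y (e / 2)) = {}"
          using dist_triangle_half_l[of x _ e y] by (force simp: dist_commute)
      qed
    qed (use F in \<open>auto simp: S_def\<close>)
    also have "\<dots> \<le> 1" by (rule \<mu>.prob_le_1)
    finally show ?thesis .
  qed
  have pos: "0 < c * (e / 2) ^ d" using low(2) e by simp
  have bnd: "card F \<le> nat \<lfloor>1 / (c * (e / 2) ^ d)\<rfloor>" if "S F" for F
    using card[OF that] pos by (intro le_nat_floor) (simp add: pos_le_divide_eq)
  have "S {}" by (simp add: S_def)
  then obtain F where F: "S F" "\<And>G. S G \<Longrightarrow> card G \<le> card F"
    using ex_has_greatest_nat[of S "{}" card "Suc (nat \<lfloor>1 / (c * (e / 2) ^ d)\<rfloor>)"] bnd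
    by (metis less_Suc_eq_le)
  have "M \<subseteq> (\<Union>p\<in>F. ball p e)"
  proof (rule ccontr)
    assume "\<not> M \<subseteq> (\<Union>p\<in>F. ball p e)"
    then obtain x where x: "x \<in> M" "x \<notin> (\<Union>p\<in>F. ball p e)" by blast
    then have x2: "\<And>p. p \<in> F \<Longrightarrow> e \<le> dist p x" by (force simp: not_less)
    have "x \<notin> F" using e(1) x2 by force
    moreover have "S (insert x F)" using F(1) x(1) x2 unfolding S_def by (auto simp: dist_commute)
    ultimately show False using F(2)[of "insert x F"] F(1) by (simp add: S_def)
  qed
  then show ?thesis using that F(1) card[OF F(1)] by (auto simp: S_def)
qed

text \<open>Centres range over all of \<open>M\<close>, so the Chernoff bound is applied to balls
  around a net of mesh e \<epsilon>(n) with e = \<delta> / 2; moving the centre to the net and back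
  costs 2 e = \<delta> in the radius. The net has of order \<epsilon>(n)^(-d) points, which is
  eventually few enough for \<open>AE_hits_uniform\<close>.\<close>

lemma AE_ball_counts:
  assumes R: "0 < \<delta>" "\<delta> < R" and t: "0 < t" "t \<le> 1"
  shows "AE w in P. eventually (\<lambda>n. \<forall>x\<in>M.
      (1 - t) * measure \<mu> (M \<inter> ball x ((R - \<delta>) * \<epsilon> n)) \<le> real (card (V n w \<inter> (M \<inter> ball x (R * \<epsilon> n)))) / real n \<and>
      real (card (V n w \<inter> (M \<inter> ball x (R * \<epsilon> n)))) / real n \<le> (1 + t) * measure \<mu> (M \<inter> ball x ((R + \<delta>) * \<epsilon> n))) sequentially"
proof -
  interpret \<mu>: prob_space \<mu> by (rule prob_space_law)
  obtain c C where c: "0 < c" and low: "\<And>x t. x \<in> M \<Longrightarrow> 0 < t \<Longrightarrow> t \<le> 1 \<Longrightarrow> c * t ^ d \<le> measure \<mu> (M \<inter> ball x t)"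
    using ahlfors by metis
  define e where "e = \<delta> / 2"
  have e: "0 < e" "e < R" using R by (auto simp: e_def)
  have "\<exists>F. 0 < \<epsilon> n \<and> e * \<epsilon> n \<le> 1 \<longrightarrow> finite F \<and> F \<subseteq> M \<and> M \<subseteq> (\<Union>p\<in>F. ball p (e * \<epsilon> n)) \<and>
      real (card F) * (c * (e * \<epsilon> n / 2) ^ d) \<le> 1" for n
  proof (cases "0 < \<epsilon> n \<and> e * \<epsilon> n \<le> 1")
    case True
    then obtain F where "finite F" "F \<subseteq> M" "M \<subseteq> (\<Union>p\<in>F. ball p (e * \<epsilon> n))" "real (card F) * (c * (e * \<epsilon> n / 2) ^ d) \<le> 1"
      using finite_net[OF low c, of "e * \<epsilon> n"] e(1) by auto
    then show ?thesis by blast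
  qed blast
  then obtain F where F: "\<And>n. 0 < \<epsilon> n \<Longrightarrow> e * \<epsilon> n \<le> 1 \<Longrightarrow> finite (F n) \<and> F n \<subseteq> M \<and>
      M \<subseteq> (\<Union>p\<in>F n. ball p (e * \<epsilon> n)) \<and> real (card (F n)) * (c * (e * \<epsilon> n / 2) ^ d) \<le> 1" by metis
  \<comment> \<open>For the finitely many \<open>n\<close> where \<epsilon> is not yet small, no net
    need exist; the empty set keeps the family finite for every \<open>n\<close>.\<close>
  define G where "G n = (if 0 < \<epsilon> n \<and> e * \<epsilon> n \<le> 1 then F n else {})" for n
  have finG: "finite (G n)" for n using F by (simp add: G_def)
  define \<B> where "\<B> n = (\<lambda>p. M \<inter> ball p ((R - e) * \<epsilon> n)) ` G n \<union> (\<lambda>p. M \<inter> ball p ((R + e) * \<epsilon> n)) ` G n" for n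
  have "eventually (\<lambda>n. 0 < \<epsilon> n \<and> \<epsilon> n < 1 / (R + e)) sequentially"
    using e by (intro ev_eps_small) auto
  then have small: "eventually (\<lambda>n. 0 < \<epsilon> n \<and> e * \<epsilon> n \<le> 1 \<and> (R + e) * \<epsilon> n \<le> 1) sequentially"
  proof eventually_elim
    case (elim n)
    have "(R + e) * \<epsilon> n < 1" using elim e by (simp add: pos_less_divide_eq mult.commute)
    moreover have "e * \<epsilon> n \<le> (R + e) * \<epsilon> n" using elim e by (intro mult_right_mono) auto
    ultimately have "e * \<epsilon> n \<le> 1" "(R + e) * \<epsilon> n \<le> 1" by linarith+
    then show ?case using elim by blast
  qed
  have "AE w in P. eventually (\<lambda>n. \<forall>B\<in>\<B> n. \<bar>hits n B w - real n * measure \<mu> B\<bar> \<le> t * (real n * measure \<mu> B)) sequentially"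
  proof (rule AE_hits_uniform[where b="\<lambda>n. c * ((R - e) * \<epsilon> n) ^ d"])
    show "finite (\<B> n)" for n using finG by (simp add: \<B>_def)
    show "B \<in> sets borel" if "B \<in> \<B> n" for n B using that by (auto simp: \<B>_def)
    show "eventually (\<lambda>n. card (\<B> n) \<le> n) sequentially"
      using small ev_scale_large[of "2 / (c * (e / 2) ^ d)"]
    proof eventually_elim
      case (elim n)
      have en: "0 < \<epsilon> n" "e * \<epsilon> n \<le> 1" using elim by auto
      have pos: "0 < c * (e / 2) ^ d" using c e by simp
      have "real (card (\<B> n)) \<le> 2 * real (card (F n))"
      proof -
        have "card (\<B> n) \<le> card (F n) + card (F n)"
          unfolding \<B>_def G_def using F[OF en] en
          by (auto intro!: order_trans[OF card_Un_le] add_mono card_image_le)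
        then show ?thesis by linarith
      qed
      then have "real (card (\<B> n)) * (c * (e / 2) ^ d) \<le> 2 * real (card (F n)) * (c * (e / 2) ^ d)"
        using pos by (intro mult_right_mono) auto
      then have "real (card (\<B> n)) * (c * (e / 2) ^ d) * \<epsilon> n ^ d \<le> 2 * (real (card (F n)) * (c * (e / 2) ^ d)) * \<epsilon> n ^ d"
        using en by (intro mult_right_mono) (auto simp: mult_ac)
      also have "\<dots> = 2 * (real (card (F n)) * (c * (e * \<epsilon> n / 2) ^ d))"
        by (simp add: power_mult_distrib power_divide field_simps)
      also have "\<dots> \<le> 2 * 1" using F[OF en] by (intro mult_left_mono) auto
      also have "\<dots> \<le> real n * \<epsilon> n ^ d * (c * (e / 2) ^ d)" using elim(2) pos by (simp add: pos_divide_le_eq)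
      finally have "real (card (\<B> n)) * (c * (e / 2) ^ d * \<epsilon> n ^ d) \<le> real n * (c * (e / 2) ^ d * \<epsilon> n ^ d)"
        by (simp add: mult_ac)
      moreover have "0 < c * (e / 2) ^ d * \<epsilon> n ^ d" by (rule mult_pos_pos[OF pos zero_less_power[OF en(1)]])
      ultimately have "real (card (\<B> n)) \<le> real n" by (rule mult_right_le_imp_le)
      then show ?case by simp
    qed
    show "eventually (\<lambda>n. \<forall>B\<in>\<B> n. c * ((R - e) * \<epsilon> n) ^ d \<le> measure \<mu> B) sequentially"
      using small
    proof eventually_elim
      case (elim n)
      have en: "0 < \<epsilon> n" "e * \<epsilon> n \<le> 1" "(R + e) * \<epsilon> n \<le> 1" using elim by auto
      have le: "(R - e) * \<epsilon> n \<le> (R + e) * \<epsilon> n" "0 < (R - e) * \<epsilon> n" using e en by auto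
      show ?case
      proof
        fix B assume "B \<in> \<B> n"
        then obtain p where p: "p \<in> M" "B = M \<inter> ball p ((R - e) * \<epsilon> n) \<or> B = M \<inter> ball p ((R + e) * \<epsilon> n)"
          using F[OF en(1,2)] en by (auto simp: \<B>_def G_def)
        have "c * ((R - e) * \<epsilon> n) ^ d \<le> measure \<mu> (M \<inter> ball p ((R - e) * \<epsilon> n))"
          using low[OF p(1) le(2)] le en by simp
        moreover have "measure \<mu> (M \<inter> ball p ((R - e) * \<epsilon> n)) \<le> measure \<mu> (M \<inter> ball p ((R + e) * \<epsilon> n))"
          using le(1) by (intro \<mu>.finite_measure_mono) auto
        ultimately show "c * ((R - e) * \<epsilon> n) ^ d \<le> measure \<mu> B" using p(2) by auto
      qed
    qed
    have "filterlim (\<lambda>n. (c * (R - e) ^ d) * (real n * \<epsilon> n ^ d / ln (real n))) at_top sequentially"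
      using c e by (intro filterlim_tendsto_pos_mult_at_top[OF tendsto_const _ scale]) auto
    then show "filterlim (\<lambda>n. real n * (c * ((R - e) * \<epsilon> n) ^ d) / ln (real n)) at_top sequentially"
      by (simp add: power_mult_distrib mult_ac)
  qed (use t in auto)
  with distinct show ?thesis
  proof eventually_elim
    case (elim w)
    note inj = elim(1)
    show ?case using elim(2) small eventually_gt_at_top[of 0]
    proof eventually_elim
      case (elim n)
      have en: "0 < \<epsilon> n" "e * \<epsilon> n \<le> 1" using elim by auto
      have count: "\<bar>real (card (V n w \<inter> B)) / real n - measure \<mu> B\<bar> \<le> t * measure \<mu> B" if "B \<in> \<B> n" for B
      proof -
        have "\<bar>real (card (V n w \<inter> B)) - real n * measure \<mu> B\<bar> \<le> t * (real n * measure \<mu> B)"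
          using elim(1) that by (simp add: hits_eq_card[OF inj, symmetric])
        then have "\<bar>real (card (V n w \<inter> B)) - real n * measure \<mu> B\<bar> / real n \<le> t * (real n * measure \<mu> B) / real n"
          by (intro divide_right_mono) auto
        also have "t * (real n * measure \<mu> B) / real n = t * measure \<mu> B" using elim by simp
        also have "\<bar>real (card (V n w \<inter> B)) - real n * measure \<mu> B\<bar> / real n = \<bar>real (card (V n w \<inter> B)) / real n - measure \<mu> B\<bar>"
          using elim by (simp add: abs_if field_simps)
        finally show ?thesis .
      qed
      have mono: "real (card (V n w \<inter> A)) / real n \<le> real (card (V n w \<inter> B)) / real n" if "A \<subseteq> B" for A B
        using that by (intro divide_right_mono of_nat_mono card_mono) auto
      show ?case
      proof (intro ballI conjI)
        fix x assume x: "x \<in> M"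
        then obtain p where p: "p \<in> F n" "dist p x < e * \<epsilon> n" using F[OF en] by auto
        have pB: "M \<inter> ball p ((R - e) * \<epsilon> n) \<in> \<B> n" "M \<inter> ball p ((R + e) * \<epsilon> n) \<in> \<B> n"
          using p en by (auto simp: \<B>_def G_def)
        have \<delta>: "\<delta> = 2 * e" by (simp add: e_def)
        have tri: "ball a q \<subseteq> ball b q'" if "dist b a < e * \<epsilon> n" "q + e * \<epsilon> n \<le> q'" for a b :: 'a and q q'
        proof
          fix z assume "z \<in> ball a q"
          then show "z \<in> ball b q'" using that dist_triangle[of b z a] by simp
        qed
        have px: "dist x p < e * \<epsilon> n" using p(2) by (simp add: dist_commute)
        have s: "ball x ((R - \<delta>) * \<epsilon> n) \<subseteq> ball p ((R - e) * \<epsilon> n)" "ball p ((R - e) * \<epsilon> n) \<subseteq> ball x (R * \<epsilon> n)"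
          "ball x (R * \<epsilon> n) \<subseteq> ball p ((R + e) * \<epsilon> n)" "ball p ((R + e) * \<epsilon> n) \<subseteq> ball x ((R + \<delta>) * \<epsilon> n)"
          using p(2) px by (intro tri; simp add: \<delta> algebra_simps)+
        have "(1 - t) * measure \<mu> (M \<inter> ball x ((R - \<delta>) * \<epsilon> n)) \<le> (1 - t) * measure \<mu> (M \<inter> ball p ((R - e) * \<epsilon> n))"
          using t s by (intro mult_left_mono \<mu>.finite_measure_mono) auto
        also have "\<dots> \<le> real (card (V n w \<inter> (M \<inter> ball p ((R - e) * \<epsilon> n)))) / real n"
          using count[OF pB(1)] unfolding abs_le_iff by (simp add: algebra_simps)
        also have "\<dots> \<le> real (card (V n w \<inter> (M \<inter> ball x (R * \<epsilon> n)))) / real n"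
          using s by (intro mono) auto
        finally show "(1 - t) * measure \<mu> (M \<inter> ball x ((R - \<delta>) * \<epsilon> n)) \<le> \<dots>" .
        have "real (card (V n w \<inter> (M \<inter> ball x (R * \<epsilon> n)))) / real n \<le> real (card (V n w \<inter> (M \<inter> ball p ((R + e) * \<epsilon> n)))) / real n"
          using s by (intro mono) auto
        also have "\<dots> \<le> (1 + t) * measure \<mu> (M \<inter> ball p ((R + e) * \<epsilon> n))"
          using count[OF pB(2)] unfolding abs_le_iff by (simp add: algebra_simps)
        also have "\<dots> \<le> (1 + t) * measure \<mu> (M \<inter> ball x ((R + \<delta>) * \<epsilon> n))"
          using t s by (intro mult_left_mono \<mu>.finite_measure_mono) auto
        finally show "real (card (V n w \<inter> (M \<inter> ball x (R * \<epsilon> n)))) / real n \<le> \<dots>" .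
      qed
    qed
  qed
qed

abbreviation deg :: "nat \<Rightarrow> 'w \<Rightarrow> 'a \<Rightarrow> real" where
  "deg n w x \<equiv> graph_degree \<eta> n (\<epsilon> n) (V n w \<inter> M) x"

text \<open>The point \<open>x\<close> may lie off \<open>M\<close>: this is how the degree from one
  piece is bounded at points of the other. The count is recentred at a sample point of
  \<open>M\<close> near \<open>x\<close>, where ball counts are available.\<close>

lemma AE_degree_upper:
  obtains C where "0 < C" "AE w in P. eventually (\<lambda>n. \<forall>x. deg n w x \<le> C * \<epsilon> n ^ d) sequentially"
proof -
  obtain c C where C: "0 < C" and up: "\<And>x t. x \<in> M \<Longrightarrow> 0 < t \<Longrightarrow> t \<le> 1 \<Longrightarrow> measure \<mu> (M \<inter> ball x t) \<le> C * t ^ d"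
    using ahlfors by metis
  have \<eta>0: "0 < \<eta> 0" using kernel by (rule kernel_pos)
  have "AE w in P. eventually (\<lambda>n. \<forall>x\<in>M.
      (1 - 1) * measure \<mu> (M \<inter> ball x ((3 - 1) * \<epsilon> n)) \<le> real (card (V n w \<inter> (M \<inter> ball x (3 * \<epsilon> n)))) / real n \<and>
      real (card (V n w \<inter> (M \<inter> ball x (3 * \<epsilon> n)))) / real n \<le> (1 + 1) * measure \<mu> (M \<inter> ball x ((3 + 1) * \<epsilon> n))) sequentially"
    by (rule AE_ball_counts) auto
  then have "AE w in P. eventually (\<lambda>n. \<forall>x. deg n w x \<le> (\<eta> 0 * (2 * (C * 4 ^ d))) * \<epsilon> n ^ d) sequentially"
  proof eventually_elim
    case (elim w)
    have "eventually (\<lambda>n. 0 < \<epsilon> n \<and> \<epsilon> n < 1 / 4) sequentially" by (rule ev_eps_small) simp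
    with elim eventually_gt_at_top[of 0] show ?case
    proof eventually_elim
      case (elim n)
      show ?case
      proof
        fix x
        define U where "U = {y \<in> V n w \<inter> M. dist x y \<le> \<epsilon> n}"
        have "deg n w x \<le> \<eta> 0 * (real (card U) / real n)"
        proof -
          have "(\<Sum>y\<in>V n w \<inter> M. \<eta> (norm (x - y) / \<epsilon> n)) \<le> (\<Sum>y\<in>V n w \<inter> M. if y \<in> U then \<eta> 0 else 0)"
          proof (rule sum_mono)
            fix y assume y: "y \<in> V n w \<inter> M"
            show "\<eta> (norm (x - y) / \<epsilon> n) \<le> (if y \<in> U then \<eta> 0 else 0)"
            proof (cases "y \<in> U")
              case True
              then show ?thesis using kernel_antimono[OF kernel order_refl, of "norm (x - y) / \<epsilon> n"] elim by simp
            next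
              case False
              then have "1 < norm (x - y) / \<epsilon> n" using y elim by (simp add: U_def dist_norm)
              then show ?thesis using kernel_zero[OF kernel] False by simp
            qed
          qed
          also have "\<dots> = (\<Sum>y\<in>U. \<eta> 0)" by (rule sum.mono_neutral_cong_right) (auto simp: U_def)
          finally show ?thesis using elim by (simp add: graph_degree_def divide_right_mono mult.commute)
        qed
        \<comment> \<open>Points of \<open>U\<close> are within 2 \<epsilon> of each other, so an
          open ball of radius 3 \<epsilon> contains them, and estimating its count costs radius 4
          \<epsilon>.\<close>
        also have "real (card U) / real n \<le> 2 * (C * 4 ^ d) * \<epsilon> n ^ d"
        proof (cases "U = {}")
          case False
          then obtain z where z: "z \<in> U" by blast
          have "U \<subseteq> V n w \<inter> (M \<inter> ball z (3 * \<epsilon> n))"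
          proof
            fix y assume y: "y \<in> U"
            then have "dist z y \<le> 2 * \<epsilon> n" using z dist_triangle[of z y x] by (simp add: U_def dist_commute)
            then show "y \<in> V n w \<inter> (M \<inter> ball z (3 * \<epsilon> n))" using y elim by (auto simp: U_def)
          qed
          then have "real (card U) / real n \<le> real (card (V n w \<inter> (M \<inter> ball z (3 * \<epsilon> n)))) / real n"
            by (intro divide_right_mono of_nat_mono card_mono) auto
          also have "\<dots> \<le> 2 * measure \<mu> (M \<inter> ball z (4 * \<epsilon> n))" using elim z by (auto simp: U_def)
          also have "\<dots> \<le> 2 * (C * (4 * \<epsilon> n) ^ d)" using z elim by (intro mult_left_mono up) (auto simp: U_def)
          finally show ?thesis by (simp add: power_mult_distrib mult_ac)
        qed (use C elim in simp)
        then have "\<eta> 0 * (real (card U) / real n) \<le> \<eta> 0 * (2 * (C * 4 ^ d) * \<epsilon> n ^ d)"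
          using \<eta>0 by (intro mult_left_mono) auto
        finally show "deg n w x \<le> (\<eta> 0 * (2 * (C * 4 ^ d))) * \<epsilon> n ^ d" by (simp add: mult_ac)
      qed
    qed
  qed
  then show ?thesis using that[of "\<eta> 0 * (2 * (C * 4 ^ d))"] C \<eta>0 by simp
qed

lemma AE_degree_lower:
  obtains c where "0 < c" "AE w in P. eventually (\<lambda>n. \<forall>x\<in>M. c * \<epsilon> n ^ d \<le> deg n w x) sequentially"
proof -
  obtain c C where c: "0 < c" and low: "\<And>x t. x \<in> M \<Longrightarrow> 0 < t \<Longrightarrow> t \<le> 1 \<Longrightarrow> c * t ^ d \<le> measure \<mu> (M \<inter> ball x t)"
    using ahlfors by metis
  obtain r0 \<eta>1 where r: "0 < r0" "r0 \<le> 1" "0 < \<eta>1" "\<And>t. 0 \<le> t \<Longrightarrow> t \<le> r0 \<Longrightarrow> \<eta>1 \<le> \<eta> t"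
    using kernel_lower_near_0[OF kernel] by metis
  define k where "k = \<eta>1 * (1 / 2 * (c * (r0 / 2) ^ d))"
  have k: "0 < k" using r c by (simp add: k_def)
  have "AE w in P. eventually (\<lambda>n. \<forall>x\<in>M.
      (1 - 1/2) * measure \<mu> (M \<inter> ball x ((r0 - r0/2) * \<epsilon> n)) \<le> real (card (V n w \<inter> (M \<inter> ball x (r0 * \<epsilon> n)))) / real n \<and>
      real (card (V n w \<inter> (M \<inter> ball x (r0 * \<epsilon> n)))) / real n \<le> (1 + 1/2) * measure \<mu> (M \<inter> ball x ((r0 + r0/2) * \<epsilon> n))) sequentially"
    using r by (intro AE_ball_counts) auto
  then have "AE w in P. eventually (\<lambda>n. \<forall>x\<in>M. k * \<epsilon> n ^ d \<le> deg n w x) sequentially"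
  proof eventually_elim
    case (elim w)
    have "eventually (\<lambda>n. 0 < \<epsilon> n \<and> \<epsilon> n < 1) sequentially" by (rule ev_eps_small) simp
    with elim eventually_gt_at_top[of 0] show ?case
    proof eventually_elim
      case (elim n)
      show ?case
      proof
        fix x assume x: "x \<in> M"
        let ?B = "V n w \<inter> (M \<inter> ball x (r0 * \<epsilon> n))"
        have "k * \<epsilon> n ^ d = \<eta>1 * ((1 - 1/2) * (c * ((r0 - r0/2) * \<epsilon> n) ^ d))"
          by (simp add: k_def power_mult_distrib power_divide)
        also have "\<dots> \<le> \<eta>1 * ((1 - 1/2) * measure \<mu> (M \<inter> ball x ((r0 - r0/2) * \<epsilon> n)))"
          using r x elim mult_mono[of "r0 / 2" 1 "\<epsilon> n" 1] by (intro mult_left_mono low) auto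
        also have "\<dots> \<le> \<eta>1 * (real (card ?B) / real n)"
          using elim x r by (intro mult_left_mono) auto
        also have "\<dots> = 1 / real n * (\<Sum>y\<in>?B. \<eta>1)" by simp
        also have "\<dots> \<le> 1 / real n * (\<Sum>y\<in>?B. \<eta> (norm (x - y) / \<epsilon> n))"
          using elim by (intro mult_left_mono sum_mono r(4)) (auto simp: dist_norm pos_divide_le_eq less_imp_le)
        also have "\<dots> \<le> deg n w x"
          unfolding graph_degree_def using elim
          by (intro mult_left_mono sum_mono2 kernel_nonneg[OF kernel]) auto
        finally show "k * \<epsilon> n ^ d \<le> deg n w x" .
      qed
    qed
  qed
  then show ?thesis using that k by blast
qed

end

section \<open>A Poincare inequality on images of cubes\<close>

definition corner :: "real^'m \<Rightarrow> real \<Rightarrow> ('m \<Rightarrow> nat) \<Rightarrow> real^'m" where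
  "corner p s i = (\<chi> k. p $ k + s * real (i k))"

lemma subcube_subset:
  assumes "0 < s" "i \<in> grid q"
  shows "cube (corner p s i) s \<subseteq> cube p (s * real q)"
proof
  fix y assume y: "y \<in> cube (corner p s i) s"
  show "y \<in> cube p (s * real q)"
    unfolding cube_def
  proof (intro CollectI allI)
    fix k
    have "Suc (i k) \<le> q" using assms(2) by (simp add: grid_def Suc_le_eq)
    then have "real (Suc (i k)) \<le> real q" by (rule of_nat_mono)
    then have "real (i k) + 1 \<le> real q" by simp
    then have "s * (real (i k) + 1) \<le> s * real q" using assms(1) by (intro mult_left_mono) auto
    then have 1: "s * real (i k) + s \<le> s * real q" by (simp only: distrib_left mult_1_right)
    have 2: "p $ k + s * real (i k) \<le> y $ k" "y $ k < p $ k + s * real (i k) + s"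
      using y by (auto simp: cube_def corner_def)
    have "0 \<le> s * real (i k)" using assms(1) by simp
    then have "p $ k \<le> y $ k" using 2 by linarith
    moreover have "y $ k < p $ k + s * real q" using 1 2 by linarith
    ultimately show "p $ k \<le> y $ k \<and> y $ k < p $ k + s * real q" ..
  qed
qed

lemma subcube_disjoint:
  assumes "0 < s" "i \<noteq> j"
  shows "cube (corner p s i) s \<inter> cube (corner p s j) s = {}"
proof -
  have *: False if "y \<in> cube (corner p s i) s" "y \<in> cube (corner p s j) s" "i k < j k" for y i j k
  proof -
    have "s * (real (i k) + 1) \<le> s * real (j k)" using that(3) assms(1) by (intro mult_left_mono) auto
    moreover have "y $ k < p $ k + s * real (i k) + s" "p $ k + s * real (j k) \<le> y $ k"
      using that by (auto simp: cube_def corner_def)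
    ultimately show False by (simp add: algebra_simps)
  qed
  obtain k where "i k \<noteq> j k" using assms(2) by blast
  then show ?thesis using *[of _ i j k] *[of _ j i k] by (cases "i k < j k") auto
qed

text \<open>Half-open cubes partition exactly; the index is the floor of the scaled
  coordinate.\<close>

lemma subcube_cover:
  assumes "0 < s"
  shows "cube p (s * real q) = (\<Union>i\<in>grid q. cube (corner p s i) s)"
proof
  show "(\<Union>i\<in>grid q. cube (corner p s i) s) \<subseteq> cube p (s * real q)"
    using subcube_subset[OF assms] by blast
  show "cube p (s * real q) \<subseteq> (\<Union>i\<in>grid q. cube (corner p s i) s)"
  proof
    fix y assume y: "y \<in> cube p (s * real q)"
    define i where "i k = nat \<lfloor>(y $ k - p $ k) / s\<rfloor>" for k
    have k: "p $ k \<le> y $ k" "y $ k < p $ k + s * real q" for k using y by (auto simp: cube_def)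
    have i: "real (i k) \<le> (y $ k - p $ k) / s" "(y $ k - p $ k) / s < real (i k) + 1" for k
      using k(1)[of k] assms unfolding i_def by (simp_all add: of_nat_nat)
    have "i k < q" for k
    proof -
      have "(y $ k - p $ k) / s < real q" using k(2)[of k] assms by (simp add: field_simps)
      then show ?thesis using i(1)[of k] by linarith
    qed
    then have "i \<in> grid q" by (simp add: grid_def)
    moreover have "y \<in> cube (corner p s i) s"
      unfolding cube_def corner_def using i assms by (auto simp: field_simps)
    ultimately show "y \<in> (\<Union>i\<in>grid q. cube (corner p s i) s)" by blast
  qed
qed

lemma norm_le_card:
  fixes v :: "real^'m" and b :: real
  assumes "\<And>k. \<bar>v $ k\<bar> \<le> b"
  shows "norm v \<le> CARD('m) * b"
  using norm_le_l1_cart[of v] sum_mono[of UNIV "\<lambda>k. \<bar>v $ k\<bar>" "\<lambda>_. b"] assms by simp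

text \<open>The hypotheses on \<open>i\<close> and \<open>j\<close> treat equal and neighbouring
  cells at once.\<close>

lemma dist_neighbour_subcubes:
  fixes y z :: "real^'m" and s :: real
  assumes "y \<in> cube (corner p s i) s" "z \<in> cube (corner p s j) s" "0 < s"
    and "\<And>l. real (i l) \<le> real (j l)" "\<And>l. real (j l) \<le> real (i l) + 1"
  shows "dist y z \<le> CARD('m) * (2 * s)"
  unfolding dist_norm
proof (rule norm_le_card)
  fix l
  have "s * real (i l) \<le> s * real (j l)"
    using assms(3,4) by (intro mult_left_mono) auto
  moreover have "s * real (j l) \<le> s * (real (i l) + 1)"
    using assms(3,5) by (intro mult_left_mono) auto
  moreover have "p $ l + s * real (i l) \<le> y $ l" "y $ l < p $ l + s * real (i l) + s"
    "p $ l + s * real (j l) \<le> z $ l" "z $ l < p $ l + s * real (j l) + s"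
    using assms by (auto simp: cube_def corner_def)
  ultimately show "\<bar>(y - z) $ l\<bar> \<le> 2 * s"
    unfolding vector_minus_component abs_le_iff distrib_left mult_1_right by linarith
qed

definition dirichlet :: "(real \<Rightarrow> real) \<Rightarrow> real \<Rightarrow> 'a::euclidean_space set \<Rightarrow> ('a \<Rightarrow> real) \<Rightarrow> real" where
  "dirichlet \<eta> e U f = (\<Sum>x\<in>U. \<Sum>y\<in>U. \<eta> (norm (x - y) / e) * (f x - f y)\<^sup>2)"

text \<open>The first factor comes from \<open>cell_poincare\<close> with counts between n c s^d / 2
  and 2 n C s^d, the last one from the lower bound on the cell side s in terms of \<epsilon>. The
  side h of the cube does not occur: the gain h^2 stays visible, and refining the partition exploits
  it.\<close>

definition poincare_const :: "nat \<Rightarrow> real \<Rightarrow> real \<Rightarrow> real \<Rightarrow> real \<Rightarrow> real \<Rightarrow> real" where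
  "poincare_const d \<Lambda> c C r0 \<eta>1 = (4 / c + 16 * C * 2 ^ d * d / c\<^sup>2) / \<eta>1 * (4 * d * \<Lambda> / r0) ^ (d + 2)"

lemma good_cube_subcube:
  assumes "good_cube M \<mu> \<psi> \<Lambda> c C p h" "0 < s" "cube p' s \<subseteq> cube p h"
  shows "good_cube M \<mu> \<psi> \<Lambda> c C p' s"
proof -
  have "inj_on \<psi> (cube p' s)" using assms unfolding good_cube_def by (meson inj_on_subset)
  moreover have "\<forall>y\<in>cube p' s. \<forall>z\<in>cube p' s. dist (\<psi> y) (\<psi> z) \<le> \<Lambda> * dist y z"
    using assms unfolding good_cube_def by (meson subsetD)
  moreover have "cube q s' \<subseteq> cube p' s \<Longrightarrow> cube q s' \<subseteq> cube p h" for q s'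
    using assms(3) by (rule subset_trans[rotated])
  ultimately show ?thesis using assms(1,2) unfolding good_cube_def by meson
qed

lemma good_cubeD:
  fixes \<psi> :: "real^'m \<Rightarrow> 'a::euclidean_space"
  assumes "good_cube M \<mu> \<psi> \<Lambda> c C p h"
  shows "0 < h" "inj_on \<psi> (cube p h)"
    "\<And>y z. y \<in> cube p h \<Longrightarrow> z \<in> cube p h \<Longrightarrow> dist (\<psi> y) (\<psi> z) \<le> \<Lambda> * dist y z"
    "\<psi> ` cube p h \<in> sets borel" "\<psi> ` cube p h \<subseteq> M"
    "c * h ^ CARD('m) \<le> measure \<mu> (\<psi> ` cube p h)" "measure \<mu> (\<psi> ` cube p h) \<le> C * h ^ CARD('m)"
  using assms unfolding good_cube_def by (meson order_refl)+

context sample_piece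
begin

text \<open>The cube is cut into cells of side comparable to \<epsilon>, fine enough that points of
  the same or of adjacent cells are joined by edges of weight at least \<eta>1. By the Chernoff
  bound all cell counts are of order n \<epsilon>^d. Since this event concerns counts only,
  \<open>cell_poincare\<close> then holds for every \<open>f\<close> at once.\<close>

lemma AE_poincare:
  fixes \<psi> :: "real^'m \<Rightarrow> 'a"
  assumes good: "good_cube M \<mu> \<psi> \<Lambda> c C p h" and d: "d = CARD('m)" and pos: "0 < \<Lambda>" "0 < c" "0 < C"
    and r0: "0 < r0" "0 < \<eta>1" "\<And>t. 0 \<le> t \<Longrightarrow> t \<le> r0 \<Longrightarrow> \<eta>1 \<le> \<eta> t"
  shows "AE w in P. eventually (\<lambda>n. \<forall>f. \<exists>a. (\<Sum>x\<in>V n w \<inter> \<psi> ` cube p h. (f x - a)\<^sup>2) \<le>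
     poincare_const d \<Lambda> c C r0 \<eta>1 * h\<^sup>2 / (real n * \<epsilon> n ^ (d + 2)) * dirichlet \<eta> (\<epsilon> n) (V n w \<inter> \<psi> ` cube p h) f) sequentially"
proof -
  \<comment> \<open>Points in adjacent cells of side s have images at distance at most 2 d \<Lambda>
    s, which is at most r0 \<epsilon> for s <= c1 \<epsilon>.\<close>
  define c1 where "c1 = r0 / (2 * d * \<Lambda>)"
  have c1: "0 < c1" using r0 pos d_pos by (simp add: c1_def)
  have h: "0 < h" by (rule good_cubeD(1)[OF good])
  \<comment> \<open>Rounding up gives sides of at most c1 \<epsilon>; once h >= c1 \<epsilon> it at
    most halves them.\<close>
  define q where "q n = nat \<lceil>h / (c1 * \<epsilon> n)\<rceil>" for n
  define s where "s n = h / real (q n)" for n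
  define cell where "cell n i = \<psi> ` cube (corner p (s n) i) (s n)" for n i
  have sq: "0 < q n \<Longrightarrow> s n * real (q n) = h" "0 < q n \<Longrightarrow> 0 < s n" for n
    using h by (auto simp: s_def)
  have cellsub: "cube (corner p (s n) i) (s n) \<subseteq> cube p h" "0 < s n" if "i \<in> grid (q n)" for n and i :: "'m \<Rightarrow> nat"
  proof -
    have "0 < q n" using that by (auto simp: grid_def)
    then show "cube (corner p (s n) i) (s n) \<subseteq> cube p h" "0 < s n" using subcube_subset[OF sq(2) that] sq[of n] by auto
  qed
  have gc: "good_cube M \<mu> \<psi> \<Lambda> c C (corner p (s n) i) (s n)" if "i \<in> grid (q n)" for n i
    using good_cube_subcube[OF good cellsub(2,1)[OF that]] .
  have small: "eventually (\<lambda>n. 0 < \<epsilon> n \<and> 0 < q n \<and> s n \<le> c1 * \<epsilon> n \<and> c1 * \<epsilon> n / 2 \<le> s n) sequentially"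
  proof -
    have "eventually (\<lambda>n. 0 < \<epsilon> n \<and> \<epsilon> n < h / c1) sequentially" using h c1 by (intro ev_eps_small) auto
    then show ?thesis
    proof eventually_elim
      case (elim n)
      define x where "x = h / (c1 * \<epsilon> n)"
      have x: "1 \<le> x" using elim c1 by (simp add: x_def field_simps)
      have q: "x \<le> real (q n)" "real (q n) \<le> 2 * x" "0 < q n"
        unfolding q_def x_def[symmetric] using x by (simp_all) linarith+
      have hx: "h = x * (c1 * \<epsilon> n)" using elim c1 by (simp add: x_def)
      have ce: "0 < c1 * \<epsilon> n" using elim c1 by simp
      have "s n \<le> c1 * \<epsilon> n" unfolding s_def hx using q ce by (simp add: pos_divide_le_eq mult_right_mono mult.commute)
      moreover have "c1 * \<epsilon> n / 2 \<le> s n"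
        unfolding s_def hx using q(2,3) ce mult_right_mono[OF q(2), of "c1 * \<epsilon> n"] by (simp add: pos_le_divide_eq field_simps)
      ultimately show ?case using elim q(3) by blast
    qed
  qed
  have "AE w in P. eventually (\<lambda>n. \<forall>B\<in>cell n ` grid (q n).
      \<bar>hits n B w - real n * measure \<mu> B\<bar> \<le> 1/2 * (real n * measure \<mu> B)) sequentially"
  proof (rule AE_hits_uniform[where b="\<lambda>n. c * (c1 * \<epsilon> n / 2) ^ d"])
    show "B \<in> sets borel" if "B \<in> cell n ` grid (q n)" for n B
      using that good_cubeD(4)[OF gc] by (auto simp: cell_def)
    show "eventually (\<lambda>n. card (cell n ` (grid (q n) :: ('m \<Rightarrow> nat) set)) \<le> n) sequentially"
      using small ev_scale_large[of "(2 * h / c1) ^ d"]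
    proof eventually_elim
      case (elim n)
      have "real (q n) = h / s n" using elim sq[of n] h by (simp add: s_def)
      also have "\<dots> \<le> h / (c1 * \<epsilon> n / 2)" using elim h c1 sq(2)[of n] by (intro divide_left_mono) auto
      also have "\<dots> = (2 * h / c1) / \<epsilon> n" by simp
      finally have "real (q n) ^ d \<le> ((2 * h / c1) / \<epsilon> n) ^ d" by (intro power_mono) auto
      also have "\<dots> = (2 * h / c1) ^ d / \<epsilon> n ^ d" by (rule power_divide)
      also have "\<dots> \<le> real n" using elim by (subst pos_divide_le_eq) auto
      finally have "q n ^ d \<le> n" by (metis of_nat_le_iff of_nat_power)
      moreover have "card (cell n ` (grid (q n) :: ('m \<Rightarrow> nat) set)) \<le> q n ^ d"
        using card_image_le[OF finite_grid, of "cell n" "q n"] by (simp add: card_grid d)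
      ultimately show ?case by simp
    qed
    show "eventually (\<lambda>n. \<forall>B\<in>cell n ` grid (q n). c * (c1 * \<epsilon> n / 2) ^ d \<le> measure \<mu> B) sequentially"
      using small
    proof eventually_elim
      case (elim n)
      have le: "c * (c1 * \<epsilon> n / 2) ^ d \<le> c * s n ^ d" using elim pos c1 by (intro mult_left_mono power_mono) auto
      show ?case
      proof
        fix B assume "B \<in> cell n ` grid (q n)"
        then show "c * (c1 * \<epsilon> n / 2) ^ d \<le> measure \<mu> B"
          using le good_cubeD(6)[OF gc] by (auto simp: cell_def d intro: order_trans)
      qed
    qed
    have "filterlim (\<lambda>n. (c * (c1 / 2) ^ d) * (real n * \<epsilon> n ^ d / ln (real n))) at_top sequentially"
      using c1 pos by (intro filterlim_tendsto_pos_mult_at_top[OF tendsto_const _ scale]) auto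
    moreover have "(c * (c1 / 2) ^ d) * (real n * \<epsilon> n ^ d / ln (real n)) = real n * (c * (c1 * \<epsilon> n / 2) ^ d) / ln (real n)" for n
      by (simp add: power_mult_distrib power_divide)
    ultimately show "filterlim (\<lambda>n. real n * (c * (c1 * \<epsilon> n / 2) ^ d) / ln (real n)) at_top sequentially"
      by (simp only:)
  qed auto
  with distinct show ?thesis
  proof eventually_elim
    case (elim w)
    note inj = elim(1)
    show ?case using elim(2) small eventually_gt_at_top[of 0]
    proof eventually_elim
      case (elim n)
      have n: "0 < real n" and en: "0 < \<epsilon> n" and q: "0 < q n" and s: "s n \<le> c1 * \<epsilon> n" "c1 * \<epsilon> n / 2 \<le> s n"
        using elim by auto
      have s0: "0 < s n" using sq(2)[OF q] .
      define W where "W i = V n w \<inter> cell n i" for i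
      have cnt: "real n * c * s n ^ d / 2 \<le> real (card (W i))" "real (card (W i)) \<le> 2 * real n * C * s n ^ d"
        if i: "i \<in> grid (q n)" for i
      proof -
        have "\<bar>real (card (W i)) - real n * measure \<mu> (cell n i)\<bar> \<le> 1/2 * (real n * measure \<mu> (cell n i))"
          using elim(1) i by (auto simp: hits_eq_card[OF inj] W_def)
        then have 1: "1/2 * (real n * measure \<mu> (cell n i)) \<le> real (card (W i))"
          "real (card (W i)) \<le> 2 * (real n * measure \<mu> (cell n i))"
          using mult_nonneg_nonneg[OF less_imp_le[OF n] measure_nonneg[of \<mu> "cell n i"]] by arith+
        have m: "c * s n ^ d \<le> measure \<mu> (cell n i)" "measure \<mu> (cell n i) \<le> C * s n ^ d"
          using good_cubeD(6,7)[OF gc[OF i]] by (auto simp: cell_def d)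
        have "real n * (c * s n ^ d) \<le> real n * measure \<mu> (cell n i)" "real n * measure \<mu> (cell n i) \<le> real n * (C * s n ^ d)"
          using m n by (auto intro!: mult_left_mono)
        with 1 show "real n * c * s n ^ d / 2 \<le> real (card (W i))" "real (card (W i)) \<le> 2 * real n * C * s n ^ d"
          by (simp_all add: mult_ac)
      qed
      have cover: "V n w \<inter> \<psi> ` cube p h = (\<Union>i\<in>grid (q n). W i)"
      proof -
        have "cube p h = (\<Union>i\<in>grid (q n). cube (corner p (s n) i) (s n))"
          using subcube_cover[OF s0, of p "q n"] sq(1)[OF q] by simp
        then show ?thesis by (auto simp: W_def cell_def)
      qed
      have near: "\<eta>1 \<le> \<eta> (norm (x - y) / \<epsilon> n)"
        if xy: "x \<in> W i" "y \<in> W j" and ij: "i \<in> grid (q n)" "j \<in> grid (q n)"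
          "\<And>l. real (i l) \<le> real (j l)" "\<And>l. real (j l) \<le> real (i l) + 1" for x y i j
      proof -
        obtain x' y' where x': "x' \<in> cube (corner p (s n) i) (s n)" "x = \<psi> x'" and y': "y' \<in> cube (corner p (s n) j) (s n)" "y = \<psi> y'"
          using xy by (auto simp: W_def cell_def)
        have "dist x y \<le> \<Lambda> * dist x' y'"
          using good_cubeD(3)[OF good] x' y' cellsub(1)[OF ij(1)] cellsub(1)[OF ij(2)] by blast
        also have "\<dots> \<le> \<Lambda> * (CARD('m) * (2 * s n))"
          using pos dist_neighbour_subcubes[OF x'(1) y'(1) s0 ij(3,4)] by (intro mult_left_mono) auto
        also have "\<dots> \<le> \<Lambda> * (CARD('m) * (2 * (c1 * \<epsilon> n)))" using pos s by (intro mult_left_mono) auto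
        also have "\<dots> = r0 * \<epsilon> n" using pos d_pos by (simp add: c1_def d field_simps)
        finally show ?thesis using en by (intro r0(3)) (auto simp: dist_norm pos_divide_le_eq)
      qed
      have Wsub: "W i \<subseteq> V n w" for i by (auto simp: W_def)
      let ?U = "V n w \<inter> \<psi> ` cube p h"
      let ?K = "2 / (real n * c * s n ^ d / 2) + 2 * (2 * real n * C * s n ^ d) / (real n * c * s n ^ d / 2)\<^sup>2 * 2 ^ CARD('m) * (real (q n))\<^sup>2 * CARD('m)"
      have dir0: "0 \<le> dirichlet \<eta> (\<epsilon> n) ?U f" for f
        unfolding dirichlet_def using en by (intro sum_nonneg mult_nonneg_nonneg kernel_nonneg[OF kernel]) auto
      have K: "?K / \<eta>1 \<le> poincare_const d \<Lambda> c C r0 \<eta>1 * h\<^sup>2 / (real n * \<epsilon> n ^ (d + 2))"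
      proof -
        define S where "S = real n * s n ^ d"
        have S: "0 < S" using n s0 by (simp add: S_def)
        have q1: "1 \<le> (real (q n))\<^sup>2" using q by simp
        have "?K = 4 / (c * S) + 16 * C / (c\<^sup>2 * S) * 2 ^ d * (real (q n))\<^sup>2 * d"
          using S pos by (simp add: S_def d power2_eq_square field_simps)
        \<comment> \<open>With q >= 1 the within-cell term is brought to the form q^2 / S as well,
          and q s = h turns q^2 into h^2 / s^2.\<close>
        also have "\<dots> \<le> 4 / (c * S) * (real (q n))\<^sup>2 + 16 * C / (c\<^sup>2 * S) * 2 ^ d * (real (q n))\<^sup>2 * d"
          using mult_left_mono[OF q1, of "4 / (c * S)"] S pos by simp
        also have "\<dots> = (4 / c + 16 * C * 2 ^ d * d / c\<^sup>2) * ((real (q n))\<^sup>2 / S)"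
          using S pos by (simp add: field_simps)
        also have "(real (q n))\<^sup>2 / S = h\<^sup>2 / (real n * s n ^ (d + 2))"
          using n s0 q h sq(1)[OF q, symmetric] by (simp add: S_def power_add power2_eq_square)
        also have "\<dots> \<le> h\<^sup>2 / (real n * (c1 * \<epsilon> n / 2) ^ (d + 2))"
          using n s s0 c1 en h by (intro divide_left_mono mult_left_mono power_mono) auto
        also have "\<dots> = (2 / c1) ^ (d + 2) * h\<^sup>2 / (real n * \<epsilon> n ^ (d + 2))"
          using c1 en n by (simp add: power_mult_distrib power_divide field_simps)
        also have "2 / c1 = 4 * d * \<Lambda> / r0" using r0 pos d_pos by (simp add: c1_def)
        finally have "?K \<le> (4 / c + 16 * C * 2 ^ d * d / c\<^sup>2) * ((4 * d * \<Lambda> / r0) ^ (d + 2) * h\<^sup>2 / (real n * \<epsilon> n ^ (d + 2)))"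
          using pos by (simp add: mult_left_mono)
        then have "?K / \<eta>1 \<le> (4 / c + 16 * C * 2 ^ d * d / c\<^sup>2) * ((4 * d * \<Lambda> / r0) ^ (d + 2) * h\<^sup>2 / (real n * \<epsilon> n ^ (d + 2))) / \<eta>1"
          using r0 by (intro divide_right_mono) auto
        also have "\<dots> = poincare_const d \<Lambda> c C r0 \<eta>1 * h\<^sup>2 / (real n * \<epsilon> n ^ (d + 2))"
          by (simp add: poincare_const_def mult_ac)
        finally show ?thesis .
      qed
      show ?case
      proof
        fix f :: "'a \<Rightarrow> real"
        have "\<exists>a. (\<Sum>x\<in>?U. (f x - a)\<^sup>2) \<le> ?K * ((\<Sum>x\<in>?U. \<Sum>y\<in>?U. \<eta> (norm (x - y) / \<epsilon> n) * (f x - f y)\<^sup>2) / \<eta>1)"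
        proof (rule cell_poincare[where W=W, OF _ _ cover cnt])
          show "W i \<inter> W j = {}" if "i \<in> grid (q n)" "j \<in> grid (q n)" "i \<noteq> j" for i j
          proof -
            have "cell n i \<inter> cell n j = \<psi> ` (cube (corner p (s n) i) (s n) \<inter> cube (corner p (s n) j) (s n))"
              unfolding cell_def using cellsub(1)[OF that(1)] cellsub(1)[OF that(2)]
              by (intro inj_on_image_Int[OF good_cubeD(2)[OF good], symmetric]) auto
            then show ?thesis using subcube_disjoint[OF s0 that(3)] by (auto simp: W_def)
          qed
          show "\<eta>1 \<le> \<eta> (norm (x - y) / \<epsilon> n)" if "i \<in> grid (q n)" "x \<in> W i" "y \<in> W i" for i x y
            using near that by auto
          show "\<eta>1 \<le> \<eta> (norm (x - y) / \<epsilon> n)"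
            if "i \<in> grid (q n)" "Suc (i k) < q n" "x \<in> W i" "y \<in> W (i(k := Suc (i k)))" for i k x y
            using that by (intro near[of x i y "i(k := Suc (i k))"]) (auto simp: grid_def)
        qed (use n pos s0 q r0 en in \<open>auto simp: W_def intro!: kernel_nonneg[OF kernel]\<close>)
        then obtain a where "(\<Sum>x\<in>?U. (f x - a)\<^sup>2) \<le> ?K / \<eta>1 * dirichlet \<eta> (\<epsilon> n) ?U f"
          by (auto simp: dirichlet_def)
        also have "\<dots> \<le> poincare_const d \<Lambda> c C r0 \<eta>1 * h\<^sup>2 / (real n * \<epsilon> n ^ (d + 2)) * dirichlet \<eta> (\<epsilon> n) ?U f"
          using K dir0 by (rule mult_right_mono)
        finally show "\<exists>a. (\<Sum>x\<in>?U. (f x - a)\<^sup>2) \<le>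
          poincare_const d \<Lambda> c C r0 \<eta>1 * h\<^sup>2 / (real n * \<epsilon> n ^ (d + 2)) * dirichlet \<eta> (\<epsilon> n) ?U f" by blast
      qed
    qed
  qed
qed

end

section \<open>Local asymptotics of the degree within a piece\<close>

lemma abs_diff_mult_leD:
  fixes m :: real
  assumes "\<bar>m - \<theta> * T\<bar> \<le> \<kappa> * T"
  shows "(\<theta> - \<kappa>) * T \<le> m" "m \<le> (\<theta> + \<kappa>) * T"
  using assms by (auto simp: abs_le_iff algebra_simps)

context sample_piece
begin

text \<open>The staircase turns the degree into finitely many ball counts, whose frequencies are
  close to \<theta> (R j \<epsilon>)^d near \<open>x0\<close>. The value \<open>D\<close> depends on
  the number of steps and thus on \<tau>; closeness up to \<tau> is claimed, not
  convergence.\<close>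

lemma AE_degree_local:
  assumes x0: "x0 \<in> M" and \<tau>: "0 < \<tau>"
  shows "\<exists>D s. 0 \<le> D \<and> 0 < s \<and>
    (AE w in P. eventually (\<lambda>n. \<forall>x\<in>M. dist x x0 < s \<longrightarrow> \<bar>deg n w x / \<epsilon> n ^ d - D\<bar> \<le> \<tau>) sequentially)"
proof -
  obtain \<theta> where \<theta>: "0 < \<theta>" "\<And>\<tau>. 0 < \<tau> \<Longrightarrow> \<exists>s>0. \<forall>x\<in>M. \<forall>t. dist x x0 < s \<longrightarrow> 0 < t \<longrightarrow> t < s \<longrightarrow>
        \<bar>measure \<mu> (M \<inter> ball x t) - \<theta> * t ^ d\<bar> \<le> \<tau> * t ^ d"
    using ball_density[OF x0] by blast
  have \<eta>0: "0 < \<eta> 0" using kernel by (rule kernel_pos)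
  \<comment> \<open>The lower staircase exceeds the kernel by at most one step h on the closed unit
    ball, which is counted within radius 2; so k is chosen to make h \<theta> 2^d smaller than
    \<tau>.\<close>
  obtain k :: nat where k: "\<eta> 0 * \<theta> * 2 ^ d / \<tau> < real k" using reals_Archimedean2 by blast
  have k0: "0 < k"
  proof -
    have "0 < \<eta> 0 * \<theta> * 2 ^ d / \<tau>" using \<eta>0 \<theta>(1) \<tau> by simp
    then show ?thesis using k by (auto intro: gr0I)
  qed
  define h where "h = \<eta> 0 / real k"
  have h: "0 < h" "h * \<theta> * 2 ^ d < \<tau>" using \<eta>0 k0 k \<tau> by (auto simp: h_def field_simps)
  obtain R where R: "\<And>j. j < k \<Longrightarrow> 0 < R j" "\<And>j. j < k \<Longrightarrow> R j \<le> 1"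
    "\<And>t. 0 \<le> t \<Longrightarrow> \<eta> t \<le> (\<Sum>j<k. if t \<le> R j then h else 0)"
    "\<And>t. 0 \<le> t \<Longrightarrow> (\<Sum>j<k. if t < R j then h else 0) \<le> \<eta> t + (if t \<le> 1 then h else 0)"
    using kernel_staircase[OF kernel k0] unfolding h_def by metis
  define D where "D = (\<Sum>j<k. h * (\<theta> * R j ^ d))"
  have D0: "0 \<le> D" unfolding D_def using h(1) \<theta>(1) R(1) by (intro sum_nonneg mult_nonneg_nonneg) (auto simp: less_imp_le)
  \<comment> \<open>\<kappa> is at once the relative error of the counts, the fattening of the radii
    and the error of the density. As it tends to 0, \<open>lo\<close> and \<open>up\<close> tend to
    D - h \<theta> 2^d and to D. Of the two \<kappa> added to a radius in \<open>up\<close>, one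
    passes from closed to open balls and one is the fattening in
    \<open>AE_ball_counts\<close>.\<close>
  define lo where "lo \<kappa> = (\<Sum>j<k. h * ((1 - \<kappa>) * ((\<theta> - \<kappa>) * (R j - \<kappa>) ^ d))) - h * ((1 + \<kappa>) * ((\<theta> + \<kappa>) * (2 + \<kappa>) ^ d))" for \<kappa>
  define up where "up \<kappa> = (\<Sum>j<k. h * ((1 + \<kappa>) * ((\<theta> + \<kappa>) * (R j + \<kappa> + \<kappa>) ^ d)))" for \<kappa>
  have "(lo \<longlongrightarrow> (\<Sum>j<k. h * ((1 - 0) * ((\<theta> - 0) * (R j - 0) ^ d))) - h * ((1 + 0) * ((\<theta> + 0) * (2 + 0) ^ d))) (at_right 0)"
    unfolding lo_def by (intro tendsto_intros)
  then have 1: "eventually (\<lambda>\<kappa>. D - \<tau> < lo \<kappa>) (at_right 0)"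
    using h(2) by (intro order_tendstoD(1)) (auto simp: D_def mult_ac)
  have "(up \<longlongrightarrow> (\<Sum>j<k. h * ((1 + 0) * ((\<theta> + 0) * (R j + 0 + 0) ^ d)))) (at_right 0)"
    unfolding up_def by (intro tendsto_intros)
  then have 2: "eventually (\<lambda>\<kappa>. up \<kappa> < D + \<tau>) (at_right 0)"
    using \<tau> by (intro order_tendstoD(2)) (auto simp: D_def)
  have 3: "eventually (\<lambda>\<kappa>. \<kappa> \<in> {0<..<min 1 \<theta>}) (at_right (0::real))"
    using \<theta>(1) by (intro eventually_at_right_real) simp
  have 4: "eventually (\<lambda>\<kappa>. \<forall>j\<in>{..<k}. \<kappa> \<in> {0<..<R j}) (at_right (0::real))"
    using R(1) by (intro eventually_ball_finite ballI eventually_at_right_real) auto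
  obtain \<kappa> where \<kappa>: "D - \<tau> < lo \<kappa>" "up \<kappa> < D + \<tau>" "0 < \<kappa>" "\<kappa> < 1" "\<kappa> < \<theta>" "\<And>j. j < k \<Longrightarrow> \<kappa> < R j"
    using eventually_happens'[OF _ eventually_conj[OF 1 eventually_conj[OF 2 eventually_conj[OF 3 4]]]] by auto
  obtain s where s: "0 < s" "\<And>x t. x \<in> M \<Longrightarrow> dist x x0 < s \<Longrightarrow> 0 < t \<Longrightarrow> t < s \<Longrightarrow>
        \<bar>measure \<mu> (M \<inter> ball x t) - \<theta> * t ^ d\<bar> \<le> \<kappa> * t ^ d"
    using \<theta>(2)[OF \<kappa>(3)] by blast
  define cnt where "cnt n w x r = real (card (V n w \<inter> (M \<inter> ball x (r * \<epsilon> n)))) / real n" for n w x r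
  have balls: "AE w in P. eventually (\<lambda>n. \<forall>x\<in>M. dist x x0 < s \<longrightarrow>
      (1 - \<kappa>) * ((\<theta> - \<kappa>) * (r - \<kappa>) ^ d) * \<epsilon> n ^ d \<le> cnt n w x r \<and>
      cnt n w x r \<le> (1 + \<kappa>) * ((\<theta> + \<kappa>) * (r + \<kappa>) ^ d) * \<epsilon> n ^ d) sequentially" if r: "\<kappa> < r" for r
  proof -
    have "AE w in P. eventually (\<lambda>n. \<forall>x\<in>M.
      (1 - \<kappa>) * measure \<mu> (M \<inter> ball x ((r - \<kappa>) * \<epsilon> n)) \<le> cnt n w x r \<and>
      cnt n w x r \<le> (1 + \<kappa>) * measure \<mu> (M \<inter> ball x ((r + \<kappa>) * \<epsilon> n))) sequentially"
      unfolding cnt_def using \<kappa> r by (intro AE_ball_counts) auto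
    then show ?thesis
    proof eventually_elim
      case (elim w)
      have rk: "0 < r + \<kappa>" using r \<kappa>(3) by simp
      then have "eventually (\<lambda>n. 0 < \<epsilon> n \<and> \<epsilon> n < s / (r + \<kappa>)) sequentially" using s(1) by (intro ev_eps_small) auto
      with elim show ?case
      proof eventually_elim
        case (elim n)
        have b: "(r + \<kappa>) * \<epsilon> n < s" using elim rk by (simp add: pos_less_divide_eq mult.commute)
        moreover have a: "(r - \<kappa>) * \<epsilon> n < (r + \<kappa>) * \<epsilon> n" using elim \<kappa>(3) by (intro mult_strict_right_mono) auto
        ultimately have a': "(r - \<kappa>) * \<epsilon> n < s" by linarith
        show ?case
        proof (intro ballI impI conjI)
          fix x assume x: "x \<in> M" "dist x x0 < s"
          have "(\<theta> - \<kappa>) * ((r - \<kappa>) * \<epsilon> n) ^ d \<le> measure \<mu> (M \<inter> ball x ((r - \<kappa>) * \<epsilon> n))"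
            using r elim by (intro abs_diff_mult_leD(1)[OF s(2)[OF x _ a']] mult_pos_pos) auto
          then have "(1 - \<kappa>) * ((\<theta> - \<kappa>) * ((r - \<kappa>) * \<epsilon> n) ^ d) \<le> (1 - \<kappa>) * measure \<mu> (M \<inter> ball x ((r - \<kappa>) * \<epsilon> n))"
            using \<kappa>(4) by (intro mult_left_mono) auto
          also have "\<dots> \<le> cnt n w x r" using elim x by blast
          finally show "(1 - \<kappa>) * ((\<theta> - \<kappa>) * (r - \<kappa>) ^ d) * \<epsilon> n ^ d \<le> cnt n w x r"
            by (simp add: power_mult_distrib mult_ac)
          have "measure \<mu> (M \<inter> ball x ((r + \<kappa>) * \<epsilon> n)) \<le> (\<theta> + \<kappa>) * ((r + \<kappa>) * \<epsilon> n) ^ d"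
            using rk elim by (intro abs_diff_mult_leD(2)[OF s(2)[OF x _ b]] mult_pos_pos) auto
          then have "(1 + \<kappa>) * measure \<mu> (M \<inter> ball x ((r + \<kappa>) * \<epsilon> n)) \<le> (1 + \<kappa>) * ((\<theta> + \<kappa>) * ((r + \<kappa>) * \<epsilon> n) ^ d)"
            using \<kappa>(3) by (intro mult_left_mono) auto
          moreover have "cnt n w x r \<le> (1 + \<kappa>) * measure \<mu> (M \<inter> ball x ((r + \<kappa>) * \<epsilon> n))" using elim x by blast
          ultimately show "cnt n w x r \<le> (1 + \<kappa>) * ((\<theta> + \<kappa>) * (r + \<kappa>) ^ d) * \<epsilon> n ^ d"
            by (simp add: power_mult_distrib mult_ac)
        qed
      qed
    qed
  qed
  have "AE w in P. \<forall>j\<in>{..<k}. eventually (\<lambda>n. \<forall>x\<in>M. dist x x0 < s \<longrightarrow>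
      (1 - \<kappa>) * ((\<theta> - \<kappa>) * (R j - \<kappa>) ^ d) * \<epsilon> n ^ d \<le> cnt n w x (R j)) sequentially"
  proof (rule AE_finite_allI)
    fix j assume "j \<in> {..<k}"
    then have "\<kappa> < R j" using \<kappa>(6) by simp
    from balls[OF this] show "AE w in P. eventually (\<lambda>n. \<forall>x\<in>M. dist x x0 < s \<longrightarrow>
      (1 - \<kappa>) * ((\<theta> - \<kappa>) * (R j - \<kappa>) ^ d) * \<epsilon> n ^ d \<le> cnt n w x (R j)) sequentially"
      by eventually_elim (auto elim!: eventually_mono)
  qed simp
  moreover have "AE w in P. \<forall>j\<in>{..<k}. eventually (\<lambda>n. \<forall>x\<in>M. dist x x0 < s \<longrightarrow>
      cnt n w x (R j + \<kappa>) \<le> (1 + \<kappa>) * ((\<theta> + \<kappa>) * (R j + \<kappa> + \<kappa>) ^ d) * \<epsilon> n ^ d) sequentially"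
  proof (rule AE_finite_allI)
    fix j assume "j \<in> {..<k}"
    then have "\<kappa> < R j + \<kappa>" using R(1) by simp
    from balls[OF this] show "AE w in P. eventually (\<lambda>n. \<forall>x\<in>M. dist x x0 < s \<longrightarrow>
      cnt n w x (R j + \<kappa>) \<le> (1 + \<kappa>) * ((\<theta> + \<kappa>) * (R j + \<kappa> + \<kappa>) ^ d) * \<epsilon> n ^ d) sequentially"
      by eventually_elim (auto elim!: eventually_mono)
  qed simp
  moreover have "AE w in P. eventually (\<lambda>n. \<forall>x\<in>M. dist x x0 < s \<longrightarrow>
      (1 - \<kappa>) * ((\<theta> - \<kappa>) * (2 - \<kappa>) ^ d) * \<epsilon> n ^ d \<le> cnt n w x 2 \<and>
      cnt n w x 2 \<le> (1 + \<kappa>) * ((\<theta> + \<kappa>) * (2 + \<kappa>) ^ d) * \<epsilon> n ^ d) sequentially"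
    using \<kappa>(4) by (intro balls) simp
  ultimately have "AE w in P. eventually (\<lambda>n. \<forall>x\<in>M. dist x x0 < s \<longrightarrow> \<bar>deg n w x / \<epsilon> n ^ d - D\<bar> \<le> \<tau>) sequentially"
  proof eventually_elim
    case (elim w)
    have e1: "eventually (\<lambda>n. \<forall>j\<in>{..<k}. \<forall>x\<in>M. dist x x0 < s \<longrightarrow>
      (1 - \<kappa>) * ((\<theta> - \<kappa>) * (R j - \<kappa>) ^ d) * \<epsilon> n ^ d \<le> cnt n w x (R j)) sequentially"
      using elim(1) by (intro eventually_ball_finite) auto
    have e2: "eventually (\<lambda>n. \<forall>j\<in>{..<k}. \<forall>x\<in>M. dist x x0 < s \<longrightarrow>
      cnt n w x (R j + \<kappa>) \<le> (1 + \<kappa>) * ((\<theta> + \<kappa>) * (R j + \<kappa> + \<kappa>) ^ d) * \<epsilon> n ^ d) sequentially"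
      using elim(2) by (intro eventually_ball_finite) auto
    show ?case using e1 e2 elim(3) eventually_gt_at_top[of 0]
    proof eventually_elim
      case (elim n)
      have n: "0 < n" "0 < \<epsilon> n" using elim eps_pos[of n] by auto
      show ?case
      proof (intro ballI impI)
        fix x assume x: "x \<in> M" "dist x x0 < s"
        let ?V = "V n w \<inter> M"
        let ?t = "\<lambda>y. norm (x - y) / \<epsilon> n"
        have t0: "0 \<le> ?t y" for y using n by simp
        have count: "(\<Sum>y\<in>?V. if Q y then h else 0) = h * real (card {y \<in> ?V. Q y})" for Q
          by (simp add: sum.If_cases Int_def)
        have card_le: "h * real (card A) / real n \<le> h * real (card B) / real n" if "A \<subseteq> B" "B \<subseteq> ?V" for A B
          using that h(1) finite_subset[OF that(2)] by (intro divide_right_mono mult_left_mono of_nat_mono card_mono) auto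
        have "deg n w x \<le> 1 / real n * (\<Sum>y\<in>?V. \<Sum>j<k. if ?t y \<le> R j then h else 0)"
          unfolding graph_degree_def using n by (intro mult_left_mono sum_mono R(3) t0) auto
        also have "\<dots> = (\<Sum>j<k. h * real (card {y \<in> ?V. ?t y \<le> R j}) / real n)"
          by (subst sum.swap) (simp add: count sum_divide_distrib)
        also have "\<dots> \<le> (\<Sum>j<k. h * real (card (V n w \<inter> (M \<inter> ball x ((R j + \<kappa>) * \<epsilon> n)))) / real n)"
        proof (intro sum_mono card_le subsetI)
          fix j y assume y: "y \<in> {y \<in> ?V. ?t y \<le> R j}"
          then have "norm (x - y) \<le> R j * \<epsilon> n" using n by (simp add: pos_divide_le_eq)
          moreover have "R j * \<epsilon> n < (R j + \<kappa>) * \<epsilon> n" using \<kappa>(3) n by (intro mult_strict_right_mono) auto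
          ultimately have "norm (x - y) < (R j + \<kappa>) * \<epsilon> n" by linarith
          then show "y \<in> V n w \<inter> (M \<inter> ball x ((R j + \<kappa>) * \<epsilon> n))" using y by (simp add: dist_norm)
        qed auto
        also have "\<dots> = (\<Sum>j<k. h * cnt n w x (R j + \<kappa>))" by (simp add: cnt_def)
        also have "\<dots> \<le> (\<Sum>j<k. h * ((1 + \<kappa>) * ((\<theta> + \<kappa>) * (R j + \<kappa> + \<kappa>) ^ d) * \<epsilon> n ^ d))"
          using h(1) elim(2) x by (intro sum_mono mult_left_mono) auto
        also have "\<dots> = up \<kappa> * \<epsilon> n ^ d" by (simp add: up_def sum_distrib_right mult.assoc)
        also have "\<dots> \<le> (D + \<tau>) * \<epsilon> n ^ d" using \<kappa>(2) n by (intro mult_right_mono) auto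
        finally have upper: "deg n w x \<le> (D + \<tau>) * \<epsilon> n ^ d" .
        have "(\<Sum>j<k. h * cnt n w x (R j)) = (\<Sum>j<k. h * real (card (V n w \<inter> (M \<inter> ball x (R j * \<epsilon> n)))) / real n)"
          by (simp add: cnt_def)
        also have "\<dots> \<le> (\<Sum>j<k. h * real (card {y \<in> ?V. ?t y < R j}) / real n)"
          using n by (intro sum_mono card_le subsetI) (auto simp: dist_norm pos_divide_less_eq)
        also have "\<dots> = 1 / real n * (\<Sum>j<k. \<Sum>y\<in>?V. if ?t y < R j then h else 0)"
          by (simp add: count sum_divide_distrib)
        also have "\<dots> = 1 / real n * (\<Sum>y\<in>?V. \<Sum>j<k. if ?t y < R j then h else 0)"
          by (subst sum.swap) (rule refl)
        also have "\<dots> \<le> 1 / real n * (\<Sum>y\<in>?V. \<eta> (?t y) + (if ?t y \<le> 1 then h else 0))"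
          using n by (intro mult_left_mono sum_mono R(4) t0) auto
        also have "\<dots> = deg n w x + h * real (card {y \<in> ?V. ?t y \<le> 1}) / real n"
          by (simp add: graph_degree_def sum.distrib count distrib_left)
        also have "h * real (card {y \<in> ?V. ?t y \<le> 1}) / real n \<le> h * real (card (V n w \<inter> (M \<inter> ball x (2 * \<epsilon> n)))) / real n"
          using n by (intro card_le subsetI) (auto simp: dist_norm pos_divide_le_eq)
        also have "\<dots> = h * cnt n w x 2" by (simp add: cnt_def)
        also have "\<dots> \<le> h * ((1 + \<kappa>) * ((\<theta> + \<kappa>) * (2 + \<kappa>) ^ d) * \<epsilon> n ^ d)"
          using h(1) elim(3) x by (intro mult_left_mono) auto
        finally have a: "(\<Sum>j<k. h * cnt n w x (R j)) \<le> deg n w x + h * ((1 + \<kappa>) * ((\<theta> + \<kappa>) * (2 + \<kappa>) ^ d) * \<epsilon> n ^ d)"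
          by simp
        have "(\<Sum>j<k. h * ((1 - \<kappa>) * ((\<theta> - \<kappa>) * (R j - \<kappa>) ^ d) * \<epsilon> n ^ d)) \<le> (\<Sum>j<k. h * cnt n w x (R j))"
          using h(1) elim(1) x by (intro sum_mono mult_left_mono) auto
        then have "(\<Sum>j<k. h * ((1 - \<kappa>) * ((\<theta> - \<kappa>) * (R j - \<kappa>) ^ d) * \<epsilon> n ^ d)) - h * ((1 + \<kappa>) * ((\<theta> + \<kappa>) * (2 + \<kappa>) ^ d) * \<epsilon> n ^ d) \<le> deg n w x"
          using a by linarith
        moreover have "(\<Sum>j<k. h * ((1 - \<kappa>) * ((\<theta> - \<kappa>) * (R j - \<kappa>) ^ d) * \<epsilon> n ^ d)) - h * ((1 + \<kappa>) * ((\<theta> + \<kappa>) * (2 + \<kappa>) ^ d) * \<epsilon> n ^ d) = lo \<kappa> * \<epsilon> n ^ d"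
          by (simp add: lo_def sum_distrib_right left_diff_distrib mult.assoc)
        moreover have "(D - \<tau>) * \<epsilon> n ^ d \<le> lo \<kappa> * \<epsilon> n ^ d" using \<kappa>(1) n by (intro mult_right_mono) auto
        ultimately have lower: "(D - \<tau>) * \<epsilon> n ^ d \<le> deg n w x" by linarith
        have "0 < \<epsilon> n ^ d" using n by simp
        then have "D - \<tau> \<le> deg n w x / \<epsilon> n ^ d" "deg n w x / \<epsilon> n ^ d \<le> D + \<tau>"
          using upper lower by (simp_all only: pos_divide_le_eq pos_le_divide_eq)
        then show "\<bar>deg n w x / \<epsilon> n ^ d - D\<bar> \<le> \<tau>" by (simp add: abs_le_iff)
      qed
    qed
  qed
  then show ?thesis using D0 s(1) by blast
qed

end

lemma disjoint_refinement:
  assumes "finite I" "\<And>i. i \<in> I \<Longrightarrow> G i \<in> sets (borel :: 'a::topological_space measure)"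
  shows "\<exists>G'. (\<forall>i\<in>I. G' i \<subseteq> G i \<and> G' i \<in> sets borel) \<and> disjoint_family_on G' I \<and> (\<Union>i\<in>I. G' i) = (\<Union>i\<in>I. G i)"
  using assms
proof (induction I)
  case empty
  then show ?case by (auto simp: disjoint_family_on_def)
next
  case (insert j I)
  then obtain G' where G': "\<forall>i\<in>I. G' i \<subseteq> G i \<and> G' i \<in> sets borel" "disjoint_family_on G' I" "(\<Union>i\<in>I. G' i) = (\<Union>i\<in>I. G i)"
    by auto
  define H where "H = G'(j := G j - (\<Union>i\<in>I. G' i))"
  have HI: "H i = G' i" if "i \<in> I" for i using that insert by (auto simp: H_def)
  have Hj: "H j = G j - (\<Union>i\<in>I. G' i)" by (simp add: H_def)
  have "\<forall>i\<in>insert j I. H i \<subseteq> G i \<and> H i \<in> sets borel"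
    using G'(1) insert Hj HI by (auto intro!: sets.Diff sets.finite_UN)
  moreover have "disjoint_family_on H (insert j I)"
    using G'(2) HI Hj unfolding disjoint_family_on_def by (auto; blast)
  moreover have "(\<Union>i\<in>insert j I. H i) = (\<Union>i\<in>insert j I. G i)"
  proof -
    have "(\<Union>i\<in>I. H i) = (\<Union>i\<in>I. G i)" using HI G'(3) by simp
    then show ?thesis using Hj G'(3) by auto
  qed
  ultimately show ?case by blast
qed

section \<open>Piecewise constant approximation on one piece\<close>

lemma dirichlet_nonneg:
  assumes "admissible_kernel \<eta>" "0 < e"
  shows "0 \<le> dirichlet \<eta> e U f"
proof -
  have "0 \<le> \<eta> (norm (x - y) / e) * (f x - f y)\<^sup>2" for x y
    using assms(2) kernel_nonneg[OF assms(1), of "norm (x - y) / e"] by simp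
  then show ?thesis unfolding dirichlet_def by (simp add: sum_nonneg)
qed

lemma sum_dirichlet_le:
  assumes "admissible_kernel \<eta>" "0 < e" "finite U" "finite I"
    and "\<And>i. i \<in> I \<Longrightarrow> A i \<subseteq> U" "disjoint_family_on A I"
  shows "(\<Sum>i\<in>I. dirichlet \<eta> e (A i) f) \<le> dirichlet \<eta> e U f"
proof -
  have nn: "0 \<le> \<eta> (norm (x - y) / e) * (f x - f y)\<^sup>2" for x y
    using assms(2) kernel_nonneg[OF assms(1), of "norm (x - y) / e"] by simp
  have fin: "finite (A i)" if "i \<in> I" for i using assms(5)[OF that] assms(3) finite_subset by blast
  have "(\<Sum>i\<in>I. dirichlet \<eta> e (A i) f) \<le> (\<Sum>i\<in>I. \<Sum>x\<in>A i. \<Sum>y\<in>U. \<eta> (norm (x - y) / e) * (f x - f y)\<^sup>2)"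
    unfolding dirichlet_def using assms(3,5) nn by (intro sum_mono sum_mono2) auto
  also have "\<dots> = (\<Sum>x\<in>(\<Union>i\<in>I. A i). \<Sum>y\<in>U. \<eta> (norm (x - y) / e) * (f x - f y)\<^sup>2)"
    using assms(4,6) fin by (intro sum.UNION_disjoint[symmetric]) (auto simp: disjoint_family_on_def)
  also have "\<dots> \<le> dirichlet \<eta> e U f"
    unfolding dirichlet_def using assms(3,5) nn by (intro sum_mono2 sum_nonneg) auto
  finally show ?thesis .
qed

lemma real_sqrt_diff_sq_le:
  assumes "0 \<le> a" "0 \<le> b"
  shows "(sqrt a - sqrt b)\<^sup>2 \<le> \<bar>a - b\<bar>"
proof -
  have "a - b = (sqrt a - sqrt b) * (sqrt a + sqrt b)"
    using assms by (simp add: algebra_simps)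
  then have "\<bar>a - b\<bar> = \<bar>sqrt a - sqrt b\<bar> * (sqrt a + sqrt b)"
    using assms by (simp add: abs_mult)
  moreover have "\<bar>sqrt a - sqrt b\<bar> * \<bar>sqrt a - sqrt b\<bar> \<le> \<bar>sqrt a - sqrt b\<bar> * (sqrt a + sqrt b)"
    using assms by (intro mult_left_mono) (auto simp: abs_le_iff)
  ultimately show ?thesis by (simp add: power2_eq_square)
qed

text \<open>Two errors are separated: replacing the weight s by t, which costs the relative error
  \<delta> on y^2 s, and replacing y by c, which costs the squared difference times the bound on the
  weight.\<close>

lemma sqrt_weight_approx:
  fixes s t \<delta> B y c :: real
  assumes "0 \<le> s" "0 \<le> t" "\<bar>s - t\<bar> \<le> \<delta> * s" "t \<le> B"
  shows "(y * sqrt s - c * sqrt t)\<^sup>2 \<le> 2 * \<delta> * (y\<^sup>2 * s) + 2 * B * (y - c)\<^sup>2"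
proof -
  have "(y * sqrt s - c * sqrt t)\<^sup>2 = (y * (sqrt s - sqrt t) + sqrt t * (y - c))\<^sup>2"
    by (simp add: algebra_simps)
  also have "\<dots> \<le> 2 * (y * (sqrt s - sqrt t))\<^sup>2 + 2 * (sqrt t * (y - c))\<^sup>2"
    by (rule sq_add_le)
  also have "\<dots> = 2 * (y\<^sup>2 * (sqrt s - sqrt t)\<^sup>2) + 2 * (t * (y - c)\<^sup>2)"
    using assms(2) by (simp add: power_mult_distrib)
  also have "\<dots> \<le> 2 * (y\<^sup>2 * (\<delta> * s)) + 2 * (B * (y - c)\<^sup>2)"
    using real_sqrt_diff_sq_le[OF assms(1,2)] assms(3,4)
    by (intro add_mono mult_left_mono mult_right_mono) auto
  finally show ?thesis by (simp add: mult_ac)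
qed

text \<open>The lower bound c e <= a converts an absolute error of a / e into a relative error of
  a.\<close>

lemma scaled_close:
  fixes e c C a D \<tau> :: real
  assumes "0 < e" "0 < c" "\<bar>a / e - D\<bar> \<le> \<tau>" "c * e \<le> a" "a \<le> C * e" "0 \<le> \<tau>" "\<tau> \<le> 1"
  shows "\<bar>a - e * D\<bar> \<le> \<tau> / c * a" "e * D \<le> e * (C + 1)" "0 \<le> a"
proof -
  have "a / e \<le> C" using assms(1,5) by (simp only: pos_divide_le_eq)
  then have "D \<le> C + 1" using assms(3,7) unfolding abs_le_iff by linarith
  then show "e * D \<le> e * (C + 1)" using assms(1) by (intro mult_left_mono) simp_all
  have "0 < c * e" by (rule mult_pos_pos[OF assms(2,1)])
  then show "0 \<le> a" using assms(4) by linarith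
  have "a - e * D = e * (a / e - D)" using assms(1) by (simp add: right_diff_distrib)
  then have "\<bar>a - e * D\<bar> = e * \<bar>a / e - D\<bar>" using assms(1) by (simp only: abs_mult abs_of_pos)
  also have "\<dots> \<le> e * \<tau>" using assms(1,3) by (intro mult_left_mono) simp_all
  also have "\<dots> = \<tau> / c * (c * e)" using assms(2) by simp
  also have "\<dots> \<le> \<tau> / c * a" using assms(2,4,6) by (intro mult_left_mono) simp_all
  finally show "\<bar>a - e * D\<bar> \<le> \<tau> / c * a" .
qed

text \<open>The \<epsilon>^d of the degree cancels the \<epsilon>^d of the Poincare bound, and what
  remains is the normalisation of the energy.\<close>

lemma cancel_scale:
  fixes e n k C T X :: real
  assumes "0 < e" "0 < n"
  shows "2 * (e ^ d * (C + 1)) * (T / (k * k) / (n * e ^ (d + 2)) * X) = 2 * (C + 1) * T / (k * k) * (1 / (n * e\<^sup>2) * X)"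
proof -
  have "2 * (a * c) * (T / q / (n * (a * b)) * X) = 2 * c * T / q * (1 / (n * b) * X)" if "a \<noteq> 0" for a b c q :: real
    using that by (simp add: mult_ac)
  moreover have "e ^ d \<noteq> 0" using assms by simp
  ultimately show ?thesis unfolding power_add by blast
qed

lemma sum_scaled_squares:
  fixes p h :: "'i \<Rightarrow> real" and k Y X :: real
  shows "(\<Sum>l\<in>F. p l * (h l / k)\<^sup>2 / Y * X) = (\<Sum>l\<in>F. p l * (h l)\<^sup>2) / (k * k) / Y * X"
  unfolding sum_divide_distrib sum_distrib_right by (simp add: power_divide power2_eq_square)

text \<open>On the i-th cell the approximating function is the constant a(i) sqrt (t(i)), a typical
  value of \<open>f\<close> times the root of the asymptotic degree. The sets \<open>A i\<close> may
  be larger than the cells: the Poincare inequality holds on images of cubes, while the cells are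
  arbitrary Borel pieces of them.\<close>

lemma piecewise_constant_approx:
  fixes f s :: "'a::euclidean_space \<Rightarrow> real" and a q t :: "'i \<Rightarrow> real"
  assumes fin: "finite I" "finite U" and cover: "(\<Union>i\<in>I. G i) = M" "U \<subseteq> M" and disj: "disjoint_family_on G I"
    and A: "\<And>i. i \<in> I \<Longrightarrow> U \<inter> G i \<subseteq> A i" "\<And>i. i \<in> I \<Longrightarrow> finite (A i)"
    and mean: "\<And>i. i \<in> I \<Longrightarrow> (\<Sum>x\<in>A i. (f x - a i)\<^sup>2) \<le> q i"
    and close: "\<And>i x. i \<in> I \<Longrightarrow> x \<in> U \<inter> G i \<Longrightarrow> 0 \<le> s x \<and> \<bar>s x - t i\<bar> \<le> \<delta> * s x"
    and t: "\<And>i. i \<in> I \<Longrightarrow> 0 \<le> t i" and tB: "\<And>i x. i \<in> I \<Longrightarrow> x \<in> U \<inter> G i \<Longrightarrow> t i \<le> B" and B: "0 \<le> B"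
  shows "\<exists>g. (\<forall>K\<in>G ` I. \<forall>x\<in>K. \<forall>y\<in>K. g x = g y) \<and>
    (\<Sum>x\<in>U. (f x * sqrt (s x) - g x)\<^sup>2) \<le> 2 * \<delta> * (\<Sum>x\<in>U. (f x)\<^sup>2 * s x) + 2 * B * (\<Sum>i\<in>I. q i)"
proof -
  define g where "g x = (let i = SOME i. i \<in> I \<and> x \<in> G i in a i * sqrt (t i))" for x
  have g: "g x = a i * sqrt (t i)" if "i \<in> I" "x \<in> G i" for x i
  proof -
    have "(SOME i. i \<in> I \<and> x \<in> G i) = i"
      using that disj by (intro some_equality) (auto simp: disjoint_family_on_def)
    then show ?thesis by (simp add: g_def)
  qed
  have U_eq: "U = (\<Union>i\<in>I. U \<inter> G i)" using cover by blast
  have sumU: "sum H U = (\<Sum>i\<in>I. \<Sum>x\<in>U \<inter> G i. H x)" for H :: "'a \<Rightarrow> real"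
    by (subst U_eq, rule sum.UNION_disjoint) (use fin disj in \<open>auto simp: disjoint_family_on_def\<close>)
  have "(\<Sum>x\<in>U. (f x * sqrt (s x) - g x)\<^sup>2) = (\<Sum>i\<in>I. \<Sum>x\<in>U \<inter> G i. (f x * sqrt (s x) - g x)\<^sup>2)"
    by (rule sumU)
  also have "\<dots> \<le> (\<Sum>i\<in>I. \<Sum>x\<in>U \<inter> G i. 2 * \<delta> * ((f x)\<^sup>2 * s x) + 2 * B * (f x - a i)\<^sup>2)"
  proof (intro sum_mono)
    fix i x assume ix: "i \<in> I" "x \<in> U \<inter> G i"
    then have "g x = a i * sqrt (t i)" using g by blast
    then show "(f x * sqrt (s x) - g x)\<^sup>2 \<le> 2 * \<delta> * ((f x)\<^sup>2 * s x) + 2 * B * (f x - a i)\<^sup>2"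
      using sqrt_weight_approx[of "s x" "t i" \<delta> B "f x" "a i"] close[OF ix] t[OF ix(1)] tB[OF ix] by (simp only:)
  qed
  also have "\<dots> = 2 * \<delta> * (\<Sum>x\<in>U. (f x)\<^sup>2 * s x) + 2 * B * (\<Sum>i\<in>I. \<Sum>x\<in>U \<inter> G i. (f x - a i)\<^sup>2)"
    unfolding sumU by (simp add: sum.distrib sum_distrib_left)
  also have "\<dots> \<le> 2 * \<delta> * (\<Sum>x\<in>U. (f x)\<^sup>2 * s x) + 2 * B * (\<Sum>i\<in>I. q i)"
  proof (intro add_left_mono mult_left_mono sum_mono)
    fix i assume i: "i \<in> I"
    have "(\<Sum>x\<in>U \<inter> G i. (f x - a i)\<^sup>2) \<le> (\<Sum>x\<in>A i. (f x - a i)\<^sup>2)"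
      using A[OF i] by (intro sum_mono2) auto
    then show "(\<Sum>x\<in>U \<inter> G i. (f x - a i)\<^sup>2) \<le> q i" using mean[OF i] by linarith
  qed (use B in simp)
  finally have "(\<Sum>x\<in>U. (f x * sqrt (s x) - g x)\<^sup>2) \<le> 2 * \<delta> * (\<Sum>x\<in>U. (f x)\<^sup>2 * s x) + 2 * B * (\<Sum>i\<in>I. q i)" .
  moreover have "\<forall>K\<in>G ` I. \<forall>x\<in>K. \<forall>y\<in>K. g x = g y" using g by auto
  ultimately show ?thesis by blast
qed

context sample_piece
begin

text \<open>Two scales are decoupled. Around each of finitely many centres the degree is nearly
  constant; then every chart cube is cut into \<kappa>^d subcubes, which divides the Poincare bound
  by \<kappa>^2. The number of subcubes does not enter, because within one chart their Dirichlet
  sums add up to at most the whole.\<close>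

lemma AE_approx:
  assumes cubes: "\<And>x0. x0 \<in> M \<Longrightarrow> \<exists>(\<psi> :: real^'m \<Rightarrow> 'a) \<Lambda> c C p h s.
      0 < \<Lambda> \<and> 0 < c \<and> 0 < C \<and> good_cube M \<mu> \<psi> \<Lambda> c C p h \<and>
      0 < s \<and> (\<forall>x\<in>M. dist x x0 < s \<longrightarrow> x \<in> \<psi> ` cube p h)"
    and d: "d = CARD('m)" and \<tau>: "0 < \<tau>"
  shows "\<exists>\<K>. finite \<K> \<and> disjoint \<K> \<and> \<K> \<subseteq> sets borel \<and> \<Union>\<K> = M \<and>
    (\<forall>K\<in>\<K>. \<forall>x\<in>K. \<forall>y\<in>K. dist x y \<le> \<tau>) \<and>
    (AE w in P. eventually (\<lambda>n. \<forall>f. \<exists>g. (\<forall>K\<in>\<K>. \<forall>x\<in>K. \<forall>y\<in>K. g x = g y) \<and>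
      (\<Sum>x\<in>V n w \<inter> M. (f x * sqrt (deg n w x) - g x)\<^sup>2) \<le>
        \<tau> * (1 / (real n * (\<epsilon> n)\<^sup>2) * dirichlet \<eta> (\<epsilon> n) (V n w \<inter> M) f + (\<Sum>x\<in>V n w \<inter> M. (f x)\<^sup>2 * deg n w x))) sequentially)"
proof -
  obtain r0 \<eta>1 where r0: "0 < r0" "r0 \<le> 1" "0 < \<eta>1" "\<And>t. 0 \<le> t \<Longrightarrow> t \<le> r0 \<Longrightarrow> \<eta>1 \<le> \<eta> t"
    using kernel_lower_near_0[OF kernel] by metis
  obtain Cu where Cu: "0 < Cu" and AE_up: "AE w in P. eventually (\<lambda>n. \<forall>x. deg n w x \<le> Cu * \<epsilon> n ^ d) sequentially"
    by (rule AE_degree_upper)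
  obtain cl where cl: "0 < cl" and AE_lo: "AE w in P. eventually (\<lambda>n. \<forall>x\<in>M. cl * \<epsilon> n ^ d \<le> deg n w x) sequentially"
    by (rule AE_degree_lower)
  \<comment> \<open>An absolute error \<tau>1 of the degree over \<epsilon>^d is a relative error
    \<tau>1 / cl, which enters the squared error with the factor 2.\<close>
  define \<tau>1 where "\<tau>1 = min 1 (\<tau> * cl / 2)"
  have \<tau>1: "0 < \<tau>1" "\<tau>1 \<le> 1" "2 * \<tau>1 / cl \<le> \<tau>"
  proof -
    show "0 < \<tau>1" "\<tau>1 \<le> 1" using \<tau> cl by (simp_all add: \<tau>1_def)
    have "2 * \<tau>1 \<le> \<tau> * cl" by (simp add: \<tau>1_def)
    then show "2 * \<tau>1 / cl \<le> \<tau>" using cl by (simp only: pos_divide_le_eq)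
  qed
  have "\<forall>x0\<in>M. \<exists>(\<psi> :: real^'m \<Rightarrow> 'a) \<Lambda> c C p h s1.
      0 < \<Lambda> \<and> 0 < c \<and> 0 < C \<and> good_cube M \<mu> \<psi> \<Lambda> c C p h \<and>
      0 < s1 \<and> (\<forall>x\<in>M. dist x x0 < s1 \<longrightarrow> x \<in> \<psi> ` cube p h)"
    by (rule ballI, rule cubes)
  then have "\<exists>(\<psi> :: 'a \<Rightarrow> real^'m \<Rightarrow> 'a) \<Lambda> c C p h s1. \<forall>x0\<in>M.
      0 < \<Lambda> x0 \<and> 0 < c x0 \<and> 0 < C x0 \<and> good_cube M \<mu> (\<psi> x0) (\<Lambda> x0) (c x0) (C x0) (p x0) (h x0) \<and>
      0 < s1 x0 \<and> (\<forall>x\<in>M. dist x x0 < s1 x0 \<longrightarrow> x \<in> \<psi> x0 ` cube (p x0) (h x0))"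
    unfolding bchoice_iff .
  then obtain \<psi> :: "'a \<Rightarrow> real^'m \<Rightarrow> 'a" and \<Lambda> c C p h s1 where chart: "\<forall>x0\<in>M.
      0 < \<Lambda> x0 \<and> 0 < c x0 \<and> 0 < C x0 \<and> good_cube M \<mu> (\<psi> x0) (\<Lambda> x0) (c x0) (C x0) (p x0) (h x0) \<and>
      0 < s1 x0 \<and> (\<forall>x\<in>M. dist x x0 < s1 x0 \<longrightarrow> x \<in> \<psi> x0 ` cube (p x0) (h x0))"
    by (elim exE)
  note chart = chart[THEN bspec]
  have "\<forall>x0\<in>M. \<exists>D s2. 0 \<le> D \<and> 0 < s2 \<and>
    (AE w in P. eventually (\<lambda>n. \<forall>x\<in>M. dist x x0 < s2 \<longrightarrow> \<bar>deg n w x / \<epsilon> n ^ d - D\<bar> \<le> \<tau>1) sequentially)"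
    using AE_degree_local[OF _ \<tau>1(1)] by (intro ballI)
  then have "\<exists>D s2. \<forall>x0\<in>M. 0 \<le> D x0 \<and> 0 < s2 x0 \<and>
    (AE w in P. eventually (\<lambda>n. \<forall>x\<in>M. dist x x0 < s2 x0 \<longrightarrow> \<bar>deg n w x / \<epsilon> n ^ d - D x0\<bar> \<le> \<tau>1) sequentially)"
    unfolding bchoice_iff .
  then obtain D s2 where loc: "\<forall>x0\<in>M. 0 \<le> D x0 \<and> 0 < s2 x0 \<and>
    (AE w in P. eventually (\<lambda>n. \<forall>x\<in>M. dist x x0 < s2 x0 \<longrightarrow> \<bar>deg n w x / \<epsilon> n ^ d - D x0\<bar> \<le> \<tau>1) sequentially)"
    by (elim exE)
  note loc = loc[THEN bspec]
  define s where "s x0 = min (s1 x0) (s2 x0)" for x0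
  have s1: "0 < s1 l" and s2: "0 < s2 l" if "l \<in> M" for l
    using chart[OF that] loc[OF that] by (simp_all only:)
  have s: "0 < s l" if "l \<in> M" for l using s1[OF that] s2[OF that] by (simp add: s_def)
  have chartM: "0 < \<Lambda> l" "0 < c l" "0 < C l" "good_cube M \<mu> (\<psi> l) (\<Lambda> l) (c l) (C l) (p l) (h l)" if "l \<in> M" for l
    using chart[OF that] by (simp_all only:)
  have chart5: "x \<in> \<psi> l ` cube (p l) (h l)" if "l \<in> M" "x \<in> M" "dist x l < s l" for l x
  proof -
    have "\<forall>x\<in>M. dist x l < s1 l \<longrightarrow> x \<in> \<psi> l ` cube (p l) (h l)" using chart[OF that(1)] by (elim conjE)
    moreover have "dist x l < s1 l" using that(3) by (simp add: s_def)
    ultimately show ?thesis using that(2) by blast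
  qed
  have "M \<subseteq> (\<Union>x\<in>M. ball x (s x))"
  proof
    fix x assume x: "x \<in> M"
    then have "x \<in> ball x (s x)" using s by simp
    then show "x \<in> (\<Union>x\<in>M. ball x (s x))" using x by blast
  qed
  then obtain F where F: "F \<subseteq> M" "finite F" "M \<subseteq> (\<Union>x\<in>F. ball x (s x))"
    using compactE_image[OF compact_M, of M "\<lambda>x. ball x (s x)"] by auto
  define pc where "pc l = poincare_const d (\<Lambda> l) (c l) (C l) r0 \<eta>1" for l
  have pc0: "0 \<le> pc l" if "l \<in> F" for l
  proof -
    have "l \<in> M" using F(1) that by blast
    then show ?thesis using chartM(1-3)[of l] r0(1-3) unfolding pc_def poincare_const_def
      by (intro mult_nonneg_nonneg divide_nonneg_pos add_nonneg_nonneg zero_le_power) (auto simp: less_imp_le)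
  qed
  define T where "T = (\<Sum>l\<in>F. pc l * (h l)\<^sup>2)"
  have T0: "0 \<le> T" unfolding T_def using pc0 by (intro sum_nonneg) auto
  \<comment> \<open>The three summands make \<kappa> large enough for the Poincare error, for the
    diameter of the cells and for \<kappa> >= 1.\<close>
  define b where "b = 2 * (Cu + 1) * T / \<tau> + (\<Sum>l\<in>F. \<Lambda> l * (d * h l)) / \<tau> + 1"
  have FM: "l \<in> M" if "l \<in> F" for l using F(1) that by blast
  note chartF = chartM[OF FM]
  have h0: "0 < h l" if "l \<in> F" for l using good_cubeD(1)[OF chartF(4)[OF that]] .
  have Lh: "0 \<le> \<Lambda> l * (d * h l)" if "l \<in> F" for l
    using chartF(1)[OF that] h0[OF that] by simp
  obtain \<kappa> :: nat where \<kappa>b: "b \<le> real \<kappa>" using real_arch_simple by blast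
  have sumLh: "0 \<le> (\<Sum>l\<in>F. \<Lambda> l * (d * h l))" using Lh by (intro sum_nonneg) auto
  have \<kappa>: "1 \<le> real \<kappa>" "2 * (Cu + 1) * T / \<tau> \<le> real \<kappa>" "(\<Sum>l\<in>F. \<Lambda> l * (d * h l)) / \<tau> \<le> real \<kappa>"
  proof -
    have "0 \<le> 2 * (Cu + 1) * T / \<tau>" "0 \<le> (\<Sum>l\<in>F. \<Lambda> l * (d * h l)) / \<tau>"
      using Cu T0 \<tau> sumLh by auto
    then show "1 \<le> real \<kappa>" "2 * (Cu + 1) * T / \<tau> \<le> real \<kappa>" "(\<Sum>l\<in>F. \<Lambda> l * (d * h l)) / \<tau> \<le> real \<kappa>"
      using \<kappa>b unfolding b_def by linarith+
  qed
  define hk where "hk l = h l / real \<kappa>" for l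
  define sub where "sub l i = cube (corner (p l) (hk l) i) (hk l)" for l i
  define I where "I = F \<times> (grid \<kappa> :: ('m \<Rightarrow> nat) set)"
  have finI: "finite I" using F(2) by (simp add: I_def)
  have hk: "0 < hk l" "hk l * real \<kappa> = h l" if "l \<in> F" for l
    using h0[OF that] \<kappa>(1) by (auto simp: hk_def)
  have sub_cube: "sub l i \<subseteq> cube (p l) (h l)" if "(l, i) \<in> I" for l i
    using subcube_subset[of "hk l" i \<kappa> "p l"] hk[of l] that by (auto simp: sub_def I_def)
  have gsub: "good_cube M \<mu> (\<psi> l) (\<Lambda> l) (c l) (C l) (corner (p l) (hk l) i) (hk l)" if li: "(l, i) \<in> I" for l i
  proof -
    have l: "l \<in> F" using li by (simp add: I_def)
    show ?thesis by (rule good_cube_subcube[OF chartF(4)[OF l] hk(1)[OF l] sub_cube[OF li, unfolded sub_def]])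
  qed
  \<comment> \<open>The ball confines the cell to the region where the degree estimate of this
    centre holds; the Poincare inequality is used on the whole image of the subcube.\<close>
  define G where "G li = \<psi> (fst li) ` sub (fst li) (snd li) \<inter> ball (fst li) (s (fst li))" for li
  have Gb: "G li \<in> sets borel" and GM: "G li \<subseteq> M" if li: "li \<in> I" for li
  proof -
    have "(fst li, snd li) \<in> I" using li by simp
    note gg = gsub[OF this]
    show "G li \<in> sets borel" using good_cubeD(4)[OF gg] by (simp add: G_def sub_def)
    show "G li \<subseteq> M" using good_cubeD(5)[OF gg] by (auto simp: G_def sub_def)
  qed
  have Gcover: "M \<subseteq> (\<Union>li\<in>I. G li)"
  proof
    fix x assume x: "x \<in> M"
    then obtain l where l: "l \<in> F" "dist x l < s l" using F(3) by (auto simp: dist_commute)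
    obtain y where y: "y \<in> cube (p l) (h l)" "x = \<psi> l y" using chart5[OF FM[OF l(1)] x l(2)] by blast
    obtain i where i: "i \<in> grid \<kappa>" "y \<in> sub l i"
      using y(1) subcube_cover[OF hk(1)[OF l(1)], of "p l" \<kappa>] hk(2)[OF l(1)] by (auto simp: sub_def)
    have "x \<in> G (l, i)" using y(2) i(2) l(2) by (auto simp: G_def dist_commute)
    moreover have "(l, i) \<in> I" using l(1) i(1) by (simp add: I_def)
    ultimately show "x \<in> (\<Union>li\<in>I. G li)" by blast
  qed
  \<comment> \<open>Cells of different charts overlap. Once made disjoint they have no particular
    shape, but they stay inside the images of the subcubes.\<close>
  have "\<exists>G'. (\<forall>i\<in>I. G' i \<subseteq> G i \<and> G' i \<in> sets borel) \<and> disjoint_family_on G' I \<and> (\<Union>i\<in>I. G' i) = (\<Union>i\<in>I. G i)"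
    by (rule disjoint_refinement[OF finI Gb])
  then obtain G' where "\<forall>i\<in>I. G' i \<subseteq> G i \<and> G' i \<in> sets borel" and G'34: "disjoint_family_on G' I" "(\<Union>i\<in>I. G' i) = (\<Union>i\<in>I. G i)"
    by (elim exE conjE)
  then have G': "\<And>li. li \<in> I \<Longrightarrow> G' li \<subseteq> G li" "\<And>li. li \<in> I \<Longrightarrow> G' li \<in> sets borel"
    "disjoint_family_on G' I" "(\<Union>li\<in>I. G' li) = (\<Union>li\<in>I. G li)"
    by simp_all
  have G'M: "(\<Union>li\<in>I. G' li) = M" unfolding G'(4)
    by (intro subset_antisym UN_least Gcover GM)
  define \<K> where "\<K> = G' ` I"
  have AE_poinc: "AE w in P. \<forall>li\<in>I. eventually (\<lambda>n. \<forall>f. \<exists>a. (\<Sum>x\<in>V n w \<inter> \<psi> (fst li) ` sub (fst li) (snd li). (f x - a)\<^sup>2) \<le>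
     pc (fst li) * (hk (fst li))\<^sup>2 / (real n * \<epsilon> n ^ (d + 2)) * dirichlet \<eta> (\<epsilon> n) (V n w \<inter> \<psi> (fst li) ` sub (fst li) (snd li)) f) sequentially"
  proof (rule AE_finite_allI[OF finI])
    fix li assume li: "li \<in> I"
    obtain l i where eq: "li = (l, i)" by (cases li)
    have l: "l \<in> F" using li eq by (simp add: I_def)
    show "AE w in P. eventually (\<lambda>n. \<forall>f. \<exists>a. (\<Sum>x\<in>V n w \<inter> \<psi> (fst li) ` sub (fst li) (snd li). (f x - a)\<^sup>2) \<le>
     pc (fst li) * (hk (fst li))\<^sup>2 / (real n * \<epsilon> n ^ (d + 2)) * dirichlet \<eta> (\<epsilon> n) (V n w \<inter> \<psi> (fst li) ` sub (fst li) (snd li)) f) sequentially"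
      unfolding eq fst_conv snd_conv sub_def pc_def
      by (rule AE_poincare[OF gsub[OF li[unfolded eq]] d chartF(1)[OF l] chartF(2)[OF l] chartF(3)[OF l] r0(1,3,4)])
  qed
  have AE_loc: "AE w in P. \<forall>l\<in>F. eventually (\<lambda>n. \<forall>x\<in>M. dist x l < s2 l \<longrightarrow> \<bar>deg n w x / \<epsilon> n ^ d - D l\<bar> \<le> \<tau>1) sequentially"
    by (rule AE_finite_allI[OF F(2)]) (rule loc[OF FM, THEN conjunct2, THEN conjunct2])
  have main: "AE w in P. eventually (\<lambda>n. \<forall>f. \<exists>g. (\<forall>K\<in>\<K>. \<forall>x\<in>K. \<forall>y\<in>K. g x = g y) \<and>
      (\<Sum>x\<in>V n w \<inter> M. (f x * sqrt (deg n w x) - g x)\<^sup>2) \<le>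
        \<tau> * (1 / (real n * (\<epsilon> n)\<^sup>2) * dirichlet \<eta> (\<epsilon> n) (V n w \<inter> M) f + (\<Sum>x\<in>V n w \<inter> M. (f x)\<^sup>2 * deg n w x))) sequentially"
    using AE_poinc AE_loc AE_up AE_lo
  proof eventually_elim
    case (elim w)
    have e1: "eventually (\<lambda>n. \<forall>li\<in>I. \<forall>f. \<exists>a. (\<Sum>x\<in>V n w \<inter> \<psi> (fst li) ` sub (fst li) (snd li). (f x - a)\<^sup>2) \<le>
     pc (fst li) * (hk (fst li))\<^sup>2 / (real n * \<epsilon> n ^ (d + 2)) * dirichlet \<eta> (\<epsilon> n) (V n w \<inter> \<psi> (fst li) ` sub (fst li) (snd li)) f) sequentially"
      using elim(1) finI by (intro eventually_ball_finite)
    have e2: "eventually (\<lambda>n. \<forall>l\<in>F. \<forall>x\<in>M. dist x l < s2 l \<longrightarrow> \<bar>deg n w x / \<epsilon> n ^ d - D l\<bar> \<le> \<tau>1) sequentially"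
      using elim(2) F(2) by (intro eventually_ball_finite)
    show ?case using e1 e2 elim(3,4) eventually_ge_at_top[of 1]
    proof eventually_elim
      case (elim n)
      have n: "0 < real n" and en: "0 < \<epsilon> n" using elim(5) eps_pos by auto
      have end0: "0 < \<epsilon> n ^ d" using en by simp
      show ?case
      proof
        fix f :: "'a \<Rightarrow> real"
        define E where "E = 1 / (real n * (\<epsilon> n)\<^sup>2) * dirichlet \<eta> (\<epsilon> n) (V n w \<inter> M) f"
        define N where "N = (\<Sum>x\<in>V n w \<inter> M. (f x)\<^sup>2 * deg n w x)"
        define A where "A li = V n w \<inter> \<psi> (fst li) ` sub (fst li) (snd li)" for li
        define q where "q li = pc (fst li) * (hk (fst li))\<^sup>2 / (real n * \<epsilon> n ^ (d + 2)) * dirichlet \<eta> (\<epsilon> n) (A li) f" for li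
        have "\<forall>li\<in>I. \<exists>a. (\<Sum>x\<in>A li. (f x - a)\<^sup>2) \<le> q li"
          unfolding A_def q_def by (rule ballI, rule elim(1)[THEN bspec, THEN spec])
        then obtain a where a: "\<forall>li\<in>I. (\<Sum>x\<in>A li. (f x - a li)\<^sup>2) \<le> q li"
          unfolding bchoice_iff by (elim exE)
        note a = a[THEN bspec]
        have finU: "finite (V n w \<inter> M)" using finite_V by simp
        have fstF: "fst li \<in> F" if "li \<in> I" for li using that by (auto simp: I_def)
        have "\<exists>g. (\<forall>K\<in>\<K>. \<forall>x\<in>K. \<forall>y\<in>K. g x = g y) \<and> (\<Sum>x\<in>V n w \<inter> M. (f x * sqrt (deg n w x) - g x)\<^sup>2) \<le>
            2 * (\<tau>1 / cl) * (\<Sum>x\<in>V n w \<inter> M. (f x)\<^sup>2 * deg n w x) + 2 * (\<epsilon> n ^ d * (Cu + 1)) * (\<Sum>li\<in>I. q li)"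
          unfolding \<K>_def
        proof (rule piecewise_constant_approx[OF finI finU G'M Int_lower2 G'(3), where A = A and a = a and t = "\<lambda>li. \<epsilon> n ^ d * D (fst li)"])
          fix li assume li: "li \<in> I"
          show "V n w \<inter> M \<inter> G' li \<subseteq> A li" using G'(1)[OF li] unfolding A_def G_def by blast
          show "finite (A li)" by (simp add: A_def)
          show "(\<Sum>x\<in>A li. (f x - a li)\<^sup>2) \<le> q li" by (rule a[OF li])
          show "0 \<le> \<epsilon> n ^ d * D (fst li)"
            using end0 loc[OF FM[OF fstF[OF li]], THEN conjunct1] by (intro mult_nonneg_nonneg) simp_all
          fix x assume x: "x \<in> V n w \<inter> M \<inter> G' li"
          have xG: "x \<in> G li" and xM: "x \<in> M" using x G'(1)[OF li] by blast+
          have "dist x (fst li) < s2 (fst li)" using xG by (simp add: G_def s_def dist_commute)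
          then have close: "\<bar>deg n w x / \<epsilon> n ^ d - D (fst li)\<bar> \<le> \<tau>1" using elim(2)[THEN bspec, OF fstF[OF li], THEN bspec, OF xM] by (elim impE)
          have deg_lo: "cl * \<epsilon> n ^ d \<le> deg n w x" by (rule elim(4)[THEN bspec, OF xM])
          have deg_up: "deg n w x \<le> Cu * \<epsilon> n ^ d" by (rule elim(3)[THEN spec])
          note * = scaled_close[OF end0 cl close deg_lo deg_up less_imp_le[OF \<tau>1(1)] \<tau>1(2)]
          show "0 \<le> deg n w x \<and> \<bar>deg n w x - \<epsilon> n ^ d * D (fst li)\<bar> \<le> \<tau>1 / cl * deg n w x"
            using * by (intro conjI)
          show "\<epsilon> n ^ d * D (fst li) \<le> \<epsilon> n ^ d * (Cu + 1)" by (rule *(2))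
        qed (use Cu end0 in simp)
        then obtain g where cg: "(\<forall>K\<in>\<K>. \<forall>x\<in>K. \<forall>y\<in>K. g x = g y) \<and> (\<Sum>x\<in>V n w \<inter> M. (f x * sqrt (deg n w x) - g x)\<^sup>2) \<le>
            2 * (\<tau>1 / cl) * (\<Sum>x\<in>V n w \<inter> M. (f x)\<^sup>2 * deg n w x) + 2 * (\<epsilon> n ^ d * (Cu + 1)) * (\<Sum>li\<in>I. q li)"
          by (elim exE)
        note const = cg[THEN conjunct1] and g = cg[THEN conjunct2, folded N_def]
        have N0: "0 \<le> N"
          unfolding N_def
        proof (rule sum_nonneg, rule mult_nonneg_nonneg)
          fix x assume "x \<in> V n w \<inter> M"
          then have "cl * \<epsilon> n ^ d \<le> deg n w x" using elim(4)[THEN bspec, of x] by simp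
          moreover have "0 < cl * \<epsilon> n ^ d" by (rule mult_pos_pos[OF cl end0])
          ultimately show "0 \<le> deg n w x" by linarith
        qed (rule zero_le_power2)
        have N\<tau>: "2 * (\<tau>1 / cl) * N \<le> \<tau> * N" using \<tau>1(3) N0 by (intro mult_right_mono) simp_all
        have "(\<Sum>li\<in>I. q li) = (\<Sum>l\<in>F. \<Sum>i\<in>grid \<kappa>. q (l, i))"
          unfolding I_def by (simp only: sum.cartesian_product split_def prod.collapse)
        also have "\<dots> = (\<Sum>l\<in>F. pc l * (hk l)\<^sup>2 / (real n * \<epsilon> n ^ (d + 2)) * (\<Sum>i\<in>grid \<kappa>. dirichlet \<eta> (\<epsilon> n) (A (l, i)) f))"
          by (simp only: q_def sum_distrib_left fst_conv)
        also have "\<dots> \<le> (\<Sum>l\<in>F. pc l * (hk l)\<^sup>2 / (real n * \<epsilon> n ^ (d + 2)) * dirichlet \<eta> (\<epsilon> n) (V n w \<inter> M) f)"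
        proof (intro sum_mono mult_left_mono)
          fix l assume l: "l \<in> F"
          show "0 \<le> pc l * (hk l)\<^sup>2 / (real n * \<epsilon> n ^ (d + 2))" using pc0[OF l] n en by simp
          show "(\<Sum>i\<in>grid \<kappa>. dirichlet \<eta> (\<epsilon> n) (A (l, i)) f) \<le> dirichlet \<eta> (\<epsilon> n) (V n w \<inter> M) f"
          proof (rule sum_dirichlet_le[OF kernel en])
            show "A (l, i) \<subseteq> V n w \<inter> M" if i: "i \<in> grid \<kappa>" for i
            proof -
              have "(l, i) \<in> I" using l i by (simp add: I_def)
              then show ?thesis using good_cubeD(5)[OF gsub[of l i]] by (auto simp: A_def sub_def)
            qed
            show "disjoint_family_on (\<lambda>i. A (l, i)) (grid \<kappa>)"
              unfolding disjoint_family_on_def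
            proof (intro ballI impI)
              fix i j :: "'m \<Rightarrow> nat" assume ij: "i \<in> grid \<kappa>" "j \<in> grid \<kappa>" "i \<noteq> j"
              then have I: "(l, i) \<in> I" "(l, j) \<in> I" using l by (simp_all add: I_def)
              have "\<psi> l ` sub l i \<inter> \<psi> l ` sub l j = \<psi> l ` (sub l i \<inter> sub l j)"
                by (rule inj_on_image_Int[OF good_cubeD(2)[OF chartF(4)[OF l]] sub_cube[OF I(1)] sub_cube[OF I(2)], symmetric])
              also have "\<dots> = {}"
                using subcube_disjoint[OF hk(1)[OF l] ij(3), of "p l"] by (simp add: sub_def)
              finally show "A (l, i) \<inter> A (l, j) = {}" unfolding A_def fst_conv snd_conv by blast
            qed
          qed auto
        qed
        also have "\<dots> = T / (real \<kappa> * real \<kappa>) / (real n * \<epsilon> n ^ (d + 2)) * dirichlet \<eta> (\<epsilon> n) (V n w \<inter> M) f"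
          unfolding T_def hk_def by (rule sum_scaled_squares)
        finally have "2 * (\<epsilon> n ^ d * (Cu + 1)) * (\<Sum>li\<in>I. q li)
          \<le> 2 * (\<epsilon> n ^ d * (Cu + 1)) * (T / (real \<kappa> * real \<kappa>) / (real n * \<epsilon> n ^ (d + 2)) * dirichlet \<eta> (\<epsilon> n) (V n w \<inter> M) f)"
          using Cu end0 by (intro mult_left_mono) simp_all
        also have "\<dots> = 2 * (Cu + 1) * T / (real \<kappa> * real \<kappa>) * E"
          unfolding E_def by (rule cancel_scale[OF en n])
        also have "\<dots> \<le> \<tau> * E"
        proof (rule mult_right_mono)
          have "2 * (Cu + 1) * T \<le> \<tau> * real \<kappa>" using \<kappa>(2) \<tau> by (simp add: pos_divide_le_eq mult.commute)
          also have "\<dots> \<le> \<tau> * (real \<kappa> * real \<kappa>)"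
            using \<tau> \<kappa>(1) mult_right_mono[of 1 "real \<kappa>" "real \<kappa>"] by (intro mult_left_mono) simp_all
          finally have le: "2 * (Cu + 1) * T \<le> \<tau> * (real \<kappa> * real \<kappa>)" .
          have "0 < real \<kappa> * real \<kappa>" using \<kappa>(1) by (intro mult_pos_pos) simp_all
          then show "2 * (Cu + 1) * T / (real \<kappa> * real \<kappa>) \<le> \<tau>" using le by (simp only: pos_divide_le_eq)
          show "0 \<le> E" unfolding E_def using n en dirichlet_nonneg[OF kernel en] by (intro mult_nonneg_nonneg) simp_all
        qed
        finally have "(\<Sum>x\<in>V n w \<inter> M. (f x * sqrt (deg n w x) - g x)\<^sup>2) \<le> \<tau> * (E + N)"
          using g N\<tau> unfolding distrib_left by linarith
        with const show "\<exists>g. (\<forall>K\<in>\<K>. \<forall>x\<in>K. \<forall>y\<in>K. g x = g y) \<and> (\<Sum>x\<in>V n w \<inter> M. (f x * sqrt (deg n w x) - g x)\<^sup>2) \<le>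
          \<tau> * (1 / (real n * (\<epsilon> n)\<^sup>2) * dirichlet \<eta> (\<epsilon> n) (V n w \<inter> M) f + (\<Sum>x\<in>V n w \<inter> M. (f x)\<^sup>2 * deg n w x))"
          unfolding E_def[symmetric] N_def[symmetric] by (intro exI[of _ g] conjI)
      qed
    qed
  qed
  have diam: "dist x y \<le> \<tau>" if K: "K \<in> \<K>" and xy: "x \<in> K" "y \<in> K" for K x y
  proof -
    obtain l i where li: "(l, i) \<in> I" "K = G' (l, i)" using K by (auto simp: \<K>_def)
    have l: "l \<in> F" using li(1) by (simp add: I_def)
    have "x \<in> \<psi> l ` sub l i" "y \<in> \<psi> l ` sub l i" using xy li G'(1)[OF li(1)] by (auto simp: G_def)
    then obtain x' y' where x': "x' \<in> sub l i" "x = \<psi> l x'" and y': "y' \<in> sub l i" "y = \<psi> l y'" by blast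
    have "dist x' y' \<le> CARD('m) * hk l"
      unfolding dist_norm
    proof (rule norm_le_card)
      fix k
      show "\<bar>(x' - y') $ k\<bar> \<le> hk l"
        using x'(1) y'(1) by (auto simp: sub_def cube_def abs_le_iff dest!: spec[of _ k])
    qed
    then have "\<Lambda> l * dist x' y' \<le> \<Lambda> l * (d * hk l)" using chartF(1)[OF l] d by (intro mult_left_mono) auto
    moreover have "dist x y \<le> \<Lambda> l * dist x' y'"
      using good_cubeD(3)[OF chartF(4)[OF l]] sub_cube[OF li(1)] x' y' by blast
    moreover have "\<Lambda> l * (d * hk l) \<le> \<tau>"
    proof -
      have "\<Lambda> l * (d * h l) \<le> (\<Sum>l\<in>F. \<Lambda> l * (d * h l))"
        by (rule member_le_sum[OF l _ F(2)]) (use Lh in auto)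
      also have "\<dots> \<le> \<tau> * real \<kappa>" using \<kappa>(3) \<tau> by (simp add: pos_divide_le_eq mult.commute)
      finally show ?thesis using \<kappa>(1) by (simp add: hk_def pos_divide_le_eq)
    qed
    ultimately show ?thesis by linarith
  qed
  have "disjoint \<K>"
    unfolding \<K>_def using G'(3) by (rule disjoint_family_on_disjoint_image)
  moreover have "finite \<K>" "\<K> \<subseteq> sets borel" "\<Union>\<K> = M" using finI G'(2) G'M by (auto simp: \<K>_def)
  ultimately show ?thesis using diam main by (intro exI[of _ \<K>] conjI) auto
qed

end

section \<open>Compactness with respect to TL2 convergence\<close>

text \<open>On the diagonal cells the coupling transports the common mass \<open>min (\<mu> K) (\<nu> K)\<close> by a product measure;
  the remaining masses are coupled independently of each other. The value 1 on null cells makes the marginals of the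
  density constant everywhere.\<close>

lemma coupling_of_partition:
  fixes \<mu> \<nu> :: "'a::euclidean_space measure"
  assumes \<mu>: "prob_space \<mu>" "sets \<mu> = sets borel" and \<nu>: "prob_space \<nu>" "sets \<nu> = sets borel"
    and \<K>: "finite \<K>" "disjoint \<K>" "\<K> \<subseteq> sets borel" "\<Union>\<K> = UNIV"
  obtains \<pi> where "is_coupling \<mu> \<nu> \<pi>"
    "emeasure \<pi> {z. \<not> (\<exists>K\<in>\<K>. fst z \<in> K \<and> snd z \<in> K)} \<le>
      ennreal (\<Sum>K\<in>\<K>. measure \<mu> K - min (measure \<mu> K) (measure \<nu> K))"
proof -
  interpret \<mu>: prob_space \<mu> by fact
  interpret \<nu>: prob_space \<nu> by fact
  define a where "a K = measure \<mu> K" for K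
  define b where "b K = measure \<nu> K" for K
  define e where "e K = a K - min (a K) (b K)" for K
  define e' where "e' K = b K - min (a K) (b K)" for K
  define D where "D = 1 - (\<Sum>K\<in>\<K>. min (a K) (b K))"
  have ab: "0 \<le> a K" "0 \<le> b K" for K by (auto simp: a_def b_def)
  have ee: "0 \<le> e K" "0 \<le> e' K" for K by (auto simp: e_def e'_def)
  have Kb: "K \<in> sets borel" if "K \<in> \<K>" for K using \<K>(3) that by blast
  have sum1: "(\<Sum>K\<in>\<K>. measure N K) = 1" if N: "prob_space N" "sets N = sets borel" for N :: "'a measure"
  proof -
    interpret N: prob_space N by fact
    have "space N = UNIV" using sets_eq_imp_space_eq[OF N(2)] by simp
    then have "1 = measure N (\<Union>K\<in>\<K>. K)" using N.prob_space \<K>(4) by simp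
    also have "\<dots> = (\<Sum>K\<in>\<K>. measure N K)"
      using \<K> N(2) Kb by (intro N.finite_measure_finite_Union) (auto simp: disjoint_family_on_def disjoint_def)
    finally show ?thesis by simp
  qed
  have suma: "(\<Sum>K\<in>\<K>. a K) = 1" and sumb: "(\<Sum>K\<in>\<K>. b K) = 1"
    unfolding a_def b_def using sum1 \<mu> \<nu> by auto
  have sume: "(\<Sum>K\<in>\<K>. e K) = D" and sume': "(\<Sum>K\<in>\<K>. e' K) = D"
    unfolding e_def e'_def D_def sum_subtractf suma sumb by auto
  have D: "0 \<le> D" using sum_nonneg[of \<K> e] ee sume by simp
  \<comment> \<open>If D = 0, the two measures give equal mass to every cell and all excesses
    vanish; the quotients by D then have the value 0 and do no harm.\<close>
  have D0: "e K = 0" "e' K = 0" if "D = 0" "K \<in> \<K>" for K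
    using sum_nonneg_eq_0_iff[of \<K> e] sum_nonneg_eq_0_iff[of \<K> e'] \<K>(1) ee sume sume' that by auto
  \<comment> \<open>The mass sent from K to L is the common mass if K = L, plus e(K) e'(L) / D, the
    independent coupling of the excess masses. Divided by a(K) b(L) it becomes a density with
    respect to the product measure.\<close>
  define H where "H K L = (if a K = 0 \<or> b L = 0 then 1 else
      (if K = L then min (a K) (b K) / (a K * b L) else 0) + e K * e' L / (D * a K * b L))" for K L
  have H0: "0 \<le> H K L" for K L
    unfolding H_def using ab ee D by auto
  have HabL: "H K L * b L = (if a K = 0 then b L else (if K = L then min (a K) (b K) / a K else 0) + e K * e' L / (D * a K))" for K L
  proof (cases "a K = 0 \<or> b L = 0")
    case True
    then show ?thesis using ab(1)[of L] ab(1)[of K] by (auto simp: H_def e'_def)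
  next
    case False
    then show ?thesis by (auto simp: H_def distrib_right)
  qed
  have HabK: "H K L * a K = (if b L = 0 then a K else (if K = L then min (a L) (b L) / b L else 0) + e K * e' L / (D * b L))" for K L
  proof (cases "a K = 0 \<or> b L = 0")
    case True
    then show ?thesis using ab(2)[of L] ab(2)[of K] by (auto simp: H_def e_def)
  next
    case False
    then show ?thesis by (auto simp: H_def distrib_right)
  qed
  have row: "(\<Sum>L\<in>\<K>. H K L * b L) = 1" if K: "K \<in> \<K>" for K
  proof (cases "a K = 0")
    case True
    then show ?thesis by (simp add: HabL sumb)
  next
    case False
    have "(\<Sum>L\<in>\<K>. H K L * b L) = (\<Sum>L\<in>\<K>. if K = L then min (a K) (b K) / a K else 0) + (\<Sum>L\<in>\<K>. e K * e' L / (D * a K))"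
      using False by (simp add: HabL sum.distrib)
    also have "(\<Sum>L\<in>\<K>. if K = L then min (a K) (b K) / a K else 0) = min (a K) (b K) / a K" using K \<K>(1) by simp
    also have "(\<Sum>L\<in>\<K>. e K * e' L / (D * a K)) = e K * D / (D * a K)"
      by (simp add: sum_distrib_left[symmetric] sum_divide_distrib[symmetric] sume')
    also have "e K * D / (D * a K) = e K / a K" using D0(1)[OF _ K] by (cases "D = 0") auto
    also have "min (a K) (b K) / a K + e K / a K = 1" using False by (simp add: e_def add_divide_distrib[symmetric])
    finally show ?thesis .
  qed
  have col: "(\<Sum>K\<in>\<K>. H K L * a K) = 1" if L: "L \<in> \<K>" for L
  proof (cases "b L = 0")
    case True
    then show ?thesis by (simp add: HabK suma)
  next
    case False
    have "(\<Sum>K\<in>\<K>. H K L * a K) = (\<Sum>K\<in>\<K>. if K = L then min (a L) (b L) / b L else 0) + (\<Sum>K\<in>\<K>. e K * e' L / (D * b L))"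
      using False by (simp add: HabK sum.distrib)
    also have "(\<Sum>K\<in>\<K>. if K = L then min (a L) (b L) / b L else 0) = min (a L) (b L) / b L" using L \<K>(1) by simp
    also have "(\<Sum>K\<in>\<K>. e K * e' L / (D * b L)) = D * e' L / (D * b L)"
      by (simp add: sum_distrib_right[symmetric] sum_divide_distrib[symmetric] sume)
    also have "D * e' L / (D * b L) = e' L / b L" using D0(2)[OF _ L] by (cases "D = 0") auto
    also have "min (a L) (b L) / b L + e' L / b L = 1" using False by (simp add: e'_def add_divide_distrib[symmetric])
    finally show ?thesis .
  qed
  define h where "h z = (\<Sum>K\<in>\<K>. \<Sum>L\<in>\<K>. ennreal (H K L) * (indicator K (fst z) * indicator L (snd z)))" for z :: "'a \<times> 'a"
  have sets2: "sets (\<mu> \<Otimes>\<^sub>M \<nu>) = sets (borel \<Otimes>\<^sub>M borel)"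
    using \<mu>(2) \<nu>(2) by (rule sets_pair_measure_cong)
  have Kmeas [measurable]: "K \<in> \<K> \<Longrightarrow> (indicator K :: 'a \<Rightarrow> ennreal) \<in> borel_measurable borel" for K
    using Kb by simp
  have mfst: "fst \<in> (\<mu> \<Otimes>\<^sub>M \<nu>) \<rightarrow>\<^sub>M borel" and msnd: "snd \<in> (\<mu> \<Otimes>\<^sub>M \<nu>) \<rightarrow>\<^sub>M borel"
    by (simp_all add: measurable_cong_sets[OF sets2 refl])
  have hm: "h \<in> borel_measurable (\<mu> \<Otimes>\<^sub>M \<nu>)"
    unfolding h_def
    by (intro borel_measurable_sum borel_measurable_times_ennreal measurable_const
        measurable_compose[OF mfst Kmeas] measurable_compose[OF msnd Kmeas]) simp
  have sp: "space \<mu> = UNIV" "space \<nu> = UNIV"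
    using sets_eq_imp_space_eq[OF \<mu>(2)] sets_eq_imp_space_eq[OF \<nu>(2)] by simp_all
  have hmy: "(\<lambda>y. h (x, y)) \<in> borel_measurable \<nu>" for x
    using measurable_Pair2[OF hm, of x] sp by simp
  have hmx: "(\<lambda>x. h (x, y)) \<in> borel_measurable \<mu>" for y
    using measurable_Pair1[OF hm, of y] sp by simp
  have pick: "(\<Sum>K\<in>\<K>. F K * indicator K x) = F K0" if "K0 \<in> \<K>" "x \<in> K0" for F :: "'a set \<Rightarrow> ennreal" and x K0
  proof -
    have "(\<Sum>K\<in>\<K>. F K * indicator K x) = (\<Sum>K\<in>\<K>. if K = K0 then F K0 else 0)"
      using \<K>(2) that by (intro sum.cong) (auto simp: disjoint_def indicator_def)
    then show ?thesis using that \<K>(1) by simp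
  qed
  have cellx: "\<exists>K\<in>\<K>. x \<in> K" for x using \<K>(4) by blast
  have em\<mu>: "emeasure \<mu> K = ennreal (a K)" and em\<nu>: "emeasure \<nu> K = ennreal (b K)" for K
    by (simp_all add: a_def b_def \<mu>.emeasure_eq_measure \<nu>.emeasure_eq_measure)
  \<comment> \<open>Row and column sums of 1 make both marginal densities identically 1, so the
    marginals are exactly the given measures.\<close>
  have int_y: "(\<integral>\<^sup>+y. h (x, y) \<partial>\<nu>) = 1" for x
  proof -
    obtain K0 where K0: "K0 \<in> \<K>" "x \<in> K0" using cellx by blast
    have "h (x, y) = (\<Sum>L\<in>\<K>. ennreal (H K0 L) * indicator L y)" for y
    proof -
      have "h (x, y) = (\<Sum>K\<in>\<K>. (\<Sum>L\<in>\<K>. ennreal (H K L) * indicator L y) * indicator K x)"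
        unfolding h_def sum_distrib_right fst_conv snd_conv by (intro sum.cong refl) (simp add: mult_ac)
      then show ?thesis using pick[OF K0] by simp
    qed
    then have "(\<integral>\<^sup>+y. h (x, y) \<partial>\<nu>) = (\<Sum>L\<in>\<K>. ennreal (H K0 L) * emeasure \<nu> L)"
      using Kb \<nu>(2) by (simp add: nn_integral_sum nn_integral_cmult_indicator)
    also have "\<dots> = ennreal (\<Sum>L\<in>\<K>. H K0 L * b L)"
      using H0 ab by (subst sum_ennreal[symmetric]) (auto simp: em\<nu> ennreal_mult)
    finally show ?thesis using row[OF K0(1)] by simp
  qed
  have int_x: "(\<integral>\<^sup>+x. h (x, y) \<partial>\<mu>) = 1" for y
  proof -
    obtain L0 where L0: "L0 \<in> \<K>" "y \<in> L0" using cellx by blast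
    have "h (x, y) = (\<Sum>K\<in>\<K>. ennreal (H K L0) * indicator K x)" for x
    proof -
      have "h (x, y) = (\<Sum>K\<in>\<K>. (\<Sum>L\<in>\<K>. (ennreal (H K L) * indicator K x) * indicator L y))"
        unfolding h_def fst_conv snd_conv by (intro sum.cong refl) (simp add: mult_ac)
      then show ?thesis using pick[OF L0] by simp
    qed
    then have "(\<integral>\<^sup>+x. h (x, y) \<partial>\<mu>) = (\<Sum>K\<in>\<K>. ennreal (H K L0) * emeasure \<mu> K)"
      using Kb \<mu>(2) by (simp add: nn_integral_sum nn_integral_cmult_indicator)
    also have "\<dots> = ennreal (\<Sum>K\<in>\<K>. H K L0 * a K)"
      using H0 ab by (subst sum_ennreal[symmetric]) (auto simp: em\<mu> ennreal_mult)
    finally show ?thesis using col[OF L0(1)] by simp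
  qed
  interpret pair_sigma_finite \<mu> \<nu> ..
  define \<pi> where "\<pi> = density (\<mu> \<Otimes>\<^sub>M \<nu>) h"
  have sets\<pi>: "sets \<pi> = sets (borel \<Otimes>\<^sub>M borel)" by (simp add: \<pi>_def sets2)
  have "distr \<pi> borel fst = \<mu>"
  proof (rule measure_eqI)
    fix A assume "A \<in> sets (distr \<pi> borel fst)"
    then have A: "A \<in> sets borel" by simp
    then have A\<mu>: "A \<in> sets \<mu>" using \<mu>(2) by simp
    have Am: "fst -` A \<inter> space (\<mu> \<Otimes>\<^sub>M \<nu>) \<in> sets (\<mu> \<Otimes>\<^sub>M \<nu>)" using mfst A by (rule measurable_sets)
    have "emeasure (distr \<pi> borel fst) A = emeasure \<pi> (fst -` A \<inter> space \<pi>)"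
      using A mfst by (intro emeasure_distr) (simp_all add: \<pi>_def)
    also have "\<dots> = (\<integral>\<^sup>+z. h z * indicator (fst -` A \<inter> space (\<mu> \<Otimes>\<^sub>M \<nu>)) z \<partial>(\<mu> \<Otimes>\<^sub>M \<nu>))"
      unfolding \<pi>_def using hm Am by (simp add: emeasure_density)
    also have "\<dots> = (\<integral>\<^sup>+z. h z * indicator A (fst z) \<partial>(\<mu> \<Otimes>\<^sub>M \<nu>))"
      by (intro nn_integral_cong) (auto simp: indicator_def)
    also have "\<dots> = (\<integral>\<^sup>+x. (\<integral>\<^sup>+y. h (x, y) * indicator A x \<partial>\<nu>) \<partial>\<mu>)"
      using hm A by (subst \<nu>.nn_integral_fst[symmetric]) (auto intro!: borel_measurable_times_ennreal measurable_compose[OF mfst])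
    also have "\<dots> = (\<integral>\<^sup>+x. indicator A x \<partial>\<mu>)"
      using hmy by (subst nn_integral_multc) (auto simp: int_y)
    also have "\<dots> = emeasure \<mu> A" using A\<mu> by simp
    finally show "emeasure (distr \<pi> borel fst) A = emeasure \<mu> A" .
  qed (simp add: \<mu>(2))
  moreover have "distr \<pi> borel snd = \<nu>"
  proof (rule measure_eqI)
    fix A assume "A \<in> sets (distr \<pi> borel snd)"
    then have A: "A \<in> sets borel" by simp
    then have A\<nu>: "A \<in> sets \<nu>" using \<nu>(2) by simp
    have Am: "snd -` A \<inter> space (\<mu> \<Otimes>\<^sub>M \<nu>) \<in> sets (\<mu> \<Otimes>\<^sub>M \<nu>)" using msnd A by (rule measurable_sets)
    have "emeasure (distr \<pi> borel snd) A = emeasure \<pi> (snd -` A \<inter> space \<pi>)"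
      using A msnd by (intro emeasure_distr) (simp_all add: \<pi>_def)
    also have "\<dots> = (\<integral>\<^sup>+z. h z * indicator (snd -` A \<inter> space (\<mu> \<Otimes>\<^sub>M \<nu>)) z \<partial>(\<mu> \<Otimes>\<^sub>M \<nu>))"
      unfolding \<pi>_def using hm Am by (simp add: emeasure_density)
    also have "\<dots> = (\<integral>\<^sup>+z. h z * indicator A (snd z) \<partial>(\<mu> \<Otimes>\<^sub>M \<nu>))"
      by (intro nn_integral_cong) (auto simp: indicator_def)
    also have "\<dots> = (\<integral>\<^sup>+y. (\<integral>\<^sup>+x. h (x, y) * indicator A y \<partial>\<mu>) \<partial>\<nu>)"
      using hm A by (subst nn_integral_snd[symmetric]) (auto intro!: borel_measurable_times_ennreal measurable_compose[OF msnd])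
    also have "\<dots> = (\<integral>\<^sup>+y. indicator A y \<partial>\<nu>)"
      using hmx by (subst nn_integral_multc) (auto simp: int_x)
    also have "\<dots> = emeasure \<nu> A" using A\<nu> by simp
    finally show "emeasure (distr \<pi> borel snd) A = emeasure \<nu> A" .
  qed (simp add: \<nu>(2))
  ultimately have coup: "is_coupling \<mu> \<nu> \<pi>" using sets\<pi> by (simp add: is_coupling_def)
  have off: "{z. \<not> (\<exists>K\<in>\<K>. fst z \<in> K \<and> snd z \<in> K)} = (\<Union>K\<in>\<K>. \<Union>L\<in>\<K> - {K}. K \<times> L)"
  proof (intro set_eqI iffI)
    fix z :: "'a \<times> 'a" assume z: "z \<in> {z. \<not> (\<exists>K\<in>\<K>. fst z \<in> K \<and> snd z \<in> K)}"
    obtain K where K: "K \<in> \<K>" "fst z \<in> K" using cellx by blast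
    obtain L where L: "L \<in> \<K>" "snd z \<in> L" using cellx by blast
    have "L \<noteq> K" using z K L by blast
    moreover have "z \<in> K \<times> L" using K(2) L(2) by (simp add: mem_Times_iff)
    ultimately show "z \<in> (\<Union>K\<in>\<K>. \<Union>L\<in>\<K> - {K}. K \<times> L)" using K(1) L(1) by blast
  next
    fix z :: "'a \<times> 'a" assume "z \<in> (\<Union>K\<in>\<K>. \<Union>L\<in>\<K> - {K}. K \<times> L)"
    then obtain K L where KL: "K \<in> \<K>" "L \<in> \<K>" "L \<noteq> K" "fst z \<in> K" "snd z \<in> L"
      by (auto simp: mem_Times_iff)
    have uniq: "A = B" if "A \<in> \<K>" "B \<in> \<K>" "x \<in> A" "x \<in> B" for A B x
      using \<K>(2) that unfolding disjoint_def by blast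
    have "\<not> (\<exists>K\<in>\<K>. fst z \<in> K \<and> snd z \<in> K)"
      using uniq[OF _ KL(1) _ KL(4)] uniq[OF _ KL(2) _ KL(5)] KL(3) by blast
    then show "z \<in> {z. \<not> (\<exists>K\<in>\<K>. fst z \<in> K \<and> snd z \<in> K)}" by blast
  qed
  have KL: "emeasure \<pi> (K \<times> L) = ennreal (H K L * a K * b L)" if K: "K \<in> \<K>" "L \<in> \<K>" for K L
  proof -
    have KLs: "K \<times> L \<in> sets (\<mu> \<Otimes>\<^sub>M \<nu>)" using Kb K \<mu>(2) \<nu>(2) by (intro pair_measureI) auto
    have "emeasure \<pi> (K \<times> L) = (\<integral>\<^sup>+z. h z * indicator (K \<times> L) z \<partial>(\<mu> \<Otimes>\<^sub>M \<nu>))"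
      unfolding \<pi>_def using hm KLs by (rule emeasure_density)
    also have "\<dots> = (\<integral>\<^sup>+z. ennreal (H K L) * indicator (K \<times> L) z \<partial>(\<mu> \<Otimes>\<^sub>M \<nu>))"
    proof (rule nn_integral_cong)
      fix z :: "'a \<times> 'a"
      show "h z * indicator (K \<times> L) z = ennreal (H K L) * indicator (K \<times> L) z"
      proof (cases "z \<in> K \<times> L")
        case True
        then have z: "fst z \<in> K" "snd z \<in> L" by auto
        have "h z = (\<Sum>K\<in>\<K>. (\<Sum>L\<in>\<K>. ennreal (H K L) * indicator L (snd z)) * indicator K (fst z))"
          unfolding h_def sum_distrib_right by (intro sum.cong refl) (simp add: mult_ac)
        also have "\<dots> = ennreal (H K L)" using pick[OF K(1) z(1)] pick[OF K(2) z(2)] by simp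
        finally show ?thesis by simp
      qed simp
    qed
    also have "\<dots> = ennreal (H K L) * (ennreal (a K) * ennreal (b L))"
      using KLs Kb K \<mu>(2) \<nu>(2) by (simp add: nn_integral_cmult_indicator \<nu>.emeasure_pair_measure_Times em\<mu> em\<nu>)
    also have "\<dots> = ennreal (H K L * a K * b L)" using H0 ab by (simp add: ennreal_mult mult.assoc)
    finally show ?thesis .
  qed
  have KLs: "K \<times> L \<in> sets \<pi>" if "K \<in> \<K>" "L \<in> \<K>" for K L
    using Kb that by (simp add: sets\<pi> pair_measureI)
  have "emeasure \<pi> {z. \<not> (\<exists>K\<in>\<K>. fst z \<in> K \<and> snd z \<in> K)} \<le> (\<Sum>K\<in>\<K>. emeasure \<pi> (\<Union>L\<in>\<K> - {K}. K \<times> L))"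
    unfolding off using \<K>(1) KLs by (intro emeasure_subadditive_finite) (auto intro!: sets.finite_UN)
  also have "\<dots> \<le> (\<Sum>K\<in>\<K>. \<Sum>L\<in>\<K> - {K}. emeasure \<pi> (K \<times> L))"
    using \<K>(1) KLs by (intro sum_mono emeasure_subadditive_finite) auto
  also have "\<dots> = (\<Sum>K\<in>\<K>. \<Sum>L\<in>\<K> - {K}. ennreal (H K L * a K * b L))"
    by (intro sum.cong) (auto simp: KL)
  also have "\<dots> \<le> (\<Sum>K\<in>\<K>. \<Sum>L\<in>\<K> - {K}. ennreal (e K * e' L / D))"
  proof (intro sum_mono ennreal_leI)
    fix K L assume KL': "K \<in> \<K>" "L \<in> \<K> - {K}"
    show "H K L * a K * b L \<le> e K * e' L / D"
    proof (cases "a K = 0 \<or> b L = 0")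
      case True
      moreover have "0 \<le> e K * e' L / D" using ee D by simp
      ultimately show ?thesis by auto
    next
      case False
      then show ?thesis using KL' by (cases "D = 0") (auto simp: H_def field_simps)
    qed
  qed
  also have "\<dots> \<le> (\<Sum>K\<in>\<K>. \<Sum>L\<in>\<K>. ennreal (e K * e' L / D))"
    using \<K>(1) by (intro sum_mono sum_mono2) auto
  also have "\<dots> = ennreal (\<Sum>K\<in>\<K>. \<Sum>L\<in>\<K>. e K * e' L / D)"
    using ee D by (simp add: sum_nonneg)
  also have "(\<Sum>K\<in>\<K>. \<Sum>L\<in>\<K>. e K * e' L / D) = D"
  proof (cases "D = 0")
    case False
    then show ?thesis
      by (simp add: sum_divide_distrib[symmetric] sum_distrib_left[symmetric] sum_distrib_right[symmetric] sume sume')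
  qed simp
  also have "D = (\<Sum>K\<in>\<K>. measure \<mu> K - min (measure \<mu> K) (measure \<nu> K))"
    using sume by (simp add: e_def a_def b_def)
  finally show ?thesis using that coup by blast
qed

text \<open>The geometric rate gives almost everywhere convergence of the whole sequence, and
  Fatou's lemma passes the rate to the limit.\<close>

lemma L2_limit_of_fast_Cauchy:
  fixes f :: "nat \<Rightarrow> 'b \<Rightarrow> real"
  assumes \<mu>: "prob_space \<mu>" and f [measurable]: "\<And>k. f k \<in> borel_measurable \<mu>"
    and C: "\<And>k l. k \<le> l \<Longrightarrow> (\<integral>\<^sup>+x. ennreal ((f k x - f l x)\<^sup>2) \<partial>\<mu>) \<le> ennreal (4 * (1/4) ^ k)"
  obtains w where "w \<in> borel_measurable \<mu>" "\<And>k. (\<integral>\<^sup>+x. ennreal ((f k x - w x)\<^sup>2) \<partial>\<mu>) \<le> ennreal (4 * (1/4) ^ k)"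
proof -
  interpret prob_space \<mu> by fact
  have step: "(\<integral>\<^sup>+x. ennreal \<bar>f (Suc k) x - f k x\<bar> \<partial>\<mu>) \<le> ennreal (5 * (1/2) ^ k)" for k
  proof -
    have "(\<integral>\<^sup>+x. ennreal \<bar>f (Suc k) x - f k x\<bar> \<partial>\<mu>)
        \<le> (\<integral>\<^sup>+x. ennreal (2 ^ k) * ennreal ((f k x - f (Suc k) x)\<^sup>2) + ennreal ((1/2) ^ k) \<partial>\<mu>)"
    proof (rule nn_integral_mono)
      fix x
      define t where "t = \<bar>f (Suc k) x - f k x\<bar>"
      have t: "0 \<le> t" "t\<^sup>2 = (f k x - f (Suc k) x)\<^sup>2" by (auto simp: t_def power2_commute)
      define q where "q = (1/2 :: real) ^ k"
      have q: "2 ^ k * q = 1" by (simp add: q_def power_one_over)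
      \<comment> \<open>The bound t <= 2^k t^2 + 2^(-k) trades the squared difference, with integral
        at most 4 (1/4)^k, for a first-power integral of at most 5 (1/2)^k, which is
        summable.\<close>
      have "0 \<le> 2 ^ k * (t - q)\<^sup>2" by simp
      also have "\<dots> = 2 ^ k * t\<^sup>2 - 2 * t * (2 ^ k * q) + (2 ^ k * q) * q"
        by (simp add: power2_eq_square algebra_simps)
      also have "\<dots> = 2 ^ k * t\<^sup>2 - 2 * t + (1/2) ^ k" by (simp add: q) (simp add: q_def)
      finally have "t \<le> 2 ^ k * t\<^sup>2 + (1/2) ^ k" using t(1) by (cases "t = 0") auto
      then show "ennreal \<bar>f (Suc k) x - f k x\<bar> \<le> ennreal (2 ^ k) * ennreal ((f k x - f (Suc k) x)\<^sup>2) + ennreal ((1/2) ^ k)"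
        by (simp add: t_def[symmetric] t(2)[symmetric] ennreal_mult[symmetric] ennreal_plus[symmetric] ennreal_leI del: ennreal_plus)
    qed
    also have "\<dots> = ennreal (2 ^ k) * (\<integral>\<^sup>+x. ennreal ((f k x - f (Suc k) x)\<^sup>2) \<partial>\<mu>) + ennreal ((1/2) ^ k)"
      by (simp add: nn_integral_add nn_integral_cmult emeasure_space_1)
    also have "\<dots> \<le> ennreal (2 ^ k) * ennreal (4 * (1/4) ^ k) + ennreal ((1/2) ^ k)"
      by (intro add_right_mono mult_left_mono C) auto
    also have "\<dots> = ennreal (2 ^ k * (4 * (1/4) ^ k) + (1/2) ^ k)"
      by (simp add: ennreal_mult[symmetric] ennreal_plus[symmetric] del: ennreal_plus)
    also have "2 ^ k * (4 * (1/4) ^ k) = 4 * (1/2::real) ^ k"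
    proof -
      have "2 ^ k * (1/4) ^ k = (1/2::real) ^ k" by (subst power_mult_distrib[symmetric]) simp
      then show ?thesis by (metis mult.left_commute)
    qed
    finally show ?thesis by simp
  qed
  have "(\<integral>\<^sup>+x. (\<Sum>k. ennreal \<bar>f (Suc k) x - f k x\<bar>) \<partial>\<mu>) = (\<Sum>k. \<integral>\<^sup>+x. ennreal \<bar>f (Suc k) x - f k x\<bar> \<partial>\<mu>)"
    by (rule nn_integral_suminf) measurable
  also have "\<dots> \<le> (\<Sum>k. ennreal (5 * (1/2) ^ k))"
    by (intro suminf_le step summableI)
  also have "\<dots> = ennreal (\<Sum>k. 5 * (1/2) ^ k)"
    by (intro suminf_ennreal2) auto
  also have "\<dots> < \<infinity>" by simp
  finally have "AE x in \<mu>. (\<Sum>k. ennreal \<bar>f (Suc k) x - f k x\<bar>) \<noteq> \<infinity>"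
    by (intro nn_integral_PInf_AE) auto
  then have conv: "AE x in \<mu>. (\<lambda>k. f k x) \<longlonglongrightarrow> lim (\<lambda>k. f k x)"
  proof eventually_elim
    case (elim x)
    then have "summable (\<lambda>k. \<bar>f (Suc k) x - f k x\<bar>)"
      by (intro summable_suminf_not_top) auto
    then have "summable (\<lambda>k. f (Suc k) x - f k x)" by (rule summable_rabs_cancel)
    then have "convergent (\<lambda>n. \<Sum>k<n. f (Suc k) x - f k x)" by (simp add: summable_iff_convergent)
    moreover have "(\<Sum>k<n. f (Suc k) x - f k x) = f n x - f 0 x" for n
      by (rule sum_lessThan_telescope[of "\<lambda>k. f k x"])
    ultimately have "convergent (\<lambda>n. f n x - f 0 x)" by simp
    then have "convergent (\<lambda>n. f n x)"
      using convergent_add_const_right_iff[of "\<lambda>n. f n x" "- f 0 x"] by simp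
    then show ?case by (rule convergent_LIMSEQ_iff[THEN iffD1])
  qed
  define w where "w x = lim (\<lambda>k. f k x)" for x
  have wm: "w \<in> borel_measurable \<mu>" unfolding w_def by measurable
  show ?thesis
  proof (rule that[OF wm])
    fix k
    have "(\<integral>\<^sup>+x. ennreal ((f k x - w x)\<^sup>2) \<partial>\<mu>) \<le> (\<integral>\<^sup>+x. liminf (\<lambda>l. ennreal ((f k x - f l x)\<^sup>2)) \<partial>\<mu>)"
    proof (rule nn_integral_mono_AE)
      show "AE x in \<mu>. ennreal ((f k x - w x)\<^sup>2) \<le> liminf (\<lambda>l. ennreal ((f k x - f l x)\<^sup>2))"
        using conv
      proof eventually_elim
        case (elim x)
        then have "(\<lambda>l. ennreal ((f k x - f l x)\<^sup>2)) \<longlonglongrightarrow> ennreal ((f k x - w x)\<^sup>2)"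
          unfolding w_def by (intro tendsto_ennrealI tendsto_intros)
        then have "liminf (\<lambda>l. ennreal ((f k x - f l x)\<^sup>2)) = ennreal ((f k x - w x)\<^sup>2)"
          by (rule lim_imp_Liminf[rotated]) simp
        then show ?case by simp
      qed
    qed
    also have "\<dots> \<le> liminf (\<lambda>l. \<integral>\<^sup>+x. ennreal ((f k x - f l x)\<^sup>2) \<partial>\<mu>)"
      by (rule nn_integral_liminf) measurable
    also have "\<dots> \<le> limsup (\<lambda>l. \<integral>\<^sup>+x. ennreal ((f k x - f l x)\<^sup>2) \<partial>\<mu>)"
      by (rule Liminf_le_Limsup) simp
    also have "\<dots> \<le> ennreal (4 * (1/4) ^ k)"
      by (intro Limsup_bounded eventually_mono[OF eventually_ge_at_top[of k]] C)
    finally show "(\<integral>\<^sup>+x. ennreal ((f k x - w x)\<^sup>2) \<partial>\<mu>) \<le> ennreal (4 * (1/4) ^ k)" .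
  qed
qed

section \<open>Empirical measures, subsequences and couplings: preparations\<close>

lemma sets_empirical_measure [simp]: "sets (empirical_measure n V) = sets borel"
  by (simp add: empirical_measure_def sets_measure_of_borel)

text \<open>As a scaled image of counting measure it can be integrated against.\<close>

lemma empirical_measure_eq_distr:
  assumes "finite V"
  shows "empirical_measure n V = scale_measure (ennreal (1 / real n)) (distr (count_space V) borel (\<lambda>x. x))"
proof (rule measure_eqI)
  fix A assume "A \<in> sets (empirical_measure n V)"
  then have A: "A \<in> sets borel" by simp
  have "(\<Sum>x\<in>V. indicator A x) = (of_nat (card (V \<inter> A)) :: ennreal)"
    using assms by (simp add: indicator_def sum.If_cases)
  moreover have "emeasure (distr (count_space V) borel (\<lambda>x. x)) A = of_nat (card (V \<inter> A))"
    using A assms by (subst emeasure_distr) (auto simp: Int_commute)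
  ultimately show "emeasure (empirical_measure n V) A =
      emeasure (scale_measure (ennreal (1 / real n)) (distr (count_space V) borel (\<lambda>x. x))) A"
    by (simp add: emeasure_empirical_measure[OF A])
qed simp

lemma nn_integral_empirical_measure:
  assumes "finite V" "f \<in> borel_measurable borel"
  shows "(\<integral>\<^sup>+x. f x \<partial>empirical_measure n V) = ennreal (1 / real n) * (\<Sum>x\<in>V. f x)"
  unfolding empirical_measure_eq_distr[OF assms(1)] using assms
  by (simp add: nn_integral_scale_measure nn_integral_distr nn_integral_count_space_finite)

lemma measure_empirical_measure:
  assumes "finite V" "A \<in> sets borel"
  shows "measure (empirical_measure n V) A = real (card (V \<inter> A)) / real n"
proof -
  have "emeasure (empirical_measure n V) A = ennreal (1 / real n) * of_nat (card (V \<inter> A))"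
    using assms by (simp add: emeasure_empirical_measure indicator_def sum.If_cases)
  also have "\<dots> = ennreal (1 / real n * real (card (V \<inter> A)))"
    by (subst ennreal_mult) (auto simp: ennreal_of_nat_eq_real_of_nat)
  finally show ?thesis by (simp add: measure_def)
qed

lemma prob_space_empirical_measure:
  assumes "finite V" "card V = n" "1 \<le> n"
  shows "prob_space (empirical_measure n V)"
proof
  have sp: "space (empirical_measure n V) = UNIV"
    using sets_eq_imp_space_eq[OF sets_empirical_measure, of n V] by simp
  have "emeasure (empirical_measure n V) UNIV = ennreal (1 / real n) * ennreal (real n)"
    using assms by (simp add: emeasure_empirical_measure ennreal_of_nat_eq_real_of_nat)
  also have "\<dots> = 1" using assms by (simp add: ennreal_mult[symmetric])
  finally show "emeasure (empirical_measure n V) (space (empirical_measure n V)) = 1" by (simp add: sp)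
qed

lemma bounded_diagonal_subsequence:
  fixes a :: "nat \<Rightarrow> nat \<Rightarrow> real"
  assumes "\<And>i. \<exists>B. eventually (\<lambda>n. \<bar>a n i\<bar> \<le> B) sequentially"
  obtains r :: "nat \<Rightarrow> nat" where "strict_mono r" "\<And>i. convergent (\<lambda>j. a (r j) i)"
proof -
  have B: "Bseq (\<lambda>n. a n i)" for i
    using assms[of i] by (auto intro: BfunI)
  interpret subseqs "\<lambda>i s. convergent (\<lambda>j. a (s j) i)"
  proof
    fix i and s :: "nat \<Rightarrow> nat" assume s: "strict_mono s"
    have "Bseq (\<lambda>j. a (s j) i)" using Bseq_subseq[OF B[of i], of s] by (simp add: o_def)
    then have "bounded (range (\<lambda>j. a (s j) i))" by (simp add: Bseq_eq_bounded)
    then obtain l r where "strict_mono r" "((\<lambda>j. a (s j) i) \<circ> r) \<longlonglongrightarrow> l"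
      using bounded_imp_convergent_subsequence by blast
    then show "\<exists>r'. strict_mono r' \<and> convergent (\<lambda>j. a ((s \<circ> r') j) i)"
      by (auto simp: o_def convergent_def)
  qed
  have "convergent (\<lambda>j. a ((diagseq \<circ> (+) (Suc i)) j) i)" for i
    by (rule diagseq_holds) (auto simp: o_def dest: convergent_subseq_convergent[unfolded o_def])
  moreover have "(\<lambda>j. a ((diagseq \<circ> (+) (Suc i)) j) i) = (\<lambda>j. a (diagseq (j + Suc i)) i)" for i
    by (simp add: fun_eq_iff add.commute)
  ultimately have "convergent (\<lambda>j. a (diagseq (j + Suc i)) i)" for i by (simp only:)
  then have "convergent (\<lambda>j. a (diagseq j) i)" for i
    using convergent_ignore_initial_segment[of "\<lambda>j. a (diagseq j) i" "Suc i"] by simp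
  then show ?thesis using that subseq_diagseq by blast
qed

text \<open>Expanding around the mean kills the cross term.\<close>

lemma sum_sq_mean_le_const:
  assumes "finite A"
  shows "(\<Sum>x\<in>A. (f x - mean f A)\<^sup>2) \<le> (\<Sum>x\<in>A. (f x - c)\<^sup>2)"
proof (cases "A = {}")
  case False
  define m where "m = mean f A"
  have "(\<Sum>x\<in>A. f x - m) = 0" using assms False by (simp add: m_def mean_def sum_subtractf)
  moreover have "(f x - c)\<^sup>2 = (f x - m)\<^sup>2 + 2 * (m - c) * (f x - m) + (m - c)\<^sup>2" for x
    by (simp add: power2_eq_square algebra_simps)
  ultimately have "(\<Sum>x\<in>A. (f x - c)\<^sup>2) = (\<Sum>x\<in>A. (f x - m)\<^sup>2) + real (card A) * (m - c)\<^sup>2"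
    by (simp add: sum.distrib sum_distrib_left[symmetric])
  then show ?thesis by (simp add: m_def)
qed simp

lemma sq_add3_le: "(a + b + c)\<^sup>2 \<le> 3 * a\<^sup>2 + 3 * b\<^sup>2 + 3 * (c::real)\<^sup>2"
  using zero_le_power2[of "a - b"] zero_le_power2[of "b - c"] zero_le_power2[of "a - c"]
  by (simp add: power2_eq_square algebra_simps)

lemma partition_pick:
  fixes F :: "'b set \<Rightarrow> real"
  assumes "finite \<K>" "disjoint \<K>" "K \<in> \<K>" "x \<in> K"
  shows "(\<Sum>K\<in>\<K>. F K * indicator K x) = F K"
proof -
  have "(\<Sum>L\<in>\<K>. F L * indicator L x) = (\<Sum>L\<in>\<K>. if L = K then F K else 0)"
    using assms by (intro sum.cong) (auto simp: disjoint_def indicator_def)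
  then show ?thesis using assms by simp
qed

lemma sum_partition:
  fixes F :: "'b \<Rightarrow> real"
  assumes "finite V" "finite \<K>" "disjoint \<K>" "V \<subseteq> \<Union>\<K>"
  shows "(\<Sum>x\<in>V. F x) = (\<Sum>K\<in>\<K>. \<Sum>x\<in>V \<inter> K. F x)"
proof -
  have "V = (\<Union>K\<in>\<K>. V \<inter> K)" using assms(4) by blast
  then have "(\<Sum>x\<in>V. F x) = sum F (\<Union>K\<in>\<K>. V \<inter> K)" by simp
  also have "\<dots> = (\<Sum>K\<in>\<K>. \<Sum>x\<in>V \<inter> K. F x)"
    using assms by (intro sum.UNION_disjoint) (auto simp: disjoint_def)
  finally show ?thesis .
qed

lemma coupling_integrals:
  fixes \<mu> \<nu> :: "'a::euclidean_space measure"
  assumes "is_coupling \<mu> \<nu> \<pi>"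
  shows "f \<in> borel_measurable borel \<Longrightarrow> (\<integral>\<^sup>+z. f (fst z) \<partial>\<pi>) = (\<integral>\<^sup>+x. f x \<partial>\<mu>)"
    and "f \<in> borel_measurable borel \<Longrightarrow> (\<integral>\<^sup>+z. f (snd z) \<partial>\<pi>) = (\<integral>\<^sup>+x. f x \<partial>\<nu>)"
    and "AE x in \<mu>. Q x \<Longrightarrow> AE z in \<pi>. Q (fst z)"
    and "AE x in \<nu>. Q x \<Longrightarrow> AE z in \<pi>. Q (snd z)"
    and "fst \<in> \<pi> \<rightarrow>\<^sub>M borel" and "snd \<in> \<pi> \<rightarrow>\<^sub>M borel"
proof -
  have s: "sets \<pi> = sets (borel \<Otimes>\<^sub>M borel)" and d: "distr \<pi> borel fst = \<mu>" "distr \<pi> borel snd = \<nu>"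
    using assms by (auto simp: is_coupling_def)
  show m: "fst \<in> \<pi> \<rightarrow>\<^sub>M borel" "snd \<in> \<pi> \<rightarrow>\<^sub>M borel"
    by (simp_all add: measurable_cong_sets[OF s refl])
  show "f \<in> borel_measurable borel \<Longrightarrow> (\<integral>\<^sup>+z. f (fst z) \<partial>\<pi>) = (\<integral>\<^sup>+x. f x \<partial>\<mu>)"
    using m by (subst d(1)[symmetric]) (simp add: nn_integral_distr)
  show "f \<in> borel_measurable borel \<Longrightarrow> (\<integral>\<^sup>+z. f (snd z) \<partial>\<pi>) = (\<integral>\<^sup>+x. f x \<partial>\<nu>)"
    using m by (subst d(2)[symmetric]) (simp add: nn_integral_distr)
  show "AE x in \<mu>. Q x \<Longrightarrow> AE z in \<pi>. Q (fst z)"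
    using AE_distrD[OF m(1)] d(1) by blast
  show "AE x in \<nu>. Q x \<Longrightarrow> AE z in \<pi>. Q (snd z)"
    using AE_distrD[OF m(2)] d(2) by blast
qed

text \<open>A single coupling witnesses closeness at scale \<open>t\<close>; couplings that are optimal up to \<open>1 / (j + 1)\<close> then
  serve all scales at once.\<close>

lemma TL2_convergesI:
  fixes \<mu> :: "'a::euclidean_space measure"
  assumes *: "\<And>t. 0 < t \<Longrightarrow> eventually (\<lambda>j. \<exists>\<pi>. is_coupling \<mu> (\<nu> j) \<pi> \<and>
      (\<integral>\<^sup>+z. ennreal (norm (fst z - snd z)) \<partial>\<pi>) + (\<integral>\<^sup>+z. ennreal (\<bar>w (fst z) - v j (snd z)\<bar>\<^sup>2) \<partial>\<pi>) \<le> ennreal t) sequentially"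
    and ex: "\<And>j. \<exists>\<pi>. is_coupling \<mu> (\<nu> j) \<pi>"
  shows "TL2_converges \<mu> \<nu> v w"
proof -
  define \<Phi> where "\<Phi> j \<pi> = (\<integral>\<^sup>+z. ennreal (norm (fst z - snd z)) \<partial>\<pi>) + (\<integral>\<^sup>+z. ennreal (\<bar>w (fst z) - v j (snd z)\<bar>\<^sup>2) \<partial>\<pi>)" for j \<pi>
  define I where "I j = (INF \<pi>\<in>{\<pi>. is_coupling \<mu> (\<nu> j) \<pi>}. \<Phi> j \<pi>)" for j
  have "\<exists>\<pi>. is_coupling \<mu> (\<nu> j) \<pi> \<and> \<Phi> j \<pi> \<le> I j + ennreal (1 / real (Suc j))" for j
  proof (cases "I j = \<top>")
    case True
    then show ?thesis using ex[of j] by auto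
  next
    case False
    then have "I j < I j + ennreal (1 / real (Suc j))"
      by (simp add: ennreal_add_left_cancel_less[of "I j" 0, simplified])
    then show ?thesis unfolding I_def INF_less_iff by (auto intro: less_imp_le)
  qed
  then obtain \<pi> where \<pi>: "\<And>j. is_coupling \<mu> (\<nu> j) (\<pi> j)" "\<And>j. \<Phi> j (\<pi> j) \<le> I j + ennreal (1 / real (Suc j))" by metis
  have lim: "(\<lambda>j. \<Phi> j (\<pi> j)) \<longlonglongrightarrow> 0"
  proof (rule order_tendstoI)
    fix a :: ennreal assume "0 < a"
    then obtain b where b: "0 < b" "b < a" using dense by blast
    define t where "t = enn2real b"
    have "b < \<top>" using b(2) by (meson less_le_trans top_greatest)
    then have bt: "b = ennreal t" by (simp add: t_def)
    have t: "0 < t" "ennreal t < a" using b by (simp_all add: bt[symmetric]) (simp add: bt)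
    have "(\<lambda>j. 1 / real (Suc j)) \<longlonglongrightarrow> 0" by (rule LIMSEQ_Suc[OF lim_1_over_n])
    then have "eventually (\<lambda>j. 1 / real (Suc j) < t / 2) sequentially"
      using t(1) by (intro order_tendstoD(2)) auto
    moreover have "eventually (\<lambda>j. I j \<le> ennreal (t / 2)) sequentially"
      using *[of "t / 2"] t(1) by (auto elim!: eventually_mono simp: I_def \<Phi>_def intro: INF_lower2)
    ultimately show "eventually (\<lambda>j. \<Phi> j (\<pi> j) < a) sequentially"
    proof eventually_elim
      case (elim j)
      have "\<Phi> j (\<pi> j) \<le> I j + ennreal (1 / real (Suc j))" by (rule \<pi>(2))
      also have "\<dots> \<le> ennreal (t / 2) + ennreal (t / 2)" using elim by (intro add_mono ennreal_leI) auto
      also have "\<dots> = ennreal t" using t(1) by (subst ennreal_plus[symmetric]) auto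
      finally show ?case using t(2) by (rule le_less_trans)
    qed
  qed simp
  have 1: "(\<lambda>j. \<integral>\<^sup>+z. ennreal (norm (fst z - snd z)) \<partial>\<pi> j) \<longlonglongrightarrow> 0"
    by (rule tendsto_sandwich[OF _ _ tendsto_const lim]) (auto simp: \<Phi>_def)
  have 2: "(\<lambda>j. \<integral>\<^sup>+z. ennreal (\<bar>w (fst z) - v j (snd z)\<bar>\<^sup>2) \<partial>\<pi> j) \<longlonglongrightarrow> 0"
    by (rule tendsto_sandwich[OF _ _ tendsto_const lim]) (auto simp: \<Phi>_def)
  show ?thesis
    unfolding TL2_converges_def using \<pi>(1) 1 2 by (intro exI[of _ \<pi>]) (simp add: split_def)
qed

text \<open>One fixed sample: the compactness argument is deterministic. Frequencies are assumed to
  converge on intersections of cells of two scales, because step functions of different scales are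
  compared. Null cells must be free of sample points, since means over them are not controlled by
  the L2 bound.\<close>

locale piecewise_approximable = prob_space \<mu> for \<mu> :: "'a::euclidean_space measure" +
  fixes S :: "'a set" and V :: "nat \<Rightarrow> 'a set" and \<K> :: "nat \<Rightarrow> 'a set set"
    and v :: "nat \<Rightarrow> 'a \<Rightarrow> real" and B :: real
  assumes sets_\<mu>: "sets \<mu> = sets borel"
    and S: "bounded S" "S \<in> sets borel" "measure \<mu> S = 1"
    and V: "\<And>n. 1 \<le> n \<Longrightarrow> finite (V n)" "\<And>n. 1 \<le> n \<Longrightarrow> card (V n) = n" "\<And>n. 1 \<le> n \<Longrightarrow> V n \<subseteq> S"
    and \<K>: "\<And>k. finite (\<K> k)" "\<And>k. disjoint (\<K> k)" "\<And>k. \<K> k \<subseteq> sets borel" "\<And>k. \<Union>(\<K> k) = S"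
      "\<And>k K x y. K \<in> \<K> k \<Longrightarrow> x \<in> K \<Longrightarrow> y \<in> K \<Longrightarrow> dist x y \<le> (1/2) ^ k"
    and lln: "\<And>k l K L. K \<in> \<K> k \<Longrightarrow> L \<in> \<K> l \<Longrightarrow> (\<lambda>n. real (card (V n \<inter> (K \<inter> L))) / real n) \<longlonglongrightarrow> measure \<mu> (K \<inter> L)"
    and null: "\<And>k K n. K \<in> \<K> k \<Longrightarrow> measure \<mu> K = 0 \<Longrightarrow> 1 \<le> n \<Longrightarrow> V n \<inter> K = {}"
    and v: "\<And>n. 1 \<le> n \<Longrightarrow> v n \<in> borel_measurable borel" "\<And>n. 1 \<le> n \<Longrightarrow> (\<Sum>x\<in>V n. (v n x)\<^sup>2) \<le> real n * B"
    and approx: "\<And>k. eventually (\<lambda>n. \<exists>g. (\<forall>K\<in>\<K> k. \<forall>x\<in>K. \<forall>y\<in>K. g x = g y) \<and>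
      (\<Sum>x\<in>V n. (v n x - g x)\<^sup>2) \<le> real n * (1/4) ^ k) sequentially"
begin

definition A :: "nat \<Rightarrow> 'a set \<Rightarrow> real" where "A n K = mean (v n) (V n \<inter> K)"

definition step :: "nat \<Rightarrow> nat \<Rightarrow> 'a \<Rightarrow> real" where "step n k x = (\<Sum>K\<in>\<K> k. A n K * indicator K x)"

lemma step_eq: "K \<in> \<K> k \<Longrightarrow> x \<in> K \<Longrightarrow> step n k x = A n K"
  unfolding step_def by (rule partition_pick[OF \<K>(1,2)])

lemma sum_cells: "1 \<le> n \<Longrightarrow> (\<Sum>x\<in>V n. F x) = (\<Sum>K\<in>\<K> k. \<Sum>x\<in>V n \<inter> K. F x)" for F :: "'a \<Rightarrow> real"
  using V[of n] \<K>(4)[of k] by (intro sum_partition \<K>) auto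

text \<open>The function \<open>g\<close> in the hypothesis is unknown and varies with
  \<open>n\<close>, but the mean is the best constant on each cell, so \<open>g\<close> can be
  replaced by the cell means.\<close>

lemma ev_step_approx: "eventually (\<lambda>n. (\<Sum>x\<in>V n. (v n x - step n k x)\<^sup>2) \<le> real n * (1/4) ^ k) sequentially"
  using approx[of k] eventually_ge_at_top[of 1]
proof eventually_elim
  case (elim n)
  then obtain g where g: "\<And>K x y. K \<in> \<K> k \<Longrightarrow> x \<in> K \<Longrightarrow> y \<in> K \<Longrightarrow> g x = g y"
    "(\<Sum>x\<in>V n. (v n x - g x)\<^sup>2) \<le> real n * (1/4) ^ k" by blast
  have "(\<Sum>x\<in>V n. (v n x - step n k x)\<^sup>2) = (\<Sum>K\<in>\<K> k. \<Sum>x\<in>V n \<inter> K. (v n x - mean (v n) (V n \<inter> K))\<^sup>2)"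
    by (subst sum_cells[OF elim(2)]) (auto intro!: sum.cong simp: step_eq A_def)
  also have "\<dots> \<le> (\<Sum>K\<in>\<K> k. \<Sum>x\<in>V n \<inter> K. (v n x - g x)\<^sup>2)"
  proof (rule sum_mono)
    fix K assume K: "K \<in> \<K> k"
    show "(\<Sum>x\<in>V n \<inter> K. (v n x - mean (v n) (V n \<inter> K))\<^sup>2) \<le> (\<Sum>x\<in>V n \<inter> K. (v n x - g x)\<^sup>2)"
    proof (cases "V n \<inter> K = {}")
      case False
      then obtain y where y: "y \<in> K" by blast
      have "(\<Sum>x\<in>V n \<inter> K. (v n x - mean (v n) (V n \<inter> K))\<^sup>2) \<le> (\<Sum>x\<in>V n \<inter> K. (v n x - g y)\<^sup>2)"
        using V(1)[OF elim(2)] by (intro sum_sq_mean_le_const) auto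
      also have "\<dots> = (\<Sum>x\<in>V n \<inter> K. (v n x - g x)\<^sup>2)"
        using g(1)[OF K _ y] by (intro sum.cong) auto
      finally show ?thesis .
    qed simp
  qed
  also have "\<dots> = (\<Sum>x\<in>V n. (v n x - g x)\<^sup>2)" by (rule sum_cells[OF elim(2), symmetric])
  finally show ?case using g(2) by linarith
qed

lemma lln1: "K \<in> \<K> k \<Longrightarrow> (\<lambda>n. real (card (V n \<inter> K)) / real n) \<longlonglongrightarrow> measure \<mu> K"
  using lln[of K k K k] by simp

text \<open>A cell of mass p > 0 eventually holds more than the fraction p / 2 of the sample, so the
  mean of v^2 over it is at most 2 B / p. Null cells contain no sample point and have mean
  0.\<close>

lemma A_bounded:
  assumes K: "K \<in> \<K> k"
  shows "\<exists>C. eventually (\<lambda>n. \<bar>A n K\<bar> \<le> C) sequentially"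
proof (cases "measure \<mu> K = 0")
  case True
  have "eventually (\<lambda>n. \<bar>A n K\<bar> \<le> 0) sequentially"
    using eventually_ge_at_top[of 1] by eventually_elim (simp add: A_def mean_def null[OF K True])
  then show ?thesis by blast
next
  case False
  define p where "p = measure \<mu> K"
  have p: "0 < p" using False by (simp add: p_def zero_less_measure_iff)
  have "eventually (\<lambda>n. p / 2 < real (card (V n \<inter> K)) / real n) sequentially"
    using lln1[OF K] p by (intro order_tendstoD(1)) (auto simp: p_def)
  then have "eventually (\<lambda>n. \<bar>A n K\<bar> \<le> 1 + 2 * B / p) sequentially"
    using eventually_ge_at_top[of 1]
  proof eventually_elim
    case (elim n)
    have n: "0 < real n" using elim by simp
    have c: "p / 2 * real n < real (card (V n \<inter> K))" using elim(1) n by (simp add: pos_less_divide_eq)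
    have c0: "0 < real (card (V n \<inter> K))" using c p n by (smt (verit) mult_pos_pos half_gt_zero)
    have B0: "0 \<le> real n * B" using v(2)[OF elim(2)] sum_nonneg[of "V n" "\<lambda>x. (v n x)\<^sup>2"] by simp
    have "(A n K)\<^sup>2 \<le> mean (\<lambda>x. (v n x)\<^sup>2) (V n \<inter> K)"
      unfolding A_def using V(1)[OF elim(2)] by (intro mean_sq_le) auto
    also have "\<dots> \<le> (\<Sum>x\<in>V n. (v n x)\<^sup>2) / real (card (V n \<inter> K))"
      unfolding mean_def using V(1)[OF elim(2)] by (intro divide_right_mono sum_mono2) auto
    also have "\<dots> \<le> (real n * B) / real (card (V n \<inter> K))"
      using v(2)[OF elim(2)] by (intro divide_right_mono) auto
    also have "\<dots> \<le> (real n * B) / (p / 2 * real n)"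
      using c c0 B0 p n by (intro divide_left_mono) auto
    also have "\<dots> = 2 * B / p" using n by simp
    finally have sq: "(A n K)\<^sup>2 \<le> 2 * B / p" .
    have "\<bar>A n K\<bar> \<le> 1 + (A n K)\<^sup>2"
    proof -
      have "0 \<le> (\<bar>A n K\<bar> - 1)\<^sup>2" by simp
      then have "2 * \<bar>A n K\<bar> \<le> 1 + (A n K)\<^sup>2" by (simp add: power2_diff)
      then show ?thesis by simp
    qed
    then show ?case using sq by linarith
  qed
  then show ?thesis by blast
qed

lemma S_nonempty: "S \<noteq> {}"
  using S(3) by auto

lemma K_nonempty: "\<K> k \<noteq> {}"
  using S_nonempty \<K>(4)[of k] by auto

lemma AE_S: "AE x in \<mu>. x \<in> S"
proof -
  have "prob S = 1" by (rule S(3))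
  then show ?thesis using S(2) sets_\<mu> by (intro AE_prob_1) auto
qed

lemma subsequence:
  obtains r :: "nat \<Rightarrow> nat" and \<alpha> where "strict_mono r" "1 \<le> r 0"
    "\<And>k K. K \<in> \<K> k \<Longrightarrow> (\<lambda>j. A (r j) K) \<longlonglongrightarrow> \<alpha> K"
proof -
  \<comment> \<open>Gives every cell of every scale an index, so that a single diagonal argument
    treats all of them.\<close>
  define cell where "cell i = from_nat_into (\<K> (fst (prod_decode i))) (snd (prod_decode i))" for i
  have "\<exists>C. eventually (\<lambda>n. \<bar>A n (cell i)\<bar> \<le> C) sequentially" for i
    unfolding cell_def by (rule A_bounded[OF from_nat_into[OF K_nonempty]])
  then obtain r where r: "strict_mono r" "\<And>i. convergent (\<lambda>j. A (r j) (cell i))"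
    using bounded_diagonal_subsequence[of "\<lambda>n i. A n (cell i)"] by blast
  have "convergent (\<lambda>j. A (r j) K)" if K: "K \<in> \<K> k" for k K
  proof -
    obtain m where "from_nat_into (\<K> k) m = K"
      using from_nat_into_surj[OF countable_finite[OF \<K>(1)] K] by blast
    then have "cell (prod_encode (k, m)) = K" by (simp add: cell_def)
    then show ?thesis using r(2) by metis
  qed
  \<comment> \<open>Dropping the first term of the subsequence ensures sample sizes of at least
    1.\<close>
  then have "(\<lambda>j. A (r (Suc j)) K) \<longlonglongrightarrow> lim (\<lambda>j. A (r j) K)" if "K \<in> \<K> k" for k K
    using that by (intro LIMSEQ_Suc) (auto simp: convergent_LIMSEQ_iff)
  moreover have "strict_mono (\<lambda>j. r (Suc j))" using r(1) by (simp add: strict_mono_def)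
  moreover have "1 \<le> r (Suc 0)" using strict_mono_imp_increasing[OF r(1), of "Suc 0"] by simp
  ultimately show ?thesis using that[of "\<lambda>j. r (Suc j)" "\<lambda>K. lim (\<lambda>j. A (r j) K)"] by blast
qed

text \<open>Over intersections of cells the frequencies converge; in this form the squared distance
  of two step functions passes to the limit along the subsequence.\<close>

lemma step_difference:
  assumes "1 \<le> n"
  shows "(\<Sum>x\<in>V n. (step n k x - step n l x)\<^sup>2) = (\<Sum>K\<in>\<K> k. \<Sum>L\<in>\<K> l. (A n K - A n L)\<^sup>2 * real (card (V n \<inter> (K \<inter> L))))"
proof -
  have "(\<Sum>x\<in>V n. (step n k x - step n l x)\<^sup>2) = (\<Sum>K\<in>\<K> k. \<Sum>x\<in>V n \<inter> K. (step n k x - step n l x)\<^sup>2)"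
    by (rule sum_cells[OF assms])
  also have "\<dots> = (\<Sum>K\<in>\<K> k. \<Sum>L\<in>\<K> l. \<Sum>x\<in>V n \<inter> K \<inter> L. (step n k x - step n l x)\<^sup>2)"
    using V[OF assms] \<K>(4)[of l] by (intro sum.cong refl sum_partition \<K>) auto
  also have "\<dots> = (\<Sum>K\<in>\<K> k. \<Sum>L\<in>\<K> l. (A n K - A n L)\<^sup>2 * real (card (V n \<inter> (K \<inter> L))))"
  proof (intro sum.cong refl)
    fix K L assume KL: "K \<in> \<K> k" "L \<in> \<K> l"
    have "(\<Sum>x\<in>V n \<inter> K \<inter> L. (step n k x - step n l x)\<^sup>2) = (\<Sum>x\<in>V n \<inter> K \<inter> L. (A n K - A n L)\<^sup>2)"
      using KL by (intro sum.cong) (auto simp: step_eq)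
    then show "(\<Sum>x\<in>V n \<inter> K \<inter> L. (step n k x - step n l x)\<^sup>2) = (A n K - A n L)\<^sup>2 * real (card (V n \<inter> (K \<inter> L)))"
      by (simp add: Int_assoc mult.commute)
  qed
  finally show ?thesis .
qed

text \<open>The limits of the cell means define functions \<open>f k\<close>. Comparing the steps of
  scales k and l through \<open>v\<close> gives the Cauchy rate for \<open>f k\<close>, hence a
  limit \<open>w\<close>. Finally \<open>w\<close>, \<open>f k\<close> and \<open>v\<close> are
  compared under couplings that match the cells of scale k up to a vanishing mass.\<close>

theorem TL2_compact:
  obtains r :: "nat \<Rightarrow> nat" and w where "strict_mono r" "1 \<le> r 0" "w \<in> borel_measurable borel"
    "(\<integral>\<^sup>+x. ennreal ((w x)\<^sup>2) \<partial>\<mu>) < \<infinity>"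
    "TL2_converges \<mu> (\<lambda>j. empirical_measure (r j) (V (r j))) (\<lambda>j. v (r j)) w"
proof -
  obtain r \<alpha> where r: "strict_mono r" "1 \<le> r 0"
    and \<alpha>: "\<And>k K. K \<in> \<K> k \<Longrightarrow> (\<lambda>j. A (r j) K) \<longlonglongrightarrow> \<alpha> K"
    using subsequence by metis
  have r1: "1 \<le> r j" for j
    using r strict_mono_less_eq[OF r(1), of 0 j] by simp
  have rlim: "filterlim r at_top sequentially" by (rule filterlim_subseq[OF r(1)])
  have evr: "eventually (\<lambda>j. Q (r j)) sequentially" if "eventually Q sequentially" for Q
    using that rlim by (auto simp: filterlim_iff)
  have llnr: "(\<lambda>j. real (card (V (r j) \<inter> (K \<inter> L))) / real (r j)) \<longlonglongrightarrow> measure \<mu> (K \<inter> L)" if "K \<in> \<K> k" "L \<in> \<K> l" for k l K L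
    using filterlim_compose[OF lln[OF that] rlim] .
  define f where "f k x = (\<Sum>K\<in>\<K> k. \<alpha> K * indicator K x)" for k x
  have f_eq: "f k x = \<alpha> K" if "K \<in> \<K> k" "x \<in> K" for k K x
    unfolding f_def using that by (rule partition_pick[OF \<K>(1,2)])
  have Kb: "K \<in> sets borel" if "K \<in> \<K> k" for k K using \<K>(3) that by blast
  have fb: "f k \<in> borel_measurable borel" for k
    unfolding f_def using Kb by (intro borel_measurable_sum borel_measurable_times measurable_const borel_measurable_indicator) auto
  have meas_cong: "g \<in> borel_measurable \<mu> \<longleftrightarrow> g \<in> borel_measurable borel" for g :: "'a \<Rightarrow> real"
    by (simp add: measurable_cong_sets[OF sets_\<mu> refl])
  have Cauchy: "(\<integral>\<^sup>+x. ennreal ((f k x - f l x)\<^sup>2) \<partial>\<mu>) \<le> ennreal (4 * (1/4) ^ k)" if kl: "k \<le> l" for k l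
  proof -
    have "(\<lambda>j. \<Sum>K\<in>\<K> k. \<Sum>L\<in>\<K> l. (A (r j) K - A (r j) L)\<^sup>2 * (real (card (V (r j) \<inter> (K \<inter> L))) / real (r j)))
        \<longlonglongrightarrow> (\<Sum>K\<in>\<K> k. \<Sum>L\<in>\<K> l. (\<alpha> K - \<alpha> L)\<^sup>2 * measure \<mu> (K \<inter> L))"
      by (intro tendsto_intros \<alpha> llnr)
    moreover have "eventually (\<lambda>j. (\<Sum>K\<in>\<K> k. \<Sum>L\<in>\<K> l. (A (r j) K - A (r j) L)\<^sup>2 * (real (card (V (r j) \<inter> (K \<inter> L))) / real (r j)))
        \<le> 4 * (1/4) ^ k) sequentially"
      using evr[OF ev_step_approx[of k]] evr[OF ev_step_approx[of l]]
    proof eventually_elim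
      case (elim j)
      have n: "0 < real (r j)" using r1[of j] by simp
      have "(\<Sum>x\<in>V (r j). (step (r j) k x - step (r j) l x)\<^sup>2)
          \<le> (\<Sum>x\<in>V (r j). 2 * (v (r j) x - step (r j) k x)\<^sup>2 + 2 * (v (r j) x - step (r j) l x)\<^sup>2)"
      proof (rule sum_mono)
        fix x
        show "(step (r j) k x - step (r j) l x)\<^sup>2 \<le> 2 * (v (r j) x - step (r j) k x)\<^sup>2 + 2 * (v (r j) x - step (r j) l x)\<^sup>2"
          using sq_add_le[of "step (r j) k x - v (r j) x" "v (r j) x - step (r j) l x"] by (simp add: power2_commute)
      qed
      also have "\<dots> = 2 * (\<Sum>x\<in>V (r j). (v (r j) x - step (r j) k x)\<^sup>2) + 2 * (\<Sum>x\<in>V (r j). (v (r j) x - step (r j) l x)\<^sup>2)"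
        by (simp add: sum.distrib sum_distrib_left)
      also have "\<dots> \<le> 2 * (real (r j) * (1/4) ^ k) + 2 * (real (r j) * (1/4) ^ l)" using elim by linarith
      also have "\<dots> \<le> 2 * (real (r j) * (1/4) ^ k) + 2 * (real (r j) * (1/4) ^ k)"
        using kl by (intro add_left_mono mult_left_mono power_decreasing) auto
      finally have le: "(\<Sum>x\<in>V (r j). (step (r j) k x - step (r j) l x)\<^sup>2) / real (r j) \<le> 4 * (1/4) ^ k"
        using n by (simp add: pos_divide_le_eq mult_ac)
      then show ?case
        unfolding step_difference[OF r1] by (simp add: sum_divide_distrib)
    qed
    ultimately have lim: "(\<Sum>K\<in>\<K> k. \<Sum>L\<in>\<K> l. (\<alpha> K - \<alpha> L)\<^sup>2 * measure \<mu> (K \<inter> L)) \<le> 4 * (1/4) ^ k"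
      by (rule tendsto_upperbound) simp
    have "(\<integral>\<^sup>+x. ennreal ((f k x - f l x)\<^sup>2) \<partial>\<mu>)
        \<le> (\<integral>\<^sup>+x. (\<Sum>K\<in>\<K> k. \<Sum>L\<in>\<K> l. ennreal ((\<alpha> K - \<alpha> L)\<^sup>2) * indicator (K \<inter> L) x) \<partial>\<mu>)"
    proof (rule nn_integral_mono_AE, use AE_S in eventually_elim)
      case (elim x)
      obtain K where K: "K \<in> \<K> k" "x \<in> K" using elim \<K>(4)[of k] by blast
      obtain L where L: "L \<in> \<K> l" "x \<in> L" using elim \<K>(4)[of l] by blast
      have "ennreal ((f k x - f l x)\<^sup>2) = ennreal ((\<alpha> K - \<alpha> L)\<^sup>2) * indicator (K \<inter> L) x"
        using K L by (simp add: f_eq)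
      also have "\<dots> \<le> (\<Sum>L\<in>\<K> l. ennreal ((\<alpha> K - \<alpha> L)\<^sup>2) * indicator (K \<inter> L) x)"
        using \<K>(1) L(1) by (intro member_le_sum) auto
      also have "\<dots> \<le> (\<Sum>K\<in>\<K> k. \<Sum>L\<in>\<K> l. ennreal ((\<alpha> K - \<alpha> L)\<^sup>2) * indicator (K \<inter> L) x)"
        using \<K>(1) K(1) by (intro member_le_sum) auto
      finally show ?case .
    qed
    also have "\<dots> = (\<Sum>K\<in>\<K> k. \<Sum>L\<in>\<K> l. ennreal ((\<alpha> K - \<alpha> L)\<^sup>2) * emeasure \<mu> (K \<inter> L))"
      using Kb sets_\<mu> by (simp add: nn_integral_sum nn_integral_cmult_indicator)
    also have "\<dots> = ennreal (\<Sum>K\<in>\<K> k. \<Sum>L\<in>\<K> l. (\<alpha> K - \<alpha> L)\<^sup>2 * measure \<mu> (K \<inter> L))"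
      by (simp add: emeasure_eq_measure ennreal_mult[symmetric] sum_nonneg)
    also have "\<dots> \<le> ennreal (4 * (1/4) ^ k)" by (rule ennreal_leI[OF lim])
    finally show ?thesis .
  qed
  obtain w where w: "w \<in> borel_measurable \<mu>" "\<And>k. (\<integral>\<^sup>+x. ennreal ((f k x - w x)\<^sup>2) \<partial>\<mu>) \<le> ennreal (4 * (1/4) ^ k)"
    using L2_limit_of_fast_Cauchy[OF prob_space_axioms, of f] fb Cauchy by (auto simp: meas_cong)
  have wb: "w \<in> borel_measurable borel" using w(1) meas_cong by blast
  have f_abs: "\<bar>f k x\<bar> \<le> (\<Sum>K\<in>\<K> k. \<bar>\<alpha> K\<bar>)" for k x
    unfolding f_def by (rule order_trans[OF sum_abs]) (auto intro!: sum_mono simp: indicator_def)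
  have fin: "(\<integral>\<^sup>+x. ennreal ((w x)\<^sup>2) \<partial>\<mu>) < \<infinity>"
  proof -
    define C where "C = (\<Sum>K\<in>\<K> 0. \<bar>\<alpha> K\<bar>)"
    have "(\<integral>\<^sup>+x. ennreal ((w x)\<^sup>2) \<partial>\<mu>) \<le> (\<integral>\<^sup>+x. 2 * ennreal ((f 0 x - w x)\<^sup>2) + ennreal (2 * C\<^sup>2) \<partial>\<mu>)"
    proof (rule nn_integral_mono)
      fix x
      have "(f 0 x)\<^sup>2 \<le> C\<^sup>2" using f_abs[of 0 x] unfolding C_def by (metis abs_ge_zero power2_abs power_mono)
      then have "(w x)\<^sup>2 \<le> 2 * (f 0 x - w x)\<^sup>2 + 2 * C\<^sup>2"
        using sq_add_le[of "w x - f 0 x" "f 0 x"] by (simp add: power2_commute)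
      then have "ennreal ((w x)\<^sup>2) \<le> ennreal (2 * (f 0 x - w x)\<^sup>2 + 2 * C\<^sup>2)" by (rule ennreal_leI)
      then show "ennreal ((w x)\<^sup>2) \<le> 2 * ennreal ((f 0 x - w x)\<^sup>2) + ennreal (2 * C\<^sup>2)"
        by (simp add: ennreal_mult)
    qed
    also have "\<dots> = 2 * (\<integral>\<^sup>+x. ennreal ((f 0 x - w x)\<^sup>2) \<partial>\<mu>) + ennreal (2 * C\<^sup>2)"
    proof -
      have [measurable]: "f 0 \<in> borel_measurable \<mu>" "w \<in> borel_measurable \<mu>" using fb w(1) by (simp_all add: meas_cong)
      show ?thesis by (subst nn_integral_add) (auto simp: nn_integral_cmult emeasure_space_1)
    qed
    also have "\<dots> \<le> 2 * ennreal (4 * (1/4) ^ 0) + ennreal (2 * C\<^sup>2)"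
      by (intro add_right_mono mult_left_mono w(2)) auto
    also have "\<dots> < \<infinity>" by (simp add: ennreal_mult_less_top)
    finally show ?thesis .
  qed
  obtain Dm where Dm: "0 < Dm" "\<And>x y. x \<in> S \<Longrightarrow> y \<in> S \<Longrightarrow> norm (x - y) \<le> Dm"
  proof -
    obtain b where b: "0 < b" "\<And>x. x \<in> S \<Longrightarrow> norm x \<le> b" using S(1) bounded_pos by blast
    have "norm (x - y) \<le> 2 * b" if "x \<in> S" "y \<in> S" for x y
      using b(2)[OF that(1)] b(2)[OF that(2)] norm_triangle_ineq4[of x y] by linarith
    then show ?thesis using that[of "2 * b"] b(1) by simp
  qed
  have conv: "TL2_converges \<mu> (\<lambda>j. empirical_measure (r j) (V (r j))) (\<lambda>j. v (r j)) w"
  proof (rule TL2_convergesI)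
    define \<nu> where "\<nu> j = empirical_measure (r j) (V (r j))" for j
    have \<nu>: "prob_space (\<nu> j)" "sets (\<nu> j) = sets borel" for j
      unfolding \<nu>_def using V r1 by (auto intro!: prob_space_empirical_measure)
    have m\<nu>: "measure (\<nu> j) K = real (card (V (r j) \<inter> K)) / real (r j)" if "K \<in> sets borel" for j K
      unfolding \<nu>_def using that V(1)[OF r1] by (simp add: measure_empirical_measure)
    show "\<exists>\<pi>. is_coupling \<mu> (empirical_measure (r j) (V (r j))) \<pi>" for j
      using coupling_of_partition[OF prob_space_axioms sets_\<mu> \<nu>, of "{UNIV}" j] unfolding \<nu>_def by auto
    fix t :: real assume t: "0 < t"
    \<comment> \<open>The errors depending on k are (1/2)^k from the diameters and 18 (1/4)^k from
      the approximations, together less than 19 t / 40; the other half of t is left for terms in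
      \<delta> and \<theta>, which tend to 0.\<close>
    obtain k where k: "(1/2) ^ k < t / 40"
      using real_arch_pow_inv[of "t / 40" "1/2"] t by auto
    \<comment> \<open>The complement of \<open>S\<close> completes the cells to a partition of the
      whole space, as the coupling lemma demands; neither measure charges it.\<close>
    define P where "P = insert (- S) (\<K> k)"
    have P: "finite P" "disjoint P" "P \<subseteq> sets borel" "\<Union>P = UNIV"
    proof -
      show "finite P" using \<K>(1) by (simp add: P_def)
      show "\<Union>P = UNIV" using \<K>(4)[of k] by (auto simp: P_def)
      show "P \<subseteq> sets borel" using \<K>(3)[of k] S(2) by (auto simp: P_def)
      show "disjoint P" using \<K>(2)[of k] \<K>(4)[of k] unfolding P_def disjoint_def by blast
    qed
    define C where "C = (\<Sum>K\<in>\<K> k. \<bar>\<alpha> K\<bar>)"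
    define \<delta> where "\<delta> j = (\<Sum>K\<in>P. measure \<mu> K - min (measure \<mu> K) (measure (\<nu> j) K))" for j
    define \<theta> where "\<theta> j = (\<Sum>K\<in>\<K> k. (\<alpha> K - A (r j) K)\<^sup>2)" for j
    have "\<delta> \<longlonglongrightarrow> (\<Sum>K\<in>P. measure \<mu> K - min (measure \<mu> K) (measure \<mu> K))"
      unfolding \<delta>_def
    proof (intro tendsto_intros tendsto_min)
      fix K assume K: "K \<in> P"
      show "(\<lambda>j. measure (\<nu> j) K) \<longlonglongrightarrow> measure \<mu> K"
      proof (cases "K = - S")
        case True
        have "V (r j) \<inter> - S = {}" for j using V(3)[OF r1[of j]] by blast
        moreover have "measure \<mu> (- S) = 0"
          using prob_compl[of S] S sets_\<mu> sets_eq_imp_space_eq[OF sets_\<mu>] by (simp add: Compl_eq_Diff_UNIV)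
        ultimately show ?thesis using S(2) by (simp add: True m\<nu>)
      next
        case False
        then have KK: "K \<in> \<K> k" using K by (simp add: P_def)
        show ?thesis using llnr[OF KK KK] Kb[OF KK] by (simp add: m\<nu>)
      qed
    qed
    then have \<delta>: "\<delta> \<longlonglongrightarrow> 0" by simp
    have "\<theta> \<longlonglongrightarrow> (\<Sum>K\<in>\<K> k. (\<alpha> K - \<alpha> K)\<^sup>2)" unfolding \<theta>_def by (intro tendsto_intros \<alpha>)
    then have \<theta>: "\<theta> \<longlonglongrightarrow> 0" by simp
    have "(\<lambda>j. (Dm + 3 * (2 * C)\<^sup>2) * \<delta> j + 6 * \<theta> j) \<longlonglongrightarrow> (Dm + 3 * (2 * C)\<^sup>2) * 0 + 6 * 0"
      by (intro tendsto_intros \<delta> \<theta>)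
    then have "eventually (\<lambda>j. (Dm + 3 * (2 * C)\<^sup>2) * \<delta> j + 6 * \<theta> j < t / 2) sequentially"
      using t by (intro order_tendstoD(2)) auto
    then show "eventually (\<lambda>j. \<exists>\<pi>. is_coupling \<mu> (empirical_measure (r j) (V (r j))) \<pi> \<and>
      (\<integral>\<^sup>+z. ennreal (norm (fst z - snd z)) \<partial>\<pi>) + (\<integral>\<^sup>+z. ennreal (\<bar>w (fst z) - v (r j) (snd z)\<bar>\<^sup>2) \<partial>\<pi>) \<le> ennreal t) sequentially"
      using evr[OF ev_step_approx[of k]]
    proof eventually_elim
      case (elim j)
      let ?n = "r j"
      have n: "0 < real ?n" "1 \<le> ?n" using r1[of j] by auto
      define bad where "bad = {z :: 'a \<times> 'a. \<not> (\<exists>K\<in>P. fst z \<in> K \<and> snd z \<in> K)}"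
      obtain \<pi> where \<pi>: "is_coupling \<mu> (\<nu> j) \<pi>" "emeasure \<pi> bad \<le> ennreal (\<delta> j)"
        by (rule coupling_of_partition[OF prob_space_axioms sets_\<mu> \<nu>(1)[of j] \<nu>(2)[of j] P, folded bad_def \<delta>_def])
      note ci = coupling_integrals[OF \<pi>(1)]
      have \<delta>0: "0 \<le> \<delta> j" unfolding \<delta>_def by (intro sum_nonneg) auto
      have sets\<pi>: "sets \<pi> = sets (borel \<Otimes>\<^sub>M borel)" using \<pi>(1) by (simp add: is_coupling_def)
      have bad_sets: "bad \<in> sets \<pi>"
      proof -
        have sp: "space \<pi> = UNIV" using sets_eq_imp_space_eq[OF sets\<pi>] by (simp add: space_pair_measure)
        have "K \<times> K \<in> sets \<pi>" if "K \<in> P" for K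
          unfolding sets\<pi> using P(3) that by (intro pair_measureI) blast+
        then have "(\<Union>K\<in>P. K \<times> K) \<in> sets \<pi>" using P(1) by (intro sets.finite_UN)
        then have "space \<pi> - (\<Union>K\<in>P. K \<times> K) \<in> sets \<pi>" by (rule sets.compl_sets)
        also have "space \<pi> - (\<Union>K\<in>P. K \<times> K) = bad" unfolding bad_def sp by (simp add: set_eq_iff mem_Times_iff)
        finally show ?thesis .
      qed
      have one: "emeasure \<pi> (space \<pi>) = 1"
      proof -
        have "emeasure \<pi> (space \<pi>) = (\<integral>\<^sup>+z. 1 \<partial>\<pi>)" by simp
        also have "\<dots> = (\<integral>\<^sup>+x. 1 \<partial>\<mu>)" by (rule ci(1)) simp
        finally show ?thesis by (simp add: emeasure_space_1)
      qed
      have AE1: "AE z in \<pi>. fst z \<in> S" by (rule ci(3)[OF AE_S])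
      have AE2: "AE z in \<pi>. snd z \<in> S"
      proof (rule ci(4))
        interpret \<nu>: prob_space "\<nu> j" by (rule \<nu>)
        have "V ?n \<inter> S = V ?n" using V(3)[OF n(2)] by blast
        then have "measure (\<nu> j) S = 1" using S(2) V(2)[OF n(2)] n by (simp add: m\<nu>)
        then show "AE x in \<nu> j. x \<in> S" using S(2) \<nu>(2) by (intro \<nu>.AE_prob_1) auto
      qed
      have good: "\<exists>K\<in>\<K> k. fst z \<in> K \<and> snd z \<in> K" if "z \<notin> bad" "fst z \<in> S" for z
        using that by (auto simp: bad_def P_def)
      have I1: "(\<integral>\<^sup>+z. ennreal (norm (fst z - snd z)) \<partial>\<pi>) \<le> ennreal ((1/2) ^ k + Dm * \<delta> j)"
      proof -
        have "(\<integral>\<^sup>+z. ennreal (norm (fst z - snd z)) \<partial>\<pi>) \<le> (\<integral>\<^sup>+z. ennreal ((1/2) ^ k) + ennreal Dm * indicator bad z \<partial>\<pi>)"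
        proof (rule nn_integral_mono_AE, use AE1 AE2 in eventually_elim)
          case (elim z)
          show ?case
          proof (cases "z \<in> bad")
            case True
            have "ennreal (norm (fst z - snd z)) \<le> ennreal Dm" using Dm(2) elim by (intro ennreal_leI) auto
            also have "\<dots> \<le> ennreal ((1/2) ^ k) + ennreal Dm" by simp
            finally show ?thesis using True by simp
          next
            case False
            then obtain K where "K \<in> \<K> k" "fst z \<in> K" "snd z \<in> K" using good elim by blast
            then show ?thesis using \<K>(5)[of K k "fst z" "snd z"] False by (simp add: dist_norm ennreal_leI)
          qed
        qed
        also have "\<dots> = ennreal ((1/2) ^ k) + ennreal Dm * emeasure \<pi> bad"
          using bad_sets one by (simp add: nn_integral_add nn_integral_cmult_indicator)
        also have "\<dots> \<le> ennreal ((1/2) ^ k) + ennreal Dm * ennreal (\<delta> j)"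
          by (intro add_left_mono mult_left_mono \<pi>(2)) auto
        also have "\<dots> = ennreal ((1/2) ^ k + Dm * \<delta> j)"
          using Dm(1) \<delta>0 by (simp add: ennreal_mult)
        finally show ?thesis .
      qed
      have third: "(\<integral>\<^sup>+y. ennreal ((f k y - v ?n y)\<^sup>2) \<partial>\<nu> j) \<le> ennreal (2 * \<theta> j + 2 * (1/4) ^ k)"
      proof -
        have "(\<Sum>x\<in>V ?n. (f k x - v ?n x)\<^sup>2) \<le> (\<Sum>x\<in>V ?n. 2 * \<theta> j + 2 * (v ?n x - step ?n k x)\<^sup>2)"
        proof (rule sum_mono)
          fix x assume x: "x \<in> V ?n"
          obtain K where K: "K \<in> \<K> k" "x \<in> K" using x V(3)[OF n(2)] \<K>(4)[of k] by blast
          have "(f k x - step ?n k x)\<^sup>2 \<le> \<theta> j"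
            unfolding \<theta>_def f_eq[OF K] step_eq[OF K] using \<K>(1) K(1) by (intro member_le_sum) auto
          then show "(f k x - v ?n x)\<^sup>2 \<le> 2 * \<theta> j + 2 * (v ?n x - step ?n k x)\<^sup>2"
            using sq_add_le[of "f k x - step ?n k x" "step ?n k x - v ?n x"] by (simp add: power2_commute)
        qed
        also have "\<dots> = real ?n * (2 * \<theta> j) + 2 * (\<Sum>x\<in>V ?n. (v ?n x - step ?n k x)\<^sup>2)"
          using V(2)[OF n(2)] by (simp add: sum.distrib sum_distrib_left)
        also have "\<dots> \<le> real ?n * (2 * \<theta> j) + 2 * (real ?n * (1/4) ^ k)" using elim(2) by linarith
        also have "\<dots> = real ?n * (2 * \<theta> j + 2 * (1/4) ^ k)" by (simp add: algebra_simps)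
        finally have le: "1 / real ?n * (\<Sum>x\<in>V ?n. (f k x - v ?n x)\<^sup>2) \<le> 2 * \<theta> j + 2 * (1/4) ^ k"
          using n by (simp add: pos_divide_le_eq mult.commute)
        have "(\<integral>\<^sup>+y. ennreal ((f k y - v ?n y)\<^sup>2) \<partial>\<nu> j) = ennreal (1 / real ?n) * (\<Sum>x\<in>V ?n. ennreal ((f k x - v ?n x)\<^sup>2))"
          unfolding \<nu>_def using fb v(1)[OF n(2)] V(1)[OF n(2)] by (intro nn_integral_empirical_measure) auto
        also have "\<dots> = ennreal (1 / real ?n * (\<Sum>x\<in>V ?n. (f k x - v ?n x)\<^sup>2))"
          by (subst ennreal_mult) (auto simp: sum_nonneg)
        also have "\<dots> \<le> ennreal (2 * \<theta> j + 2 * (1/4) ^ k)" by (rule ennreal_leI[OF le])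
        finally show ?thesis .
      qed
      have \<theta>0: "0 \<le> \<theta> j" unfolding \<theta>_def by (intro sum_nonneg) auto
      have I2: "(\<integral>\<^sup>+z. ennreal (\<bar>w (fst z) - v ?n (snd z)\<bar>\<^sup>2) \<partial>\<pi>)
          \<le> ennreal (3 * (4 * (1/4) ^ k) + 3 * (2 * \<theta> j + 2 * (1/4) ^ k) + 3 * (2 * C)\<^sup>2 * \<delta> j)"
      proof -
        have m1: "(\<lambda>x. ennreal ((f k x - w x)\<^sup>2)) \<in> borel_measurable borel" using fb wb by measurable
        have m2: "(\<lambda>x. ennreal ((f k x - v ?n x)\<^sup>2)) \<in> borel_measurable borel" using fb v(1)[OF n(2)] by measurable
        have "(\<integral>\<^sup>+z. ennreal (\<bar>w (fst z) - v ?n (snd z)\<bar>\<^sup>2) \<partial>\<pi>)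
            \<le> (\<integral>\<^sup>+z. 3 * ennreal ((f k (fst z) - w (fst z))\<^sup>2) + 3 * ennreal ((f k (snd z) - v ?n (snd z))\<^sup>2)
                + ennreal (3 * (2 * C)\<^sup>2) * indicator bad z \<partial>\<pi>)"
        proof (rule nn_integral_mono_AE, use AE1 in eventually_elim)
          case (elim z)
          define c where "c = 3 * (2 * C)\<^sup>2 * (indicator bad z :: real)"
          have "3 * (f k (fst z) - f k (snd z))\<^sup>2 \<le> c"
          proof (cases "z \<in> bad")
            case True
            have "\<bar>f k (fst z) - f k (snd z)\<bar> \<le> 2 * C"
              using f_abs[of k "fst z"] f_abs[of k "snd z"] unfolding C_def by linarith
            then have "\<bar>f k (fst z) - f k (snd z)\<bar>\<^sup>2 \<le> (2 * C)\<^sup>2" by (intro power_mono) auto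
            then show ?thesis using True by (simp add: c_def)
          next
            case False
            then obtain K where "K \<in> \<K> k" "fst z \<in> K" "snd z \<in> K" using good elim by blast
            then show ?thesis using False by (simp add: f_eq c_def)
          qed
          \<comment> \<open>Passing from \<open>w\<close> to \<open>v\<close> through
            \<open>f k\<close> at both points leaves a middle difference. It vanishes for pairs in a
            common cell; otherwise it is at most 2 C, on a set of mass at most
            \<open>\<delta> j\<close>.\<close>
          then have "\<bar>w (fst z) - v ?n (snd z)\<bar>\<^sup>2 \<le> 3 * (f k (fst z) - w (fst z))\<^sup>2 + 3 * (f k (snd z) - v ?n (snd z))\<^sup>2 + c"
            using sq_add3_le[of "w (fst z) - f k (fst z)" "f k (snd z) - v ?n (snd z)" "f k (fst z) - f k (snd z)"]
            by (simp add: power2_commute)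
          then have "ennreal (\<bar>w (fst z) - v ?n (snd z)\<bar>\<^sup>2) \<le> ennreal (3 * (f k (fst z) - w (fst z))\<^sup>2 + 3 * (f k (snd z) - v ?n (snd z))\<^sup>2 + c)"
            by (rule ennreal_leI)
          also have "\<dots> = 3 * ennreal ((f k (fst z) - w (fst z))\<^sup>2) + 3 * ennreal ((f k (snd z) - v ?n (snd z))\<^sup>2)
                + ennreal (3 * (2 * C)\<^sup>2) * indicator bad z"
            by (simp add: c_def ennreal_mult indicator_def)
          finally show ?case .
        qed
        also have "\<dots> = 3 * (\<integral>\<^sup>+x. ennreal ((f k x - w x)\<^sup>2) \<partial>\<mu>) + 3 * (\<integral>\<^sup>+y. ennreal ((f k y - v ?n y)\<^sup>2) \<partial>\<nu> j)
            + ennreal (3 * (2 * C)\<^sup>2) * emeasure \<pi> bad"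
          using bad_sets measurable_compose[OF ci(5) m1] measurable_compose[OF ci(6) m2]
          by (simp add: nn_integral_add nn_integral_cmult nn_integral_cmult_indicator ci(1)[OF m1] ci(2)[OF m2])
        also have "\<dots> \<le> 3 * ennreal (4 * (1/4) ^ k) + 3 * ennreal (2 * \<theta> j + 2 * (1/4) ^ k) + ennreal (3 * (2 * C)\<^sup>2) * ennreal (\<delta> j)"
          by (intro add_mono mult_left_mono w(2) third \<pi>(2)) auto
        also have "\<dots> = ennreal (3 * (4 * (1/4) ^ k) + 3 * (2 * \<theta> j + 2 * (1/4) ^ k) + 3 * (2 * C)\<^sup>2 * \<delta> j)"
        proof -
          have 3: "3 * ennreal x = ennreal (3 * x)" if "0 \<le> x" for x using that by (simp add: ennreal_mult)
          show ?thesis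
            using \<theta>0 \<delta>0 by (subst (1 2) 3) (auto simp: ennreal_mult[symmetric] ennreal_plus[symmetric] simp del: ennreal_plus)
        qed
        finally show ?thesis .
      qed
      have quarter: "(1/4 :: real) ^ k \<le> (1/2) ^ k" by (intro power_mono) auto
      have "(1/2) ^ k + Dm * \<delta> j + (3 * (4 * (1/4) ^ k) + 3 * (2 * \<theta> j + 2 * (1/4) ^ k) + 3 * (2 * C)\<^sup>2 * \<delta> j)
          = (1/2) ^ k + 18 * (1/4) ^ k + ((Dm + 3 * (2 * C)\<^sup>2) * \<delta> j + 6 * \<theta> j)"
        by (simp add: algebra_simps)
      also have "\<dots> \<le> t"
      proof -
        have "a + 18 * b + c \<le> t" if "b \<le> a" "a < t / 40" "c < t / 2" for a b c :: real
          using that t by linarith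
        from this[OF quarter k elim(1)] show ?thesis .
      qed
      finally have tot: "(1/2) ^ k + Dm * \<delta> j + (3 * (4 * (1/4) ^ k) + 3 * (2 * \<theta> j + 2 * (1/4) ^ k) + 3 * (2 * C)\<^sup>2 * \<delta> j) \<le> t" .
      have "(\<integral>\<^sup>+z. ennreal (norm (fst z - snd z)) \<partial>\<pi>) + (\<integral>\<^sup>+z. ennreal (\<bar>w (fst z) - v ?n (snd z)\<bar>\<^sup>2) \<partial>\<pi>)
          \<le> ennreal ((1/2) ^ k + Dm * \<delta> j) + ennreal (3 * (4 * (1/4) ^ k) + 3 * (2 * \<theta> j + 2 * (1/4) ^ k) + 3 * (2 * C)\<^sup>2 * \<delta> j)"
        by (intro add_mono I1 I2)
      also have "\<dots> = ennreal ((1/2) ^ k + Dm * \<delta> j + (3 * (4 * (1/4) ^ k) + 3 * (2 * \<theta> j + 2 * (1/4) ^ k) + 3 * (2 * C)\<^sup>2 * \<delta> j))"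
        using Dm(1) \<delta>0 \<theta>0 by (intro ennreal_plus[symmetric]) auto
      also have "\<dots> \<le> ennreal t" by (rule ennreal_leI[OF tot])
      finally show ?case using \<pi>(1) unfolding \<nu>_def by blast
    qed
  qed
  show ?thesis using that[OF r wb fin conv] .
qed

end

section \<open>Interaction of the two pieces\<close>

lemma dirichlet_mono:
  assumes "admissible_kernel \<eta>" "0 < e" "finite U" "A \<subseteq> U"
  shows "dirichlet \<eta> e A f \<le> dirichlet \<eta> e U f"
  using sum_dirichlet_le[OF assms(1-3), of "{()}" "\<lambda>_. A" f] assms(4) by (simp add: disjoint_family_on_def)

lemma graph_energy_eq_dirichlet:
  "graph_energy \<eta> n e U u = 1 / ((real n)\<^sup>2 * e\<^sup>2) * dirichlet \<eta> e U (\<lambda>x. u x / sqrt (graph_degree \<eta> n e U x))"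
  by (simp add: graph_energy_def dirichlet_def)

lemma graph_degree_nonneg:
  assumes "admissible_kernel \<eta>" "0 < e"
  shows "0 \<le> graph_degree \<eta> n e U x"
proof -
  have "0 \<le> \<eta> (norm (x - y) / e)" for y
    using assms(2) kernel_nonneg[OF assms(1), of "norm (x - y) / e"] by simp
  then show ?thesis unfolding graph_degree_def by (simp add: sum_nonneg)
qed

lemma graph_degree_Un:
  "finite A \<Longrightarrow> finite B \<Longrightarrow> A \<inter> B = {} \<Longrightarrow> graph_degree \<eta> n e (A \<union> B) x = graph_degree \<eta> n e A x + graph_degree \<eta> n e B x"
  by (simp add: graph_degree_def sum.union_disjoint distrib_left)

lemma sqrt_add_diff_sq_le:
  fixes a b :: real
  assumes "0 \<le> a" "0 \<le> b"
  shows "(sqrt (a + b) - sqrt a)\<^sup>2 \<le> b"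
  using real_sqrt_diff_sq_le[of "a + b" a] assms by simp

text \<open>Collects what almost every sample satisfies; from here on the sample is fixed. The bound
  on the degree from M2 is required at all points, because it is applied on M1. The common partition
  takes its cells on M1 from the first piece and removes M1 from those of the second.\<close>

locale good_sample = prob_space \<mu> for \<mu> :: "'a::euclidean_space measure" +
  fixes M1 M2 :: "'a set" and V :: "nat \<Rightarrow> 'a set" and \<eta> :: "real \<Rightarrow> real" and \<epsilon> :: "nat \<Rightarrow> real"
    and d1 d2 :: nat and c1 C2 c2 :: real and \<K>1 \<K>2 \<K> :: "nat \<Rightarrow> 'a set set"
  assumes sets_\<mu>: "sets \<mu> = sets borel"
    and M: "compact M1" "compact M2" "M2 \<noteq> {}" "measure \<mu> (M1 \<union> M2) = 1" "measure \<mu> (M1 \<inter> M2) = 0"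
    and kernel: "admissible_kernel \<eta>"
    and eps_pos: "\<And>n. 1 \<le> n \<Longrightarrow> 0 < \<epsilon> n" and eps_lim: "\<epsilon> \<longlonglongrightarrow> 0"
    and d: "d1 \<le> d2" and c: "0 < c1" "0 < c2" "0 < C2"
    and V: "\<And>n. 1 \<le> n \<Longrightarrow> finite (V n)" "\<And>n. 1 \<le> n \<Longrightarrow> card (V n) = n" "\<And>n. 1 \<le> n \<Longrightarrow> V n \<subseteq> M1 \<union> M2"
      "\<And>n. 1 \<le> n \<Longrightarrow> V n \<inter> (M1 \<inter> M2) = {}"
    and lower1: "eventually (\<lambda>n. \<forall>x\<in>M1. c1 * \<epsilon> n ^ d1 \<le> graph_degree \<eta> n (\<epsilon> n) (V n \<inter> M1) x) sequentially"
    and lower2: "eventually (\<lambda>n. \<forall>x\<in>M2. c2 * \<epsilon> n ^ d2 \<le> graph_degree \<eta> n (\<epsilon> n) (V n \<inter> M2) x) sequentially"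
    and upper2: "eventually (\<lambda>n. \<forall>x. graph_degree \<eta> n (\<epsilon> n) (V n \<inter> M2) x \<le> C2 * \<epsilon> n ^ d2) sequentially"
    and \<K>1: "\<And>m. finite (\<K>1 m)" "\<And>m. disjoint (\<K>1 m)" "\<And>m. \<K>1 m \<subseteq> sets borel" "\<And>m. \<Union>(\<K>1 m) = M1"
      "\<And>m K x y. K \<in> \<K>1 m \<Longrightarrow> x \<in> K \<Longrightarrow> y \<in> K \<Longrightarrow> dist x y \<le> (1/4) ^ m"
    and \<K>2: "\<And>m. finite (\<K>2 m)" "\<And>m. disjoint (\<K>2 m)" "\<And>m. \<K>2 m \<subseteq> sets borel" "\<And>m. \<Union>(\<K>2 m) = M2"
      "\<And>m K x y. K \<in> \<K>2 m \<Longrightarrow> x \<in> K \<Longrightarrow> y \<in> K \<Longrightarrow> dist x y \<le> (1/4) ^ m"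
    and approx1: "\<And>m. eventually (\<lambda>n. \<forall>f. \<exists>g. (\<forall>K\<in>\<K>1 m. \<forall>x\<in>K. \<forall>y\<in>K. g x = g y) \<and>
        (\<Sum>x\<in>V n \<inter> M1. (f x * sqrt (graph_degree \<eta> n (\<epsilon> n) (V n \<inter> M1) x) - g x)\<^sup>2) \<le>
        (1/4) ^ m * (1 / (real n * (\<epsilon> n)\<^sup>2) * dirichlet \<eta> (\<epsilon> n) (V n \<inter> M1) f
          + (\<Sum>x\<in>V n \<inter> M1. (f x)\<^sup>2 * graph_degree \<eta> n (\<epsilon> n) (V n \<inter> M1) x))) sequentially"
    and approx2: "\<And>m. eventually (\<lambda>n. \<forall>f. \<exists>g. (\<forall>K\<in>\<K>2 m. \<forall>x\<in>K. \<forall>y\<in>K. g x = g y) \<and>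
        (\<Sum>x\<in>V n \<inter> M2. (f x * sqrt (graph_degree \<eta> n (\<epsilon> n) (V n \<inter> M2) x) - g x)\<^sup>2) \<le>
        (1/4) ^ m * (1 / (real n * (\<epsilon> n)\<^sup>2) * dirichlet \<eta> (\<epsilon> n) (V n \<inter> M2) f
          + (\<Sum>x\<in>V n \<inter> M2. (f x)\<^sup>2 * graph_degree \<eta> n (\<epsilon> n) (V n \<inter> M2) x))) sequentially"
    and \<K>: "\<And>m. \<K> m = \<K>1 m \<union> (\<lambda>K. K - M1) ` \<K>2 m"
    and lln: "\<And>k l K L. K \<in> \<K> k \<Longrightarrow> L \<in> \<K> l \<Longrightarrow> (\<lambda>n. real (card (V n \<inter> (K \<inter> L))) / real n) \<longlonglongrightarrow> measure \<mu> (K \<inter> L)"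
    and null: "\<And>k K n. K \<in> \<K> k \<Longrightarrow> measure \<mu> K = 0 \<Longrightarrow> 1 \<le> n \<Longrightarrow> V n \<inter> K = {}"
    and lln_near: "\<And>l. (\<lambda>n. real (card (V n \<inter> {x\<in>M1. infdist x M2 \<le> 1 / real (Suc l)})) / real n)
        \<longlonglongrightarrow> measure \<mu> {x\<in>M1. infdist x M2 \<le> 1 / real (Suc l)}"
begin

text \<open>The tubes of points of M1 close to M2 decrease to the intersection, which is null;
  measures are continuous from above.\<close>

lemma near_small:
  assumes "0 < \<theta>"
  obtains l where "measure \<mu> {x\<in>M1. infdist x M2 \<le> 1 / real (Suc l)} < \<theta>"
proof -
  let ?N = "\<lambda>l. {x\<in>M1. infdist x M2 \<le> 1 / real (Suc l)}"
  have "closed {x. infdist x M2 \<le> t}" for t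
    by (intro closed_Collect_le continuous_intros)
  then have "closed (M1 \<inter> {x. infdist x M2 \<le> t})" for t
    using M(1) compact_imp_closed by (intro closed_Int) auto
  moreover have "?N l = M1 \<inter> {x. infdist x M2 \<le> 1 / real (Suc l)}" for l by blast
  ultimately have "?N l \<in> sets \<mu>" for l using sets_\<mu> by (simp add: borel_closed)
  then have "(\<lambda>l. measure \<mu> (?N l)) \<longlonglongrightarrow> measure \<mu> (\<Inter>l. ?N l)"
  proof (intro finite_Lim_measure_decseq)
    show "decseq ?N"
    proof (rule decseq_SucI)
      fix l
      have "1 / real (Suc (Suc l)) \<le> 1 / real (Suc l)" by (simp add: frac_le)
      then show "?N (Suc l) \<subseteq> ?N l" by force
    qed
  qed auto
  moreover have "(\<Inter>l. ?N l) = M1 \<inter> M2"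
  proof (intro subset_antisym subsetI)
    fix x assume x: "x \<in> (\<Inter>l. ?N l)"
    have "infdist x M2 \<le> 0"
    proof (rule ccontr)
      assume "\<not> infdist x M2 \<le> 0"
      then obtain l where "inverse (real (Suc l)) < infdist x M2" using reals_Archimedean[of "infdist x M2"] by auto
      moreover have "infdist x M2 \<le> 1 / real (Suc l)" using x by blast
      ultimately show False by (simp add: inverse_eq_divide)
    qed
    then have "infdist x M2 = 0" using infdist_nonneg[of x M2] by linarith
    \<comment> \<open>Closedness turns distance 0 into membership; nonemptiness matters since
      \<open>infdist\<close> to the empty set is 0.\<close>
    then show "x \<in> M1 \<inter> M2" using x in_closed_iff_infdist_zero[OF compact_imp_closed[OF M(2)] M(3)] by blast
  next
    fix x assume "x \<in> M1 \<inter> M2"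
    then show "x \<in> (\<Inter>l. ?N l)" by auto
  qed
  ultimately have "(\<lambda>l. measure \<mu> (?N l)) \<longlonglongrightarrow> 0" using M(5) by simp
  then have "eventually (\<lambda>l. measure \<mu> (?N l) < \<theta>) sequentially" using assms by (rule order_tendstoD)
  then show ?thesis using that by (auto dest: eventually_happens)
qed

end

locale bounded_energy = good_sample +
  fixes u :: "nat \<Rightarrow> 'a \<Rightarrow> real" and E B :: real
  assumes u: "\<And>n. 1 \<le> n \<Longrightarrow> u n \<in> borel_measurable borel"
    and energy: "\<And>n. 1 \<le> n \<Longrightarrow> graph_energy \<eta> n (\<epsilon> n) (V n) (u n) \<le> E"
    and bound: "\<And>n. 1 \<le> n \<Longrightarrow> (\<Sum>x\<in>V n. (u n x)\<^sup>2) \<le> real n * B"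
begin

abbreviation "D1 n x \<equiv> graph_degree \<eta> n (\<epsilon> n) (V n \<inter> M1) x"
abbreviation "D2 n x \<equiv> graph_degree \<eta> n (\<epsilon> n) (V n \<inter> M2) x"

definition f :: "nat \<Rightarrow> 'a \<Rightarrow> real" where
  "f n x = u n x / sqrt (graph_degree \<eta> n (\<epsilon> n) (V n) x)"

lemma V_disj: "1 \<le> n \<Longrightarrow> (V n \<inter> M1) \<inter> (V n \<inter> M2) = {}" and V_Un: "1 \<le> n \<Longrightarrow> V n = (V n \<inter> M1) \<union> (V n \<inter> M2)"
  using V(3,4)[of n] by blast+

lemma degree_split: "1 \<le> n \<Longrightarrow> graph_degree \<eta> n (\<epsilon> n) (V n) x = D1 n x + D2 n x"
  using graph_degree_Un[of "V n \<inter> M1" "V n \<inter> M2"] V_disj[of n] V_Un[of n] V(1)[of n] by simp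

lemma sum_split: "1 \<le> n \<Longrightarrow> sum F (V n) = sum F (V n \<inter> M1) + sum F (V n \<inter> M2)" for F :: "'a \<Rightarrow> real"
  using sum.union_disjoint[of "V n \<inter> M1" "V n \<inter> M2" F] V_disj[of n] V_Un[of n] V(1)[of n] by simp

lemma D_nonneg: "1 \<le> n \<Longrightarrow> 0 \<le> D1 n x" "1 \<le> n \<Longrightarrow> 0 \<le> D2 n x"
  by (intro graph_degree_nonneg kernel eps_pos; assumption)+

lemma dirichlet_bound: "1 \<le> n \<Longrightarrow> dirichlet \<eta> (\<epsilon> n) (V n) (f n) \<le> (real n)\<^sup>2 * (\<epsilon> n)\<^sup>2 * E"
proof -
  assume n: "1 \<le> n"
  have pos: "0 < (real n)\<^sup>2 * (\<epsilon> n)\<^sup>2" using n eps_pos[OF n] by simp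
  have "f n = (\<lambda>x. u n x / sqrt (graph_degree \<eta> n (\<epsilon> n) (V n) x))" by (simp add: f_def fun_eq_iff)
  then have "1 / ((real n)\<^sup>2 * (\<epsilon> n)\<^sup>2) * dirichlet \<eta> (\<epsilon> n) (V n) (f n) \<le> E"
    using energy[OF n] by (simp only: graph_energy_eq_dirichlet)
  then have "dirichlet \<eta> (\<epsilon> n) (V n) (f n) / ((real n)\<^sup>2 * (\<epsilon> n)\<^sup>2) \<le> E" by simp
  then show ?thesis using pos by (simp only: pos_divide_le_eq mult.commute)
qed

lemma E_nonneg: "0 \<le> E"
proof -
  have "0 \<le> dirichlet \<eta> (\<epsilon> 1) (V 1) (f 1)" using kernel eps_pos[of 1] by (intro dirichlet_nonneg) auto
  then have "0 \<le> (\<epsilon> 1)\<^sup>2 * E" using dirichlet_bound[of 1] by simp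
  then show ?thesis using eps_pos[of 1] by (simp add: zero_le_mult_iff)
qed

lemma B_nonneg: "0 \<le> B"
proof -
  have "0 \<le> (\<Sum>x\<in>V 1. (u 1 x)\<^sup>2)" by (intro sum_nonneg zero_le_power2)
  then show ?thesis using bound[of 1] by simp
qed

text \<open>Splits u^2 according to the piece that supplies the degree: one term with the degree
  within the own piece and one cross term. The lower bounds on the degrees exclude a division by
  0.\<close>

lemma ev_f_sq: "eventually (\<lambda>n. 1 \<le> n \<and> (\<forall>x\<in>V n. (f n x)\<^sup>2 * D1 n x + (f n x)\<^sup>2 * D2 n x = (u n x)\<^sup>2)) sequentially"
  using lower1 lower2 eventually_ge_at_top[of 1]
proof eventually_elim
  case (elim n)
  have "(f n x)\<^sup>2 * D1 n x + (f n x)\<^sup>2 * D2 n x = (u n x)\<^sup>2" if x: "x \<in> V n" for x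
  proof -
    have en: "0 < \<epsilon> n" using elim(3) by (rule eps_pos)
    have "0 < c1 * \<epsilon> n ^ d1" "0 < c2 * \<epsilon> n ^ d2" using c en by simp_all
    then have "0 < D1 n x + D2 n x"
      using V(3)[OF elim(3)] x elim(1,2) D_nonneg[OF elim(3), of x] by (smt (verit) UnE subsetD)
    then have "(f n x)\<^sup>2 * (D1 n x + D2 n x) = (u n x)\<^sup>2"
      by (simp add: f_def degree_split[OF elim(3)] power_divide)
    then show ?thesis by (simp only: distrib_left)
  qed
  then show ?case using elim(3) by blast
qed

lemma ev_mass: "eventually (\<lambda>n. 1 \<le> n \<and> (\<Sum>x\<in>V n \<inter> M1. (f n x)\<^sup>2 * D1 n x) \<le> real n * B \<and>
    (\<Sum>x\<in>V n \<inter> M2. (f n x)\<^sup>2 * D2 n x) \<le> real n * B) sequentially"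
  using ev_f_sq
proof eventually_elim
  case (elim n)
  then have n: "1 \<le> n" and eq: "\<And>x. x \<in> V n \<Longrightarrow> (f n x)\<^sup>2 * D1 n x + (f n x)\<^sup>2 * D2 n x = (u n x)\<^sup>2" by blast+
  have nn: "0 \<le> (f n x)\<^sup>2 * D1 n x" "0 \<le> (f n x)\<^sup>2 * D2 n x" for x
    using D_nonneg[OF n] by (intro mult_nonneg_nonneg zero_le_power2; simp)+
  have "(\<Sum>x\<in>V n \<inter> M1. (f n x)\<^sup>2 * D1 n x) \<le> (\<Sum>x\<in>V n \<inter> M1. (u n x)\<^sup>2)"
    "(\<Sum>x\<in>V n \<inter> M2. (f n x)\<^sup>2 * D2 n x) \<le> (\<Sum>x\<in>V n \<inter> M2. (u n x)\<^sup>2)"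
    using eq nn by (intro sum_mono, metis IntD1 add_increasing2 add_increasing order_refl)+
  moreover have "0 \<le> (\<Sum>x\<in>V n \<inter> M1. (u n x)\<^sup>2)" "0 \<le> (\<Sum>x\<in>V n \<inter> M2. (u n x)\<^sup>2)"
    by (intro sum_nonneg zero_le_power2)+
  ultimately show ?case using bound[OF n] sum_split[OF n, of "\<lambda>x. (u n x)\<^sup>2"] n by linarith
qed

lemma energy_part: 
  assumes n: "1 \<le> n"
  shows "1 / (real n * (\<epsilon> n)\<^sup>2) * dirichlet \<eta> (\<epsilon> n) (V n \<inter> M') (f n) \<le> real n * E"
proof -
  have pos: "0 < real n * (\<epsilon> n)\<^sup>2" using n eps_pos[OF n] by simp
  have "dirichlet \<eta> (\<epsilon> n) (V n \<inter> M') (f n) \<le> dirichlet \<eta> (\<epsilon> n) (V n) (f n)"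
    by (rule dirichlet_mono[OF kernel eps_pos[OF n] V(1)[OF n] Int_lower1])
  also have "\<dots> \<le> (real n)\<^sup>2 * (\<epsilon> n)\<^sup>2 * E" by (rule dirichlet_bound[OF n])
  also have "\<dots> = real n * E * (real n * (\<epsilon> n)\<^sup>2)" by (simp add: power2_eq_square)
  finally have "dirichlet \<eta> (\<epsilon> n) (V n \<inter> M') (f n) / (real n * (\<epsilon> n)\<^sup>2) \<le> real n * E" 
    using pos by (simp only: pos_divide_le_eq)
  then show ?thesis by simp
qed

lemma ev_approx1: "eventually (\<lambda>n. \<exists>g. (\<forall>K\<in>\<K>1 m. \<forall>x\<in>K. \<forall>y\<in>K. g x = g y) \<and>
    (\<Sum>x\<in>V n \<inter> M1. (f n x * sqrt (D1 n x) - g x)\<^sup>2) \<le> (1/4) ^ m * (real n * (E + B))) sequentially"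
  using approx1[of m] ev_mass
proof eventually_elim
  case (elim n)
  note n = elim(2)[THEN conjunct1]
  note ex = elim(1)[THEN spec, of "f n"]
  from ex obtain g where g: "(\<forall>K\<in>\<K>1 m. \<forall>x\<in>K. \<forall>y\<in>K. g x = g y) \<and>
        (\<Sum>x\<in>V n \<inter> M1. (f n x * sqrt (D1 n x) - g x)\<^sup>2) \<le>
        (1/4) ^ m * (1 / (real n * (\<epsilon> n)\<^sup>2) * dirichlet \<eta> (\<epsilon> n) (V n \<inter> M1) (f n) + (\<Sum>x\<in>V n \<inter> M1. (f n x)\<^sup>2 * D1 n x))"
    by (elim exE)
  have "1 / (real n * (\<epsilon> n)\<^sup>2) * dirichlet \<eta> (\<epsilon> n) (V n \<inter> M1) (f n) + (\<Sum>x\<in>V n \<inter> M1. (f n x)\<^sup>2 * D1 n x) \<le> real n * (E + B)"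
    using energy_part[OF n, of M1] elim(2) unfolding distrib_left by linarith
  then have "(1/4) ^ m * (1 / (real n * (\<epsilon> n)\<^sup>2) * dirichlet \<eta> (\<epsilon> n) (V n \<inter> M1) (f n) + (\<Sum>x\<in>V n \<inter> M1. (f n x)\<^sup>2 * D1 n x))
     \<le> (1/4) ^ m * (real n * (E + B))" by (rule mult_left_mono) simp
  from order_trans[OF g[THEN conjunct2] this] g[THEN conjunct1] show ?case by (intro exI[of _ g] conjI)
qed

lemma ev_approx2: "eventually (\<lambda>n. \<exists>g. (\<forall>K\<in>\<K>2 m. \<forall>x\<in>K. \<forall>y\<in>K. g x = g y) \<and>
    (\<Sum>x\<in>V n \<inter> M2. (f n x * sqrt (D2 n x) - g x)\<^sup>2) \<le> (1/4) ^ m * (real n * (E + B))) sequentially"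
  using approx2[of m] ev_mass
proof eventually_elim
  case (elim n)
  note n = elim(2)[THEN conjunct1]
  note ex = elim(1)[THEN spec, of "f n"]
  from ex obtain g where g: "(\<forall>K\<in>\<K>2 m. \<forall>x\<in>K. \<forall>y\<in>K. g x = g y) \<and>
        (\<Sum>x\<in>V n \<inter> M2. (f n x * sqrt (D2 n x) - g x)\<^sup>2) \<le>
        (1/4) ^ m * (1 / (real n * (\<epsilon> n)\<^sup>2) * dirichlet \<eta> (\<epsilon> n) (V n \<inter> M2) (f n) + (\<Sum>x\<in>V n \<inter> M2. (f n x)\<^sup>2 * D2 n x))"
    by (elim exE)
  have "1 / (real n * (\<epsilon> n)\<^sup>2) * dirichlet \<eta> (\<epsilon> n) (V n \<inter> M2) (f n) + (\<Sum>x\<in>V n \<inter> M2. (f n x)\<^sup>2 * D2 n x) \<le> real n * (E + B)"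
    using energy_part[OF n, of M2] elim(2) unfolding distrib_left by linarith
  then have "(1/4) ^ m * (1 / (real n * (\<epsilon> n)\<^sup>2) * dirichlet \<eta> (\<epsilon> n) (V n \<inter> M2) (f n) + (\<Sum>x\<in>V n \<inter> M2. (f n x)\<^sup>2 * D2 n x))
     \<le> (1/4) ^ m * (real n * (E + B))" by (rule mult_left_mono) simp
  from order_trans[OF g[THEN conjunct2] this] g[THEN conjunct1] show ?case by (intro exI[of _ g] conjI)
qed

text \<open>The cross term is controlled by moving mass across the two pieces along the edges of the graph.\<close>

lemma cross_term_transfer:
  assumes n: "1 \<le> n"
  shows "(\<Sum>x\<in>V n \<inter> M2. (f n x)\<^sup>2 * D1 n x) \<le> real n * (2 * (\<epsilon> n)\<^sup>2 * E) + 2 * (\<Sum>x\<in>V n \<inter> M1. (f n x)\<^sup>2 * D2 n x)"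
proof -
  have en: "0 < \<epsilon> n" by (rule eps_pos[OF n])
  define k where "k x y = \<eta> (norm (x - y) / \<epsilon> n)" for x y :: 'a
  have k0: "0 \<le> k x y" for x y using kernel_nonneg[OF kernel, of "norm (x - y) / \<epsilon> n"] en by (simp add: k_def)
  have ksym: "k x y = k y x" for x y by (simp add: k_def norm_minus_commute)
  have D: "D1 n x = 1 / real n * (\<Sum>y\<in>V n \<inter> M1. k x y)" "D2 n x = 1 / real n * (\<Sum>y\<in>V n \<inter> M2. k x y)" for x
    by (simp_all add: graph_degree_def k_def)
  have "(\<Sum>x\<in>V n \<inter> M2. (f n x)\<^sup>2 * D1 n x) = 1 / real n * (\<Sum>x\<in>V n \<inter> M2. \<Sum>y\<in>V n \<inter> M1. k x y * (f n x)\<^sup>2)"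
    by (simp add: D sum_distrib_left sum_distrib_right mult_ac)
  also have "\<dots> \<le> 1 / real n * (\<Sum>x\<in>V n \<inter> M2. \<Sum>y\<in>V n \<inter> M1. 2 * (k x y * (f n x - f n y)\<^sup>2) + 2 * (k x y * (f n y)\<^sup>2))"
  proof (intro mult_left_mono sum_mono)
    fix x y
    have "(f n x)\<^sup>2 \<le> 2 * (f n x - f n y)\<^sup>2 + 2 * (f n y)\<^sup>2" using sq_add_le[of "f n x - f n y" "f n y"] by simp
    then have "k x y * (f n x)\<^sup>2 \<le> k x y * (2 * (f n x - f n y)\<^sup>2 + 2 * (f n y)\<^sup>2)" using k0 by (rule mult_left_mono)
    then show "k x y * (f n x)\<^sup>2 \<le> 2 * (k x y * (f n x - f n y)\<^sup>2) + 2 * (k x y * (f n y)\<^sup>2)" by (simp add: algebra_simps)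
  qed simp
  also have "\<dots> = 2 / real n * (\<Sum>x\<in>V n \<inter> M2. \<Sum>y\<in>V n \<inter> M1. k x y * (f n x - f n y)\<^sup>2)
      + 2 / real n * (\<Sum>x\<in>V n \<inter> M2. \<Sum>y\<in>V n \<inter> M1. k x y * (f n y)\<^sup>2)"
    by (simp only: sum.distrib sum_distrib_left[symmetric] distrib_left)
  also have "(\<Sum>x\<in>V n \<inter> M2. \<Sum>y\<in>V n \<inter> M1. k x y * (f n y)\<^sup>2) = (\<Sum>y\<in>V n \<inter> M1. \<Sum>x\<in>V n \<inter> M2. k x y * (f n y)\<^sup>2)"
    by (rule sum.swap)
  also have "2 / real n * \<dots> = 2 * (\<Sum>x\<in>V n \<inter> M1. (f n x)\<^sup>2 * D2 n x)"
    by (simp add: D sum_distrib_left sum_distrib_right mult_ac ksym)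
  also have "2 / real n * (\<Sum>x\<in>V n \<inter> M2. \<Sum>y\<in>V n \<inter> M1. k x y * (f n x - f n y)\<^sup>2) \<le> 2 / real n * dirichlet \<eta> (\<epsilon> n) (V n) (f n)"
    unfolding dirichlet_def k_def[symmetric]
  proof (rule mult_left_mono)
    have nn: "0 \<le> k x y * (f n x - f n y)\<^sup>2" for x y using k0 by simp
    have "(\<Sum>x\<in>V n \<inter> M2. \<Sum>y\<in>V n \<inter> M1. k x y * (f n x - f n y)\<^sup>2) \<le> (\<Sum>x\<in>V n \<inter> M2. \<Sum>y\<in>V n. k x y * (f n x - f n y)\<^sup>2)"
      using V(1)[OF n] nn by (intro sum_mono sum_mono2) auto
    also have "\<dots> \<le> (\<Sum>x\<in>V n. \<Sum>y\<in>V n. k x y * (f n x - f n y)\<^sup>2)"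
      using V(1)[OF n] nn by (intro sum_mono2 sum_nonneg) auto
    finally show "(\<Sum>x\<in>V n \<inter> M2. \<Sum>y\<in>V n \<inter> M1. k x y * (f n x - f n y)\<^sup>2) \<le> (\<Sum>x\<in>V n. \<Sum>y\<in>V n. k x y * (f n x - f n y)\<^sup>2)" .
  qed simp
  also have "2 / real n * dirichlet \<eta> (\<epsilon> n) (V n) (f n) \<le> 2 / real n * ((real n)\<^sup>2 * (\<epsilon> n)\<^sup>2 * E)"
    by (rule mult_left_mono[OF dirichlet_bound[OF n]]) simp
  also have "\<dots> = real n * (2 * (\<epsilon> n)\<^sup>2 * E)" using n by (simp add: power2_eq_square)
  finally show ?thesis by simp
qed

text \<open>On M1 the degree from M2 is at most a constant times the own degree, as d1 <= d2, and it
  vanishes outside a tube around M2. So the sum is controlled by h^2, the product of f^2 and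
  \<open>D1\<close>, over the tube. As h is close to a piecewise constant function whose values at
  sample points are bounded uniformly in n, it cannot concentrate on a set of small
  frequency.\<close>

lemma ev_cross1:
  assumes \<delta>: "0 < \<delta>"
  shows "eventually (\<lambda>n. (\<Sum>x\<in>V n \<inter> M1. (f n x)\<^sup>2 * D2 n x) \<le> real n * \<delta>) sequentially"
proof -
  define Q where "Q = E + B + 1"
  have Q: "0 < Q" "E + B \<le> Q" "B \<le> Q" using E_nonneg B_nonneg by (auto simp: Q_def)
  define C' where "C' = C2 / c1"
  have C': "0 < C'" using c by (simp add: C'_def)
  \<comment> \<open>The order of the choices: the scale m depends on \<delta>, the bound
    \<open>G\<close> on the cells of that scale, the admissible mass \<theta> of the tube on
    \<open>G\<close>, and the width of the tube on \<theta>.\<close>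
  obtain m where "(1/4 :: real) ^ m < \<delta> / (4 * C' * Q)"
    using real_arch_pow_inv[of "\<delta> / (4 * C' * Q)" "1/4"] \<delta> C' Q by auto
  then have m: "2 * C' * ((1/4) ^ m * Q) \<le> \<delta> / 2"
    using C' Q by (simp add: pos_less_divide_eq mult_ac)
  \<comment> \<open>The squares of the piecewise constant function g will sum to at most 4 n Q, and
    a cell K of positive mass holds at least n times half its mass in sample points, so g^2 is at
    most 8 Q over the mass of K there. Null cells contribute 0 by division by 0, and no sample point
    lies in them.\<close>
  define G where "G = (\<Sum>K\<in>\<K>1 m. 8 * Q / measure \<mu> K) + 1"
  have Gn: "0 \<le> 8 * Q / measure \<mu> K" for K using Q by simp
  have "0 \<le> (\<Sum>K\<in>\<K>1 m. 8 * Q / measure \<mu> K)" using Gn by (rule sum_nonneg)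
  then have G0: "0 < G" by (simp add: G_def)
  have GK: "8 * Q / measure \<mu> K \<le> G" if "K \<in> \<K>1 m" for K
    using member_le_sum[OF that, of "\<lambda>K. 8 * Q / measure \<mu> K"] Gn \<K>1(1) by (simp add: G_def)
  define \<theta> where "\<theta> = \<delta> / (4 * C' * G)"
  have \<theta>: "0 < \<theta>" "2 * C' * (G * \<theta>) = \<delta> / 2" using \<delta> C' G0 by (auto simp: \<theta>_def)
  obtain l where l: "measure \<mu> {x\<in>M1. infdist x M2 \<le> 1 / real (Suc l)} < \<theta>" by (rule near_small[OF \<theta>(1)])
  define N where "N = {x\<in>M1. infdist x M2 \<le> 1 / real (Suc l)}"
  have evN: "eventually (\<lambda>n. real (card (V n \<inter> N)) / real n < \<theta>) sequentially"
    using order_tendstoD(2)[OF lln_near[of l] l] by (simp add: N_def)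
  have evK: "eventually (\<lambda>n. \<forall>K\<in>\<K>1 m. measure \<mu> K \<noteq> 0 \<longrightarrow> measure \<mu> K / 2 < real (card (V n \<inter> K)) / real n) sequentially"
  proof (rule eventually_ball_finite[OF \<K>1(1)], rule ballI)
    fix K assume K: "K \<in> \<K>1 m"
    show "eventually (\<lambda>n. measure \<mu> K \<noteq> 0 \<longrightarrow> measure \<mu> K / 2 < real (card (V n \<inter> K)) / real n) sequentially"
    proof (cases "measure \<mu> K = 0")
      case False
      then have "measure \<mu> K / 2 < measure \<mu> K" by (simp add: zero_less_measure_iff)
      moreover have "(\<lambda>n. real (card (V n \<inter> K)) / real n) \<longlonglongrightarrow> measure \<mu> K"
        using lln[of K m K m] K \<K>[of m] by simp
      ultimately have "eventually (\<lambda>n. measure \<mu> K / 2 < real (card (V n \<inter> K)) / real n) sequentially"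
        by (intro order_tendstoD(1))
      then show ?thesis by eventually_elim simp
    qed simp
  qed
  have eps1: "eventually (\<lambda>n. \<epsilon> n < 1 / real (Suc l)) sequentially"
    using order_tendstoD(2)[OF eps_lim, of "1 / real (Suc l)"] by simp
  show ?thesis using ev_approx1[of m] ev_mass evN evK eps1 lower1 upper2
  proof eventually_elim
    case (elim n)
    note n = elim(2)[THEN conjunct1]
    have en: "0 < \<epsilon> n" by (rule eps_pos[OF n])
    have n0: "0 < real n" using n by simp
    have fin: "finite (V n)" by (rule V(1)[OF n])
    note ex = elim(1)
    from ex obtain g where cg: "(\<forall>K\<in>\<K>1 m. \<forall>x\<in>K. \<forall>y\<in>K. g x = g y) \<and>
      (\<Sum>x\<in>V n \<inter> M1. (f n x * sqrt (D1 n x) - g x)\<^sup>2) \<le> (1/4) ^ m * (real n * (E + B))" by (elim exE)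
    define h where "h x = f n x * sqrt (D1 n x)" for x
    have h2: "(h x)\<^sup>2 = (f n x)\<^sup>2 * D1 n x" for x
      using D_nonneg(1)[OF n, of x] by (simp add: h_def power_mult_distrib)
    have const: "g x = g y" if "K \<in> \<K>1 m" "x \<in> K" "y \<in> K" for K x y using cg that by blast
    have "(1/4) ^ m * (real n * (E + B)) \<le> (1/4) ^ m * (real n * Q)"
      using Q by (intro mult_left_mono) auto
    then have hg: "(\<Sum>x\<in>V n \<inter> M1. (h x - g x)\<^sup>2) \<le> real n * ((1/4) ^ m * Q)"
      using cg by (simp add: h_def mult_ac)
    have "(1/4 :: real) ^ m \<le> 1" by (intro power_le_one) auto
    then have "real n * ((1/4) ^ m * Q) \<le> real n * (1 * Q)" using Q by (intro mult_left_mono mult_right_mono) auto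
    then have hgQ: "(\<Sum>x\<in>V n \<inter> M1. (h x - g x)\<^sup>2) \<le> real n * Q" using hg by linarith
    have "real n * B \<le> real n * Q" using Q by (intro mult_left_mono) auto
    then have hQ: "(\<Sum>x\<in>V n \<inter> M1. (h x)\<^sup>2) \<le> real n * Q" using elim(2) unfolding h2 by linarith
    have "(g x)\<^sup>2 \<le> 2 * (h x)\<^sup>2 + 2 * (h x - g x)\<^sup>2" for x using sq_add_le[of "h x" "g x - h x"] by (simp add: power2_commute)
    then have "(\<Sum>x\<in>V n \<inter> M1. (g x)\<^sup>2) \<le> (\<Sum>x\<in>V n \<inter> M1. 2 * (h x)\<^sup>2 + 2 * (h x - g x)\<^sup>2)" by (intro sum_mono)
    also have "\<dots> = 2 * (\<Sum>x\<in>V n \<inter> M1. (h x)\<^sup>2) + 2 * (\<Sum>x\<in>V n \<inter> M1. (h x - g x)\<^sup>2)"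
      by (simp add: sum.distrib sum_distrib_left)
    also have "\<dots> \<le> 4 * (real n * Q)" using hQ hgQ by linarith
    finally have gQ: "(\<Sum>x\<in>V n \<inter> M1. (g x)\<^sup>2) \<le> 4 * (real n * Q)" .
    have gG: "(g x)\<^sup>2 \<le> G" if x: "x \<in> V n \<inter> M1" for x
    proof -
      obtain K where K: "K \<in> \<K>1 m" "x \<in> K" using x \<K>1(4)[of m] by blast
      have KM: "K \<subseteq> M1" using K(1) \<K>1(4)[of m] by blast
      have \<mu>K: "measure \<mu> K \<noteq> 0" using null[of K m n] K x n \<K>[of m] by blast
      then have \<mu>K0: "0 < measure \<mu> K" using measure_nonneg[of \<mu> K] by linarith
      have "measure \<mu> K / 2 < real (card (V n \<inter> K)) / real n" using elim(4) K(1) \<mu>K by blast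
      then have card: "measure \<mu> K / 2 * real n \<le> real (card (V n \<inter> K))" using n0 by (simp add: pos_less_divide_eq)
      have "measure \<mu> K / 2 * real n * (g x)\<^sup>2 \<le> real (card (V n \<inter> K)) * (g x)\<^sup>2"
        using card by (rule mult_right_mono) simp
      also have "\<dots> = (\<Sum>y\<in>V n \<inter> K. (g y)\<^sup>2)"
      proof -
        have "(\<Sum>y\<in>V n \<inter> K. (g y)\<^sup>2) = (\<Sum>y\<in>V n \<inter> K. (g x)\<^sup>2)"
          using const[OF K(1) _ K(2)] by (intro sum.cong refl) (metis IntD2)
        then show ?thesis by simp
      qed
      also have "\<dots> \<le> (\<Sum>y\<in>V n \<inter> M1. (g y)\<^sup>2)" using fin KM by (intro sum_mono2) auto
      also have "\<dots> \<le> 4 * (real n * Q)" by (rule gQ)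
      finally have "real n * ((g x)\<^sup>2 * measure \<mu> K) \<le> real n * (8 * Q)" by (simp add: mult_ac)
      then have "(g x)\<^sup>2 * measure \<mu> K \<le> 8 * Q" using n0 by (simp only: mult_le_cancel_left_pos)
      then have "(g x)\<^sup>2 \<le> 8 * Q / measure \<mu> K" using \<mu>K0 by (simp only: pos_le_divide_eq)
      then show ?thesis using GK[OF K(1)] by linarith
    qed
    have sl: "\<epsilon> n < 1" 
    proof -
      have "1 / real (Suc l) \<le> 1" by simp
      then show ?thesis using elim(5) by linarith
    qed
    have D2C: "D2 n x \<le> C' * D1 n x" if x: "x \<in> M1" for x
    proof -
      have "D2 n x \<le> C2 * \<epsilon> n ^ d2" using elim(7) by blast
      also have "\<dots> \<le> C2 * \<epsilon> n ^ d1" using c d en sl by (intro mult_left_mono power_decreasing) auto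
      also have "\<dots> = C' * (c1 * \<epsilon> n ^ d1)" using c by (simp add: C'_def)
      also have "\<dots> \<le> C' * D1 n x" using elim(6) x C' by (intro mult_left_mono) auto
      finally show ?thesis .
    qed
    have D2N: "D2 n x = 0" if x: "x \<in> M1" "x \<notin> N" for x
    proof -
      have "\<eta> (norm (x - y) / \<epsilon> n) = 0" if y: "y \<in> M2" for y
      proof -
        have "1 / real (Suc l) < infdist x M2" using x by (simp add: N_def)
        also have "\<dots> \<le> norm (x - y)" using infdist_le[OF y, of x] by (simp add: dist_norm)
        finally have "\<epsilon> n < norm (x - y)" using elim(5) by linarith
        then have "1 < norm (x - y) / \<epsilon> n" using en by simp
        then show ?thesis by (rule kernel_zero[OF kernel])
      qed
      then show ?thesis by (simp add: graph_degree_def)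
    qed
    have pt: "(f n x)\<^sup>2 * D2 n x \<le> (if x \<in> N then C' * (2 * G + 2 * (h x - g x)\<^sup>2) else 0)" if x: "x \<in> V n \<inter> M1" for x
    proof (cases "x \<in> N")
      case True
      have "(f n x)\<^sup>2 * D2 n x \<le> (f n x)\<^sup>2 * (C' * D1 n x)" using D2C x by (intro mult_left_mono) auto
      also have "\<dots> = C' * (h x)\<^sup>2" by (simp add: h2)
      also have "\<dots> \<le> C' * (2 * (g x)\<^sup>2 + 2 * (h x - g x)\<^sup>2)"
        using sq_add_le[of "g x" "h x - g x"] C' by (intro mult_left_mono) auto
      also have "\<dots> \<le> C' * (2 * G + 2 * (h x - g x)\<^sup>2)" using gG[OF x] C' by (intro mult_left_mono) auto
      finally show ?thesis using True by simp
    next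
      case False
      then show ?thesis using D2N[of x] x by simp
    qed
    have NM: "N \<subseteq> M1" by (auto simp: N_def)
    have "(\<Sum>x\<in>V n \<inter> M1. (f n x)\<^sup>2 * D2 n x) \<le> (\<Sum>x\<in>V n \<inter> M1. if x \<in> N then C' * (2 * G + 2 * (h x - g x)\<^sup>2) else 0)"
      by (rule sum_mono[OF pt])
    also have "\<dots> = (\<Sum>x\<in>V n \<inter> M1 \<inter> N. C' * (2 * G + 2 * (h x - g x)\<^sup>2))"
      by (rule sum.inter_restrict[symmetric]) (use fin in simp)
    also have "V n \<inter> M1 \<inter> N = V n \<inter> N" using NM by blast
    also have "(\<Sum>x\<in>V n \<inter> N. C' * (2 * G + 2 * (h x - g x)\<^sup>2)) =
        2 * C' * (G * real (card (V n \<inter> N))) + 2 * C' * (\<Sum>x\<in>V n \<inter> N. (h x - g x)\<^sup>2)"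
      by (simp add: sum.distrib distrib_left sum_distrib_left mult_ac)
    also have "\<dots> \<le> 2 * C' * (G * (\<theta> * real n)) + 2 * C' * (real n * ((1/4) ^ m * Q))"
    proof (intro add_mono mult_left_mono)
      show "real (card (V n \<inter> N)) \<le> \<theta> * real n" using elim(3) n0 by (simp add: pos_divide_less_eq)
      have "(\<Sum>x\<in>V n \<inter> N. (h x - g x)\<^sup>2) \<le> (\<Sum>x\<in>V n \<inter> M1. (h x - g x)\<^sup>2)"
        using fin NM by (intro sum_mono2) auto
      then show "(\<Sum>x\<in>V n \<inter> N. (h x - g x)\<^sup>2) \<le> real n * ((1/4) ^ m * Q)" using hg by linarith
    qed (use C' G0 in simp_all)
    also have "\<dots> = real n * (2 * C' * (G * \<theta>) + 2 * C' * ((1/4) ^ m * Q))" by (simp add: algebra_simps)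
    also have "\<dots> \<le> real n * (\<delta> / 2 + \<delta> / 2)" using \<theta>(2) m by (intro mult_left_mono) linarith+
    finally show ?case by simp
  qed
qed

lemma ev_cross2:
  assumes \<delta>: "0 < \<delta>"
  shows "eventually (\<lambda>n. (\<Sum>x\<in>V n \<inter> M2. (f n x)\<^sup>2 * D1 n x) \<le> real n * \<delta>) sequentially"
proof -
  have "(\<lambda>n. 2 * (\<epsilon> n)\<^sup>2 * E) \<longlonglongrightarrow> 2 * 0\<^sup>2 * E" by (intro tendsto_intros eps_lim)
  then have "eventually (\<lambda>n. 2 * (\<epsilon> n)\<^sup>2 * E < \<delta> / 2) sequentially"
    using \<delta> by (intro order_tendstoD) auto
  moreover have "eventually (\<lambda>n. (\<Sum>x\<in>V n \<inter> M1. (f n x)\<^sup>2 * D2 n x) \<le> real n * (\<delta> / 4)) sequentially"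
    using \<delta> by (intro ev_cross1) simp
  ultimately show ?thesis using eventually_ge_at_top[of 1]
  proof eventually_elim
    case (elim n)
    have "real n * (2 * (\<epsilon> n)\<^sup>2 * E) \<le> real n * (\<delta> / 2)" using elim(1) by (intro mult_left_mono) auto
    then show ?case using cross_term_transfer[OF elim(3)] elim(2) by simp
  qed
qed

text \<open>On each piece the degree within that piece replaces the full degree, at the price of the two cross
  terms.\<close>

lemma ev_approx:
  assumes k0: "8 * (E + B) \<le> 4 ^ k0"
  shows "eventually (\<lambda>n. \<exists>g. (\<forall>K\<in>\<K> (k + k0). \<forall>x\<in>K. \<forall>y\<in>K. g x = g y) \<and>
      (\<Sum>x\<in>V n. (u n x - g x)\<^sup>2) \<le> real n * (1/4) ^ k) sequentially"
proof -
  \<comment> \<open>Four error sums, two on each piece, enter with the factor 2 each, so \<delta> is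
    an eighth of the target; the shift by \<open>k0\<close> absorbs the constant E + B.\<close>
  define \<delta> :: real where "\<delta> = (1/4) ^ k / 8"
  have \<delta>: "0 < \<delta>" by (simp add: \<delta>_def)
  let ?m = "k + k0"
  have "8 * (E + B) * (1/4) ^ ?m \<le> 4 ^ k0 * (1/4) ^ ?m" using k0 by (rule mult_right_mono) simp
  also have "\<dots> = (1/4 :: real) ^ k" by (simp add: power_add power_divide)
  finally have Q: "(1/4) ^ ?m * (E + B) \<le> \<delta>" unfolding \<delta>_def by (simp only: mult_ac)
  show ?thesis using ev_approx1[of ?m] ev_approx2[of ?m] ev_cross1[OF \<delta>] ev_cross2[OF \<delta>] ev_f_sq lower1 lower2
  proof eventually_elim
    case (elim n)
    note n = elim(5)[THEN conjunct1]
    have fin: "finite (V n)" by (rule V(1)[OF n])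
    note ex1 = elim(1) and ex2 = elim(2)
    from ex1 obtain g1 where cg1: "(\<forall>K\<in>\<K>1 ?m. \<forall>x\<in>K. \<forall>y\<in>K. g1 x = g1 y) \<and>
      (\<Sum>x\<in>V n \<inter> M1. (f n x * sqrt (D1 n x) - g1 x)\<^sup>2) \<le> (1/4) ^ ?m * (real n * (E + B))" by (elim exE)
    from ex2 obtain g2 where cg2: "(\<forall>K\<in>\<K>2 ?m. \<forall>x\<in>K. \<forall>y\<in>K. g2 x = g2 y) \<and>
      (\<Sum>x\<in>V n \<inter> M2. (f n x * sqrt (D2 n x) - g2 x)\<^sup>2) \<le> (1/4) ^ ?m * (real n * (E + B))" by (elim exE)
    have Qn: "(1/4) ^ ?m * (real n * (E + B)) \<le> real n * \<delta>"
    proof -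
      have "(1/4) ^ ?m * (real n * (E + B)) = real n * ((1/4) ^ ?m * (E + B))" by simp
      also have "\<dots> \<le> real n * \<delta>" using Q by (rule mult_left_mono) simp
      finally show ?thesis .
    qed
    have u_eq: "u n x = f n x * sqrt (D1 n x + D2 n x)" if x: "x \<in> V n" for x
    proof -
      have en: "0 < \<epsilon> n" by (rule eps_pos[OF n])
      have "0 < c1 * \<epsilon> n ^ d1" "0 < c2 * \<epsilon> n ^ d2" using c en by simp_all
      then have "0 < D1 n x + D2 n x"
        using V(3)[OF n] x elim(6,7) D_nonneg[OF n, of x] by (smt (verit) UnE subsetD)
      then show ?thesis by (simp add: f_def degree_split[OF n])
    qed
    have *: "(u' * sqrt (a + b) - g')\<^sup>2 \<le> 2 * (u'\<^sup>2 * b) + 2 * (u' * sqrt a - g')\<^sup>2"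
      if "0 \<le> a" "0 \<le> b" for u' a b g' :: real
    proof -
      have "(u' * sqrt (a + b) - g')\<^sup>2 = (u' * (sqrt (a + b) - sqrt a) + (u' * sqrt a - g'))\<^sup>2"
        by (simp add: algebra_simps)
      also have "\<dots> \<le> 2 * (u' * (sqrt (a + b) - sqrt a))\<^sup>2 + 2 * (u' * sqrt a - g')\<^sup>2" by (rule sq_add_le)
      also have "(u' * (sqrt (a + b) - sqrt a))\<^sup>2 = u'\<^sup>2 * (sqrt (a + b) - sqrt a)\<^sup>2" by (rule power_mult_distrib)
      also have "\<dots> \<le> u'\<^sup>2 * b" using sqrt_add_diff_sq_le[OF that] by (rule mult_left_mono) simp
      finally show ?thesis by simp
    qed
    define g where "g x = (if x \<in> M1 then g1 x else g2 x)" for x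
    have const: "\<forall>K\<in>\<K> ?m. \<forall>x\<in>K. \<forall>y\<in>K. g x = g y"
    proof (intro ballI)
      fix K x y assume K: "K \<in> \<K> ?m" and xy: "x \<in> K" "y \<in> K"
      from K consider "K \<in> \<K>1 ?m" | L where "L \<in> \<K>2 ?m" "K = L - M1" unfolding \<K> by blast
      then show "g x = g y"
      proof cases
        case 1
        then have "K \<subseteq> M1" using \<K>1(4)[of ?m] by blast
        then have "x \<in> M1" "y \<in> M1" using xy by blast+
        moreover have "g1 x = g1 y" using cg1 1 xy by blast
        ultimately show ?thesis by (simp add: g_def)
      next
        case 2
        then have "x \<notin> M1" "y \<notin> M1" using xy by blast+
        moreover have "g2 x = g2 y" using cg2 2 xy by blast
        ultimately show ?thesis by (simp add: g_def)
      qed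
    qed
    have "(\<Sum>x\<in>V n \<inter> M1. (u n x - g x)\<^sup>2) \<le> (\<Sum>x\<in>V n \<inter> M1. 2 * ((f n x)\<^sup>2 * D2 n x) + 2 * (f n x * sqrt (D1 n x) - g1 x)\<^sup>2)"
    proof (rule sum_mono)
      fix x assume x: "x \<in> V n \<inter> M1"
      then have "u n x = f n x * sqrt (D1 n x + D2 n x)" "g x = g1 x" using u_eq by (auto simp: g_def)
      then show "(u n x - g x)\<^sup>2 \<le> 2 * ((f n x)\<^sup>2 * D2 n x) + 2 * (f n x * sqrt (D1 n x) - g1 x)\<^sup>2"
        using *[OF D_nonneg(1)[OF n, of x] D_nonneg(2)[OF n, of x], of "f n x" "g1 x"] by (simp only:)
    qed
    also have "\<dots> = 2 * (\<Sum>x\<in>V n \<inter> M1. (f n x)\<^sup>2 * D2 n x) + 2 * (\<Sum>x\<in>V n \<inter> M1. (f n x * sqrt (D1 n x) - g1 x)\<^sup>2)"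
      by (simp add: sum.distrib sum_distrib_left)
    also have "\<dots> \<le> 4 * (real n * \<delta>)" using elim(3) cg1 Qn by linarith
    finally have s1: "(\<Sum>x\<in>V n \<inter> M1. (u n x - g x)\<^sup>2) \<le> 4 * (real n * \<delta>)" .
    have "(\<Sum>x\<in>V n \<inter> M2. (u n x - g x)\<^sup>2) \<le> (\<Sum>x\<in>V n \<inter> M2. 2 * ((f n x)\<^sup>2 * D1 n x) + 2 * (f n x * sqrt (D2 n x) - g2 x)\<^sup>2)"
    proof (rule sum_mono)
      fix x assume x: "x \<in> V n \<inter> M2"
      then have "x \<notin> M1" using V(4)[OF n] by blast
      then have "u n x = f n x * sqrt (D2 n x + D1 n x)" "g x = g2 x" using u_eq x by (auto simp: g_def add.commute)
      then show "(u n x - g x)\<^sup>2 \<le> 2 * ((f n x)\<^sup>2 * D1 n x) + 2 * (f n x * sqrt (D2 n x) - g2 x)\<^sup>2"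
        using *[OF D_nonneg(2)[OF n, of x] D_nonneg(1)[OF n, of x], of "f n x" "g2 x"] by (simp only:)
    qed
    also have "\<dots> = 2 * (\<Sum>x\<in>V n \<inter> M2. (f n x)\<^sup>2 * D1 n x) + 2 * (\<Sum>x\<in>V n \<inter> M2. (f n x * sqrt (D2 n x) - g2 x)\<^sup>2)"
      by (simp add: sum.distrib sum_distrib_left)
    also have "\<dots> \<le> 4 * (real n * \<delta>)" using elim(4) cg2 Qn by linarith
    finally have s2: "(\<Sum>x\<in>V n \<inter> M2. (u n x - g x)\<^sup>2) \<le> 4 * (real n * \<delta>)" .
    have "(\<Sum>x\<in>V n. (u n x - g x)\<^sup>2) \<le> 8 * (real n * \<delta>)"
      using s1 s2 sum_split[OF n, of "\<lambda>x. (u n x - g x)\<^sup>2"] by linarith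
    also have "\<dots> = real n * (1/4) ^ k" by (simp add: \<delta>_def)
    finally show ?case using const by blast
  qed
qed

text \<open>Shifting the partitions by \<open>k0\<close> brings the error of scale k to the form
  (1/4)^k demanded by \<open>piecewise_approximable\<close>, whatever the bounds on energy and norm
  are.\<close>

lemma subsequence:
  obtains r w where "strict_mono r" "1 \<le> r (0::nat)" "w \<in> borel_measurable borel" "(\<integral>\<^sup>+x. ennreal ((w x)\<^sup>2) \<partial>\<mu>) < \<infinity>"
    "TL2_converges \<mu> (\<lambda>j. empirical_measure (r j) (V (r j))) (\<lambda>j. u (r j)) w"
proof -
  obtain k0 where "8 * (E + B) < 4 ^ k0" using real_arch_pow[of 4 "8 * (E + B)"] by auto
  then have k0: "8 * (E + B) \<le> 4 ^ k0" by simp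
  have borelM: "M1 \<in> sets borel" "M2 \<in> sets borel" using M(1,2) by (simp_all add: borel_closed compact_imp_closed)
  interpret pa: piecewise_approximable \<mu> "M1 \<union> M2" V "\<lambda>k. \<K> (k + k0)" u B
  proof unfold_locales
    show "bounded (M1 \<union> M2)" using M(1,2) by (simp add: compact_imp_bounded)
    show "M1 \<union> M2 \<in> sets borel" using borelM by auto
    fix k
    let ?m = "k + k0"
    show "finite (\<K> ?m)" unfolding \<K> using \<K>1(1) \<K>2(1) by simp
    show "\<K> ?m \<subseteq> sets borel" unfolding \<K> using \<K>1(3)[of ?m] \<K>2(3)[of ?m] borelM(1) by auto
    show "\<Union> (\<K> ?m) = M1 \<union> M2" unfolding \<K> using \<K>1(4)[of ?m] \<K>2(4)[of ?m] by auto
    show "disjoint (\<K> ?m)"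
    proof (rule disjointI)
      fix K L assume KL: "K \<in> \<K> ?m" "L \<in> \<K> ?m" "K \<noteq> L"
      have sub: "K' \<subseteq> M1" if "K' \<in> \<K>1 ?m" for K' using that \<K>1(4)[of ?m] by blast
      have d1: "K' \<inter> L' = {}" if "K' \<in> \<K>1 ?m" "L' \<in> \<K>1 ?m" "K' \<noteq> L'" for K' L'
        using disjointD[OF \<K>1(2) that] .
      have d2: "K' \<inter> L' = {}" if "K' \<in> \<K>2 ?m" "L' \<in> \<K>2 ?m" "K' \<noteq> L'" for K' L'
        using disjointD[OF \<K>2(2) that] .
      from KL(1) consider "K \<in> \<K>1 ?m" | K' where "K' \<in> \<K>2 ?m" "K = K' - M1" unfolding \<K> by blast
      then show "K \<inter> L = {}"
      proof cases
        case 1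
        from KL(2) consider "L \<in> \<K>1 ?m" | L' where "L = L' - M1" unfolding \<K> by blast
        then show ?thesis using d1[OF 1 _ KL(3)] sub[OF 1] by cases blast+
      next
        case 2
        from KL(2) consider "L \<in> \<K>1 ?m" | L' where "L' \<in> \<K>2 ?m" "L = L' - M1" unfolding \<K> by blast
        then show ?thesis
        proof cases
          case 1 then show ?thesis using sub[OF 1] 2 by blast
        next
          case L: 2
          then have "K' \<noteq> L'" using 2 KL(3) by blast
          then show ?thesis using d2[OF 2(1) L(1)] 2 L by blast
        qed
      qed
    qed
    fix K assume K: "K \<in> \<K> ?m"
    show "dist x y \<le> (1/2) ^ k" if xy: "x \<in> K" "y \<in> K" for x y
    proof -
      from K have "dist x y \<le> (1/4) ^ ?m" unfolding \<K> using \<K>1(5)[of _ ?m x y] \<K>2(5)[of _ ?m x y] xy by blast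
      also have "\<dots> \<le> (1/4 :: real) ^ k" by (intro power_decreasing) auto
      also have "\<dots> \<le> (1/2) ^ k" by (intro power_mono) auto
      finally show ?thesis .
    qed
  next
    show "eventually (\<lambda>n. \<exists>g. (\<forall>K\<in>\<K> (k + k0). \<forall>x\<in>K. \<forall>y\<in>K. g x = g y) \<and>
      (\<Sum>x\<in>V n. (u n x - g x)\<^sup>2) \<le> real n * (1/4) ^ k) sequentially" for k by (rule ev_approx[OF k0])
  qed (use sets_\<mu> M(4) V(1-3) lln null u bound in auto)
  show ?thesis using pa.TL2_compact that by blast
qed

end

section \<open>The two-piece sample\<close>

text \<open>For d = 1 the assumed scale is eventually larger than ln n / n, so the condition n
  \<epsilon>^d / ln n -> infinity becomes available in every dimension.\<close>

lemma ln_le_connectivity_scale: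
  assumes "1 \<le> d"
  shows "eventually (\<lambda>n. (ln (real n) / real n) powr (1 / real d) \<le> connectivity_scale d n) sequentially"
proof (cases "d = 1")
  case True
  have "eventually (\<lambda>n::nat. ln (real n) / real n \<le> sqrt (ln (ln (real n)) / real n)) sequentially"
    by real_asymp
  moreover have "eventually (\<lambda>n::nat. 0 \<le> ln (real n) / real n) sequentially"
    by real_asymp
  ultimately show ?thesis by eventually_elim (simp add: True connectivity_scale_def)
qed (simp add: connectivity_scale_def)

text \<open>The quantity in question is the inverse of the d-th power of (ln n / n)^(1/d) /
  \<epsilon>, which is eventually positive and tends to 0.\<close>

lemma scale_at_top:
  fixes \<epsilon> :: "nat \<Rightarrow> real"
  assumes d: "1 \<le> d" and pos: "\<And>n. 1 \<le> n \<Longrightarrow> 0 < \<epsilon> n"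
    and lim: "(\<lambda>n. connectivity_scale d n / \<epsilon> n) \<longlonglongrightarrow> 0"
  shows "filterlim (\<lambda>n. real n * \<epsilon> n ^ d / ln (real n)) at_top sequentially"
proof -
  define a where "a n = (ln (real n) / real n) powr (1 / real d) / \<epsilon> n" for n
  have "a \<longlonglongrightarrow> 0"
  proof (rule tendsto_sandwich[OF _ _ tendsto_const lim])
    show "eventually (\<lambda>n. 0 \<le> a n) sequentially"
      using eventually_ge_at_top[of 1] by eventually_elim (simp add: a_def pos less_imp_le)
    show "eventually (\<lambda>n. a n \<le> connectivity_scale d n / \<epsilon> n) sequentially"
      using ln_le_connectivity_scale[OF d] eventually_ge_at_top[of 1]
      by eventually_elim (simp add: a_def pos less_imp_le divide_right_mono)
  qed
  then have "(\<lambda>n. a n ^ d) \<longlonglongrightarrow> 0 ^ d" by (intro tendsto_power)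
  then have lim0: "(\<lambda>n. a n ^ d) \<longlonglongrightarrow> 0" using d by (simp add: power_0_left)
  have "eventually (\<lambda>n::nat. 0 < ln (real n)) sequentially" by real_asymp
  then have ev: "eventually (\<lambda>n. 0 < a n ^ d \<and> inverse (a n ^ d) = real n * \<epsilon> n ^ d / ln (real n)) sequentially"
    using eventually_ge_at_top[of 1]
  proof eventually_elim
    case (elim n)
    have q: "0 < ln (real n) / real n" using elim by simp
    have "a n ^ d = ((ln (real n) / real n) powr (1 / real d)) ^ d / \<epsilon> n ^ d" by (simp add: a_def power_divide)
    also have "((ln (real n) / real n) powr (1 / real d)) ^ d = (ln (real n) / real n) powr (1 / real d * real d)"
    proof -
      have "0 < (ln (real n) / real n) powr (1 / real d)" by (rule powr_gt_zero[THEN iffD2]) (use q in linarith)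
      then show ?thesis by (simp only: powr_realpow[symmetric] powr_powr)
    qed
    also have "\<dots> = ln (real n) / real n" using q d elim by simp
    finally have "a n ^ d = ln (real n) / real n / \<epsilon> n ^ d" .
    moreover have "0 < \<epsilon> n ^ d" using pos[OF elim(2)] by simp
    moreover have "0 < real n" using elim(2) by simp
    ultimately show ?case using elim(1) by simp
  qed
  have "filterlim (\<lambda>n. inverse (a n ^ d)) at_top sequentially"
    using lim0 ev by (intro filterlim_inverse_at_top) (auto elim: eventually_mono)
  moreover have "eventually (\<lambda>n. inverse (a n ^ d) = real n * \<epsilon> n ^ d / ln (real n)) sequentially"
    using ev by (auto elim: eventually_mono)
  ultimately show ?thesis by (simp only: filterlim_cong[OF refl refl])
qed

lemma scale_at_top_mono:
  fixes \<epsilon> :: "nat \<Rightarrow> real"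
  assumes "filterlim (\<lambda>n. real n * \<epsilon> n ^ d / ln (real n)) at_top sequentially" "d' \<le> d"
    and pos: "\<And>n. 1 \<le> n \<Longrightarrow> 0 < \<epsilon> n" and lim: "\<epsilon> \<longlonglongrightarrow> 0"
  shows "filterlim (\<lambda>n. real n * \<epsilon> n ^ d' / ln (real n)) at_top sequentially"
proof (rule filterlim_at_top_mono[OF assms(1)])
  have "eventually (\<lambda>n. \<epsilon> n < 1) sequentially" using lim by (rule order_tendstoD) simp
  then show "eventually (\<lambda>n. real n * \<epsilon> n ^ d / ln (real n) \<le> real n * \<epsilon> n ^ d' / ln (real n)) sequentially"
    using eventually_ge_at_top[of 1]
  proof eventually_elim
    case (elim n)
    have "\<epsilon> n ^ d \<le> \<epsilon> n ^ d'" using assms(2) pos[OF elim(2)] elim(1) by (intro power_decreasing) auto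
    moreover have "0 \<le> ln (real n)" using elim(2) by simp
    ultimately show ?case by (intro divide_right_mono mult_left_mono) auto
  qed
qed

text \<open>Small balls of radius t around a point have mass at most a constant times t^m with m >=
  1.\<close>

lemma regular_piece_atomless:
  assumes reg: "regular_piece TYPE('m::finite) M m" and "finite_measure m" "sets m = sets borel" and x: "x \<in> M"
  shows "measure m {x} = 0"
proof (rule ccontr)
  interpret finite_measure m by fact
  have M: "M \<in> sets m" using reg assms(3) by (simp add: regular_piece_def borel_closed compact_imp_closed)
  assume "measure m {x} \<noteq> 0"
  then have a: "0 < measure m {x}" by (simp add: zero_less_measure_iff)
  obtain \<theta> s where \<theta>: "0 < \<theta>" and s: "0 < s"
    and up: "\<And>t. 0 < t \<Longrightarrow> t < s \<Longrightarrow> \<bar>measure m (M \<inter> ball x t) - \<theta> * t ^ CARD('m)\<bar> \<le> 1 * t ^ CARD('m)"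
    using regular_piece_ball[OF reg x] x by (metis dist_self zero_less_one)
  define t where "t = min (min (s / 2) (1 / 2)) (measure m {x} / (2 * (\<theta> + 1)))"
  have t: "0 < t" "t < s" "t \<le> 1" "t \<le> measure m {x} / (2 * (\<theta> + 1))"
    using s \<theta> a by (auto simp: t_def)
  have "measure m {x} \<le> measure m (M \<inter> ball x t)"
    using x t(1) M assms(3) by (intro finite_measure_mono) auto
  also have "\<dots> \<le> (\<theta> + 1) * t ^ CARD('m)"
    using up[OF t(1,2)] unfolding abs_le_iff distrib_right by linarith
  also have "\<dots> \<le> (\<theta> + 1) * t ^ 1"
    using \<theta> t by (intro mult_left_mono power_decreasing) auto
  also have "\<dots> \<le> measure m {x} / 2" using t(4) \<theta> by (simp add: pos_le_divide_eq mult_ac)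
  finally show False using a by simp
qed

text \<open>The last claim, from \<rho> >= 1 / C, is what later turns integrability with respect to
  the sampling law into integrability with respect to the volume.\<close>

lemma density_on_measure:
  assumes M: "compact M" and \<nu>: "sets \<nu> = sets borel" and C: "0 < C" and \<rho>: "admissible_density M \<nu> C \<rho>"
  shows "sets (density_on M \<nu> \<rho>) = sets borel" "prob_space (density_on M \<nu> \<rho>)" "measure (density_on M \<nu> \<rho>) M = 1"
    "\<And>B. B \<in> sets borel \<Longrightarrow> B \<subseteq> M \<Longrightarrow> emeasure \<nu> B \<le> ennreal C * emeasure (density_on M \<nu> \<rho>) B"
proof -
  have borelM: "M \<in> sets borel" using M by (simp add: borel_closed compact_imp_closed)
  obtain L where "L-lipschitz_on M \<rho>" using \<rho> by (auto simp: admissible_density_def)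
  then have "continuous_on M \<rho>" by (rule lipschitz_on_continuous_on)
  from borel_measurable_continuous_on_indicator[OF borelM this]
  have "(\<lambda>x. \<rho> x * indicator M x) \<in> borel_measurable borel" by (simp add: mult.commute)
  then have "(\<lambda>x. \<rho> x * indicator M x) \<in> borel_measurable \<nu>" by (simp cong: measurable_cong_sets add: \<nu>)
  then have meas: "(\<lambda>x. ennreal (\<rho> x * indicator M x)) \<in> borel_measurable \<nu>" by simp
  show sets: "sets (density_on M \<nu> \<rho>) = sets borel" by (simp add: density_on_def \<nu>)
  show pr: "prob_space (density_on M \<nu> \<rho>)" using \<rho> by (simp add: admissible_density_def)
  interpret D: prob_space "density_on M \<nu> \<rho>" by (rule pr)
  have em: "emeasure (density_on M \<nu> \<rho>) B = (\<integral>\<^sup>+x. ennreal (\<rho> x * indicator M x) * indicator B x \<partial>\<nu>)" if "B \<in> sets borel" for B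
    unfolding density_on_def using meas that by (intro emeasure_density) (simp_all add: \<nu>)
  have "ennreal (\<rho> x * indicator M x) * indicator (- M) x = 0" for x by (simp add: indicator_def)
  then have "emeasure (density_on M \<nu> \<rho>) (- M) = (\<integral>\<^sup>+x. 0 \<partial>\<nu>)"
    using borelM by (subst em) (simp_all only: borel_comp)
  then have "measure (density_on M \<nu> \<rho>) (- M) = 0" by (simp add: measure_def)
  moreover have "measure (density_on M \<nu> \<rho>) (- M) = 1 - measure (density_on M \<nu> \<rho>) M"
    using D.prob_compl[of M] borelM sets sets_eq_imp_space_eq[OF sets] by (simp add: Compl_eq_Diff_UNIV)
  ultimately show "measure (density_on M \<nu> \<rho>) M = 1" by simp
  fix B assume B: "B \<in> sets borel" "B \<subseteq> M"
  have "emeasure \<nu> B = (\<integral>\<^sup>+x. indicator B x \<partial>\<nu>)" using B \<nu> by simp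
  also have "\<dots> \<le> (\<integral>\<^sup>+x. ennreal C * (ennreal (\<rho> x * indicator M x) * indicator B x) \<partial>\<nu>)"
  proof (rule nn_integral_mono)
    fix x
    show "indicator B x \<le> ennreal C * (ennreal (\<rho> x * indicator M x) * indicator B x)"
    proof (cases "x \<in> B")
      case True
      then have "1 / C \<le> \<rho> x" "x \<in> M" using B \<rho> by (auto simp: admissible_density_def)
      then have "1 \<le> C * \<rho> x" using C by (simp add: pos_divide_le_eq mult.commute)
      then have "1 \<le> ennreal (C * \<rho> x)" by simp
      also have "\<dots> = ennreal C * ennreal (\<rho> x)" using C by (simp add: ennreal_mult')
      finally show ?thesis using True \<open>x \<in> M\<close> by simp
    qed simp
  qed
  also have "\<dots> = ennreal C * emeasure (density_on M \<nu> \<rho>) B"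
    using meas B \<nu> by (subst nn_integral_cmult) (auto simp: em)
  finally show "emeasure \<nu> B \<le> ennreal C * emeasure (density_on M \<nu> \<rho>) B" .
qed

lemma L2_norm_empirical:
  assumes "finite U" "1 \<le> n" "in_L2 (empirical_measure n U) u" "L2_norm (empirical_measure n U) u \<le> b"
  shows "u \<in> borel_measurable borel" "(\<Sum>x\<in>U. (u x)\<^sup>2) \<le> real n * b\<^sup>2"
proof -
  have "u \<in> borel_measurable (empirical_measure n U)" using assms(3) by (simp add: in_L2_def)
  then show u: "u \<in> borel_measurable borel" by (simp cong: measurable_cong_sets)
  let ?I = "\<integral>x. (u x)\<^sup>2 \<partial>empirical_measure n U"
  have "ennreal ?I = (\<integral>\<^sup>+x. ennreal ((u x)\<^sup>2) \<partial>empirical_measure n U)"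
    using assms(3) by (intro nn_integral_eq_integral[symmetric]) (auto simp: in_L2_def)
  also have "\<dots> = ennreal (1 / real n) * (\<Sum>x\<in>U. ennreal ((u x)\<^sup>2))"
    using u by (intro nn_integral_empirical_measure assms(1)) measurable
  also have "(\<Sum>x\<in>U. ennreal ((u x)\<^sup>2)) = ennreal (\<Sum>x\<in>U. (u x)\<^sup>2)" by (intro sum_ennreal) simp
  also have "ennreal (1 / real n) * \<dots> = ennreal (1 / real n * (\<Sum>x\<in>U. (u x)\<^sup>2))"
    by (rule ennreal_mult'[symmetric]) simp
  finally have eq: "?I = 1 / real n * (\<Sum>x\<in>U. (u x)\<^sup>2)"
    by (subst (asm) ennreal_inj) (simp_all add: sum_nonneg)
  have I0: "0 \<le> ?I" by simp
  have "sqrt ?I \<le> b" using assms(4) by (simp add: L2_norm_def)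
  then have "(sqrt ?I)\<^sup>2 \<le> b\<^sup>2" using I0 by (intro power_mono) auto
  then have "?I \<le> b\<^sup>2" using I0 by simp
  then have "(\<Sum>x\<in>U. (u x)\<^sup>2) / real n \<le> b\<^sup>2" unfolding eq by simp
  then show "(\<Sum>x\<in>U. (u x)\<^sup>2) \<le> real n * b\<^sup>2" using assms(2) by (simp add: pos_divide_le_eq mult.commute)
qed

lemma in_L2_of_dominated:
  assumes "sets \<nu> = sets borel" "sets \<mu> = sets borel" "w \<in> borel_measurable borel"
    and dom: "\<And>A. A \<in> sets borel \<Longrightarrow> emeasure \<nu> A \<le> ennreal c * emeasure \<mu> A"
    and fin: "(\<integral>\<^sup>+x. ennreal ((w x)\<^sup>2) \<partial>\<mu>) < \<infinity>"
  shows "in_L2 \<nu> w"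
proof -
  have w: "w \<in> borel_measurable \<nu>" "(\<lambda>x. ennreal ((w x)\<^sup>2)) \<in> borel_measurable \<mu>"
    using assms(1-3) by (simp_all cong: measurable_cong_sets)
  have "\<nu> \<le> scale_measure (ennreal c) \<mu>"
    unfolding le_measure_iff
  proof (simp add: assms(1,2) sets_eq_imp_space_eq[of \<nu> \<mu>] space_scale_measure le_fun_def, intro allI)
    fix A
    show "emeasure \<nu> A \<le> ennreal c * emeasure \<mu> A"
      using dom[of A] assms(1) by (cases "A \<in> sets borel") (auto simp: emeasure_notin_sets)
  qed
  then have "(\<integral>\<^sup>+x. ennreal ((w x)\<^sup>2) \<partial>\<nu>) \<le> (\<integral>\<^sup>+x. ennreal ((w x)\<^sup>2) \<partial>scale_measure (ennreal c) \<mu>)"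
    using assms(1,2) by (intro nn_integral_mono_measure) auto
  also have "\<dots> = ennreal c * (\<integral>\<^sup>+x. ennreal ((w x)\<^sup>2) \<partial>\<mu>)" using w(2) by (rule nn_integral_scale_measure)
  also have "\<dots> < \<infinity>" using fin by (simp add: ennreal_mult_less_top)
  finally have "(\<integral>\<^sup>+x. ennreal ((w x)\<^sup>2) \<partial>\<nu>) < \<infinity>" .
  then show ?thesis
    unfolding in_L2_def using w(1) by (intro conjI integrableI_nonneg) auto
qed

text \<open>The approximation properties appear as hypotheses and are supplied by
  \<open>AE_approx\<close>; in this way the two chart types stay out of the combination of the
  pieces.\<close>

locale two_pieces = p1: sample_piece P X \<mu> M1 d1 \<eta> \<epsilon> + p2: sample_piece P X \<mu> M2 d2 \<eta> \<epsilon>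
  for P :: "'w measure" and X :: "nat \<Rightarrow> 'w \<Rightarrow> 'a::euclidean_space" and \<mu> M1 M2 d1 d2 \<eta> \<epsilon> +
  assumes dims: "d1 \<le> d2" and M2_nonempty: "M2 \<noteq> {}"
    and full: "measure \<mu> (M1 \<union> M2) = 1" and inter_null: "measure \<mu> (M1 \<inter> M2) = 0"
    and approx_M1: "\<And>\<tau>. 0 < \<tau> \<Longrightarrow> \<exists>\<K>. finite \<K> \<and> disjoint \<K> \<and> \<K> \<subseteq> sets borel \<and> \<Union>\<K> = M1 \<and>
      (\<forall>K\<in>\<K>. \<forall>x\<in>K. \<forall>y\<in>K. dist x y \<le> \<tau>) \<and>
      (AE w in P. eventually (\<lambda>n. \<forall>f. \<exists>g. (\<forall>K\<in>\<K>. \<forall>x\<in>K. \<forall>y\<in>K. g x = g y) \<and>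
        (\<Sum>x\<in>p1.V n w \<inter> M1. (f x * sqrt (p1.deg n w x) - g x)\<^sup>2) \<le>
          \<tau> * (1 / (real n * (\<epsilon> n)\<^sup>2) * dirichlet \<eta> (\<epsilon> n) (p1.V n w \<inter> M1) f + (\<Sum>x\<in>p1.V n w \<inter> M1. (f x)\<^sup>2 * p1.deg n w x))) sequentially)"
    and approx_M2: "\<And>\<tau>. 0 < \<tau> \<Longrightarrow> \<exists>\<K>. finite \<K> \<and> disjoint \<K> \<and> \<K> \<subseteq> sets borel \<and> \<Union>\<K> = M2 \<and>
      (\<forall>K\<in>\<K>. \<forall>x\<in>K. \<forall>y\<in>K. dist x y \<le> \<tau>) \<and>
      (AE w in P. eventually (\<lambda>n. \<forall>f. \<exists>g. (\<forall>K\<in>\<K>. \<forall>x\<in>K. \<forall>y\<in>K. g x = g y) \<and>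
        (\<Sum>x\<in>p2.V n w \<inter> M2. (f x * sqrt (p2.deg n w x) - g x)\<^sup>2) \<le>
          \<tau> * (1 / (real n * (\<epsilon> n)\<^sup>2) * dirichlet \<eta> (\<epsilon> n) (p2.V n w \<inter> M2) f + (\<Sum>x\<in>p2.V n w \<inter> M2. (f x)\<^sup>2 * p2.deg n w x))) sequentially)"
begin

text \<open>Constants and partitions are quantified outside the almost sure statement: they depend
  on the law and not on the sample. The good samples then contain a countable intersection of almost
  sure events.\<close>

theorem AE_good_sample:
  "\<exists>c1 C2 c2 \<K>1 \<K>2 \<K>. AE w in P. good_sample \<mu> M1 M2 (\<lambda>n. p1.V n w) \<eta> \<epsilon> d1 d2 c1 C2 c2 \<K>1 \<K>2 \<K>"
proof -
  interpret \<mu>: prob_space \<mu> by (rule p1.prob_space_law)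
  obtain c1 where c1: "0 < c1" and lower1: "AE w in P. eventually (\<lambda>n. \<forall>x\<in>M1. c1 * \<epsilon> n ^ d1 \<le> p1.deg n w x) sequentially"
    by (rule p1.AE_degree_lower)
  obtain c2 where c2: "0 < c2" and lower2: "AE w in P. eventually (\<lambda>n. \<forall>x\<in>M2. c2 * \<epsilon> n ^ d2 \<le> p2.deg n w x) sequentially"
    by (rule p2.AE_degree_lower)
  obtain C2 where C2: "0 < C2" and upper2: "AE w in P. eventually (\<lambda>n. \<forall>x. p2.deg n w x \<le> C2 * \<epsilon> n ^ d2) sequentially"
    by (rule p2.AE_degree_upper)
  have q: "(0::real) < (1/4) ^ m" for m by simp
  have "\<exists>\<K>1. \<forall>m::nat. finite (\<K>1 m) \<and> disjoint (\<K>1 m) \<and> \<K>1 m \<subseteq> sets borel \<and> \<Union>(\<K>1 m) = M1 \<and>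
      (\<forall>K\<in>\<K>1 m. \<forall>x\<in>K. \<forall>y\<in>K. dist x y \<le> (1/4) ^ m) \<and>
      (AE w in P. eventually (\<lambda>n. \<forall>f. \<exists>g. (\<forall>K\<in>\<K>1 m. \<forall>x\<in>K. \<forall>y\<in>K. g x = g y) \<and>
        (\<Sum>x\<in>p1.V n w \<inter> M1. (f x * sqrt (p1.deg n w x) - g x)\<^sup>2) \<le>
          (1/4) ^ m * (1 / (real n * (\<epsilon> n)\<^sup>2) * dirichlet \<eta> (\<epsilon> n) (p1.V n w \<inter> M1) f + (\<Sum>x\<in>p1.V n w \<inter> M1. (f x)\<^sup>2 * p1.deg n w x))) sequentially)"
    (is "\<exists>\<K>. \<forall>m. ?Q1 m \<K>")
    by (rule choice, rule allI, rule approx_M1, rule q)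
  then obtain \<K>1 where \<K>1: "\<forall>m. ?Q1 m \<K>1"
    by (elim exE)
  have "\<exists>\<K>2. \<forall>m::nat. finite (\<K>2 m) \<and> disjoint (\<K>2 m) \<and> \<K>2 m \<subseteq> sets borel \<and> \<Union>(\<K>2 m) = M2 \<and>
      (\<forall>K\<in>\<K>2 m. \<forall>x\<in>K. \<forall>y\<in>K. dist x y \<le> (1/4) ^ m) \<and>
      (AE w in P. eventually (\<lambda>n. \<forall>f. \<exists>g. (\<forall>K\<in>\<K>2 m. \<forall>x\<in>K. \<forall>y\<in>K. g x = g y) \<and>
        (\<Sum>x\<in>p2.V n w \<inter> M2. (f x * sqrt (p2.deg n w x) - g x)\<^sup>2) \<le>
          (1/4) ^ m * (1 / (real n * (\<epsilon> n)\<^sup>2) * dirichlet \<eta> (\<epsilon> n) (p2.V n w \<inter> M2) f + (\<Sum>x\<in>p2.V n w \<inter> M2. (f x)\<^sup>2 * p2.deg n w x))) sequentially)"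
    (is "\<exists>\<K>. \<forall>m. ?Q2 m \<K>")
    by (rule choice, rule allI, rule approx_M2, rule q)
  then obtain \<K>2 where \<K>2: "\<forall>m. ?Q2 m \<K>2"
    by (elim exE)
  note \<K>1 = \<K>1[THEN spec] and \<K>2 = \<K>2[THEN spec]
  have k1: "finite (\<K>1 m)"
    "disjoint (\<K>1 m)"
    "\<K>1 m \<subseteq> sets borel"
    "\<Union>(\<K>1 m) = M1"
    "\<forall>K\<in>\<K>1 m. \<forall>x\<in>K. \<forall>y\<in>K. dist x y \<le> (1/4) ^ m" for m
  proof -
    show "finite (\<K>1 m)" using \<K>1[of m] by (elim conjE)
    show "disjoint (\<K>1 m)" using \<K>1[of m] by (elim conjE)
    show "\<K>1 m \<subseteq> sets borel" using \<K>1[of m] by (elim conjE)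
    show "\<Union>(\<K>1 m) = M1" using \<K>1[of m] by (elim conjE)
    show "\<forall>K\<in>\<K>1 m. \<forall>x\<in>K. \<forall>y\<in>K. dist x y \<le> (1/4) ^ m" using \<K>1[of m] by (elim conjE)
  qed
  have k2: "finite (\<K>2 m)"
    "disjoint (\<K>2 m)"
    "\<K>2 m \<subseteq> sets borel"
    "\<Union>(\<K>2 m) = M2"
    "\<forall>K\<in>\<K>2 m. \<forall>x\<in>K. \<forall>y\<in>K. dist x y \<le> (1/4) ^ m" for m
  proof -
    show "finite (\<K>2 m)" using \<K>2[of m] by (elim conjE)
    show "disjoint (\<K>2 m)" using \<K>2[of m] by (elim conjE)
    show "\<K>2 m \<subseteq> sets borel" using \<K>2[of m] by (elim conjE)
    show "\<Union>(\<K>2 m) = M2" using \<K>2[of m] by (elim conjE)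
    show "\<forall>K\<in>\<K>2 m. \<forall>x\<in>K. \<forall>y\<in>K. dist x y \<le> (1/4) ^ m" using \<K>2[of m] by (elim conjE)
  qed
  have ae1: "AE w in P. \<forall>m. eventually (\<lambda>n. \<forall>f. \<exists>g. (\<forall>K\<in>\<K>1 m. \<forall>x\<in>K. \<forall>y\<in>K. g x = g y) \<and>
        (\<Sum>x\<in>p1.V n w \<inter> M1. (f x * sqrt (p1.deg n w x) - g x)\<^sup>2) \<le>
          (1/4) ^ m * (1 / (real n * (\<epsilon> n)\<^sup>2) * dirichlet \<eta> (\<epsilon> n) (p1.V n w \<inter> M1) f + (\<Sum>x\<in>p1.V n w \<inter> M1. (f x)\<^sup>2 * p1.deg n w x))) sequentially"
    unfolding AE_all_countable by (intro allI, rule \<K>1[THEN conjunct2, THEN conjunct2, THEN conjunct2, THEN conjunct2, THEN conjunct2])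
  have ae2: "AE w in P. \<forall>m. eventually (\<lambda>n. \<forall>f. \<exists>g. (\<forall>K\<in>\<K>2 m. \<forall>x\<in>K. \<forall>y\<in>K. g x = g y) \<and>
        (\<Sum>x\<in>p2.V n w \<inter> M2. (f x * sqrt (p2.deg n w x) - g x)\<^sup>2) \<le>
          (1/4) ^ m * (1 / (real n * (\<epsilon> n)\<^sup>2) * dirichlet \<eta> (\<epsilon> n) (p2.V n w \<inter> M2) f + (\<Sum>x\<in>p2.V n w \<inter> M2. (f x)\<^sup>2 * p2.deg n w x))) sequentially"
    unfolding AE_all_countable by (intro allI, rule \<K>2[THEN conjunct2, THEN conjunct2, THEN conjunct2, THEN conjunct2, THEN conjunct2])
  define \<K> where "\<K> m = \<K>1 m \<union> (\<lambda>K. K - M1) ` \<K>2 m" for m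
  \<comment> \<open>All cells of all scales form a countable family, so the laws of large numbers
    for all pairwise intersections hold simultaneously.\<close>
  define \<C> where "\<C> = (\<Union>m. \<K> m)"
  have \<K>fin: "finite (\<K> m)" for m using k1(1) k2(1) by (simp add: \<K>_def)
  have \<K>b: "K \<in> sets borel" if "K \<in> \<C>" for K
  proof -
    from that obtain m where "K \<in> \<K>1 m \<or> (\<exists>L\<in>\<K>2 m. K = L - M1)" by (auto simp: \<C>_def \<K>_def)
    then show ?thesis
    proof
      assume "\<exists>L\<in>\<K>2 m. K = L - M1"
      then obtain L where "L \<in> \<K>2 m" "K = L - M1" by blast
      then show ?thesis using subsetD[OF k2(3)] p1.M_borel by (simp add: sets.Diff)
    qed (use subsetD[OF k1(3)] in blast)
  qed
  have \<C>: "countable \<C>" unfolding \<C>_def using \<K>fin by (auto intro: countable_finite)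
  have ae_lln: "AE w in P. \<forall>K\<in>\<C>. \<forall>L\<in>\<C>. (\<lambda>n. p1.hits n (K \<inter> L) w / real n) \<longlonglongrightarrow> measure \<mu> (K \<inter> L)"
    unfolding AE_ball_countable[OF \<C>] using \<K>b by (intro ballI p1.AE_lln) auto
  have ae_null: "AE w in P. \<forall>K\<in>\<C>. measure \<mu> K = 0 \<longrightarrow> (\<forall>i\<ge>1. X i w \<notin> K)"
    unfolding AE_ball_countable[OF \<C>]
  proof
    fix K assume K: "K \<in> \<C>"
    show "AE w in P. measure \<mu> K = 0 \<longrightarrow> (\<forall>i\<ge>1. X i w \<notin> K)"
    proof (cases "measure \<mu> K = 0")
      case True
      then show ?thesis using p1.AE_not_hit[OF \<K>b[OF K]] by simp
    qed simp
  qed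
  have near_b: "{x\<in>M1. infdist x M2 \<le> t} \<in> sets borel" for t
  proof -
    have "closed {x. infdist x M2 \<le> t}" by (intro closed_Collect_le continuous_intros)
    then have "M1 \<inter> {x. infdist x M2 \<le> t} \<in> sets borel" by (rule sets.Int[OF p1.M_borel borel_closed])
    then show ?thesis by (simp add: Int_def)
  qed
  have ae_near: "AE w in P. \<forall>l. (\<lambda>n. p1.hits n {x\<in>M1. infdist x M2 \<le> 1 / real (Suc l)} w / real n)
        \<longlonglongrightarrow> measure \<mu> {x\<in>M1. infdist x M2 \<le> 1 / real (Suc l)}"
    unfolding AE_all_countable by (intro allI p1.AE_lln near_b)
  have U: "M1 \<union> M2 \<in> sets borel" "M1 \<inter> M2 \<in> sets borel" using p1.M_borel p2.M_borel by auto
  have "measure \<mu> (- (M1 \<union> M2)) = 0"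
    using \<mu>.prob_compl[of "M1 \<union> M2"] U full by (simp add: Compl_eq_Diff_UNIV)
  then have ae_out: "AE w in P. \<forall>i\<ge>1. X i w \<notin> - (M1 \<union> M2)" using U by (intro p1.AE_not_hit) auto
  have ae_N: "AE w in P. \<forall>i\<ge>1. X i w \<notin> M1 \<inter> M2" using U inter_null by (intro p1.AE_not_hit)
  have "AE w in P. good_sample \<mu> M1 M2 (\<lambda>n. p1.V n w) \<eta> \<epsilon> d1 d2 c1 C2 c2 \<K>1 \<K>2 \<K>"
    using p1.distinct lower1 lower2 upper2 ae1 ae2 ae_lln ae_null ae_near ae_out ae_N
  proof eventually_elim
    case (elim w)
    note card = p1.hits_eq_card[OF elim(1)]
    show ?case
    proof unfold_locales
      show "card (p1.V n w) = n" for n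
        unfolding p1.V_def using card_image[OF inj_on_subset[OF elim(1)], of "{1..n}"] by auto
      show "p1.V n w \<subseteq> M1 \<union> M2" "p1.V n w \<inter> (M1 \<inter> M2) = {}" for n
        unfolding p1.V_def using elim(10,11) by auto
      show "eventually (\<lambda>n. \<forall>x\<in>M1. c1 * \<epsilon> n ^ d1 \<le> graph_degree \<eta> n (\<epsilon> n) (p1.V n w \<inter> M1) x) sequentially" by (rule elim(2))
      show "eventually (\<lambda>n. \<forall>x\<in>M2. c2 * \<epsilon> n ^ d2 \<le> graph_degree \<eta> n (\<epsilon> n) (p1.V n w \<inter> M2) x) sequentially" by (rule elim(3))
      show "eventually (\<lambda>n. \<forall>x. graph_degree \<eta> n (\<epsilon> n) (p1.V n w \<inter> M2) x \<le> C2 * \<epsilon> n ^ d2) sequentially" by (rule elim(4))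
      show "eventually (\<lambda>n. \<forall>f. \<exists>g. (\<forall>K\<in>\<K>1 m. \<forall>x\<in>K. \<forall>y\<in>K. g x = g y) \<and>
        (\<Sum>x\<in>p1.V n w \<inter> M1. (f x * sqrt (graph_degree \<eta> n (\<epsilon> n) (p1.V n w \<inter> M1) x) - g x)\<^sup>2) \<le>
        (1/4) ^ m * (1 / (real n * (\<epsilon> n)\<^sup>2) * dirichlet \<eta> (\<epsilon> n) (p1.V n w \<inter> M1) f
          + (\<Sum>x\<in>p1.V n w \<inter> M1. (f x)\<^sup>2 * graph_degree \<eta> n (\<epsilon> n) (p1.V n w \<inter> M1) x))) sequentially" for m
        by (rule elim(5)[THEN spec])
      show "eventually (\<lambda>n. \<forall>f. \<exists>g. (\<forall>K\<in>\<K>2 m. \<forall>x\<in>K. \<forall>y\<in>K. g x = g y) \<and>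
        (\<Sum>x\<in>p1.V n w \<inter> M2. (f x * sqrt (graph_degree \<eta> n (\<epsilon> n) (p1.V n w \<inter> M2) x) - g x)\<^sup>2) \<le>
        (1/4) ^ m * (1 / (real n * (\<epsilon> n)\<^sup>2) * dirichlet \<eta> (\<epsilon> n) (p1.V n w \<inter> M2) f
          + (\<Sum>x\<in>p1.V n w \<inter> M2. (f x)\<^sup>2 * graph_degree \<eta> n (\<epsilon> n) (p1.V n w \<inter> M2) x))) sequentially" for m
        by (rule elim(6)[THEN spec])
      show "\<K> m = \<K>1 m \<union> (\<lambda>K. K - M1) ` \<K>2 m" for m by (rule \<K>_def)
      show "(\<lambda>n. real (card (p1.V n w \<inter> (K \<inter> L))) / real n) \<longlonglongrightarrow> measure \<mu> (K \<inter> L)" if "K \<in> \<K> k" "L \<in> \<K> l" for k l K L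
        using elim(7) that unfolding card \<C>_def by blast
      show "p1.V n w \<inter> K = {}" if "K \<in> \<K> k" "measure \<mu> K = 0" for k K n
        using elim(8) that unfolding \<C>_def p1.V_def by fastforce
      show "(\<lambda>n. real (card (p1.V n w \<inter> {x\<in>M1. infdist x M2 \<le> 1 / real (Suc l)})) / real n)
        \<longlonglongrightarrow> measure \<mu> {x\<in>M1. infdist x M2 \<le> 1 / real (Suc l)}" for l
        using elim(9)[THEN spec, of l] unfolding card .
      show "dist x y \<le> (1/4) ^ m" if "K \<in> \<K>1 m" "x \<in> K" "y \<in> K" for m K x y using k1(5)[of m] that by blast
      show "dist x y \<le> (1/4) ^ m" if "K \<in> \<K>2 m" "x \<in> K" "y \<in> K" for m K x y using k2(5)[of m] that by blast
    qed (use p1.sets_law p1.compact_M p2.compact_M M2_nonempty full inter_null p1.kernel p1.eps_pos p1.eps_lim dims c1 c2 C2 k1(1-4) k2(1-4) in auto)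
  qed
  then show ?thesis by (intro exI)
qed

end

theorem theorem2p1:
  fixes M1 M2 :: "'a::euclidean_space set"
    and vol1 vol2 :: "'a measure"
    and \<rho>1 \<rho>2 :: "'a \<Rightarrow> real"
    and C\<^sub>\<rho> \<alpha>1 \<alpha>2 :: real
    and d12 :: nat
    and \<eta> :: "real \<Rightarrow> real"
    and \<epsilon> :: "nat \<Rightarrow> real"
    and P :: "'w measure"
    and X :: "nat \<Rightarrow> 'w \<Rightarrow> 'a"
  defines "d1 \<equiv> CARD('m1::finite)" and "d2 \<equiv> CARD('m2::finite)"
  defines "Vol \<equiv> union_measure M1 M2 vol1 vol2"
  defines "\<mu> \<equiv> union_measure M1 M2
      (scale_measure (ennreal \<alpha>1) (density_on M1 vol1 \<rho>1))
      (scale_measure (ennreal \<alpha>2) (density_on M2 vol2 \<rho>2))"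
  defines "V \<equiv> \<lambda>n \<omega>. (\<lambda>i. X i \<omega>) ` {1..n}"
  defines "\<mu>n \<equiv> \<lambda>n \<omega>. empirical_measure n (V n \<omega>)"
  assumes "d1 \<le> d2"
    and "compact M1" and "smooth_submanifold d1 M1"
    and "compact M2" and "smooth_submanifold d2 M2"
    and "nondegenerate_intersection d1 d2 d12 M1 M2"
    and "riemannian_volume TYPE('m1) M1 vol1"
    and "riemannian_volume TYPE('m2) M2 vol2"
    and "C\<^sub>\<rho> > 0"
    and "admissible_density M1 vol1 C\<^sub>\<rho> \<rho>1"
    and "admissible_density M2 vol2 C\<^sub>\<rho> \<rho>2"
    and "\<alpha>1 > 0" and "\<alpha>2 > 0" and "\<alpha>1 + \<alpha>2 = 1"
    and "prob_space P"
    and "prob_space.indep_vars P (\<lambda>_. borel) X {1..}"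
    and "\<And>i. i \<ge> 1 \<Longrightarrow> distr P borel (X i) = \<mu>"
    and "admissible_kernel \<eta>"
    and "\<And>n. n \<ge> 1 \<Longrightarrow> \<epsilon> n > 0"
    and "(\<lambda>n. connectivity_scale (max d1 d2) n / \<epsilon> n) \<longlonglongrightarrow> 0"
    and "\<epsilon> \<longlonglongrightarrow> 0"
  shows "AE \<omega> in P. \<forall>u :: nat \<Rightarrow> 'a \<Rightarrow> real.
      (\<forall>n\<ge>1. in_L2 (\<mu>n n \<omega>) (u n)) \<longrightarrow>
      bdd_above ((\<lambda>n. graph_energy \<eta> n (\<epsilon> n) (V n \<omega>) (u n)) ` {1..}) \<longrightarrow>
      bdd_above ((\<lambda>n. L2_norm (\<mu>n n \<omega>) (u n)) ` {1..}) \<longrightarrow>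
      (\<exists>(r :: nat \<Rightarrow> nat) w. strict_mono r \<and> r 0 \<ge> 1 \<and> in_L2 Vol w \<and>
         TL2_converges \<mu> (\<lambda>k. \<mu>n (r k) \<omega>) (\<lambda>k. u (r k)) w)"
proof -
  interpret P: prob_space P by fact
  define m1 where "m1 = density_on M1 vol1 \<rho>1"
  define m2 where "m2 = density_on M2 vol2 \<rho>2"
  have sv: "sets vol1 = sets borel" "sets vol2 = sets borel"
    using \<open>riemannian_volume TYPE('m1) M1 vol1\<close> \<open>riemannian_volume TYPE('m2) M2 vol2\<close>
    by (simp_all add: riemannian_volume_def)
  note D1 = density_on_measure[OF \<open>compact M1\<close> sv(1) \<open>0 < C\<^sub>\<rho>\<close> \<open>admissible_density M1 vol1 C\<^sub>\<rho> \<rho>1\<close>, folded m1_def]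
  note D2 = density_on_measure[OF \<open>compact M2\<close> sv(2) \<open>0 < C\<^sub>\<rho>\<close> \<open>admissible_density M2 vol2 C\<^sub>\<rho> \<rho>2\<close>, folded m2_def]
  interpret m1: prob_space m1 by (rule D1(2))
  interpret m2: prob_space m2 by (rule D2(2))
  have bM: "M1 \<in> sets borel" "M2 \<in> sets borel"
    using \<open>compact M1\<close> \<open>compact M2\<close> by (simp_all add: borel_closed compact_imp_closed)
  have reg1: "regular_piece TYPE('m1) M1 m1" unfolding m1_def
    using \<open>smooth_submanifold d1 M1\<close> \<open>compact M1\<close> \<open>riemannian_volume TYPE('m1) M1 vol1\<close> \<open>0 < C\<^sub>\<rho>\<close>
      \<open>admissible_density M1 vol1 C\<^sub>\<rho> \<rho>1\<close> unfolding d1_def by (intro regular_piece_density)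
  have reg2: "regular_piece TYPE('m2) M2 m2" unfolding m2_def
    using \<open>smooth_submanifold d2 M2\<close> \<open>compact M2\<close> \<open>riemannian_volume TYPE('m2) M2 vol2\<close> \<open>0 < C\<^sub>\<rho>\<close>
      \<open>admissible_density M2 vol2 C\<^sub>\<rho> \<rho>2\<close> unfolding d2_def by (intro regular_piece_density)
  \<comment> \<open>The intersection has smaller dimension than either piece, which will make it
    null for both measures.\<close>
  have N: "compact (M1 \<inter> M2)" "smooth_submanifold d12 (M1 \<inter> M2)" "d12 < CARD('m1)" "d12 < CARD('m2)"
    using \<open>nondegenerate_intersection d1 d2 d12 M1 M2\<close> \<open>compact M1\<close> \<open>compact M2\<close> \<open>d1 \<le> d2\<close>
    by (auto simp: nondegenerate_intersection_def d1_def d2_def compact_Int)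
  have null1: "measure m1 (M1 \<inter> M2) = 0"
    by (rule regular_piece_null[OF reg1 m1.finite_measure_axioms D1(1) N(1) _ N(2,3)]) simp
  have null2: "measure m2 (M1 \<inter> M2) = 0"
    by (rule regular_piece_null[OF reg2 m2.finite_measure_axioms D2(1) N(1) _ N(2,4)]) simp
  have emeas: "emeasure \<mu> A = ennreal \<alpha>1 * emeasure m1 (A \<inter> M1) + ennreal \<alpha>2 * emeasure m2 (A \<inter> M2)"
    if "A \<in> sets borel" for A
    unfolding \<mu>_def m1_def[symmetric] m2_def[symmetric]
    using emeasure_union_measure[of "scale_measure (ennreal \<alpha>1) m1" "scale_measure (ennreal \<alpha>2) m2" M1 M2 A] D1(1) D2(1) bM that
    by simp
  have meas: "measure \<mu> A = \<alpha>1 * measure m1 (A \<inter> M1) + \<alpha>2 * measure m2 (A \<inter> M2)" if "A \<in> sets borel" for A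
  proof -
    have "emeasure \<mu> A = ennreal (\<alpha>1 * measure m1 (A \<inter> M1) + \<alpha>2 * measure m2 (A \<inter> M2))"
      unfolding emeas[OF that] m1.emeasure_eq_measure m2.emeasure_eq_measure
      using \<open>0 < \<alpha>1\<close> \<open>0 < \<alpha>2\<close> by (simp add: ennreal_mult ennreal_plus)
    then show ?thesis using \<open>0 < \<alpha>1\<close> \<open>0 < \<alpha>2\<close> by (intro measure_eq_emeasure_eq_ennreal) simp_all
  qed
  \<comment> \<open>Inside M1 the second measure charges only the intersection, which is null for
    it. So the sampling law is there a multiple of the first measure, and regularity transfers to
    it.\<close>
  have meas1: "measure \<mu> B = \<alpha>1 * measure m1 B" if B: "B \<in> sets borel" "B \<subseteq> M1" for B
  proof -
    have "measure m2 (B \<inter> M2) \<le> measure m2 (M1 \<inter> M2)"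
      using B bM D2(1) by (intro m2.finite_measure_mono) auto
    then have "measure m2 (B \<inter> M2) = 0" using null2 measure_nonneg[of m2 "B \<inter> M2"] by linarith
    then show ?thesis using meas[OF B(1)] B(2) by (simp add: Int_absorb2)
  qed
  have meas2: "measure \<mu> B = \<alpha>2 * measure m2 B" if B: "B \<in> sets borel" "B \<subseteq> M2" for B
  proof -
    have "measure m1 (B \<inter> M1) \<le> measure m1 (M1 \<inter> M2)"
      using B bM D1(1) by (intro m1.finite_measure_mono) auto
    then have "measure m1 (B \<inter> M1) = 0" using null1 measure_nonneg[of m1 "B \<inter> M1"] by linarith
    then show ?thesis using meas[OF B(1)] B(2) by (simp add: Int_absorb2)
  qed
  have r1: "regular_piece TYPE('m1) M1 \<mu>" by (rule regular_piece_scale[OF reg1 \<open>0 < \<alpha>1\<close> meas1])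
  have r2: "regular_piece TYPE('m2) M2 \<mu>" by (rule regular_piece_scale[OF reg2 \<open>0 < \<alpha>2\<close> meas2])
  interpret s: iid_sample P X \<mu>
    by unfold_locales (fact \<open>P.indep_vars (\<lambda>_. borel) X {1..}\<close>, rule \<open>\<And>i. 1 \<le> i \<Longrightarrow> distr P borel (X i) = \<mu>\<close>)
  interpret \<mu>: prob_space \<mu> by (rule s.prob_space_law)
  have full: "measure \<mu> (M1 \<union> M2) = 1"
    using meas[of "M1 \<union> M2"] bM D1(3) D2(3) \<open>\<alpha>1 + \<alpha>2 = 1\<close> by (simp add: Int_absorb1)
  have inter: "measure \<mu> (M1 \<inter> M2) = 0"
    using meas1[of "M1 \<inter> M2"] bM null1 by simp
  have atom: "measure \<mu> {x} = 0" for x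
  proof -
    consider "x \<in> M1" | "x \<in> M2" | "x \<notin> M1" "x \<notin> M2" by blast
    then show ?thesis
    proof cases
      case 1 then show ?thesis by (rule regular_piece_atomless[OF r1 \<mu>.finite_measure_axioms s.sets_law])
    next
      case 2 then show ?thesis by (rule regular_piece_atomless[OF r2 \<mu>.finite_measure_axioms s.sets_law])
    next
      case 3 then show ?thesis using meas[of "{x}"] by simp
    qed
  qed
  have sc: "filterlim (\<lambda>n. real n * \<epsilon> n ^ max d1 d2 / ln (real n)) at_top sequentially"
    by (rule scale_at_top[OF _ assms(25,26)]) (simp_all add: d1_def Suc_le_eq le_max_iff_disj)
  note sc' = scale_at_top_mono[OF sc _ assms(25,27)]
  interpret p1: sample_piece P X \<mu> M1 "CARD('m1)" \<eta> \<epsilon>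
    using \<open>compact M1\<close> regular_piece_ball[OF r1] s.AE_distinct[OF atom] \<open>admissible_kernel \<eta>\<close> assms(25,27) sc'[of "CARD('m1)"]
    by unfold_locales (simp_all add: d1_def)
  interpret p2: sample_piece P X \<mu> M2 "CARD('m2)" \<eta> \<epsilon>
    using \<open>compact M2\<close> regular_piece_ball[OF r2] s.AE_distinct[OF atom] \<open>admissible_kernel \<eta>\<close> assms(25,27) sc'[of "CARD('m2)"]
    by unfold_locales (simp_all add: d2_def)
  have cubes1: "\<exists>(\<psi> :: real^'m1 \<Rightarrow> 'a) \<Lambda> c C p h s. 0 < \<Lambda> \<and> 0 < c \<and> 0 < C \<and> good_cube M1 \<mu> \<psi> \<Lambda> c C p h \<and>
      0 < s \<and> (\<forall>x\<in>M1. dist x x0 < s \<longrightarrow> x \<in> \<psi> ` cube p h)" if "x0 \<in> M1" for x0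
    using regular_piece_good_cube[OF r1 that] by blast
  have cubes2: "\<exists>(\<psi> :: real^'m2 \<Rightarrow> 'a) \<Lambda> c C p h s. 0 < \<Lambda> \<and> 0 < c \<and> 0 < C \<and> good_cube M2 \<mu> \<psi> \<Lambda> c C p h \<and>
      0 < s \<and> (\<forall>x\<in>M2. dist x x0 < s \<longrightarrow> x \<in> \<psi> ` cube p h)" if "x0 \<in> M2" for x0
    using regular_piece_good_cube[OF r2 that] by blast
  interpret t: two_pieces P X \<mu> M1 M2 "CARD('m1)" "CARD('m2)" \<eta> \<epsilon>
  proof unfold_locales
    show "CARD('m1) \<le> CARD('m2)" using \<open>d1 \<le> d2\<close> by (simp add: d1_def d2_def)
    show "M2 \<noteq> {}" using D2(3) by auto
  qed (rule full, rule inter, rule p1.AE_approx[OF cubes1 refl], assumption+, rule p2.AE_approx[OF cubes2 refl], assumption+)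
  have VV: "p1.V = V" by (simp add: fun_eq_iff p1.V_def V_def)
  obtain c1 C2 c2 \<K>1 \<K>2 \<K> where
    good: "AE w in P. good_sample \<mu> M1 M2 (\<lambda>n. V n w) \<eta> \<epsilon> CARD('m1) CARD('m2) c1 C2 c2 \<K>1 \<K>2 \<K>"
    using t.AE_good_sample unfolding VV by blast
  \<comment> \<open>The lower bound 1 / C on the densities and the smaller of the two weights
    combine to the constant; this makes \<open>w\<close>, square integrable for the sampling law,
    square integrable for the volume.\<close>
  have Vol: "emeasure Vol A \<le> ennreal (C\<^sub>\<rho> / min \<alpha>1 \<alpha>2) * emeasure \<mu> A" if A: "A \<in> sets borel" for A
  proof -
    define a where "a = min \<alpha>1 \<alpha>2"
    have a: "0 < a" "a \<le> \<alpha>1" "a \<le> \<alpha>2" using \<open>0 < \<alpha>1\<close> \<open>0 < \<alpha>2\<close> by (auto simp: a_def)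
    have le: "ennreal C\<^sub>\<rho> * y \<le> ennreal (C\<^sub>\<rho> / a) * (ennreal \<alpha> * y)" if "a \<le> \<alpha>" for \<alpha> y
    proof -
      have "C\<^sub>\<rho> \<le> C\<^sub>\<rho> / a * \<alpha>" using a(1) that \<open>0 < C\<^sub>\<rho>\<close> by (simp add: pos_le_divide_eq)
      then have "ennreal C\<^sub>\<rho> \<le> ennreal (C\<^sub>\<rho> / a * \<alpha>)" by (rule ennreal_leI)
      also have "\<dots> = ennreal (C\<^sub>\<rho> / a) * ennreal \<alpha>" using a(1) \<open>0 < C\<^sub>\<rho>\<close> by (intro ennreal_mult') simp
      finally have "ennreal C\<^sub>\<rho> * y \<le> ennreal (C\<^sub>\<rho> / a) * ennreal \<alpha> * y" by (rule mult_right_mono) simp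
      then show ?thesis by (simp add: mult.assoc)
    qed
    have "emeasure Vol A = emeasure vol1 (A \<inter> M1) + emeasure vol2 (A \<inter> M2)"
      unfolding Vol_def using sv bM A by (intro emeasure_union_measure)
    also have "\<dots> \<le> ennreal C\<^sub>\<rho> * emeasure m1 (A \<inter> M1) + ennreal C\<^sub>\<rho> * emeasure m2 (A \<inter> M2)"
      using A bM by (intro add_mono D1(4) D2(4)) auto
    also have "\<dots> \<le> ennreal (C\<^sub>\<rho> / a) * (ennreal \<alpha>1 * emeasure m1 (A \<inter> M1)) + ennreal (C\<^sub>\<rho> / a) * (ennreal \<alpha>2 * emeasure m2 (A \<inter> M2))"
      using a by (intro add_mono le)
    also have "\<dots> = ennreal (C\<^sub>\<rho> / a) * emeasure \<mu> A" by (simp add: emeas[OF A] distrib_left)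
    finally show ?thesis by (simp add: a_def)
  qed
  have sets_Vol: "sets Vol = sets borel" by (simp add: Vol_def union_measure_def sets_measure_of_borel)
  show ?thesis using good
  proof eventually_elim
    case (elim \<omega>)
    interpret g: good_sample \<mu> M1 M2 "\<lambda>n. V n \<omega>" \<eta> \<epsilon> "CARD('m1)" "CARD('m2)" c1 C2 c2 \<K>1 \<K>2 \<K> by (rule elim)
    show ?case
    proof (intro allI impI)
      \<comment> \<open>The almost sure event concerns the sample only: \<omega> is fixed before the
        sequence \<open>u\<close>, as the order of quantifiers demands.\<close>
      fix u :: "nat \<Rightarrow> 'a \<Rightarrow> real"
      assume L2: "\<forall>n\<ge>1. in_L2 (\<mu>n n \<omega>) (u n)"
        and en: "bdd_above ((\<lambda>n. graph_energy \<eta> n (\<epsilon> n) (V n \<omega>) (u n)) ` {1..})"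
        and nrm: "bdd_above ((\<lambda>n. L2_norm (\<mu>n n \<omega>) (u n)) ` {1..})"
      obtain E where E: "\<And>n. 1 \<le> n \<Longrightarrow> graph_energy \<eta> n (\<epsilon> n) (V n \<omega>) (u n) \<le> E"
        using en by (auto simp: bdd_above_def)
      obtain b where b: "\<And>n. 1 \<le> n \<Longrightarrow> L2_norm (\<mu>n n \<omega>) (u n) \<le> b"
        using nrm by (auto simp: bdd_above_def)
      have ub: "u n \<in> borel_measurable borel" "(\<Sum>x\<in>V n \<omega>. (u n x)\<^sup>2) \<le> real n * b\<^sup>2" if "1 \<le> n" for n
        using L2_norm_empirical[OF g.V(1)[OF that] that, of "u n" b] L2 b[OF that] that by (simp_all add: \<mu>n_def)
      interpret be: bounded_energy \<mu> M1 M2 "\<lambda>n. V n \<omega>" \<eta> \<epsilon> "CARD('m1)" "CARD('m2)" c1 C2 c2 \<K>1 \<K>2 \<K> u E "b\<^sup>2"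
        by unfold_locales (use E ub in auto)
      obtain r w where r: "strict_mono r" "1 \<le> r (0::nat)" and w: "w \<in> borel_measurable borel" "(\<integral>\<^sup>+x. ennreal ((w x)\<^sup>2) \<partial>\<mu>) < \<infinity>"
        and TL: "TL2_converges \<mu> (\<lambda>j. empirical_measure (r j) (V (r j) \<omega>)) (\<lambda>j. u (r j)) w"
        by (rule be.subsequence)
      have "in_L2 Vol w" by (rule in_L2_of_dominated[OF sets_Vol s.sets_law w(1) Vol w(2)])
      then show "\<exists>(r :: nat \<Rightarrow> nat) w. strict_mono r \<and> r 0 \<ge> 1 \<and> in_L2 Vol w \<and>
         TL2_converges \<mu> (\<lambda>k. \<mu>n (r k) \<omega>) (\<lambda>k. u (r k)) w"
        using r TL unfolding \<mu>n_def by (intro exI[of _ r] exI[of _ w] conjI)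
    qed
  qed
qed

end
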